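(* Let $(\mathcal{C},J)$ be a small site, let $\mathcal{Q}$ be a small quantaloid with $\mathcal{Q}\simeq\mathcal{R}(\mathcal{C},J)$, and let $\mathcal{E}$ be any set of symmetric idempotents in $\mathcal{Q}$ containing all identities. Then there are equivalences: 1. $\mathsf{Sh}(\mathcal{Q},\mathcal{E})\simeq\mathsf{SymCat}_{\mathsf{cc}}(\mathcal{Q})\simeq\mathsf{Sh}(\mathcal{C},J)$ (of categories, isomorphic parallel functors between enriched categories being identified); 2. $\mathsf{Rel}(\mathcal{Q},\mathcal{E})\simeq\mathsf{SymDist}(\mathcal{Q})\simeq\mathsf{Rel}(\mathsf{Sh}(\mathcal{C},J))$ (of involutive quantaloids).
   Context: A quantaloid is a category whose homs are complete lattices and whose composition preserves arbitrary suprema in each variable; a homomorphism is a functor preserving local suprema. An involution on $\mathcal{Q}$ is a homomorphism $(-)^{\circ}:\mathcal{Q}^{\mathrm{op}}\to\mathcal{Q}$ that is the identity on objects with $f^{\circ\circ}=f$; homomorphisms and equivalences of involutive quantaloids preserve it. A morphism $f:X\to Y$ is a left adjoint if there is $f^*:Y\to X$ with $1_X\le f^*f$, $ff^*\le 1_Y$; it is a symmetric left adjoint if moreover $f^*=f^{\circ}$. Closed cribles. For a small site $(\mathcal{C},J)$, the quantaloid $\mathcal{R}(\mathcal{C},J)$ has the objects of $\mathcal{C}$ as objects; an arrow $X\to Y$ is a closed crible, i.e. a set $R$ of spans $(f:U\to Y,\ g:U\to X)$ in $\mathcal{C}$ closed under precomposition and such that a span $(f,g)$ with domain $U$ is in $R$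 whenever $\{s:V\to U\mid (fs,gs)\in R\}\in J(U)$. Arrows are ordered by inclusion; $S\circ R$ is the smallest closed crible containing $\{(h,g)\mid \exists f: (h,f)\in S,(f,g)\in R\}$; the identity on $X$ is the smallest closed crible containing $(1_X,1_X)$. A quantaloid $\mathcal{Q}\simeq\mathcal{R}(\mathcal{C},J)$ is always considered with the involution sending $q:Y\to X$ to $q^{\circ}=\bigvee\{gf^*\mid f:U\to X,\ g:U\to Y\text{ left adjoints in }\mathcal{Q}\text{ with } fg^*\le q\}$ (for $\mathcal{R}(\mathcal{C},J)$: reversal of spans). Splitting. If $\mathcal{E}$ is a class of symmetric idempotents ($e^2=e=e^{\circ}$), the involutive quantaloid $\mathcal{Q}_{\mathcal{E}}$ has the elements of $\mathcal{E}$ as objects and $\mathcal{Q}_{\mathcal{E}}(e,f)=\{x:A\to B\mid fx=x=xe\}$ for $e:A\to A$, $f:B\to B$; composition, suprema and involution are as in $\mathcal{Q}$, the identity on $e$ is $e$. Enriched categories (over any small involutive quantaloid $\mathcal{Q}$). A $\mathcal{Q}$-category $\mathbb{A}$ is a set $\mathbb{A}_0$ with types $tx\in\mathcal{Q}_0$ and arrows $\mathbb{A}(y,x):tx\to ty$ with $\mathbb{A}(z,y)\circ\mathbb{A}(y,x)\le\mathbb{A}(z,x)$ and $1_{tx}\le\mathbb{A}(x,x)$; it is symmetric if $\mathbb{A}(x,y)=\mathbb{A}(y,x)^{\circ}$. A functor $F:\mathbb{A}\to\mathbb{B}$ is a type-preserving object map with $\mathbb{A}(y,x)\le\mathbb{B}(Fy,Fx)$;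 $F\le G$ means $1_{tx}\le\mathbb{B}(Fx,Gx)$ for all $x$ (a symmetric relation when $\mathbb{B}$ is symmetric). A distributor $\Phi$ from $\mathbb{A}$ to $\mathbb{B}$ is a family $\Phi(y,x):tx\to ty$ ($x\in\mathbb{A}_0$, $y\in\mathbb{B}_0$) with $\mathbb{B}(y',y)\circ\Phi(y,x)\le\Phi(y',x)$ and $\Phi(y,x)\circ\mathbb{A}(x,x')\le\Phi(y,x')$; composition is $(\Psi\otimes\Phi)(z,x)=\bigvee_y\Psi(z,y)\circ\Phi(y,x)$, the identity on $\mathbb{A}$ is given by its hom-arrows, order is elementwise; this gives the quantaloid $\mathsf{Dist}(\mathcal{Q})$. $\mathsf{SymDist}(\mathcal{Q})$ is its full subquantaloid on symmetric $\mathcal{Q}$-categories, with involution $\Phi^{\circ}(a,b)=\Phi(b,a)^{\circ}$. A functor $F:\mathbb{B}\to\mathbb{A}$ represents the left adjoint distributor $\mathbb{A}(-,F-)$ from $\mathbb{B}$ to $\mathbb{A}$. $\mathbb{A}$ is Cauchy complete if every left adjoint in $\mathsf{Dist}(\mathcal{Q})$ with codomain $\mathbb{A}$ is represented by a functor; a symmetric $\mathbb{A}$ is symmetrically complete if every symmetric left adjoint in $\mathsf{SymDist}(\mathcal{Q})$ with codomain $\mathbb{A}$ is represented by a functor. $\mathsf{SymCat}_{\mathsf{cc}}(\mathcal{Q})$ consists of symmetric Cauchy complete $\mathcal{Q}$-categories and functors; $\mathsf{SymCat}_{\mathsf{sc}}(\mathcal{Q})$ (resp. $\mathsf{SymDist}_{\mathsf{sc}}(\mathcal{Q})$)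 of symmetrically complete symmetric $\mathcal{Q}$-categories and functors (resp. distributors). Define $\mathsf{Sh}(\mathcal{Q},\mathcal{E}):=\mathsf{SymCat}_{\mathsf{sc}}(\mathcal{Q}_{\mathcal{E}})$ and $\mathsf{Rel}(\mathcal{Q},\mathcal{E}):=\mathsf{SymDist}_{\mathsf{sc}}(\mathcal{Q}_{\mathcal{E}})$. $\mathsf{Sh}(\mathcal{C},J)$ is the topos of sheaves on the site; for a topos $\mathcal{T}$, $\mathsf{Rel}(\mathcal{T})$ is the category of objects of $\mathcal{T}$ and internal relations (subobjects of products), ordered by inclusion, with opposite relation as involution. *)

theory Defs
  imports "HOL-Library.FuncSet" "HOL-Library.Equipollence"
begin

section \<open>Universes\<close>

text \<open>
  A type \<open>'u\<close> plays the role of a universe of sets: a set (over any type) is small if its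
  cardinality is strictly below that of \<open>'u\<close>, and the category of sets is represented by
  the small subsets of \<open>'u\<close>.  The predicate \<open>universe\<close> says that the cardinality of \<open>'u\<close>
  is a regular strong limit, i.e. that small sets are closed under power sets and under
  unions indexed by small sets, as in a Grothendieck universe.
\<close>

definition small :: "'u itself \<Rightarrow> 'a set \<Rightarrow> bool" where
  "small U A \<longleftrightarrow> A \<prec> (UNIV :: 'u set)"

definition universe :: "'u itself \<Rightarrow> bool" where
  "universe U \<longleftrightarrow>
     (\<forall>A :: 'u set. small U A \<longrightarrow> small U (Pow A)) \<and>
     (\<forall>(A :: 'u set) (B :: 'u \<Rightarrow> 'u set).
        small U A \<longrightarrow> (\<forall>a\<in>A. small U (B a)) \<longrightarrow> small U (\<Union>a\<in>A. B a))"

section \<open>Categories\<close>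

record ('o, 'm) category =
  Obj :: "'o set"
  Arr :: "'m set"
  Dom :: "'m \<Rightarrow> 'o"
  Cod :: "'m \<Rightarrow> 'o"
  Ide :: "'o \<Rightarrow> 'm"
  Comp :: "'m \<Rightarrow> 'm \<Rightarrow> 'm"  (infixl "\<odot>\<index>" 70)

definition hom :: "('o, 'm, 'z) category_scheme \<Rightarrow> 'o \<Rightarrow> 'o \<Rightarrow> 'm set" where
  "hom C X Y = {f \<in> Arr C. Dom C f = X \<and> Cod C f = Y}"

definition is_category :: "('o, 'm, 'z) category_scheme \<Rightarrow> bool" where
  "is_category C \<longleftrightarrow>
     (\<forall>f\<in>Arr C. Dom C f \<in> Obj C \<and> Cod C f \<in> Obj C) \<and>
     (\<forall>X\<in>Obj C. Ide C X \<in> hom C X X) \<and>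
     (\<forall>X Y Z. \<forall>f\<in>hom C X Y. \<forall>g\<in>hom C Y Z. g \<odot>\<^bsub>C\<^esub> f \<in> hom C X Z) \<and>
     (\<forall>X Y. \<forall>f\<in>hom C X Y. f \<odot>\<^bsub>C\<^esub> Ide C X = f \<and> Ide C Y \<odot>\<^bsub>C\<^esub> f = f) \<and>
     (\<forall>W X Y Z. \<forall>f\<in>hom C W X. \<forall>g\<in>hom C X Y. \<forall>h\<in>hom C Y Z.
        h \<odot>\<^bsub>C\<^esub> (g \<odot>\<^bsub>C\<^esub> f) = (h \<odot>\<^bsub>C\<^esub> g) \<odot>\<^bsub>C\<^esub> f)"

definition small_category :: "'u itself \<Rightarrow> ('o, 'm, 'z) category_scheme \<Rightarrow> bool" where
  "small_category U C \<longleftrightarrow> small U (Obj C) \<and> small U (Arr C)"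

definition full_sub :: "('o \<Rightarrow> bool) \<Rightarrow> ('o, 'm, 'z) category_scheme \<Rightarrow> ('o, 'm, 'z) category_scheme" where
  "full_sub P C =
     C\<lparr>Obj := {X \<in> Obj C. P X}, Arr := {f \<in> Arr C. P (Dom C f) \<and> P (Cod C f)}\<rparr>"

definition is_functor ::
  "('o1, 'm1, 'z1) category_scheme \<Rightarrow> ('o2, 'm2, 'z2) category_scheme
    \<Rightarrow> ('o1 \<Rightarrow> 'o2) \<Rightarrow> ('m1 \<Rightarrow> 'm2) \<Rightarrow> bool" where
  "is_functor C D Fo Fm \<longleftrightarrow>
     (\<forall>X\<in>Obj C. Fo X \<in> Obj D) \<and>
     (\<forall>X Y. \<forall>f\<in>hom C X Y. Fm f \<in> hom D (Fo X) (Fo Y)) \<and>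
     (\<forall>X\<in>Obj C. Fm (Ide C X) = Ide D (Fo X)) \<and>
     (\<forall>X Y Z. \<forall>f\<in>hom C X Y. \<forall>g\<in>hom C Y Z. Fm (g \<odot>\<^bsub>C\<^esub> f) = Fm g \<odot>\<^bsub>D\<^esub> Fm f)"

definition is_iso :: "('o, 'm, 'z) category_scheme \<Rightarrow> 'm \<Rightarrow> bool" where
  "is_iso C f \<longleftrightarrow> f \<in> Arr C \<and>
     (\<exists>g\<in>hom C (Cod C f) (Dom C f).
        g \<odot>\<^bsub>C\<^esub> f = Ide C (Dom C f) \<and> f \<odot>\<^bsub>C\<^esub> g = Ide C (Cod C f))"

definition naturally_isomorphic ::
  "('o1, 'm1, 'z1) category_scheme \<Rightarrow> ('o2, 'm2, 'z2) category_scheme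
    \<Rightarrow> ('o1 \<Rightarrow> 'o2) \<Rightarrow> ('m1 \<Rightarrow> 'm2) \<Rightarrow> ('o1 \<Rightarrow> 'o2) \<Rightarrow> ('m1 \<Rightarrow> 'm2) \<Rightarrow> bool" where
  "naturally_isomorphic C D Fo Fm Go Gm \<longleftrightarrow>
     (\<exists>\<eta>. (\<forall>X\<in>Obj C. \<eta> X \<in> hom D (Fo X) (Go X) \<and> is_iso D (\<eta> X)) \<and>
          (\<forall>X Y. \<forall>f\<in>hom C X Y. \<eta> Y \<odot>\<^bsub>D\<^esub> Fm f = Gm f \<odot>\<^bsub>D\<^esub> \<eta> X))"

definition category_equiv ::
  "('o1, 'm1, 'z1) category_scheme \<Rightarrow> ('o2, 'm2, 'z2) category_scheme \<Rightarrow> bool" where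
  "category_equiv C D \<longleftrightarrow>
     (\<exists>Fo Fm Go Gm. is_functor C D Fo Fm \<and> is_functor D C Go Gm \<and>
        naturally_isomorphic C C (Go \<circ> Fo) (Gm \<circ> Fm) id id \<and>
        naturally_isomorphic D D (Fo \<circ> Go) (Fm \<circ> Gm) id id)"

section \<open>Quantaloids and involutions\<close>

record ('o, 'm) quantaloid = "('o, 'm) category" +
  Leq :: "'m \<Rightarrow> 'm \<Rightarrow> bool"  (infix "\<sqsubseteq>\<index>" 50)

definition is_lub :: "('o, 'm, 'z) quantaloid_scheme \<Rightarrow> 'o \<Rightarrow> 'o \<Rightarrow> 'm set \<Rightarrow> 'm \<Rightarrow> bool" where
  "is_lub Q X Y S s \<longleftrightarrow> s \<in> hom Q X Y \<and> (\<forall>f\<in>S. f \<sqsubseteq>\<^bsub>Q\<^esub> s) \<and>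
     (\<forall>t\<in>hom Q X Y. (\<forall>f\<in>S. f \<sqsubseteq>\<^bsub>Q\<^esub> t) \<longrightarrow> s \<sqsubseteq>\<^bsub>Q\<^esub> t)"

definition join :: "('o, 'm, 'z) quantaloid_scheme \<Rightarrow> 'o \<Rightarrow> 'o \<Rightarrow> 'm set \<Rightarrow> 'm" where
  "join Q X Y S = (THE s. is_lub Q X Y S s)"

definition is_quantaloid :: "('o, 'm, 'z) quantaloid_scheme \<Rightarrow> bool" where
  "is_quantaloid Q \<longleftrightarrow> is_category Q \<and>
     (\<forall>f\<in>Arr Q. f \<sqsubseteq>\<^bsub>Q\<^esub> f) \<and>
     (\<forall>X Y. \<forall>f\<in>hom Q X Y. \<forall>g\<in>hom Q X Y. f \<sqsubseteq>\<^bsub>Q\<^esub> g \<longrightarrow> g \<sqsubseteq>\<^bsub>Q\<^esub> f \<longrightarrow> f = g) \<and>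
     (\<forall>X Y. \<forall>f\<in>hom Q X Y. \<forall>g\<in>hom Q X Y. \<forall>h\<in>hom Q X Y.
        f \<sqsubseteq>\<^bsub>Q\<^esub> g \<longrightarrow> g \<sqsubseteq>\<^bsub>Q\<^esub> h \<longrightarrow> f \<sqsubseteq>\<^bsub>Q\<^esub> h) \<and>
     (\<forall>X\<in>Obj Q. \<forall>Y\<in>Obj Q. \<forall>S\<subseteq>hom Q X Y. \<exists>s. is_lub Q X Y S s) \<and>
     (\<forall>X\<in>Obj Q. \<forall>Y\<in>Obj Q. \<forall>Z\<in>Obj Q. \<forall>S\<subseteq>hom Q X Y. \<forall>s. \<forall>g\<in>hom Q Y Z.
        is_lub Q X Y S s \<longrightarrow> is_lub Q X Z ((\<lambda>f. g \<odot>\<^bsub>Q\<^esub> f) ` S) (g \<odot>\<^bsub>Q\<^esub> s)) \<and>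
     (\<forall>X\<in>Obj Q. \<forall>Y\<in>Obj Q. \<forall>Z\<in>Obj Q. \<forall>S\<subseteq>hom Q Y Z. \<forall>s. \<forall>f\<in>hom Q X Y.
        is_lub Q Y Z S s \<longrightarrow> is_lub Q X Z ((\<lambda>g. g \<odot>\<^bsub>Q\<^esub> f) ` S) (s \<odot>\<^bsub>Q\<^esub> f))"

definition is_homomorphism ::
  "('o1, 'm1, 'z1) quantaloid_scheme \<Rightarrow> ('o2, 'm2, 'z2) quantaloid_scheme
    \<Rightarrow> ('o1 \<Rightarrow> 'o2) \<Rightarrow> ('m1 \<Rightarrow> 'm2) \<Rightarrow> bool" where
  "is_homomorphism Q R Fo Fm \<longleftrightarrow> is_functor Q R Fo Fm \<and>
     (\<forall>X\<in>Obj Q. \<forall>Y\<in>Obj Q. \<forall>S\<subseteq>hom Q X Y. \<forall>s.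
        is_lub Q X Y S s \<longrightarrow> is_lub R (Fo X) (Fo Y) (Fm ` S) (Fm s))"

definition quantaloid_equiv ::
  "('o1, 'm1, 'z1) quantaloid_scheme \<Rightarrow> ('o2, 'm2, 'z2) quantaloid_scheme \<Rightarrow> bool" where
  "quantaloid_equiv Q R \<longleftrightarrow>
     (\<exists>Fo Fm Go Gm. is_homomorphism Q R Fo Fm \<and> is_homomorphism R Q Go Gm \<and>
        naturally_isomorphic Q Q (Go \<circ> Fo) (Gm \<circ> Fm) id id \<and>
        naturally_isomorphic R R (Fo \<circ> Go) (Fm \<circ> Gm) id id)"

record ('o, 'm) inv_quantaloid = "('o, 'm) quantaloid" +
  Inv :: "'m \<Rightarrow> 'm"

definition is_inv_quantaloid :: "('o, 'm, 'z) inv_quantaloid_scheme \<Rightarrow> bool" where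
  "is_inv_quantaloid Q \<longleftrightarrow> is_quantaloid Q \<and>
     (\<forall>X Y. \<forall>f\<in>hom Q X Y. Inv Q f \<in> hom Q Y X \<and> Inv Q (Inv Q f) = f) \<and>
     (\<forall>X\<in>Obj Q. Inv Q (Ide Q X) = Ide Q X) \<and>
     (\<forall>X Y Z. \<forall>f\<in>hom Q X Y. \<forall>g\<in>hom Q Y Z. Inv Q (g \<odot>\<^bsub>Q\<^esub> f) = Inv Q f \<odot>\<^bsub>Q\<^esub> Inv Q g) \<and>
     (\<forall>X\<in>Obj Q. \<forall>Y\<in>Obj Q. \<forall>S\<subseteq>hom Q X Y. \<forall>s.
        is_lub Q X Y S s \<longrightarrow> is_lub Q Y X (Inv Q ` S) (Inv Q s))"

definition is_inv_homomorphism ::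
  "('o1, 'm1, 'z1) inv_quantaloid_scheme \<Rightarrow> ('o2, 'm2, 'z2) inv_quantaloid_scheme
    \<Rightarrow> ('o1 \<Rightarrow> 'o2) \<Rightarrow> ('m1 \<Rightarrow> 'm2) \<Rightarrow> bool" where
  "is_inv_homomorphism Q R Fo Fm \<longleftrightarrow> is_homomorphism Q R Fo Fm \<and>
     (\<forall>f\<in>Arr Q. Fm (Inv Q f) = Inv R (Fm f))"

definition inv_quantaloid_equiv ::
  "('o1, 'm1, 'z1) inv_quantaloid_scheme \<Rightarrow> ('o2, 'm2, 'z2) inv_quantaloid_scheme \<Rightarrow> bool" where
  "inv_quantaloid_equiv Q R \<longleftrightarrow>
     (\<exists>Fo Fm Go Gm. is_inv_homomorphism Q R Fo Fm \<and> is_inv_homomorphism R Q Go Gm \<and>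
        naturally_isomorphic Q Q (Go \<circ> Fo) (Gm \<circ> Fm) id id \<and>
        naturally_isomorphic R R (Fo \<circ> Go) (Fm \<circ> Gm) id id)"

definition adjoint :: "('o, 'm, 'z) quantaloid_scheme \<Rightarrow> 'm \<Rightarrow> 'm \<Rightarrow> bool" where
  "adjoint Q f f' \<longleftrightarrow> f \<in> Arr Q \<and> f' \<in> hom Q (Cod Q f) (Dom Q f) \<and>
     Ide Q (Dom Q f) \<sqsubseteq>\<^bsub>Q\<^esub> f' \<odot>\<^bsub>Q\<^esub> f \<and> f \<odot>\<^bsub>Q\<^esub> f' \<sqsubseteq>\<^bsub>Q\<^esub> Ide Q (Cod Q f)"

definition left_adjoint :: "('o, 'm, 'z) quantaloid_scheme \<Rightarrow> 'm \<Rightarrow> bool" where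
  "left_adjoint Q f \<longleftrightarrow> (\<exists>f'. adjoint Q f f')"

definition sym_left_adjoint :: "('o, 'm, 'z) inv_quantaloid_scheme \<Rightarrow> 'm \<Rightarrow> bool" where
  "sym_left_adjoint Q f \<longleftrightarrow> adjoint Q f (Inv Q f)"

text \<open>The canonical involution of a quantaloid that is equivalent to one of closed cribles.\<close>

definition canonical_inv :: "('o, 'm) quantaloid \<Rightarrow> 'm \<Rightarrow> 'm" where
  "canonical_inv Q q = join Q (Cod Q q) (Dom Q q)
     {g \<odot>\<^bsub>Q\<^esub> f' | U f g f' g'. f \<in> hom Q U (Cod Q q) \<and> g \<in> hom Q U (Dom Q q) \<and>
        adjoint Q f f' \<and> adjoint Q g g' \<and> f \<odot>\<^bsub>Q\<^esub> g' \<sqsubseteq>\<^bsub>Q\<^esub> q}"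

definition with_canonical_inv :: "('o, 'm) quantaloid \<Rightarrow> ('o, 'm) inv_quantaloid" where
  "with_canonical_inv Q = quantaloid.extend Q (inv_quantaloid.fields (canonical_inv Q))"

definition sym_idempotent :: "('o, 'm, 'z) inv_quantaloid_scheme \<Rightarrow> 'm \<Rightarrow> bool" where
  "sym_idempotent Q e \<longleftrightarrow> e \<in> Arr Q \<and> Dom Q e = Cod Q e \<and> e \<odot>\<^bsub>Q\<^esub> e = e \<and> Inv Q e = e"

text \<open>An arrow \<open>x : e \<rightarrow> f\<close> of the splitting is stored as the triple \<open>(e, x, f)\<close>.\<close>

definition splitting ::
  "('o, 'm) inv_quantaloid \<Rightarrow> 'm set \<Rightarrow> ('m, 'm \<times> 'm \<times> 'm) inv_quantaloid" where
  "splitting Q E =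
     \<lparr>Obj = E,
      Arr = {(e, x, f). e \<in> E \<and> f \<in> E \<and> x \<in> hom Q (Dom Q e) (Dom Q f) \<and>
               f \<odot>\<^bsub>Q\<^esub> x = x \<and> x \<odot>\<^bsub>Q\<^esub> e = x},
      Dom = (\<lambda>(e, x, f). e),
      Cod = (\<lambda>(e, x, f). f),
      Ide = (\<lambda>e. (e, e, e)),
      Comp = (\<lambda>(f, y, g) (e, x, f'). (e, y \<odot>\<^bsub>Q\<^esub> x, g)),
      Leq = (\<lambda>(e, x, f) (e', x', f'). e = e' \<and> f = f' \<and> x \<sqsubseteq>\<^bsub>Q\<^esub> x'),
      Inv = (\<lambda>(e, x, f). (f, Inv Q x, e))\<rparr>"

section \<open>Sites and closed cribles\<close>

definition sieve :: "('o, 'm) category \<Rightarrow> 'o \<Rightarrow> 'm set \<Rightarrow> bool" where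
  "sieve C X S \<longleftrightarrow> S \<subseteq> {f \<in> Arr C. Cod C f = X} \<and>
     (\<forall>f\<in>S. \<forall>g\<in>Arr C. Cod C g = Dom C f \<longrightarrow> f \<odot>\<^bsub>C\<^esub> g \<in> S)"

definition pullback_sieve :: "('o, 'm) category \<Rightarrow> 'm \<Rightarrow> 'm set \<Rightarrow> 'm set" where
  "pullback_sieve C f S = {g \<in> Arr C. Cod C g = Dom C f \<and> f \<odot>\<^bsub>C\<^esub> g \<in> S}"

definition grothendieck_topology :: "('o, 'm) category \<Rightarrow> ('o \<Rightarrow> 'm set set) \<Rightarrow> bool" where
  "grothendieck_topology C J \<longleftrightarrow>
     (\<forall>X\<in>Obj C. \<forall>S\<in>J X. sieve C X S) \<and>
     (\<forall>X\<in>Obj C. {f \<in> Arr C. Cod C f = X} \<in> J X) \<and>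
     (\<forall>X\<in>Obj C. \<forall>S\<in>J X. \<forall>f\<in>Arr C. Cod C f = X \<longrightarrow> pullback_sieve C f S \<in> J (Dom C f)) \<and>
     (\<forall>X\<in>Obj C. \<forall>S\<in>J X. \<forall>T. sieve C X T \<longrightarrow>
        (\<forall>f\<in>S. pullback_sieve C f T \<in> J (Dom C f)) \<longrightarrow> T \<in> J X)"

definition is_site :: "('o, 'm) category \<Rightarrow> ('o \<Rightarrow> 'm set set) \<Rightarrow> bool" where
  "is_site C J \<longleftrightarrow> is_category C \<and> grothendieck_topology C J"

text \<open>As an arrow \<open>X \<rightarrow> Y\<close>, a set of spans consists of pairs \<open>(f : U \<rightarrow> Y, g : U \<rightarrow> X)\<close>.\<close>

definition spans :: "('o, 'm, 'z) category_scheme \<Rightarrow> 'o \<Rightarrow> 'o \<Rightarrow> ('m \<times> 'm) set" where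
  "spans C X Y = {(f, g). f \<in> hom C (Dom C f) Y \<and> g \<in> hom C (Dom C f) X}"

definition closed_crible ::
  "('o, 'm) category \<Rightarrow> ('o \<Rightarrow> 'm set set) \<Rightarrow> 'o \<Rightarrow> 'o \<Rightarrow> ('m \<times> 'm) set \<Rightarrow> bool" where
  "closed_crible C J X Y R \<longleftrightarrow> R \<subseteq> spans C X Y \<and>
     (\<forall>(f, g)\<in>R. \<forall>s\<in>Arr C. Cod C s = Dom C f \<longrightarrow> (f \<odot>\<^bsub>C\<^esub> s, g \<odot>\<^bsub>C\<^esub> s) \<in> R) \<and>
     (\<forall>(f, g)\<in>spans C X Y.
        {s \<in> Arr C. Cod C s = Dom C f \<and> (f \<odot>\<^bsub>C\<^esub> s, g \<odot>\<^bsub>C\<^esub> s) \<in> R} \<in> J (Dom C f)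
          \<longrightarrow> (f, g) \<in> R)"

definition crible_closure ::
  "('o, 'm) category \<Rightarrow> ('o \<Rightarrow> 'm set set) \<Rightarrow> 'o \<Rightarrow> 'o \<Rightarrow> ('m \<times> 'm) set \<Rightarrow> ('m \<times> 'm) set" where
  "crible_closure C J X Y T = \<Inter>{R. closed_crible C J X Y R \<and> T \<subseteq> R}"

definition crible_quantaloid ::
  "('o, 'm) category \<Rightarrow> ('o \<Rightarrow> 'm set set) \<Rightarrow> ('o, 'o \<times> ('m \<times> 'm) set \<times> 'o) quantaloid" where
  "crible_quantaloid C J =
     \<lparr>Obj = Obj C,
      Arr = {(X, R, Y). X \<in> Obj C \<and> Y \<in> Obj C \<and> closed_crible C J X Y R},
      Dom = (\<lambda>(X, R, Y). X),
      Cod = (\<lambda>(X, R, Y). Y),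
      Ide = (\<lambda>X. (X, crible_closure C J X X {(Ide C X, Ide C X)}, X)),
      Comp = (\<lambda>(Y, S, Z) (X, R, Y').
        (X, crible_closure C J X Z {(h, g) | h g. \<exists>f. (h, f) \<in> S \<and> (f, g) \<in> R}, Z)),
      Leq = (\<lambda>(X, R, Y) (X', R', Y'). X = X' \<and> Y = Y' \<and> R \<subseteq> R')\<rparr>"

section \<open>Enriched categories\<close>

text \<open>
  The arrow \<open>qhom A y x : qty A x \<rightarrow> qty A y\<close> is the hom-arrow written \<open>A(y, x)\<close>.
  All functions on object sets are extensional, so that equality of records is equality of
  enriched categories.
\<close>

record ('u, 'o, 'm) qcat =
  qobj :: "'u set"
  qty :: "'u \<Rightarrow> 'o"
  qhom :: "'u \<Rightarrow> 'u \<Rightarrow> 'm"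

definition is_qcat :: "('o, 'm, 'z) quantaloid_scheme \<Rightarrow> ('u, 'o, 'm) qcat \<Rightarrow> bool" where
  "is_qcat Q A \<longleftrightarrow> small TYPE('u) (qobj A) \<and>
     qty A \<in> qobj A \<rightarrow>\<^sub>E Obj Q \<and>
     qhom A \<in> (\<Pi>\<^sub>E y\<in>qobj A. \<Pi>\<^sub>E x\<in>qobj A. hom Q (qty A x) (qty A y)) \<and>
     (\<forall>x\<in>qobj A. \<forall>y\<in>qobj A. \<forall>z\<in>qobj A. qhom A z y \<odot>\<^bsub>Q\<^esub> qhom A y x \<sqsubseteq>\<^bsub>Q\<^esub> qhom A z x) \<and>
     (\<forall>x\<in>qobj A. Ide Q (qty A x) \<sqsubseteq>\<^bsub>Q\<^esub> qhom A x x)"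

definition symmetric_qcat :: "('o, 'm, 'z) inv_quantaloid_scheme \<Rightarrow> ('u, 'o, 'm) qcat \<Rightarrow> bool" where
  "symmetric_qcat Q A \<longleftrightarrow> (\<forall>x\<in>qobj A. \<forall>y\<in>qobj A. qhom A x y = Inv Q (qhom A y x))"

definition is_qfunctor ::
  "('o, 'm, 'z) quantaloid_scheme \<Rightarrow> ('u, 'o, 'm) qcat \<Rightarrow> ('u, 'o, 'm) qcat
    \<Rightarrow> ('u \<Rightarrow> 'u) \<Rightarrow> bool" where
  "is_qfunctor Q A B F \<longleftrightarrow> F \<in> qobj A \<rightarrow>\<^sub>E qobj B \<and>
     (\<forall>x\<in>qobj A. qty B (F x) = qty A x) \<and>
     (\<forall>x\<in>qobj A. \<forall>y\<in>qobj A. qhom A y x \<sqsubseteq>\<^bsub>Q\<^esub> qhom B (F y) (F x))"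

definition qfunctor_le ::
  "('o, 'm, 'z) quantaloid_scheme \<Rightarrow> ('u, 'o, 'm) qcat \<Rightarrow> ('u, 'o, 'm) qcat
    \<Rightarrow> ('u \<Rightarrow> 'u) \<Rightarrow> ('u \<Rightarrow> 'u) \<Rightarrow> bool" where
  "qfunctor_le Q A B F G \<longleftrightarrow> (\<forall>x\<in>qobj A. Ide Q (qty A x) \<sqsubseteq>\<^bsub>Q\<^esub> qhom B (F x) (G x))"

definition qfunctor_iso ::
  "('o, 'm, 'z) quantaloid_scheme \<Rightarrow> ('u, 'o, 'm) qcat \<Rightarrow> ('u, 'o, 'm) qcat
    \<Rightarrow> ('u \<Rightarrow> 'u) \<Rightarrow> ('u \<Rightarrow> 'u) \<Rightarrow> bool" where
  "qfunctor_iso Q A B F G \<longleftrightarrow> qfunctor_le Q A B F G \<and> qfunctor_le Q A B G F"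

definition qfunctor_class ::
  "('o, 'm, 'z) quantaloid_scheme \<Rightarrow> ('u, 'o, 'm) qcat \<Rightarrow> ('u, 'o, 'm) qcat
    \<Rightarrow> ('u \<Rightarrow> 'u) \<Rightarrow> ('u \<Rightarrow> 'u) set" where
  "qfunctor_class Q A B F = {G. is_qfunctor Q A B G \<and> qfunctor_iso Q A B F G}"

definition is_distributor ::
  "('o, 'm, 'z) quantaloid_scheme \<Rightarrow> ('u, 'o, 'm) qcat \<Rightarrow> ('u, 'o, 'm) qcat
    \<Rightarrow> ('u \<Rightarrow> 'u \<Rightarrow> 'm) \<Rightarrow> bool" where
  "is_distributor Q A B \<Phi> \<longleftrightarrow>
     \<Phi> \<in> (\<Pi>\<^sub>E y\<in>qobj B. \<Pi>\<^sub>E x\<in>qobj A. hom Q (qty A x) (qty B y)) \<and>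
     (\<forall>x\<in>qobj A. \<forall>y\<in>qobj B. \<forall>y'\<in>qobj B. qhom B y' y \<odot>\<^bsub>Q\<^esub> \<Phi> y x \<sqsubseteq>\<^bsub>Q\<^esub> \<Phi> y' x) \<and>
     (\<forall>x\<in>qobj A. \<forall>x'\<in>qobj A. \<forall>y\<in>qobj B. \<Phi> y x \<odot>\<^bsub>Q\<^esub> qhom A x x' \<sqsubseteq>\<^bsub>Q\<^esub> \<Phi> y x')"

type_synonym ('u, 'o, 'm) distributor =
  "('u, 'o, 'm) qcat \<times> ('u \<Rightarrow> 'u \<Rightarrow> 'm) \<times> ('u, 'o, 'm) qcat"

definition Dist ::
  "('o, 'm, 'z) quantaloid_scheme \<Rightarrow> (('u, 'o, 'm) qcat, ('u, 'o, 'm) distributor) quantaloid" where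
  "Dist Q =
     \<lparr>Obj = {A. is_qcat Q A},
      Arr = {(A, \<Phi>, B). is_qcat Q A \<and> is_qcat Q B \<and> is_distributor Q A B \<Phi>},
      Dom = (\<lambda>(A, \<Phi>, B). A),
      Cod = (\<lambda>(A, \<Phi>, B). B),
      Ide = (\<lambda>A. (A, qhom A, A)),
      Comp = (\<lambda>(B, \<Psi>, C) (A, \<Phi>, B').
        (A, \<lambda>z\<in>qobj C. \<lambda>x\<in>qobj A.
              join Q (qty A x) (qty C z) {\<Psi> z y \<odot>\<^bsub>Q\<^esub> \<Phi> y x | y. y \<in> qobj B}, C)),
      Leq = (\<lambda>(A, \<Phi>, B) (A', \<Phi>', B'). A = A' \<and> B = B' \<and>
        (\<forall>y\<in>qobj B. \<forall>x\<in>qobj A. \<Phi> y x \<sqsubseteq>\<^bsub>Q\<^esub> \<Phi>' y x))\<rparr>"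

definition SymDist ::
  "('o, 'm, 'z) inv_quantaloid_scheme
    \<Rightarrow> (('u, 'o, 'm) qcat, ('u, 'o, 'm) distributor) inv_quantaloid" where
  "SymDist Q = quantaloid.extend (full_sub (symmetric_qcat Q) (Dist Q))
     (inv_quantaloid.fields
        (\<lambda>(A, \<Phi>, B). (B, \<lambda>a\<in>qobj A. \<lambda>b\<in>qobj B. Inv Q (\<Phi> b a), A)))"

definition represented ::
  "('u, 'o, 'm) qcat \<Rightarrow> ('u, 'o, 'm) qcat \<Rightarrow> ('u \<Rightarrow> 'u) \<Rightarrow> ('u, 'o, 'm) distributor" where
  "represented B A F = (B, \<lambda>a\<in>qobj A. \<lambda>b\<in>qobj B. qhom A a (F b), A)"

definition cauchy_complete :: "('o, 'm, 'z) quantaloid_scheme \<Rightarrow> ('u, 'o, 'm) qcat \<Rightarrow> bool" where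
  "cauchy_complete Q A \<longleftrightarrow>
     (\<forall>B \<Phi>. left_adjoint (Dist Q) (B, \<Phi>, A) \<longrightarrow>
        (\<exists>F. is_qfunctor Q B A F \<and> (B, \<Phi>, A) = represented B A F))"

definition symmetrically_complete ::
  "('o, 'm, 'z) inv_quantaloid_scheme \<Rightarrow> ('u, 'o, 'm) qcat \<Rightarrow> bool" where
  "symmetrically_complete Q A \<longleftrightarrow>
     (\<forall>B \<Phi>. sym_left_adjoint (SymDist Q) (B, \<Phi>, A) \<longrightarrow>
        (\<exists>F. is_qfunctor Q B A F \<and> (B, \<Phi>, A) = represented B A F))"

type_synonym ('u, 'o, 'm) qfunctor_arrow =
  "('u, 'o, 'm) qcat \<times> ('u \<Rightarrow> 'u) set \<times> ('u, 'o, 'm) qcat"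

text \<open>Symmetric enriched categories, and isomorphism classes of functors between them.\<close>

definition SymCat ::
  "('o, 'm, 'z) inv_quantaloid_scheme
    \<Rightarrow> (('u, 'o, 'm) qcat, ('u, 'o, 'm) qfunctor_arrow) category" where
  "SymCat Q =
     \<lparr>Obj = {A. is_qcat Q A \<and> symmetric_qcat Q A},
      Arr = {(A, qfunctor_class Q A B F, B) | A B F.
               is_qcat Q A \<and> symmetric_qcat Q A \<and> is_qcat Q B \<and> symmetric_qcat Q B \<and>
               is_qfunctor Q A B F},
      Dom = (\<lambda>(A, f, B). A),
      Cod = (\<lambda>(A, f, B). B),
      Ide = (\<lambda>A. (A, qfunctor_class Q A A (\<lambda>x\<in>qobj A. x), A)),
      Comp = (\<lambda>(B, g, C) (A, f, B').
        (A, \<Union>F\<in>f. \<Union>G\<in>g. qfunctor_class Q A C (compose (qobj A) G F), C))\<rparr>"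

definition SymCat_cc ::
  "('o, 'm, 'z) inv_quantaloid_scheme
    \<Rightarrow> (('u, 'o, 'm) qcat, ('u, 'o, 'm) qfunctor_arrow) category" where
  "SymCat_cc Q = full_sub (cauchy_complete Q) (SymCat Q)"

definition SymCat_sc ::
  "('o, 'm, 'z) inv_quantaloid_scheme
    \<Rightarrow> (('u, 'o, 'm) qcat, ('u, 'o, 'm) qfunctor_arrow) category" where
  "SymCat_sc Q = full_sub (symmetrically_complete Q) (SymCat Q)"

definition SymDist_sc ::
  "('o, 'm, 'z) inv_quantaloid_scheme
    \<Rightarrow> (('u, 'o, 'm) qcat, ('u, 'o, 'm) distributor) inv_quantaloid" where
  "SymDist_sc Q = full_sub (symmetrically_complete Q) (SymDist Q)"

definition ShQ ::
  "('o, 'm) inv_quantaloid \<Rightarrow> 'm set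
    \<Rightarrow> (('u, 'm, 'm \<times> 'm \<times> 'm) qcat, ('u, 'm, 'm \<times> 'm \<times> 'm) qfunctor_arrow) category" where
  "ShQ Q E = SymCat_sc (splitting Q E)"

definition RelQ ::
  "('o, 'm) inv_quantaloid \<Rightarrow> 'm set
    \<Rightarrow> (('u, 'm, 'm \<times> 'm \<times> 'm) qcat, ('u, 'm, 'm \<times> 'm \<times> 'm) distributor) inv_quantaloid" where
  "RelQ Q E = SymDist_sc (splitting Q E)"

section \<open>Sheaves on a site\<close>

record ('u, 'o, 'm) presheaf =
  val :: "'o \<Rightarrow> 'u set"
  act :: "'m \<Rightarrow> 'u \<Rightarrow> 'u"

definition is_presheaf :: "('o, 'm) category \<Rightarrow> ('u, 'o, 'm) presheaf \<Rightarrow> bool" where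
  "is_presheaf C F \<longleftrightarrow>
     val F \<in> extensional (Obj C) \<and>
     (\<forall>X\<in>Obj C. small TYPE('u) (val F X)) \<and>
     act F \<in> (\<Pi>\<^sub>E f\<in>Arr C. val F (Cod C f) \<rightarrow>\<^sub>E val F (Dom C f)) \<and>
     (\<forall>X\<in>Obj C. \<forall>x\<in>val F X. act F (Ide C X) x = x) \<and>
     (\<forall>X Y Z. \<forall>f\<in>hom C X Y. \<forall>g\<in>hom C Y Z. \<forall>x\<in>val F Z.
        act F (g \<odot>\<^bsub>C\<^esub> f) x = act F f (act F g x))"

definition matching_family ::
  "('o, 'm) category \<Rightarrow> ('u, 'o, 'm) presheaf \<Rightarrow> 'm set \<Rightarrow> ('m \<Rightarrow> 'u) \<Rightarrow> bool" where
  "matching_family C F S x \<longleftrightarrow> (\<forall>f\<in>S. x f \<in> val F (Dom C f)) \<and>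
     (\<forall>f\<in>S. \<forall>g\<in>Arr C. Cod C g = Dom C f \<longrightarrow> x (f \<odot>\<^bsub>C\<^esub> g) = act F g (x f))"

definition is_sheaf ::
  "('o, 'm) category \<Rightarrow> ('o \<Rightarrow> 'm set set) \<Rightarrow> ('u, 'o, 'm) presheaf \<Rightarrow> bool" where
  "is_sheaf C J F \<longleftrightarrow> is_presheaf C F \<and>
     (\<forall>X\<in>Obj C. \<forall>S\<in>J X. \<forall>x. matching_family C F S x \<longrightarrow>
        (\<exists>!a. a \<in> val F X \<and> (\<forall>f\<in>S. act F f a = x f)))"

definition is_transformation ::
  "('o, 'm) category \<Rightarrow> ('u, 'o, 'm) presheaf \<Rightarrow> ('u, 'o, 'm) presheaf
    \<Rightarrow> ('o \<Rightarrow> 'u \<Rightarrow> 'u) \<Rightarrow> bool" where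
  "is_transformation C F G \<alpha> \<longleftrightarrow>
     \<alpha> \<in> (\<Pi>\<^sub>E X\<in>Obj C. val F X \<rightarrow>\<^sub>E val G X) \<and>
     (\<forall>X Y. \<forall>f\<in>hom C X Y. \<forall>y\<in>val F Y. \<alpha> X (act F f y) = act G f (\<alpha> Y y))"

type_synonym ('u, 'o, 'm) transformation =
  "('u, 'o, 'm) presheaf \<times> ('o \<Rightarrow> 'u \<Rightarrow> 'u) \<times> ('u, 'o, 'm) presheaf"

definition Sh ::
  "('o, 'm) category \<Rightarrow> ('o \<Rightarrow> 'm set set)
    \<Rightarrow> (('u, 'o, 'm) presheaf, ('u, 'o, 'm) transformation) category" where
  "Sh C J =
     \<lparr>Obj = {F. is_sheaf C J F},
      Arr = {(F, \<alpha>, G). is_sheaf C J F \<and> is_sheaf C J G \<and> is_transformation C F G \<alpha>},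
      Dom = (\<lambda>(F, \<alpha>, G). F),
      Cod = (\<lambda>(F, \<alpha>, G). G),
      Ide = (\<lambda>F. (F, \<lambda>X\<in>Obj C. \<lambda>x\<in>val F X. x, F)),
      Comp = (\<lambda>(G, \<beta>, H) (F, \<alpha>, G'). (F, \<lambda>X\<in>Obj C. compose (val F X) (\<beta> X) (\<alpha> X), H))\<rparr>"

section \<open>Internal relations\<close>

definition is_product :: "('o, 'm) category \<Rightarrow> 'o \<Rightarrow> 'o \<Rightarrow> 'o \<Rightarrow> 'm \<Rightarrow> 'm \<Rightarrow> bool" where
  "is_product T X Y P p q \<longleftrightarrow> p \<in> hom T P X \<and> q \<in> hom T P Y \<and>
     (\<forall>W. \<forall>f\<in>hom T W X. \<forall>g\<in>hom T W Y.
        \<exists>!h. h \<in> hom T W P \<and> p \<odot>\<^bsub>T\<^esub> h = f \<and> q \<odot>\<^bsub>T\<^esub> h = g)"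

definition is_mono :: "('o, 'm) category \<Rightarrow> 'm \<Rightarrow> bool" where
  "is_mono T m \<longleftrightarrow> m \<in> Arr T \<and>
     (\<forall>W. \<forall>f\<in>hom T W (Dom T m). \<forall>g\<in>hom T W (Dom T m). m \<odot>\<^bsub>T\<^esub> f = m \<odot>\<^bsub>T\<^esub> g \<longrightarrow> f = g)"

definition is_pullback :: "('o, 'm) category \<Rightarrow> 'm \<Rightarrow> 'm \<Rightarrow> 'm \<Rightarrow> 'm \<Rightarrow> bool" where
  "is_pullback T f g p q \<longleftrightarrow> f \<in> Arr T \<and> g \<in> Arr T \<and> Cod T f = Cod T g \<and>
     p \<in> hom T (Dom T p) (Dom T f) \<and> q \<in> hom T (Dom T p) (Dom T g) \<and>
     f \<odot>\<^bsub>T\<^esub> p = g \<odot>\<^bsub>T\<^esub> q \<and>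
     (\<forall>W. \<forall>a\<in>hom T W (Dom T f). \<forall>b\<in>hom T W (Dom T g). f \<odot>\<^bsub>T\<^esub> a = g \<odot>\<^bsub>T\<^esub> b \<longrightarrow>
        (\<exists>!h. h \<in> hom T W (Dom T p) \<and> p \<odot>\<^bsub>T\<^esub> h = a \<and> q \<odot>\<^bsub>T\<^esub> h = b))"

text \<open>
  A monomorphism \<open>m : R \<rightarrow> P\<close> into a product of \<open>Y\<close> and \<open>X\<close> is recorded by its two
  components \<open>(R \<rightarrow> Y, R \<rightarrow> X)\<close>, which makes the choice of the product irrelevant.  Factorization
  of spans is then factorization over the product, and subobjects are the equivalence classes of
  the resulting preorder on \<open>mono_spans\<close>.
\<close>

definition mono_spans :: "('o, 'm) category \<Rightarrow> 'o \<Rightarrow> 'o \<Rightarrow> ('m \<times> 'm) set" where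
  "mono_spans T X Y = {(p \<odot>\<^bsub>T\<^esub> m, q \<odot>\<^bsub>T\<^esub> m) | P p q m.
     is_product T Y X P p q \<and> is_mono T m \<and> Cod T m = P}"

definition span_le :: "('o, 'm) category \<Rightarrow> 'm \<times> 'm \<Rightarrow> 'm \<times> 'm \<Rightarrow> bool" where
  "span_le T r s \<longleftrightarrow> (\<exists>h\<in>hom T (Dom T (fst r)) (Dom T (fst s)).
     fst r = fst s \<odot>\<^bsub>T\<^esub> h \<and> snd r = snd s \<odot>\<^bsub>T\<^esub> h)"

definition subobject_class :: "('o, 'm) category \<Rightarrow> 'o \<Rightarrow> 'o \<Rightarrow> 'm \<times> 'm \<Rightarrow> ('m \<times> 'm) set" where
  "subobject_class T X Y r = {s \<in> mono_spans T X Y. span_le T r s \<and> span_le T s r}"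

text \<open>\<open>i\<close> is the image, in a product of \<open>Y\<close> and \<open>X\<close>, of the arrow with components \<open>s\<close>.\<close>

definition is_image :: "('o, 'm) category \<Rightarrow> 'o \<Rightarrow> 'o \<Rightarrow> 'm \<times> 'm \<Rightarrow> 'm \<times> 'm \<Rightarrow> bool" where
  "is_image T X Y s i \<longleftrightarrow> i \<in> mono_spans T X Y \<and> span_le T s i \<and>
     (\<forall>j\<in>mono_spans T X Y. span_le T s j \<longrightarrow> span_le T i j)"

definition Rel ::
  "('o, 'm) category \<Rightarrow> ('o, 'o \<times> ('m \<times> 'm) set \<times> 'o) inv_quantaloid" where
  "Rel T =
     \<lparr>Obj = Obj T,
      Arr = {(X, subobject_class T X Y r, Y) | X Y r.
               X \<in> Obj T \<and> Y \<in> Obj T \<and> r \<in> mono_spans T X Y},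
      Dom = (\<lambda>(X, R, Y). X),
      Cod = (\<lambda>(X, R, Y). Y),
      Ide = (\<lambda>X. (X, subobject_class T X X (Ide T X, Ide T X), X)),
      Comp = (\<lambda>(Y, S, Z) (X, R, Y').
        (X, {i. \<exists>(h, k)\<in>S. \<exists>(f, g)\<in>R. \<exists>a b.
               is_pullback T k f a b \<and> is_image T X Z (h \<odot>\<^bsub>T\<^esub> a, g \<odot>\<^bsub>T\<^esub> b) i}, Z)),
      Leq = (\<lambda>(X, R, Y) (X', R', Y'). X = X' \<and> Y = Y' \<and> (\<forall>r\<in>R. \<forall>s\<in>R'. span_le T r s)),
      Inv = (\<lambda>(X, R, Y). (Y, prod.swap ` R, X))\<rparr>"

end

theory Submission
  imports Defs
begin

text \<open>
  All equivalences come from functors that are fully faithful, compatible with order and involution,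
  and essentially surjective up to unitaries; such a functor restricts to the categories of symmetric
  left adjoints. \<open>SymDist\<close> is invariant under change of base along such a functor \<open>K \<rightarrow> L\<close> as soon as
  every identity of \<open>L\<close> is a join of \<open>u u\<degree>\<close> for symmetric left adjoints \<open>u\<close> with domain in the image of \<open>K\<close>.
  This applies to \<open>\<Q> \<rightarrow> \<Q>\<^sub>\<E>\<close> and to \<open>\<Q> \<rightarrow> \<R>(C, J)\<close>, so it suffices to work over \<open>\<R>(C, J)\<close>.
  There a sheaf is sent to its category of elements, with homs the closed cribles of spans on which two
  elements agree: local relations between sheaves are exactly the distributors between such categories,
  and a symmetric category is unitarily equivalent to the elements of the sheaf of its locally
  representable sections. Internal relations are tabulated by subsheaves of products.

  Every symmetric category has a symmetric completion, to which it is unitarily equivalent in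
  \<open>SymDist\<close>. Between symmetrically complete categories functors up to isomorphism are the same as symmetric left
  adjoints, so the statements on categories follow from those on involutive quantaloids. Finally, in
  \<open>\<R>(C, J)\<close> a left adjoint into a symmetric category is automatically symmetric, which
  identifies Cauchy completeness with symmetric completeness over \<open>\<Q>\<close>.
\<close>

section \<open>Small sets\<close>

text \<open>The hypothesis on \<open>Q\<close> is an equivalence of bare quantaloids: nothing in it
  speaks of an involution, while every later construction uses one. The bridge is that among closed
  cribles a right adjoint is forced to be the reversal of its left adjoint. Adjoints, and with them
  the formula for the canonical involution, can therefore be read off order and composition alone,
  and the equivalence carries this formula to reversal of spans. For the same reason an isomorphism
  of cribles is unitary, which turns ordinary essential surjectivity into the one up to unitaries.
  Unitaries are asked for because conjugation by a unitary commutes with the involution, which a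
  mere isomorphism does not guarantee. The density criterion is a form of Morita invariance: when
  the joins of u u\<degree> reach the identities, an object is determined by its restrictions along
  arrows out of the smaller base. Automatic symmetry of left adjoints is transported from cribles to
  \<open>Q\<close> only; hence Cauchy completeness appears over \<open>Q\<close> and symmetric
  completeness over the split base.\<close>

lemma small_lepoll: "small U A ==> B \<lesssim> A ==> small U B"
  unfolding small_def by (rule lesspoll_trans1)

lemma small_subset: "small U A ==> B \<subseteq> A ==> small U B"
  using small_lepoll subset_imp_lepoll by blast

lemma small_image: "small U A ==> small U (f ` A)"
  using small_lepoll image_lepoll by blast

lemma small_inj:
  assumes "small TYPE('u) (A :: 'a set)"
  obtains f :: "'a => 'u" where "inj_on f A"
  using assms lesspoll_imp_lepoll unfolding small_def lepoll_def by blast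

text \<open>A finite type with n elements cannot be a strong limit: removing one point leaves a
  small set with n - 1 elements, whose power set has 2 ^ (n - 1) > n - 1, hence at least n,
  elements.\<close>

lemma universe_infinite:
  assumes "universe TYPE('u)"
  shows "infinite (UNIV :: 'u set)"
proof
  assume fin: "finite (UNIV :: 'u set)"
  fix x :: 'u
  define A where "A = UNIV - {x}"
  define n where "n = card (UNIV :: 'u set)"
  have n: "n > 0" unfolding n_def using fin by (simp add: card_gt_0_iff)
  have cA: "card A = n - 1" using fin by (simp add: A_def n_def)
  have finA: "finite A" using fin by (simp add: A_def)
  have "\<not> A \<approx> (UNIV :: 'u set)"
    using eqpoll_iff_card[OF finA fin] cA n n_def by simp
  then have "small TYPE('u) A"
    unfolding small_def lesspoll_def by (simp add: subset_imp_lepoll)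
  then have "small TYPE('u) (Pow A)"
    using assms unfolding universe_def by blast
  then have "Pow A \<lesssim> (UNIV :: 'u set)" "\<not> Pow A \<approx> (UNIV :: 'u set)"
    unfolding small_def lesspoll_def by auto
  then have "card (Pow A) < n"
    using finA fin lepoll_iff_card_le[of "Pow A" "UNIV :: 'u set"]
      eqpoll_iff_card[of "Pow A" "UNIV :: 'u set"] n_def by force
  then have "2 ^ (n - 1) < n" using cA finA by (simp add: card_Pow)
  then show False using less_exp[of "n - 1"] by linarith
qed

text \<open>Pairs of elements of the universe get codes in the universe. This is what allows objects
  of enriched categories and sections of presheaves to be built from pairs although both must have
  type \<open>'u\<close>.\<close>

lemma universe_pairing:
  assumes "universe TYPE('u)"
  obtains p :: "'u \<times> 'u => 'u" where "inj p"
proof -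
  have "ordIso2 (card_of ((UNIV :: 'u set) \<times> (UNIV :: 'u set))) (card_of (UNIV :: 'u set))"
    using card_of_Times_same_infinite[OF universe_infinite[OF assms]] .
  then obtain p :: "'u \<times> 'u => 'u" where "bij_betw p (UNIV \<times> UNIV) UNIV"
    using card_of_ordIso by blast
  then have "inj p" by (simp add: bij_betw_def)
  then show thesis by (rule that)
qed

text \<open>The closure axioms of \<open>universe\<close> concern subsets of \<open>'u\<close> and
  plain unions. So index set and fibres are first injected into \<open>'u\<close>, and the fibres
  are made disjoint by tagging each with the code of its index.\<close>

lemma small_Sigma:
  assumes U: "universe TYPE('u)" and A: "small TYPE('u) A"
    and B: "\<And>a. a \<in> A ==> small TYPE('u) (B a)"
  shows "small TYPE('u) (Sigma A B)"
proof -
  obtain p :: "'u \<times> 'u => 'u" where p: "inj p" using universe_pairing[OF U] .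
  obtain f :: "_ => 'u" where f: "inj_on f A" using small_inj[OF A] .
  have "\<forall>a\<in>A. \<exists>g :: _ => 'u. inj_on g (B a)" using small_inj[OF B] by metis
  then obtain g :: "_ => _ => 'u" where g: "\<And>a. a \<in> A ==> inj_on (g a) (B a)" by metis
  define h where "h = (\<lambda>(a, b). p (f a, g a b))"
  \<comment> \<open>The tagged fibre must be a function of the code u, so the index is recovered
    from u by inverting f on A.\<close>
  define B' where "B' u = (let a = inv_into A f u in (\<lambda>b. p (u, g a b)) ` B a)" for u
  have "inj_on h (Sigma A B)"
    unfolding inj_on_def h_def using inj_eq[OF p] inj_on_eq_iff[OF f] inj_on_eq_iff[OF g] by auto
  moreover have "h ` Sigma A B \<subseteq> (\<Union>u\<in>f ` A. B' u)"
    using f by (force simp: h_def B'_def Let_def)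
  ultimately have "Sigma A B \<lesssim> (\<Union>u\<in>f ` A. B' u)" unfolding lepoll_def by blast
  moreover have "small TYPE('u) (B' u)" if "u \<in> f ` A" for u
    unfolding B'_def Let_def by (intro small_image B) (use that in \<open>simp add: inv_into_into\<close>)
  then have "small TYPE('u) (\<Union>u\<in>f ` A. B' u)"
    using U small_image[OF A, of f] unfolding universe_def by blast
  ultimately show ?thesis by (rule small_lepoll[rotated])
qed

lemma small_Times:
  "universe TYPE('u) ==> small TYPE('u) A ==> small TYPE('u) B ==> small TYPE('u) (A \<times> B)"
  by (rule small_Sigma)

lemma small_Pow:
  assumes U: "universe TYPE('u)" and A: "small TYPE('u) A"
  shows "small TYPE('u) (Pow A)"
proof -
  obtain f :: "_ => 'u" where f: "inj_on f A" using small_inj[OF A] .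
  have "inj_on (image f) (Pow A)" using f by (rule inj_on_image_Pow)
  moreover have "image f ` Pow A \<subseteq> Pow (f ` A)" by auto
  ultimately have "Pow A \<lesssim> Pow (f ` A)" unfolding lepoll_def by blast
  moreover have "small TYPE('u) (Pow (f ` A))"
    using U small_image[OF A, of f] unfolding universe_def by blast
  ultimately show ?thesis by (rule small_lepoll[rotated])
qed

lemma small_singleton:
  assumes U: "universe TYPE('u)"
  shows "small TYPE('u) {x}"
  unfolding small_def by (rule finite_lesspoll_infinite) (use universe_infinite[OF U] in auto)

text \<open>An extensional function is determined by its graph, a subset of the product, so products
  and power sets suffice.\<close>

lemma small_PiE:
  assumes U: "universe TYPE('u)" and A: "small TYPE('u) A" and B: "small TYPE('u) B"
  shows "small TYPE('u) (A \<rightarrow>\<^sub>E B)"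
proof -
  define h where "h f = {(a, f a) | a. a \<in> A}" for f :: "'a => 'b"
  have "inj_on h (A \<rightarrow>\<^sub>E B)"
  proof (rule inj_onI)
    fix f g assume fg: "f \<in> A \<rightarrow>\<^sub>E B" "g \<in> A \<rightarrow>\<^sub>E B" "h f = h g"
    then have "f a = g a" if "a \<in> A" for a using that unfolding h_def by blast
    then show "f = g" using fg by (intro PiE_ext) auto
  qed
  moreover have "h ` (A \<rightarrow>\<^sub>E B) \<subseteq> Pow (A \<times> B)" by (auto simp: h_def PiE_def Pi_def)
  ultimately have "(A \<rightarrow>\<^sub>E B) \<lesssim> Pow (A \<times> B)" unfolding lepoll_def by blast
  then show ?thesis using small_Pow[OF U small_Times[OF U A B]] small_lepoll by blast
qed

section \<open>Fully faithful functors and equivalences\<close>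

lemma homI: "f \<in> Arr C ==> Dom C f = X ==> Cod C f = Y ==> f \<in> hom C X Y"
  by (simp add: hom_def)

lemma homD:
  assumes "f \<in> hom C X Y"
  shows "f \<in> Arr C" "Dom C f = X" "Cod C f = Y"
  using assms by (auto simp: hom_def)

lemma Arr_hom: "f \<in> Arr C ==> f \<in> hom C (Dom C f) (Cod C f)"
  by (simp add: hom_def)

context
  fixes C :: "('o, 'm, 'z) category_scheme" (structure)
  assumes C: "is_category C"
begin

lemma cat_hom_obj: "f \<in> hom C X Y ==> X \<in> Obj C" "f \<in> hom C X Y ==> Y \<in> Obj C"
  using C unfolding is_category_def hom_def by auto

lemma cat_ide: "X \<in> Obj C ==> Ide C X \<in> hom C X X"
  using C unfolding is_category_def by blast

lemma cat_comp: "g \<in> hom C Y Z ==> f \<in> hom C X Y ==> g \<odot> f \<in> hom C X Z"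
  using C unfolding is_category_def by blast

lemma cat_idr: "f \<in> hom C X Y ==> f \<odot> Ide C X = f"
  using C unfolding is_category_def by blast

lemma cat_idl: "f \<in> hom C X Y ==> Ide C Y \<odot> f = f"
  using C unfolding is_category_def by blast

lemma cat_assoc:
  "h \<in> hom C Y Z ==> g \<in> hom C X Y ==> f \<in> hom C W X ==> (h \<odot> g) \<odot> f = h \<odot> (g \<odot> f)"
  using C unfolding is_category_def by metis

lemma cat_isoI:
  "f \<in> hom C X Y ==> g \<in> hom C Y X ==> g \<odot> f = Ide C X ==> f \<odot> g = Ide C Y ==> is_iso C f"
  unfolding is_iso_def by (auto simp: hom_def)

lemma cat_isoE:
  assumes "is_iso C f" "f \<in> hom C X Y"
  obtains g where "g \<in> hom C Y X" "g \<odot> f = Ide C X" "f \<odot> g = Ide C Y"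
  using assms unfolding is_iso_def hom_def by auto

lemma cat_iso_comp:
  assumes "is_iso C f" "f \<in> hom C X Y" "is_iso C g" "g \<in> hom C Y Z"
  shows "is_iso C (g \<odot> f)"
proof -
  obtain f' where f': "f' \<in> hom C Y X" "f' \<odot> f = Ide C X" "f \<odot> f' = Ide C Y"
    using assms cat_isoE by blast
  obtain g' where g': "g' \<in> hom C Z Y" "g' \<odot> g = Ide C Y" "g \<odot> g' = Ide C Z"
    using assms cat_isoE by blast
  show ?thesis
  proof (rule cat_isoI)
    show "g \<odot> f \<in> hom C X Z" "f' \<odot> g' \<in> hom C Z X" using assms f' g' cat_comp by blast+
    have "(f' \<odot> g') \<odot> (g \<odot> f) = f' \<odot> ((g' \<odot> g) \<odot> f)"
      using cat_assoc[OF f'(1) g'(1) cat_comp[OF assms(4,2)]] cat_assoc[OF g'(1) assms(4,2)] by simp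
    then show "(f' \<odot> g') \<odot> (g \<odot> f) = Ide C X" using g' f' assms cat_idl by metis
    have "(g \<odot> f) \<odot> (f' \<odot> g') = g \<odot> ((f \<odot> f') \<odot> g')"
      using cat_assoc[OF assms(4,2) cat_comp[OF f'(1) g'(1)]] cat_assoc[OF assms(2) f'(1) g'(1)] by simp
    then show "(g \<odot> f) \<odot> (f' \<odot> g') = Ide C Z" using g' f' assms cat_idl by metis
  qed
qed

end

lemma functorD:
  assumes "is_functor C D Fo Fm"
  shows "X \<in> Obj C ==> Fo X \<in> Obj D"
    and "f \<in> hom C X Y ==> Fm f \<in> hom D (Fo X) (Fo Y)"
    and "X \<in> Obj C ==> Fm (Ide C X) = Ide D (Fo X)"
    and "f \<in> hom C X Y ==> g \<in> hom C Y Z ==> Fm (g \<odot>\<^bsub>C\<^esub> f) = Fm g \<odot>\<^bsub>D\<^esub> Fm f"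
  using assms unfolding is_functor_def by blast+

lemma functor_iso:
  assumes "is_functor C D Fo Fm" "is_category C" "is_iso C f" "f \<in> hom C X Y"
  shows "is_iso D (Fm f)"
proof -
  obtain g where g: "g \<in> hom C Y X" "g \<odot>\<^bsub>C\<^esub> f = Ide C X" "f \<odot>\<^bsub>C\<^esub> g = Ide C Y"
    using cat_isoE[OF assms(2-4)] .
  note F = functorD[OF assms(1)]
  have "Fm g \<odot>\<^bsub>D\<^esub> Fm f = Ide D (Fo X)" "Fm f \<odot>\<^bsub>D\<^esub> Fm g = Ide D (Fo Y)"
    using F(3,4) g assms cat_hom_obj[OF assms(2)] by metis+
  then show ?thesis
    using F(2) g assms(4) unfolding is_iso_def by (auto simp: hom_def)
qed

lemma functor_comp:
  assumes "is_functor A B Fo Fm" "is_functor B C Go Gm"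
  shows "is_functor A C (Go \<circ> Fo) (Gm \<circ> Fm)"
  unfolding is_functor_def o_def
  using functorD[OF assms(1)] functorD[OF assms(2)] by metis

text \<open>The isomorphism for the composite is \<theta> whiskered by the outer functor and
  followed by \<eta>: at X it is \<eta> X after \<open>Gm (\<theta> (Fo X))\<close>.\<close>

lemma naturally_isomorphic_comp:
  fixes A :: "('o, 'm, 'z) category_scheme" (structure)
  assumes A: "is_category A" and B: "is_category B"
    and F: "is_functor A B Fo Fm" and G: "is_functor B A Go Gm"
    and F': "is_functor B C Fo' Fm'" and G': "is_functor C B Go' Gm'"
    and n: "naturally_isomorphic A A (Go \<circ> Fo) (Gm \<circ> Fm) id id"
    and n': "naturally_isomorphic B B (Go' \<circ> Fo') (Gm' \<circ> Fm') id id"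
  shows "naturally_isomorphic A A ((Go \<circ> Go') \<circ> (Fo' \<circ> Fo)) ((Gm \<circ> Gm') \<circ> (Fm' \<circ> Fm)) id id"
proof -
  note f = functorD[OF F] note g = functorD[OF G]
  note f' = functorD[OF F'] note g' = functorD[OF G']
  obtain \<eta> where
    e: "\<And>X. X \<in> Obj A ==> \<eta> X \<in> hom A (Go (Fo X)) X" "\<And>X. X \<in> Obj A ==> is_iso A (\<eta> X)"
      "\<And>X Y f. f \<in> hom A X Y ==> \<eta> Y \<odot> Gm (Fm f) = f \<odot> \<eta> X"
    using n unfolding naturally_isomorphic_def comp_apply id_apply by blast
  obtain \<theta> where
    t: "\<And>X. X \<in> Obj B ==> \<theta> X \<in> hom B (Go' (Fo' X)) X" "\<And>X. X \<in> Obj B ==> is_iso B (\<theta> X)"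
      "\<And>X Y f. f \<in> hom B X Y ==> \<theta> Y \<odot>\<^bsub>B\<^esub> Gm' (Fm' f) = f \<odot>\<^bsub>B\<^esub> \<theta> X"
    using n' unfolding naturally_isomorphic_def comp_apply id_apply by blast
  have m: "Gm (\<theta> (Fo X)) \<in> hom A (Go (Go' (Fo' (Fo X)))) (Go (Fo X))"
    "is_iso A (Gm (\<theta> (Fo X)))" if "X \<in> Obj A" for X
    using g(2) t(1) f(1) that functor_iso[OF G B t(2)] by blast+
  show ?thesis unfolding naturally_isomorphic_def
  proof (intro exI[of _ "\<lambda>X. \<eta> X \<odot> Gm (\<theta> (Fo X))"] conjI ballI allI, simp_all)
    fix X assume X: "X \<in> Obj A"
    show "\<eta> X \<odot> Gm (\<theta> (Fo X)) \<in> hom A (Go (Go' (Fo' (Fo X)))) X"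
      using cat_comp[OF A] e(1) m(1) X by blast
    show "is_iso A (\<eta> X \<odot> Gm (\<theta> (Fo X)))"
      using cat_iso_comp[OF A m(2,1) e(2,1)] X by blast
  next
    fix X Y h assume h: "h \<in> hom A X Y"
    have X: "X \<in> Obj A" "Y \<in> Obj A" using cat_hom_obj[OF A h] .
    have h1: "Fm h \<in> hom B (Fo X) (Fo Y)" "Gm (Fm h) \<in> hom A (Go (Fo X)) (Go (Fo Y))"
      "Gm' (Fm' (Fm h)) \<in> hom B (Go' (Fo' (Fo X))) (Go' (Fo' (Fo Y)))"
      "Gm (Gm' (Fm' (Fm h))) \<in> hom A (Go (Go' (Fo' (Fo X)))) (Go (Go' (Fo' (Fo Y))))"
      using h f(2) g(2) g'(2) f'(2) by auto
    have "(\<eta> Y \<odot> Gm (\<theta> (Fo Y))) \<odot> Gm (Gm' (Fm' (Fm h)))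
        = \<eta> Y \<odot> (Gm (\<theta> (Fo Y)) \<odot> Gm (Gm' (Fm' (Fm h))))"
      using cat_assoc[OF A e(1)[OF X(2)] m(1)[OF X(2)] h1(4)] .
    also have "Gm (\<theta> (Fo Y)) \<odot> Gm (Gm' (Fm' (Fm h))) = Gm (\<theta> (Fo Y) \<odot>\<^bsub>B\<^esub> Gm' (Fm' (Fm h)))"
      using g(4) h1(3) t(1) f(1) X by metis
    also have "\<dots> = Gm (Fm h) \<odot> Gm (\<theta> (Fo X))"
      using t(3)[OF h1(1)] g(4) h1(1) t(1)[OF f(1)[OF X(1)]] by metis
    also have "\<eta> Y \<odot> (Gm (Fm h) \<odot> Gm (\<theta> (Fo X))) = (\<eta> Y \<odot> Gm (Fm h)) \<odot> Gm (\<theta> (Fo X))"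
      using cat_assoc[OF A e(1)[OF X(2)] h1(2) m(1)[OF X(1)]] by simp
    also have "\<dots> = (h \<odot> \<eta> X) \<odot> Gm (\<theta> (Fo X))" using e(3)[OF h] by simp
    also have "\<dots> = h \<odot> (\<eta> X \<odot> Gm (\<theta> (Fo X)))"
      using cat_assoc[OF A h e(1)[OF X(1)] m(1)[OF X(1)]] .
    finally show "(\<eta> Y \<odot> Gm (\<theta> (Fo Y))) \<odot> Gm (Gm' (Fm' (Fm h))) = h \<odot> (\<eta> X \<odot> Gm (\<theta> (Fo X)))" .
  qed
qed

lemma category_equiv_sym: "category_equiv C D ==> category_equiv D C"
  unfolding category_equiv_def by blast

lemma category_equiv_trans:
  assumes "category_equiv A B" "category_equiv B C"
    and c: "is_category A" "is_category B" "is_category C"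
  shows "category_equiv A C"
proof -
  obtain Fo Fm Go Gm where 1: "is_functor A B Fo Fm" "is_functor B A Go Gm"
    "naturally_isomorphic A A (Go \<circ> Fo) (Gm \<circ> Fm) id id"
    "naturally_isomorphic B B (Fo \<circ> Go) (Fm \<circ> Gm) id id"
    using assms(1) unfolding category_equiv_def by blast
  obtain Fo' Fm' Go' Gm' where 2: "is_functor B C Fo' Fm'" "is_functor C B Go' Gm'"
    "naturally_isomorphic B B (Go' \<circ> Fo') (Gm' \<circ> Fm') id id"
    "naturally_isomorphic C C (Fo' \<circ> Go') (Fm' \<circ> Gm') id id"
    using assms(2) unfolding category_equiv_def by blast
  show ?thesis unfolding category_equiv_def
    using functor_comp[OF 1(1) 2(1)] functor_comp[OF 2(2) 1(2)]
      naturally_isomorphic_comp[OF c(1,2) 1(1,2) 2(1,2) 1(3) 2(3)]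
      naturally_isomorphic_comp[OF c(3,2) 2(2,1) 1(2,1) 2(4) 1(4)] by blast
qed

lemma inv_quantaloid_equiv_sym: "inv_quantaloid_equiv C D ==> inv_quantaloid_equiv D C"
  unfolding inv_quantaloid_equiv_def by blast

lemma inv_quantaloid_is_category: "is_inv_quantaloid Q ==> is_category Q"
  unfolding is_inv_quantaloid_def is_quantaloid_def by blast

lemma inv_homomorphism_functor: "is_inv_homomorphism A B Fo Fm ==> is_functor A B Fo Fm"
  unfolding is_inv_homomorphism_def is_homomorphism_def by blast

lemma inv_homomorphism_comp:
  assumes 1: "is_inv_homomorphism A B Fo Fm" and 2: "is_inv_homomorphism B C Go Gm"
  shows "is_inv_homomorphism A C (Go \<circ> Fo) (Gm \<circ> Fm)"
proof -
  note F = functorD[OF inv_homomorphism_functor[OF 1]]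
  have "is_lub C (Go (Fo X)) (Go (Fo Y)) (Gm ` (Fm ` S)) (Gm (Fm s))"
    if "X \<in> Obj A" "Y \<in> Obj A" "S \<subseteq> hom A X Y" "is_lub A X Y S s" for X Y S s
  proof -
    have "is_lub B (Fo X) (Fo Y) (Fm ` S) (Fm s)"
      using 1 that unfolding is_inv_homomorphism_def is_homomorphism_def by blast
    moreover have "Fm ` S \<subseteq> hom B (Fo X) (Fo Y)" using F(2) that by blast
    ultimately show ?thesis
      using 2 F(1) that(1,2) unfolding is_inv_homomorphism_def is_homomorphism_def by blast
  qed
  moreover have "Gm (Fm (Inv A f)) = Inv C (Gm (Fm f))" if "f \<in> Arr A" for f
    using 1 2 that F(2)[OF Arr_hom[OF that]] unfolding is_inv_homomorphism_def by (metis homD(1))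
  ultimately show ?thesis
    using functor_comp[OF inv_homomorphism_functor[OF 1] inv_homomorphism_functor[OF 2]]
    unfolding is_inv_homomorphism_def is_homomorphism_def by (simp add: image_comp)
qed

lemma inv_quantaloid_equiv_trans:
  assumes "inv_quantaloid_equiv A B" "inv_quantaloid_equiv B C"
    and c: "is_inv_quantaloid A" "is_inv_quantaloid B" "is_inv_quantaloid C"
  shows "inv_quantaloid_equiv A C"
proof -
  note c = c[THEN inv_quantaloid_is_category]
  obtain Fo Fm Go Gm where 1: "is_inv_homomorphism A B Fo Fm" "is_inv_homomorphism B A Go Gm"
    "naturally_isomorphic A A (Go \<circ> Fo) (Gm \<circ> Fm) id id"
    "naturally_isomorphic B B (Fo \<circ> Go) (Fm \<circ> Gm) id id"
    using assms(1) unfolding inv_quantaloid_equiv_def by blast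
  obtain Fo' Fm' Go' Gm' where 2: "is_inv_homomorphism B C Fo' Fm'" "is_inv_homomorphism C B Go' Gm'"
    "naturally_isomorphic B B (Go' \<circ> Fo') (Gm' \<circ> Fm') id id"
    "naturally_isomorphic C C (Fo' \<circ> Go') (Fm' \<circ> Gm') id id"
    using assms(2) unfolding inv_quantaloid_equiv_def by blast
  note f = 1(1,2)[THEN inv_homomorphism_functor] 2(1,2)[THEN inv_homomorphism_functor]
  show ?thesis unfolding inv_quantaloid_equiv_def
    using inv_homomorphism_comp[OF 1(1) 2(1)] inv_homomorphism_comp[OF 2(2) 1(2)]
      naturally_isomorphic_comp[OF c(1,2) f 1(3) 2(3)]
      naturally_isomorphic_comp[OF c(3,2) f(4,3,2,1) 2(4) 1(4)] by blast
qed

section \<open>Calculus in involutive quantaloids\<close>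

locale qloid =
  fixes Q :: "('o, 'm, 'z) quantaloid_scheme" (structure)
  assumes Q: "is_quantaloid Q"
begin

lemma cat: "is_category Q"
  using Q unfolding is_quantaloid_def by blast

lemmas hom_obj = cat_hom_obj[OF cat]
lemmas ide_in = cat_ide[OF cat]
lemmas comp_in = cat_comp[OF cat]
lemmas idr = cat_idr[OF cat]
lemmas idl = cat_idl[OF cat]
lemmas assoc = cat_assoc[OF cat]

lemma le_refl: "f \<in> hom Q X Y ==> f \<sqsubseteq> f"
proof -
  assume "f \<in> hom Q X Y"
  then show "f \<sqsubseteq> f" using Q[unfolded is_quantaloid_def, THEN conjunct2, THEN conjunct1, THEN bspec] homD(1)[of f Q X Y] by simp
qed

lemma le_antisym: "f \<in> hom Q X Y ==> g \<in> hom Q X Y ==> f \<sqsubseteq> g ==> g \<sqsubseteq> f ==> f = g"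
  using Q unfolding is_quantaloid_def by meson

lemma le_trans:
  "f \<sqsubseteq> g ==> g \<sqsubseteq> h ==> f \<in> hom Q X Y ==> g \<in> hom Q X Y ==> h \<in> hom Q X Y ==> f \<sqsubseteq> h"
  using Q unfolding is_quantaloid_def by meson

lemma lub_unique: "is_lub Q X Y S s ==> is_lub Q X Y S t ==> s = t"
  unfolding is_lub_def by (meson le_antisym)

lemma join_lub: "X \<in> Obj Q ==> Y \<in> Obj Q ==> S \<subseteq> hom Q X Y ==> is_lub Q X Y S (join Q X Y S)"
proof -
  assume "X \<in> Obj Q" "Y \<in> Obj Q" "S \<subseteq> hom Q X Y"
  then obtain s where s: "is_lub Q X Y S s" using Q unfolding is_quantaloid_def by meson
  then show ?thesis unfolding join_def using lub_unique by (metis the_equality)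
qed

lemma join_eq: "is_lub Q X Y S s ==> join Q X Y S = s"
  unfolding join_def using lub_unique by blast

lemma join_in: "X \<in> Obj Q ==> Y \<in> Obj Q ==> S \<subseteq> hom Q X Y ==> join Q X Y S \<in> hom Q X Y"
  using join_lub unfolding is_lub_def by blast

lemma join_upper: "f \<in> S ==> X \<in> Obj Q ==> Y \<in> Obj Q ==> S \<subseteq> hom Q X Y ==> f \<sqsubseteq> join Q X Y S"
  using join_lub unfolding is_lub_def by blast

lemma lub_le_iff:
  assumes "is_lub Q X Y S s" "S \<subseteq> hom Q X Y" "t \<in> hom Q X Y"
  shows "s \<sqsubseteq> t \<longleftrightarrow> (\<forall>f\<in>S. f \<sqsubseteq> t)"
  using assms unfolding is_lub_def by (meson le_trans subsetD)

lemma join_le_iff: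
  assumes "S \<subseteq> hom Q X Y" "t \<in> hom Q X Y"
  shows "join Q X Y S \<sqsubseteq> t \<longleftrightarrow> (\<forall>f\<in>S. f \<sqsubseteq> t)"
  using lub_le_iff[OF join_lub assms] hom_obj assms(2) assms(1) by blast

lemma lub_comp_left:
  assumes "is_lub Q X Y S s" "S \<subseteq> hom Q X Y" "g \<in> hom Q Y Z"
  shows "is_lub Q X Z ((\<lambda>f. g \<odot> f) ` S) (g \<odot> s)"
proof -
  have "s \<in> hom Q X Y" using assms unfolding is_lub_def by blast
  then show ?thesis using assms hom_obj Q unfolding is_quantaloid_def by meson
qed

lemma lub_comp_right:
  assumes "is_lub Q Y Z S s" "S \<subseteq> hom Q Y Z" "f \<in> hom Q X Y"
  shows "is_lub Q X Z ((\<lambda>g. g \<odot> f) ` S) (s \<odot> f)"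
proof -
  have "s \<in> hom Q Y Z" using assms unfolding is_lub_def by blast
  then show ?thesis using assms hom_obj Q unfolding is_quantaloid_def by meson
qed

lemma comp_join_le_iff:
  assumes "S \<subseteq> hom Q X Y" "g \<in> hom Q Y Z" "t \<in> hom Q X Z"
  shows "g \<odot> join Q X Y S \<sqsubseteq> t \<longleftrightarrow> (\<forall>f\<in>S. g \<odot> f \<sqsubseteq> t)"
proof -
  have "is_lub Q X Z ((\<lambda>f. g \<odot> f) ` S) (g \<odot> join Q X Y S)"
    by (rule lub_comp_left[OF join_lub]) (use assms hom_obj in blast)+
  moreover have "(\<lambda>f. g \<odot> f) ` S \<subseteq> hom Q X Z" using assms comp_in by blast
  ultimately show ?thesis using lub_le_iff[OF _ _ assms(3)] by simp
qed

lemma join_comp_le_iff: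
  assumes "S \<subseteq> hom Q Y Z" "f \<in> hom Q X Y" "t \<in> hom Q X Z"
  shows "join Q Y Z S \<odot> f \<sqsubseteq> t \<longleftrightarrow> (\<forall>g\<in>S. g \<odot> f \<sqsubseteq> t)"
proof -
  have "is_lub Q X Z ((\<lambda>g. g \<odot> f) ` S) (join Q Y Z S \<odot> f)"
    by (rule lub_comp_right[OF join_lub]) (use assms hom_obj in blast)+
  moreover have "(\<lambda>g. g \<odot> f) ` S \<subseteq> hom Q X Z" using assms comp_in by blast
  ultimately show ?thesis using lub_le_iff[OF _ _ assms(3)] by simp
qed

lemma lub_pair:
  assumes "f \<sqsubseteq> g" "f \<in> hom Q X Y" "g \<in> hom Q X Y"
  shows "is_lub Q X Y {f, g} g"
  using assms le_refl unfolding is_lub_def by auto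

lemma comp_mono_right:
  assumes "f \<sqsubseteq> f'" "f \<in> hom Q X Y" "f' \<in> hom Q X Y" "g \<in> hom Q Y Z"
  shows "g \<odot> f \<sqsubseteq> g \<odot> f'"
  using lub_comp_left[OF lub_pair[OF assms(1-3)] _ assms(4)] assms(2,3) unfolding is_lub_def by auto

lemma comp_mono_left:
  assumes "g \<sqsubseteq> g'" "g \<in> hom Q Y Z" "g' \<in> hom Q Y Z" "f \<in> hom Q X Y"
  shows "g \<odot> f \<sqsubseteq> g' \<odot> f"
  using lub_comp_right[OF lub_pair[OF assms(1-3)] _ assms(4)] assms(2,3) unfolding is_lub_def by auto

lemma comp_mono:
  assumes "g \<sqsubseteq> g'" "f \<sqsubseteq> f'" "g \<in> hom Q Y Z" "g' \<in> hom Q Y Z" "f \<in> hom Q X Y" "f' \<in> hom Q X Y"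
  shows "g \<odot> f \<sqsubseteq> g' \<odot> f'"
  using le_trans[OF comp_mono_left[OF assms(1,3,4,5)] comp_mono_right[OF assms(2,5,6,4)]]
    assms comp_in by blast

text \<open>The Yoneda principle for the order. Iterated joins are compared through their upper
  bounds, which avoids exchanging joins.\<close>

lemma le_eqI:
  assumes "f \<in> hom Q X Y" "g \<in> hom Q X Y" "\<And>t. t \<in> hom Q X Y ==> f \<sqsubseteq> t \<longleftrightarrow> g \<sqsubseteq> t"
  shows "f = g"
  using assms le_antisym le_refl by meson

end

locale iqloid =
  fixes Q :: "('o, 'm, 'z) inv_quantaloid_scheme" (structure)
  assumes IQ: "is_inv_quantaloid Q"

sublocale iqloid \<subseteq> qloid Q
  by unfold_locales (use IQ in \<open>unfold is_inv_quantaloid_def, blast\<close>)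

context iqloid
begin

lemma inv_in: "f \<in> hom Q X Y ==> Inv Q f \<in> hom Q Y X"
  using IQ unfolding is_inv_quantaloid_def by blast

lemma inv_inv: "f \<in> hom Q X Y ==> Inv Q (Inv Q f) = f"
  using IQ unfolding is_inv_quantaloid_def by blast

lemma inv_ide: "X \<in> Obj Q ==> Inv Q (Ide Q X) = Ide Q X"
  using IQ unfolding is_inv_quantaloid_def by blast

lemma inv_comp: "g \<in> hom Q Y Z ==> f \<in> hom Q X Y ==> Inv Q (g \<odot> f) = Inv Q f \<odot> Inv Q g"
  using IQ unfolding is_inv_quantaloid_def by blast

lemma inv_lub:
  assumes "is_lub Q X Y S s" "S \<subseteq> hom Q X Y"
  shows "is_lub Q Y X (Inv Q ` S) (Inv Q s)"
proof -
  have "s \<in> hom Q X Y" using assms unfolding is_lub_def by blast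
  then show ?thesis using assms hom_obj IQ unfolding is_inv_quantaloid_def by meson
qed

lemma inv_mono: "f \<sqsubseteq> g ==> f \<in> hom Q X Y ==> g \<in> hom Q X Y ==> Inv Q f \<sqsubseteq> Inv Q g"
  using inv_lub[OF lub_pair, of f g X Y] unfolding is_lub_def by auto

lemma inv_join:
  "X \<in> Obj Q ==> Y \<in> Obj Q ==> S \<subseteq> hom Q X Y ==> Inv Q (join Q X Y S) = join Q Y X (Inv Q ` S)"
  using join_eq[OF inv_lub[OF join_lub]] by metis

lemma sym_left_adjoint_iff:
  "f \<in> hom Q X Y ==> sym_left_adjoint Q f \<longleftrightarrow> Ide Q X \<sqsubseteq> Inv Q f \<odot> f \<and> f \<odot> Inv Q f \<sqsubseteq> Ide Q Y"
  unfolding sym_left_adjoint_def adjoint_def using inv_in homD by metis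

lemma sym_left_adjoint_ide: "X \<in> Obj Q ==> sym_left_adjoint Q (Ide Q X)"
  using sym_left_adjoint_iff[OF ide_in] inv_ide idl[OF ide_in] le_refl[OF ide_in] by metis

lemma sym_left_adjoint_comp:
  assumes f: "f \<in> hom Q X Y" "sym_left_adjoint Q f" and g: "g \<in> hom Q Y Z" "sym_left_adjoint Q g"
  shows "sym_left_adjoint Q (g \<odot> f)"
proof -
  note if' = inv_in[OF f(1)] and ig = inv_in[OF g(1)]
  have F: "Ide Q X \<sqsubseteq> Inv Q f \<odot> f" "f \<odot> Inv Q f \<sqsubseteq> Ide Q Y"
    using f sym_left_adjoint_iff by blast+
  have G: "Ide Q Y \<sqsubseteq> Inv Q g \<odot> g" "g \<odot> Inv Q g \<sqsubseteq> Ide Q Z"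
    using g sym_left_adjoint_iff by blast+
  note o = hom_obj[OF f(1)] hom_obj[OF g(1)]
  have "Inv Q f \<odot> (Ide Q Y \<odot> f) \<sqsubseteq> Inv Q f \<odot> ((Inv Q g \<odot> g) \<odot> f)"
    by (intro comp_mono_right comp_mono_left G) (use f g if' ig ide_in[OF o(2)] comp_in in blast)+
  moreover have "Inv Q f \<odot> ((Inv Q g \<odot> g) \<odot> f) = Inv Q (g \<odot> f) \<odot> (g \<odot> f)"
    using inv_comp[OF g(1) f(1)] assoc[OF if' ig comp_in[OF g(1) f(1)]] assoc[OF ig g(1) f(1)] by simp
  ultimately have "Inv Q f \<odot> f \<sqsubseteq> Inv Q (g \<odot> f) \<odot> (g \<odot> f)" using idl[OF f(1)] by simp
  note gf = comp_in[OF g(1) f(1)]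
  from \<open>Inv Q f \<odot> f \<sqsubseteq> Inv Q (g \<odot> f) \<odot> (g \<odot> f)\<close> have 1: "Ide Q X \<sqsubseteq> Inv Q (g \<odot> f) \<odot> (g \<odot> f)"
    by (rule le_trans[OF F(1) _ ide_in[OF o(1)] comp_in[OF if' f(1)] comp_in[OF inv_in[OF gf] gf]])
  have "g \<odot> ((f \<odot> Inv Q f) \<odot> Inv Q g) \<sqsubseteq> g \<odot> (Ide Q Y \<odot> Inv Q g)"
    by (intro comp_mono_right comp_mono_left F) (use f g if' ig ide_in[OF o(2)] comp_in in blast)+
  moreover have "g \<odot> ((f \<odot> Inv Q f) \<odot> Inv Q g) = (g \<odot> f) \<odot> Inv Q (g \<odot> f)"
    using inv_comp[OF g(1) f(1)] assoc[OF g(1) f(1) comp_in[OF if' ig]] assoc[OF f(1) if' ig] by simp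
  ultimately have "(g \<odot> f) \<odot> Inv Q (g \<odot> f) \<sqsubseteq> g \<odot> Inv Q g" using idl[OF ig] by simp
  then have 2: "(g \<odot> f) \<odot> Inv Q (g \<odot> f) \<sqsubseteq> Ide Q Z"
    by (rule le_trans[OF _ G(2) comp_in[OF gf inv_in[OF gf]] comp_in[OF g(1) ig] ide_in[OF o(4)]])
  show ?thesis using 1 2 sym_left_adjoint_iff[OF comp_in[OF g(1) f(1)]] by blast
qed

end

section \<open>Embeddings\<close>

text \<open>\<open>C\<close> is not assumed to be a category: the axioms are transported from \<open>D\<close>.\<close>

definition cat_embedding ::
  "('o1, 'm1, 'z1) category_scheme => ('o2, 'm2, 'z2) category_scheme
    => ('o1 => 'o2) => ('m1 => 'm2) => bool" where
  "cat_embedding C D Fo Fm \<longleftrightarrow>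
     (\<forall>f\<in>Arr C. Dom C f \<in> Obj C \<and> Cod C f \<in> Obj C) \<and>
     (\<forall>X\<in>Obj C. Ide C X \<in> hom C X X) \<and>
     (\<forall>X Y Z. \<forall>f\<in>hom C X Y. \<forall>g\<in>hom C Y Z. g \<odot>\<^bsub>C\<^esub> f \<in> hom C X Z) \<and>
     (\<forall>X\<in>Obj C. Fo X \<in> Obj D) \<and>
     (\<forall>X\<in>Obj C. \<forall>Y\<in>Obj C. bij_betw Fm (hom C X Y) (hom D (Fo X) (Fo Y))) \<and>
     (\<forall>X\<in>Obj C. Fm (Ide C X) = Ide D (Fo X)) \<and>
     (\<forall>X Y Z. \<forall>f\<in>hom C X Y. \<forall>g\<in>hom C Y Z. Fm (g \<odot>\<^bsub>C\<^esub> f) = Fm g \<odot>\<^bsub>D\<^esub> Fm f)"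

lemma cat_embeddingD:
  assumes "cat_embedding C D Fo Fm"
  shows "f \<in> hom C X Y ==> X \<in> Obj C" "f \<in> hom C X Y ==> Y \<in> Obj C"
    and "X \<in> Obj C ==> Ide C X \<in> hom C X X"
    and "g \<in> hom C Y Z ==> f \<in> hom C X Y ==> g \<odot>\<^bsub>C\<^esub> f \<in> hom C X Z"
    and "X \<in> Obj C ==> Fo X \<in> Obj D"
    and "X \<in> Obj C ==> Y \<in> Obj C ==> bij_betw Fm (hom C X Y) (hom D (Fo X) (Fo Y))"
    and "X \<in> Obj C ==> Fm (Ide C X) = Ide D (Fo X)"
    and "g \<in> hom C Y Z ==> f \<in> hom C X Y ==> Fm (g \<odot>\<^bsub>C\<^esub> f) = Fm g \<odot>\<^bsub>D\<^esub> Fm f"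
  using assms unfolding cat_embedding_def hom_def by blast+

lemma embedding_in:
  assumes "cat_embedding C D Fo Fm" "f \<in> hom C X Y"
  shows "Fm f \<in> hom D (Fo X) (Fo Y)"
  using cat_embeddingD(1,2,6)[OF assms(1)] assms(2) unfolding bij_betw_def by blast

lemma embedding_inj:
  assumes "cat_embedding C D Fo Fm" "f \<in> hom C X Y" "g \<in> hom C X Y" "Fm f = Fm g"
  shows "f = g"
  using cat_embeddingD(1,2,6)[OF assms(1)] assms(2-) unfolding bij_betw_def inj_on_def by blast

lemma embedding_surj:
  assumes "cat_embedding C D Fo Fm" "X \<in> Obj C" "Y \<in> Obj C" "g \<in> hom D (Fo X) (Fo Y)"
  obtains f where "f \<in> hom C X Y" "Fm f = g"
proof -
  have "g \<in> Fm ` hom C X Y" using cat_embeddingD(6)[OF assms(1-3)] assms(4) by (simp add: bij_betw_def)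
  then show thesis using that by blast
qed

lemma cat_embedding_functor: "cat_embedding C D Fo Fm ==> is_functor C D Fo Fm"
  unfolding is_functor_def
  by (intro conjI allI ballI)
    ((rule cat_embeddingD(5,7,8) embedding_in, assumption, assumption, assumption?)+)

lemma embedding_is_category:
  fixes C :: "('o, 'm, 'z) category_scheme" (structure)
  assumes F: "cat_embedding C D Fo Fm" and D: "is_category D"
  shows "is_category C"
proof -
  note f = cat_embeddingD[OF F]
  have id: "f \<odot> Ide C X = f \<and> Ide C Y \<odot> f = f" if h: "f \<in> hom C X Y" for f X Y
  proof -
    note o = f(1,2)[OF h] note i = f(3)[OF o(1)] f(3)[OF o(2)]
    have "Fm (f \<odot> Ide C X) = Fm f" "Fm (Ide C Y \<odot> f) = Fm f"
      using f(8)[OF h i(1)] f(8)[OF i(2) h] f(7) o cat_idl[OF D] cat_idr[OF D] embedding_in[OF F h] by simp_all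
    then show ?thesis using embedding_inj[OF F f(4)[OF h i(1)] h] embedding_inj[OF F f(4)[OF i(2) h] h] by blast
  qed
  have as: "h \<odot> (g \<odot> f) = (h \<odot> g) \<odot> f"
    if h: "f \<in> hom C W X" "g \<in> hom C X Y" "h \<in> hom C Y Z" for f g h W X Y Z
  proof (rule embedding_inj[OF F])
    show "h \<odot> (g \<odot> f) \<in> hom C W Z" "h \<odot> g \<odot> f \<in> hom C W Z"
      using h f(4) by blast+
    have "Fm (h \<odot> (g \<odot> f)) = Fm h \<odot>\<^bsub>D\<^esub> (Fm g \<odot>\<^bsub>D\<^esub> Fm f)"
      using f(8)[OF h(3) f(4)[OF h(2,1)]] f(8)[OF h(2,1)] by simp
    also have "\<dots> = (Fm h \<odot>\<^bsub>D\<^esub> Fm g) \<odot>\<^bsub>D\<^esub> Fm f"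
      using cat_assoc[OF D embedding_in[OF F h(3)] embedding_in[OF F h(2)] embedding_in[OF F h(1)]] by simp
    also have "\<dots> = Fm (h \<odot> g \<odot> f)"
      using f(8)[OF f(4)[OF h(3,2)] h(1)] f(8)[OF h(3,2)] by simp
    finally show "Fm (h \<odot> (g \<odot> f)) = Fm (h \<odot> g \<odot> f)" .
  qed
  show ?thesis unfolding is_category_def
  proof (intro conjI allI ballI)
    show "Dom C f \<in> Obj C" "Cod C f \<in> Obj C" if "f \<in> Arr C" for f
      using f(1,2)[OF Arr_hom[OF that]] .
    show "Ide C X \<in> hom C X X" if "X \<in> Obj C" for X using f(3)[OF that] .
    show "g \<odot> h \<in> hom C X Z" if "h \<in> hom C X Y" "g \<in> hom C Y Z" for X Y Z g h
      using f(4)[OF that(2,1)] .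
    show "h \<odot> Ide C X = h" "Ide C Y \<odot> h = h" if "h \<in> hom C X Y" for h X Y
      using id[OF that] by auto
    show "h \<odot> (g \<odot> f) = h \<odot> g \<odot> f"
      if "f \<in> hom C W X" "g \<in> hom C X Y" "h \<in> hom C Y Z" for f g h W X Y Z
      using as[OF that] .
  qed
qed

text \<open>The inverse of a fully faithful functor is conjugation by chosen isomorphisms, pulled
  back along fullness. The formula for \<open>Fm (Gm g)\<close> is part of the conclusion because
  preservation of involution and suprema by \<open>Gm\<close> is read off it in
  \<open>dagger_equivalence_equiv\<close>.\<close>

lemma embedding_inverse:
  fixes D :: "('o, 'm, 'z) category_scheme" (structure)
  assumes F: "cat_embedding C D Fo Fm" and D: "is_category D"
    and Go: "\<And>Y. Y \<in> Obj D ==> Go Y \<in> Obj C"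
    and e: "\<And>Y. Y \<in> Obj D ==> \<eta> Y \<in> hom D (Fo (Go Y)) Y"
    and e': "\<And>Y. Y \<in> Obj D ==> \<eta>' Y \<in> hom D Y (Fo (Go Y))"
    and ee: "\<And>Y. Y \<in> Obj D ==> \<eta>' Y \<odot> \<eta> Y = Ide D (Fo (Go Y))"
      "\<And>Y. Y \<in> Obj D ==> \<eta> Y \<odot> \<eta>' Y = Ide D Y"
  shows "\<exists>Gm. is_functor D C Go Gm \<and>
    (\<forall>g Y Z. g \<in> hom D Y Z --> Gm g \<in> hom C (Go Y) (Go Z)) \<and>
    (\<forall>g Y Z. g \<in> hom D Y Z --> Fm (Gm g) = \<eta>' Z \<odot> (g \<odot> \<eta> Y)) \<and>
    naturally_isomorphic C C (Go \<circ> Fo) (Gm \<circ> Fm) id id \<and>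
    naturally_isomorphic D D (Fo \<circ> Go) (Fm \<circ> Gm) id id"
proof -
  note f = cat_embeddingD[OF F] note o = cat_hom_obj[OF D]
  note as = cat_assoc[OF D] note comp = cat_comp[OF D] note il = cat_idl[OF D] note ir = cat_idr[OF D]
  have C: "is_category C" using embedding_is_category[OF F D] .
  have "\<exists>f. f \<in> hom C (Go (Dom D g)) (Go (Cod D g)) \<and>
      Fm f = \<eta>' (Cod D g) \<odot> (g \<odot> \<eta> (Dom D g))" if "g \<in> Arr D" for g
  proof -
    have g: "g \<in> hom D (Dom D g) (Cod D g)" using Arr_hom[OF that] .
    have "\<eta>' (Cod D g) \<odot> (g \<odot> \<eta> (Dom D g)) \<in> hom D (Fo (Go (Dom D g))) (Fo (Go (Cod D g)))"
      using comp[OF e' comp[OF g e]] o[OF g] by blast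
    then show ?thesis using embedding_surj[OF F] Go o[OF g] by metis
  qed
  then obtain Gm where G0: "\<And>g. g \<in> Arr D ==> Gm g \<in> hom C (Go (Dom D g)) (Go (Cod D g)) \<and>
      Fm (Gm g) = \<eta>' (Cod D g) \<odot> (g \<odot> \<eta> (Dom D g))"
    by metis
  have G: "Gm g \<in> hom C (Go Y) (Go Z)" "Fm (Gm g) = \<eta>' Z \<odot> (g \<odot> \<eta> Y)"
    if "g \<in> hom D Y Z" for g Y Z
    using G0[of g] that by (auto simp: hom_def)
  \<comment> \<open>Naturality of \<eta>. It yields both the compatibility of \<open>Gm\<close> with
    composition and the second natural isomorphism.\<close>
  have eG: "\<eta> Z \<odot> Fm (Gm g) = g \<odot> \<eta> Y" if g: "g \<in> hom D Y Z" for g Y Z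
  proof -
    note c = comp[OF g e[OF o(1)[OF g]]] note z = o(2)[OF g]
    have "\<eta> Z \<odot> Fm (Gm g) = (\<eta> Z \<odot> \<eta>' Z) \<odot> (g \<odot> \<eta> Y)"
      using G(2)[OF g] as[OF e[OF z] e'[OF z] c] by simp
    then show ?thesis using ee(2)[OF z] il[OF c] by simp
  qed
  have Gi: "Gm (Ide D X) = Ide C (Go X)" if X: "X \<in> Obj D" for X
  proof (rule embedding_inj[OF F])
    show "Gm (Ide D X) \<in> hom C (Go X) (Go X)" using G(1) cat_ide[OF D X] .
    show "Ide C (Go X) \<in> hom C (Go X) (Go X)" using f(3)[OF Go[OF X]] .
    show "Fm (Gm (Ide D X)) = Fm (Ide C (Go X))"
      using G(2)[OF cat_ide[OF D X]] il[OF e[OF X]] ee(1)[OF X] f(7)[OF Go[OF X]] by simp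
  qed
  have Gc: "Gm (g \<odot> h) = Gm g \<odot>\<^bsub>C\<^esub> Gm h" if h: "h \<in> hom D X Y" and g: "g \<in> hom D Y Z" for g h X Y Z
  proof (rule embedding_inj[OF F])
    show "Gm (g \<odot> h) \<in> hom C (Go X) (Go Z)" using G(1) comp[OF g h] .
    show "Gm g \<odot>\<^bsub>C\<^esub> Gm h \<in> hom C (Go X) (Go Z)" using f(4) G(1) g h by blast
    note x = e[OF o(1)[OF h]] and y = e[OF o(1)[OF g]] and z = e'[OF o(2)[OF g]]
    note Fh = embedding_in[OF F G(1)[OF h]]
    have "Fm (Gm g \<odot>\<^bsub>C\<^esub> Gm h) = (\<eta>' Z \<odot> (g \<odot> \<eta> Y)) \<odot> Fm (Gm h)"
      using f(8)[OF G(1)[OF g] G(1)[OF h]] G(2)[OF g] by simp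
    also have "\<dots> = \<eta>' Z \<odot> (g \<odot> (\<eta> Y \<odot> Fm (Gm h)))"
      using as[OF z comp[OF g y] Fh] as[OF g y Fh] by simp
    also have "\<dots> = \<eta>' Z \<odot> ((g \<odot> h) \<odot> \<eta> X)"
      using eG[OF h] as[OF g h x] by simp
    finally show "Fm (Gm (g \<odot> h)) = Fm (Gm g \<odot>\<^bsub>C\<^esub> Gm h)" using G(2)[OF comp[OF g h]] by simp
  qed
  have Gf: "is_functor D C Go Gm" unfolding is_functor_def using Go G(1) Gi Gc by blast
  have "naturally_isomorphic D D (Fo \<circ> Go) (Fm \<circ> Gm) id id"
    unfolding naturally_isomorphic_def comp_apply id_apply
    by (intro exI[of _ \<eta>]) (use e e' ee eG cat_isoI[OF D] in blast)
  \<comment> \<open>The components on the side of C are the preimages of the arrows \<eta> (Fo X)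
    under the fully faithful functor; every equation about them is checked after applying
    \<open>Fm\<close>.\<close>
  moreover have "naturally_isomorphic C C (Go \<circ> Fo) (Gm \<circ> Fm) id id"
  proof -
    have "\<exists>t. t \<in> hom C (Go (Fo X)) X \<and> Fm t = \<eta> (Fo X) \<and> is_iso C t" if X: "X \<in> Obj C" for X
    proof -
      note FX = f(5)[OF X] note GX = Go[OF FX]
      obtain t where t: "t \<in> hom C (Go (Fo X)) X" "Fm t = \<eta> (Fo X)"
        using embedding_surj[OF F GX X e[OF FX]] .
      obtain s where s: "s \<in> hom C X (Go (Fo X))" "Fm s = \<eta>' (Fo X)"
        using embedding_surj[OF F X GX e'[OF FX]] .
      have "s \<odot>\<^bsub>C\<^esub> t = Ide C (Go (Fo X))"
        by (rule embedding_inj[OF F f(4)[OF s(1) t(1)] f(3)[OF GX]])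
          (simp add: f(8)[OF s(1) t(1)] s t ee FX f(7)[OF GX])
      moreover have "t \<odot>\<^bsub>C\<^esub> s = Ide C X"
        by (rule embedding_inj[OF F f(4)[OF t(1) s(1)] f(3)[OF X]])
          (simp add: f(8)[OF t(1) s(1)] s t ee FX f(7)[OF X])
      ultimately show ?thesis using cat_isoI[OF C t(1) s(1)] t by blast
    qed
    then obtain \<theta> where t: "\<And>X. X \<in> Obj C ==> \<theta> X \<in> hom C (Go (Fo X)) X"
      "\<And>X. X \<in> Obj C ==> Fm (\<theta> X) = \<eta> (Fo X)" "\<And>X. X \<in> Obj C ==> is_iso C (\<theta> X)" by metis
    have "\<theta> Y \<odot>\<^bsub>C\<^esub> Gm (Fm h) = h \<odot>\<^bsub>C\<^esub> \<theta> X" if h: "h \<in> hom C X Y" for h X Y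
    proof (rule embedding_inj[OF F])
      note ox = f(1,2)[OF h] note Fh = embedding_in[OF F h]
      show "\<theta> Y \<odot>\<^bsub>C\<^esub> Gm (Fm h) \<in> hom C (Go (Fo X)) Y" "h \<odot>\<^bsub>C\<^esub> \<theta> X \<in> hom C (Go (Fo X)) Y"
        using f(4) t(1) ox h G(1)[OF Fh] by blast+
      show "Fm (\<theta> Y \<odot>\<^bsub>C\<^esub> Gm (Fm h)) = Fm (h \<odot>\<^bsub>C\<^esub> \<theta> X)"
        using f(8)[OF t(1)[OF ox(2)] G(1)[OF Fh]] f(8)[OF h t(1)[OF ox(1)]] t(2) ox eG[OF Fh] by simp
    qed
    then show ?thesis
      unfolding naturally_isomorphic_def comp_apply id_apply using t(1,3) by blast
  qed
  ultimately show ?thesis using Gf G by (intro exI[of _ Gm] conjI allI impI)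
qed

lemma embedding_equiv:
  assumes F: "cat_embedding C D Fo Fm" and D: "is_category D"
    and es: "\<And>Y. Y \<in> Obj D ==> \<exists>X\<in>Obj C. \<exists>u\<in>hom D (Fo X) Y. is_iso D u"
  shows "category_equiv C D"
proof -
  have "\<exists>X u v. X \<in> Obj C \<and> u \<in> hom D (Fo X) Y \<and> v \<in> hom D Y (Fo X) \<and>
      v \<odot>\<^bsub>D\<^esub> u = Ide D (Fo X) \<and> u \<odot>\<^bsub>D\<^esub> v = Ide D Y" if "Y \<in> Obj D" for Y
    using es[OF that] cat_isoE[OF D] by metis
  then obtain Go \<eta> \<eta>' where *: "\<And>Y. Y \<in> Obj D ==> Go Y \<in> Obj C"
    "\<And>Y. Y \<in> Obj D ==> \<eta> Y \<in> hom D (Fo (Go Y)) Y"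
    "\<And>Y. Y \<in> Obj D ==> \<eta>' Y \<in> hom D Y (Fo (Go Y))"
    "\<And>Y. Y \<in> Obj D ==> \<eta>' Y \<odot>\<^bsub>D\<^esub> \<eta> Y = Ide D (Fo (Go Y))"
    "\<And>Y. Y \<in> Obj D ==> \<eta> Y \<odot>\<^bsub>D\<^esub> \<eta>' Y = Ide D Y" by metis
  obtain Gm where "is_functor D C Go Gm"
    "naturally_isomorphic C C (Go \<circ> Fo) (Gm \<circ> Fm) id id"
    "naturally_isomorphic D D (Fo \<circ> Go) (Fm \<circ> Gm) id id"
    using embedding_inverse[where Go = Go and \<eta> = \<eta> and \<eta>' = \<eta>', OF F D *] by blast
  then show ?thesis unfolding category_equiv_def using cat_embedding_functor[OF F] by blast
qed

text \<open>The order is preserved and reflected, so \<open>Fm\<close> is an order isomorphism on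
  each hom and thereby preserves and reflects local suprema; see
  \<open>dagger_embedding_lub\<close>.\<close>

definition dagger_embedding ::
  "('o1, 'm1, 'z1) inv_quantaloid_scheme => ('o2, 'm2, 'z2) inv_quantaloid_scheme
    => ('o1 => 'o2) => ('m1 => 'm2) => bool" where
  "dagger_embedding K L Fo Fm \<longleftrightarrow> cat_embedding K L Fo Fm \<and>
     (\<forall>X Y. \<forall>f\<in>hom K X Y. \<forall>g\<in>hom K X Y. f \<sqsubseteq>\<^bsub>K\<^esub> g \<longleftrightarrow> Fm f \<sqsubseteq>\<^bsub>L\<^esub> Fm g) \<and>
     (\<forall>X Y. \<forall>f\<in>hom K X Y. Inv K f \<in> hom K Y X \<and> Fm (Inv K f) = Inv L (Fm f))"

lemma dagger_embeddingD:
  assumes "dagger_embedding K L Fo Fm"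
  shows "cat_embedding K L Fo Fm"
    and "f \<in> hom K X Y ==> g \<in> hom K X Y ==> f \<sqsubseteq>\<^bsub>K\<^esub> g \<longleftrightarrow> Fm f \<sqsubseteq>\<^bsub>L\<^esub> Fm g"
    and "f \<in> hom K X Y ==> Inv K f \<in> hom K Y X"
    and "f \<in> hom K X Y ==> Fm (Inv K f) = Inv L (Fm f)"
  using assms unfolding dagger_embedding_def by blast+

lemma dagger_embedding_lub:
  assumes F: "dagger_embedding K L Fo Fm" and X: "X \<in> Obj K" "Y \<in> Obj K"
    and S: "S \<subseteq> hom K X Y" and s: "s \<in> hom K X Y"
  shows "is_lub K X Y S s \<longleftrightarrow> is_lub L (Fo X) (Fo Y) (Fm ` S) (Fm s)"
proof -
  have le: "f \<in> hom K X Y ==> g \<in> hom K X Y ==> f \<sqsubseteq>\<^bsub>K\<^esub> g \<longleftrightarrow> Fm f \<sqsubseteq>\<^bsub>L\<^esub> Fm g" for f g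
    using dagger_embeddingD(2)[OF F] .
  have h: "hom L (Fo X) (Fo Y) = Fm ` hom K X Y"
    using cat_embeddingD(6)[OF dagger_embeddingD(1)[OF F] X] unfolding bij_betw_def by blast
  have "s \<in> hom K X Y \<longleftrightarrow> Fm s \<in> hom L (Fo X) (Fo Y)" using s h by blast
  moreover have "(\<forall>f\<in>S. f \<sqsubseteq>\<^bsub>K\<^esub> t) \<longleftrightarrow> (\<forall>f\<in>Fm ` S. f \<sqsubseteq>\<^bsub>L\<^esub> Fm t)" if "t \<in> hom K X Y" for t
    using le[OF _ that] S by blast
  ultimately show ?thesis unfolding is_lub_def h using s le by auto
qed

text \<open>With an involution, composition on one side determines composition on the other.\<close>

lemma inv_quantaloidI:
  fixes K :: "('o, 'm, 'z) inv_quantaloid_scheme" (structure)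
  assumes cat: "is_category K"
    and refl: "\<And>X Y f. f \<in> hom K X Y ==> f \<sqsubseteq> f"
    and antisym: "\<And>X Y f g. f \<in> hom K X Y ==> g \<in> hom K X Y ==> f \<sqsubseteq> g ==> g \<sqsubseteq> f ==> f = g"
    and trans: "\<And>X Y f g h. f \<in> hom K X Y ==> g \<in> hom K X Y ==> h \<in> hom K X Y ==> f \<sqsubseteq> g ==> g \<sqsubseteq> h ==> f \<sqsubseteq> h"
    and inv: "\<And>X Y f. f \<in> hom K X Y ==> Inv K f \<in> hom K Y X" "\<And>X Y f. f \<in> hom K X Y ==> Inv K (Inv K f) = f"
    and mono: "\<And>X Y f g. f \<in> hom K X Y ==> g \<in> hom K X Y ==> f \<sqsubseteq> g ==> Inv K f \<sqsubseteq> Inv K g"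
    and comp: "\<And>X Y Z f g. f \<in> hom K X Y ==> g \<in> hom K Y Z ==> Inv K (g \<odot> f) = Inv K f \<odot> Inv K g"
    and lub: "\<And>X Y S. X \<in> Obj K ==> Y \<in> Obj K ==> S \<subseteq> hom K X Y ==>
      \<exists>s. is_lub K X Y S s \<and> (\<forall>Z. \<forall>g\<in>hom K Y Z. \<forall>t\<in>hom K X Z. g \<odot> s \<sqsubseteq> t \<longleftrightarrow> (\<forall>f\<in>S. g \<odot> f \<sqsubseteq> t))"
  shows "is_inv_quantaloid K"
proof -
  note cin = cat_comp[OF cat] and o = cat_hom_obj[OF cat]
  have lin: "s \<in> hom K X Y" if "is_lub K X Y S s" for X Y S s using that unfolding is_lub_def by blast
  \<comment> \<open>The hypothesis \<open>lub\<close> speaks of one supremum of S; by antisymmetry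
    every supremum coincides with that one.\<close>
  have left: "is_lub K X Z ((\<lambda>f. g \<odot> f) ` S) (g \<odot> s)"
    if s: "is_lub K X Y S s" and S: "S \<subseteq> hom K X Y" and g: "g \<in> hom K Y Z" for X Y Z S s g
  proof -
    obtain s' where s': "is_lub K X Y S s'" "\<And>t. t \<in> hom K X Z ==> g \<odot> s' \<sqsubseteq> t \<longleftrightarrow> (\<forall>f\<in>S. g \<odot> f \<sqsubseteq> t)"
      using lub[OF o[OF lin[OF s]] S] g by blast
    have "s = s'" by (rule antisym[OF lin[OF s] lin[OF s'(1)]]) (use s s'(1) in \<open>unfold is_lub_def, blast+\<close>)
    then show ?thesis using s'(2) cin[OF g lin[OF s]] refl[OF cin[OF g lin[OF s]]] unfolding is_lub_def by blast
  qed
  have il: "is_lub K Y X (Inv K ` S) (Inv K s)" if s: "is_lub K X Y S s" and S: "S \<subseteq> hom K X Y" for X Y S s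
    unfolding is_lub_def
  proof (intro conjI ballI impI)
    show "Inv K s \<in> hom K Y X" using inv(1)[OF lin[OF s]] .
    show "f \<sqsubseteq> Inv K s" if "f \<in> Inv K ` S" for f
      using that mono[OF _ lin[OF s]] s S unfolding is_lub_def by blast
    fix t assume t: "t \<in> hom K Y X" "\<forall>f\<in>Inv K ` S. f \<sqsubseteq> t"
    have "f \<sqsubseteq> Inv K t" if "f \<in> S" for f
      using mono[OF inv(1) t(1), of f] inv(2)[of f X Y] t(2) that S by auto
    then have "s \<sqsubseteq> Inv K t" using s inv(1)[OF t(1)] unfolding is_lub_def by blast
    then show "Inv K s \<sqsubseteq> t" using mono[OF lin[OF s] inv(1)[OF t(1)]] inv(2)[OF t(1)] by simp
  qed
  \<comment> \<open>Precomposition with f is postcomposition with f\<degree>, conjugated by the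
    involution, and the involution preserves suprema by \<open>il\<close>.\<close>
  have right: "is_lub K X Z ((\<lambda>g. g \<odot> f) ` S) (s \<odot> f)"
    if s: "is_lub K Y Z S s" and S: "S \<subseteq> hom K Y Z" and f: "f \<in> hom K X Y" for X Y Z S s f
  proof -
    have e: "Inv K (Inv K f \<odot> Inv K g) = g \<odot> f" if "g \<in> hom K Y Z" for g
      using inv(2)[OF cin[OF that f]] comp[OF f that] by simp
    have S': "Inv K ` S \<subseteq> hom K Z Y" "(\<lambda>g. Inv K f \<odot> g) ` Inv K ` S \<subseteq> hom K Z X"
      using S inv(1) cin[OF inv(1)[OF f]] by blast+
    have "Inv K ` (\<lambda>g. Inv K f \<odot> g) ` Inv K ` S = (\<lambda>g. g \<odot> f) ` S"
      unfolding image_image by (rule image_cong) (use e S in auto)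
    then show ?thesis using il[OF left[OF il[OF s S] S'(1) inv(1)[OF f]] S'(2)] e[OF lin[OF s]] by simp
  qed
  \<comment> \<open>With i the identity, i\<degree> = i i\<degree>. Applying the involution gives i
    on the left and i\<degree>\<degree> i\<degree> = i i\<degree> = i\<degree> on the right.\<close>
  have id: "Inv K (Ide K X) = Ide K X" if "X \<in> Obj K" for X
  proof -
    note i = cat_ide[OF cat that]
    show ?thesis using comp[OF inv(1)[OF i] i] cat_idl[OF cat inv(1)[OF i]] cat_idr[OF cat inv(1)[OF i]] inv(2)[OF i] by simp
  qed
  have q: "is_quantaloid K" unfolding is_quantaloid_def
  proof (intro conjI allI ballI impI)
    show "f \<sqsubseteq> f" if "f \<in> Arr K" for f using refl[OF Arr_hom[OF that]] .
    show "\<exists>s. is_lub K X Y S s" if "X \<in> Obj K" "Y \<in> Obj K" "S \<subseteq> hom K X Y" for X Y S using lub[OF that] by blast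
  qed ((fact cat antisym trans | (rule left right, assumption, assumption, assumption))+)
  show ?thesis unfolding is_inv_quantaloid_def
  proof (intro conjI allI ballI impI)
  qed ((fact q inv id comp | (rule il, assumption, assumption))+)
qed

text \<open>Equations and inequalities are reflected, and a join in K is the preimage, by fullness,
  of the join in L. In this way \<open>Qi\<close>, \<open>SymDist_sc\<close> and \<open>Rel\<close>
  of the topos become involutive quantaloids without a separate verification of the axioms.\<close>

lemma dagger_embedding_inv_quantaloid:
  assumes F: "dagger_embedding K L Fo Fm" and L: "is_inv_quantaloid L"
  shows "is_inv_quantaloid K"
proof -
  interpret L: iqloid L using L by unfold_locales
  note F1 = dagger_embeddingD(1)[OF F] note f = cat_embeddingD[OF F1]
  note le = dagger_embeddingD(2)[OF F] note inv = dagger_embeddingD(3,4)[OF F]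
  note fin = embedding_in[OF F1] note inj = embedding_inj[OF F1]
  show ?thesis
  proof (rule inv_quantaloidI[OF embedding_is_category[OF F1 L.cat]])
    fix X Y f assume h: "f \<in> hom K X Y"
    show "f \<sqsubseteq>\<^bsub>K\<^esub> f" using le[OF h h] L.le_refl[OF fin[OF h]] by blast
    show "Inv K f \<in> hom K Y X" using inv(1)[OF h] .
    show "Inv K (Inv K f) = f"
      using inj[OF inv(1)[OF inv(1)[OF h]] h] inv(2)[OF inv(1)[OF h]] inv(2)[OF h] L.inv_inv[OF fin[OF h]] by simp
    fix g assume g: "g \<in> hom K X Y"
    show "f \<sqsubseteq>\<^bsub>K\<^esub> g ==> g \<sqsubseteq>\<^bsub>K\<^esub> f ==> f = g"
      using inj[OF h g] L.le_antisym[OF fin[OF h] fin[OF g]] le h g by blast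
    show "f \<sqsubseteq>\<^bsub>K\<^esub> g ==> Inv K f \<sqsubseteq>\<^bsub>K\<^esub> Inv K g"
      using L.inv_mono[OF _ fin[OF h] fin[OF g]] le[OF h g] le[OF inv(1)[OF h] inv(1)[OF g]] inv(2)[OF h] inv(2)[OF g] by simp
    show "f \<sqsubseteq>\<^bsub>K\<^esub> k" if "k \<in> hom K X Y" "f \<sqsubseteq>\<^bsub>K\<^esub> g" "g \<sqsubseteq>\<^bsub>K\<^esub> k" for k
      using L.le_trans[OF _ _ fin[OF h] fin[OF g] fin[OF that(1)]] le that h g by blast
  next
    fix X Y Z f g assume h: "f \<in> hom K X Y" "g \<in> hom K Y Z"
    note i = cat_embeddingD(4)[OF F1]
    show "Inv K (g \<odot>\<^bsub>K\<^esub> f) = Inv K f \<odot>\<^bsub>K\<^esub> Inv K g"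
      using inj[OF inv(1)[OF i[OF h(2,1)]] i[OF inv(1)[OF h(1)] inv(1)[OF h(2)]]] inv(2)[OF i[OF h(2,1)]]
        cat_embeddingD(8)[OF F1 h(2,1)] cat_embeddingD(8)[OF F1 inv(1)[OF h(1)] inv(1)[OF h(2)]]
        inv(2)[OF h(1)] inv(2)[OF h(2)] L.inv_comp[OF fin[OF h(2)] fin[OF h(1)]] by simp
  next
    fix X Y S assume h: "X \<in> Obj K" "Y \<in> Obj K" "S \<subseteq> hom K X Y"
    let ?j = "join L (Fo X) (Fo Y) (Fm ` S)"
    have S: "Fm ` S \<subseteq> hom L (Fo X) (Fo Y)" using h(3) fin by blast
    note o = f(5)[OF h(1)] f(5)[OF h(2)]
    obtain s where s: "s \<in> hom K X Y" "Fm s = ?j" using embedding_surj[OF F1 h(1,2) L.join_in[OF o S]] .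
    have "is_lub K X Y S s" using dagger_embedding_lub[OF F h s(1)] L.join_lub[OF o S] s(2) by simp
    moreover have "g \<odot>\<^bsub>K\<^esub> s \<sqsubseteq>\<^bsub>K\<^esub> t \<longleftrightarrow> (\<forall>f\<in>S. g \<odot>\<^bsub>K\<^esub> f \<sqsubseteq>\<^bsub>K\<^esub> t)" if g: "g \<in> hom K Y Z" and t: "t \<in> hom K X Z" for Z g t
    proof -
      have "g \<odot>\<^bsub>K\<^esub> f' \<sqsubseteq>\<^bsub>K\<^esub> t \<longleftrightarrow> Fm g \<odot>\<^bsub>L\<^esub> Fm f' \<sqsubseteq>\<^bsub>L\<^esub> Fm t" if "f' \<in> hom K X Y" for f'
        using le[OF f(4)[OF g that] t] f(8)[OF g that] by simp
      then show ?thesis using L.comp_join_le_iff[OF S fin[OF g] fin[OF t]] s h(3) by auto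
    qed
    ultimately show "\<exists>s. is_lub K X Y S s \<and> (\<forall>Z. \<forall>g\<in>hom K Y Z. \<forall>t\<in>hom K X Z. g \<odot>\<^bsub>K\<^esub> s \<sqsubseteq>\<^bsub>K\<^esub> t \<longleftrightarrow> (\<forall>f\<in>S. g \<odot>\<^bsub>K\<^esub> f \<sqsubseteq>\<^bsub>K\<^esub> t))" by blast
  qed
qed

lemma dagger_embedding_homomorphism:
  assumes F: "dagger_embedding K L Fo Fm"
  shows "is_inv_homomorphism K L Fo Fm"
proof -
  have "is_lub L (Fo X) (Fo Y) (Fm ` S) (Fm s)"
    if "X \<in> Obj K" "Y \<in> Obj K" "S \<subseteq> hom K X Y" "is_lub K X Y S s" for X Y S s
    using dagger_embedding_lub[OF F that(1-3)] that(4) unfolding is_lub_def by blast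
  then show ?thesis unfolding is_inv_homomorphism_def is_homomorphism_def
    using cat_embedding_functor[OF dagger_embeddingD(1)[OF F]] dagger_embeddingD(4)[OF F Arr_hom] by simp
qed

definition unitary :: "('o, 'm, 'z) inv_quantaloid_scheme => 'o => 'o => 'm => bool" where
  "unitary L X Y u \<longleftrightarrow> u \<in> hom L X Y \<and> Inv L u \<odot>\<^bsub>L\<^esub> u = Ide L X \<and> u \<odot>\<^bsub>L\<^esub> Inv L u = Ide L Y"

definition dagger_equivalence ::
  "('o1, 'm1, 'z1) inv_quantaloid_scheme => ('o2, 'm2, 'z2) inv_quantaloid_scheme
    => ('o1 => 'o2) => ('m1 => 'm2) => bool" where
  "dagger_equivalence K L Fo Fm \<longleftrightarrow> dagger_embedding K L Fo Fm \<and>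
     (\<forall>Y\<in>Obj L. \<exists>X\<in>Obj K. \<exists>u. unitary L (Fo X) Y u)"

text \<open>Taking \<eta>\<degree> as inverse of \<eta>, the inverse functor sends g to the preimage
  of \<eta>\<degree> g \<eta>. This expression commutes with the involution because the two outer
  factors are exchanged by it, and with suprema because composition does.\<close>

lemma dagger_equivalence_equiv:
  assumes F: "dagger_equivalence K L Fo Fm" and L: "is_inv_quantaloid L"
  shows "inv_quantaloid_equiv K L"
proof -
  have F1: "dagger_embedding K L Fo Fm" using F unfolding dagger_equivalence_def by blast
  note F2 = dagger_embeddingD(1)[OF F1]
  interpret L: iqloid L using L by unfold_locales
  interpret K: iqloid K using dagger_embedding_inv_quantaloid[OF F1 L] by unfold_locales
  obtain Go \<eta> where G: "\<And>Y. Y \<in> Obj L ==> Go Y \<in> Obj K"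
    and u: "\<And>Y. Y \<in> Obj L ==> unitary L (Fo (Go Y)) Y (\<eta> Y)"
    using F unfolding dagger_equivalence_def by metis
  define \<eta>' where "\<eta>' Y = Inv L (\<eta> Y)" for Y
  have e: "\<And>Y. Y \<in> Obj L ==> \<eta> Y \<in> hom L (Fo (Go Y)) Y"
    "\<And>Y. Y \<in> Obj L ==> \<eta>' Y \<in> hom L Y (Fo (Go Y))"
    "\<And>Y. Y \<in> Obj L ==> \<eta>' Y \<odot>\<^bsub>L\<^esub> \<eta> Y = Ide L (Fo (Go Y))"
    "\<And>Y. Y \<in> Obj L ==> \<eta> Y \<odot>\<^bsub>L\<^esub> \<eta>' Y = Ide L Y"
    using u L.inv_in unfolding unitary_def \<eta>'_def by blast+
  obtain Gm where Gm: "is_functor L K Go Gm"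
    "\<And>g Y Z. g \<in> hom L Y Z ==> Gm g \<in> hom K (Go Y) (Go Z)"
    "\<And>g Y Z. g \<in> hom L Y Z ==> Fm (Gm g) = \<eta>' Z \<odot>\<^bsub>L\<^esub> (g \<odot>\<^bsub>L\<^esub> \<eta> Y)"
    "naturally_isomorphic K K (Go \<circ> Fo) (Gm \<circ> Fm) id id"
    "naturally_isomorphic L L (Fo \<circ> Go) (Fm \<circ> Gm) id id"
    using embedding_inverse[where Go = Go and \<eta> = \<eta> and \<eta>' = \<eta>', OF F2 L.cat G e] by blast
  have 1: "Gm (Inv L g) = Inv K (Gm g)" if g: "g \<in> hom L Y Z" for g Y Z
  proof (rule embedding_inj[OF F2])
    note o = L.hom_obj[OF g]
    show "Gm (Inv L g) \<in> hom K (Go Z) (Go Y)" using Gm(2) L.inv_in[OF g] .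
    show "Inv K (Gm g) \<in> hom K (Go Z) (Go Y)" using K.inv_in Gm(2)[OF g] .
    have "Fm (Inv K (Gm g)) = Inv L (\<eta>' Z \<odot>\<^bsub>L\<^esub> (g \<odot>\<^bsub>L\<^esub> \<eta> Y))"
      using dagger_embeddingD(4)[OF F1 Gm(2)[OF g]] Gm(3)[OF g] by simp
    also have "\<dots> = (\<eta>' Y \<odot>\<^bsub>L\<^esub> Inv L g) \<odot>\<^bsub>L\<^esub> \<eta> Z"
      using L.inv_comp[OF e(2)[OF o(2)] L.comp_in[OF g e(1)[OF o(1)]]] L.inv_comp[OF g e(1)[OF o(1)]]
        L.inv_inv[OF e(1)[OF o(2)]] by (simp add: \<eta>'_def)
    also have "\<dots> = \<eta>' Y \<odot>\<^bsub>L\<^esub> (Inv L g \<odot>\<^bsub>L\<^esub> \<eta> Z)"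
      using L.assoc[OF e(2)[OF o(1)] L.inv_in[OF g] e(1)[OF o(2)]] .
    finally show "Fm (Gm (Inv L g)) = Fm (Inv K (Gm g))" using Gm(3)[OF L.inv_in[OF g]] by simp
  qed
  have 2: "is_lub K (Go X) (Go Y) (Gm ` S) (Gm s)"
    if h: "X \<in> Obj L" "Y \<in> Obj L" "S \<subseteq> hom L X Y" "is_lub L X Y S s" for X Y S s
  proof -
    have s: "s \<in> hom L X Y" using h(4) unfolding is_lub_def by blast
    let ?h = "\<lambda>g. \<eta>' Y \<odot>\<^bsub>L\<^esub> (g \<odot>\<^bsub>L\<^esub> \<eta> X)"
    have S': "(\<lambda>g. g \<odot>\<^bsub>L\<^esub> \<eta> X) ` S \<subseteq> hom L (Fo (Go X)) Y" using h(3) L.comp_in e(1)[OF h(1)] by blast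
    have "is_lub L (Fo (Go X)) (Fo (Go Y)) ((\<lambda>g. \<eta>' Y \<odot>\<^bsub>L\<^esub> g) ` (\<lambda>g. g \<odot>\<^bsub>L\<^esub> \<eta> X) ` S) (?h s)"
      using L.lub_comp_left[OF L.lub_comp_right[OF h(4,3) e(1)[OF h(1)]] S' e(2)[OF h(2)]] .
    moreover have "(\<lambda>g. \<eta>' Y \<odot>\<^bsub>L\<^esub> g) ` (\<lambda>g. g \<odot>\<^bsub>L\<^esub> \<eta> X) ` S = Fm ` (Gm ` S)"
      unfolding image_image by (rule image_cong) (use Gm(3) h(3) in auto)
    moreover have "?h s = Fm (Gm s)" using Gm(3)[OF s] by simp
    moreover have "Gm ` S \<subseteq> hom K (Go X) (Go Y)" using h(3) Gm(2) by blast
    ultimately show ?thesis using dagger_embedding_lub[OF F1 G[OF h(1)] G[OF h(2)] _ Gm(2)[OF s]] by simp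
  qed
  have "is_inv_homomorphism L K Go Gm"
    unfolding is_inv_homomorphism_def is_homomorphism_def
  proof (intro conjI ballI allI impI)
    show "Gm (Inv L f) = Inv K (Gm f)" if "f \<in> Arr L" for f using 1[OF Arr_hom[OF that]] .
  qed (fact Gm(1) 2)+
  then show ?thesis unfolding inv_quantaloid_equiv_def
    using dagger_embedding_homomorphism[OF F1] Gm by blast
qed

section \<open>The category of symmetric left adjoints\<close>

text \<open>The symmetric counterpart of the category of maps in an ordered category of relations.
  Both \<open>SymCat_sc\<close> and the topos of sheaves are compared with it, which lets results on
  relations descend to functions.\<close>

definition sym_maps :: "('o, 'm, 'z) inv_quantaloid_scheme => ('o, 'm) category" where
  "sym_maps H = \<lparr>Obj = Obj H, Arr = {f \<in> Arr H. sym_left_adjoint H f}, Dom = Dom H, Cod = Cod H,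
     Ide = Ide H, Comp = Comp H\<rparr>"

lemma sym_maps_simps [simp]:
  "Obj (sym_maps H) = Obj H" "Dom (sym_maps H) = Dom H" "Cod (sym_maps H) = Cod H"
  "Ide (sym_maps H) = Ide H" "Comp (sym_maps H) = Comp H"
  by (simp_all add: sym_maps_def)

lemma hom_sym_maps: "hom (sym_maps H) X Y = {f \<in> hom H X Y. sym_left_adjoint H f}"
  by (auto simp: hom_def sym_maps_def)

lemma (in iqloid) sym_maps_category: "is_category (sym_maps Q)"
proof -
  have "Arr (sym_maps Q) \<subseteq> Arr Q" by (auto simp: sym_maps_def)
  then have "Dom Q f \<in> Obj Q \<and> Cod Q f \<in> Obj Q" if "f \<in> Arr (sym_maps Q)" for f
    using that hom_obj[OF Arr_hom, of f] by blast
  then show ?thesis unfolding is_category_def hom_sym_maps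
    using ide_in sym_left_adjoint_ide comp_in sym_left_adjoint_comp idl idr assoc by auto
qed

lemma (in iqloid) unitary_sym_left_adjoint: "unitary Q X Y u ==> sym_left_adjoint Q u"
  using sym_left_adjoint_iff le_refl ide_in hom_obj unfolding unitary_def by metis

lemma (in iqloid) unitary_inv: "unitary Q X Y u ==> unitary Q Y X (Inv Q u)"
  using inv_in inv_inv unfolding unitary_def by metis

lemma (in iqloid) unitary_is_iso:
  assumes u: "unitary Q X Y u"
  shows "is_iso (sym_maps Q) u" "u \<in> hom (sym_maps Q) X Y"
proof -
  show h: "u \<in> hom (sym_maps Q) X Y"
    using u unitary_sym_left_adjoint unfolding hom_sym_maps unitary_def by blast
  have "Inv Q u \<in> hom (sym_maps Q) Y X"
    using unitary_inv[OF u] unitary_sym_left_adjoint unfolding hom_sym_maps unitary_def by blast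
  then show "is_iso (sym_maps Q) u"
    by (rule cat_isoI[OF sym_maps_category h]) (use u in \<open>simp_all add: unitary_def\<close>)
qed

lemma dagger_embedding_sym_left_adjoint:
  assumes F: "dagger_embedding K L Fo Fm" and L: "is_inv_quantaloid L" and f: "f \<in> hom K X Y"
  shows "sym_left_adjoint L (Fm f) \<longleftrightarrow> sym_left_adjoint K f"
proof -
  interpret L: iqloid L using L by unfold_locales
  interpret K: iqloid K using dagger_embedding_inv_quantaloid[OF F L] by unfold_locales
  note e = cat_embeddingD[OF dagger_embeddingD(1)[OF F]]
  note o = e(1,2)[OF f] note fi = K.inv_in[OF f]
  show ?thesis
    using L.sym_left_adjoint_iff[OF embedding_in[OF dagger_embeddingD(1)[OF F] f]] K.sym_left_adjoint_iff[OF f]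
      dagger_embeddingD(2)[OF F e(3)[OF o(1)] e(4)[OF fi f]] dagger_embeddingD(2)[OF F e(4)[OF f fi] e(3)[OF o(2)]]
      e(8)[OF fi f] e(8)[OF f fi] dagger_embeddingD(4)[OF F f] e(7) o by simp
qed

lemma dagger_equivalence_sym_maps:
  assumes F: "dagger_equivalence K L Fo Fm" and L: "is_inv_quantaloid L"
  shows "category_equiv (sym_maps K) (sym_maps L)"
proof (rule embedding_equiv)
  have F1: "dagger_embedding K L Fo Fm" using F unfolding dagger_equivalence_def by blast
  note F2 = dagger_embeddingD(1)[OF F1] note f = cat_embeddingD[OF F2]
  interpret L: iqloid L using L by unfold_locales
  interpret K: iqloid K using dagger_embedding_inv_quantaloid[OF F1 L] by unfold_locales
  show "is_category (sym_maps L)" using L.sym_maps_category .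
  have K': "is_category (sym_maps K)" using K.sym_maps_category .
  have b: "bij_betw Fm (hom (sym_maps K) X Y) (hom (sym_maps L) (Fo X) (Fo Y))"
    if "X \<in> Obj K" "Y \<in> Obj K" for X Y
    using f(6)[OF that] dagger_embedding_sym_left_adjoint[OF F1 L, of _ X Y]
    unfolding hom_sym_maps bij_betw_def inj_on_def by blast
  show "cat_embedding (sym_maps K) (sym_maps L) Fo Fm"
    unfolding cat_embedding_def
  proof (intro conjI allI ballI)
    show "Dom (sym_maps K) f \<in> Obj (sym_maps K)" "Cod (sym_maps K) f \<in> Obj (sym_maps K)"
      if "f \<in> Arr (sym_maps K)" for f
      using cat_hom_obj[OF K' Arr_hom[OF that]] .
    show "Ide (sym_maps K) X \<in> hom (sym_maps K) X X" if "X \<in> Obj (sym_maps K)" for X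
      using cat_ide[OF K' that] .
    show "g \<odot>\<^bsub>sym_maps K\<^esub> h \<in> hom (sym_maps K) X Z"
      if "h \<in> hom (sym_maps K) X Y" "g \<in> hom (sym_maps K) Y Z" for X Y Z g h
      using cat_comp[OF K' that(2,1)] .
    show "Fm (g \<odot>\<^bsub>sym_maps K\<^esub> h) = Fm g \<odot>\<^bsub>sym_maps L\<^esub> Fm h"
      if "h \<in> hom (sym_maps K) X Y" "g \<in> hom (sym_maps K) Y Z" for X Y Z g h
      using that f(8)[of g Y Z h X] by (simp add: hom_sym_maps)
  qed (use f(5,7) b in simp_all)
  fix Y assume "Y \<in> Obj (sym_maps L)"
  then obtain X u where X: "X \<in> Obj K" and u: "unitary L (Fo X) Y u"
    using F unfolding dagger_equivalence_def by auto
  then show "\<exists>X\<in>Obj (sym_maps K). \<exists>u\<in>hom (sym_maps L) (Fo X) Y. is_iso (sym_maps L) u"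
    using L.unitary_is_iso[OF u] by auto
qed

section \<open>The involutive quantaloid of symmetric enriched categories\<close>

text \<open>\<open>SymDist\<close>, the canonical involution on \<open>Q\<close> and the reversal of
  cribles all add an involution to a given quantaloid record; a common constant gives them common
  simplification rules.\<close>

definition with_inv :: "('o, 'm) quantaloid => ('m => 'm) => ('o, 'm) inv_quantaloid" where
  "with_inv K i = quantaloid.extend K (inv_quantaloid.fields i)"

lemmas SymDist_with_inv = SymDist_def[folded with_inv_def]
lemmas canonical_with_inv = with_canonical_inv_def[folded with_inv_def]

lemma with_inv_simps [simp]:
  "Obj (with_inv K i) = Obj K"
  "Arr (with_inv K i) = Arr K"
  "Dom (with_inv K i) = Dom K"
  "Cod (with_inv K i) = Cod K"
  "Ide (with_inv K i) = Ide K"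
  "Comp (with_inv K i) = Comp K"
  "Leq (with_inv K i) = Leq K"
  "Inv (with_inv K i) = i"
  by (simp_all add: with_inv_def quantaloid.defs inv_quantaloid.defs)

lemma hom_with_inv [simp]: "hom (with_inv K i) X Y = hom K X Y"
  by (simp add: hom_def)

lemma is_quantaloid_with_inv [simp]:
  "is_quantaloid (with_inv K i) \<longleftrightarrow> is_quantaloid K"
  by (simp add: is_quantaloid_def is_category_def is_lub_def)

lemma full_sub_simps [simp]:
  "Obj (full_sub P C) = {X \<in> Obj C. P X}" "Dom (full_sub P C) = Dom C" "Cod (full_sub P C) = Cod C"
  "Ide (full_sub P C) = Ide C" "Comp (full_sub P C) = Comp C"
  by (simp_all add: full_sub_def)

lemma full_sub_Leq [simp]: "Leq (full_sub P K) = Leq K"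
  by (simp add: full_sub_def)

lemma full_sub_Inv [simp]: "Inv (full_sub P K) = Inv K"
  by (simp add: full_sub_def)

lemma hom_full_sub: "hom (full_sub P C) X Y = (if P X \<and> P Y then hom C X Y else {})"
  by (auto simp: hom_def full_sub_def)

lemma is_category_full_sub:
  assumes C: "is_category C"
  shows "is_category (full_sub P C)"
proof -
  have "Dom C f \<in> {X \<in> Obj C. P X} \<and> Cod C f \<in> {X \<in> Obj C. P X}" if "f \<in> Arr (full_sub P C)" for f
    using cat_hom_obj[OF C Arr_hom, of f] that by (auto simp: full_sub_def)
  then show ?thesis unfolding is_category_def hom_full_sub
    using cat_ide[OF C] cat_comp[OF C] cat_idl[OF C] cat_idr[OF C] cat_assoc[OF C] by auto
qed

lemma dagger_embedding_full_sub:
  assumes K: "is_inv_quantaloid K"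
  shows "dagger_embedding (full_sub P K) K (\<lambda>X. X) (\<lambda>f. f)"
proof -
  interpret K: iqloid K using K by unfold_locales
  note c = is_category_full_sub[OF K.cat]
  show ?thesis unfolding dagger_embedding_def cat_embedding_def
    using cat_ide[OF c] cat_comp[OF c] cat_hom_obj[OF c Arr_hom, of _ P] K.inv_in
    by (auto simp: bij_betw_def hom_full_sub split: if_splits)
qed

section \<open>Calculus of distributors over a quantaloid\<close>

context qloid
begin

lemma qcatD:
  assumes "is_qcat Q A"
  shows "x \<in> qobj A ==> qty A x \<in> Obj Q"
    and "x \<in> qobj A ==> y \<in> qobj A ==> qhom A y x \<in> hom Q (qty A x) (qty A y)"
    and "x \<in> qobj A ==> y \<in> qobj A ==> z \<in> qobj A ==> qhom A z y \<odot> qhom A y x \<sqsubseteq> qhom A z x"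
    and "x \<in> qobj A ==> Ide Q (qty A x) \<sqsubseteq> qhom A x x"
  using assms unfolding is_qcat_def by (blast, fastforce, blast, blast)

definition dst :: "('u, 'o, 'm) qcat => ('u, 'o, 'm) qcat => ('u => 'u => 'm) => bool" where
  "dst A B M \<longleftrightarrow> is_qcat Q A \<and> is_qcat Q B \<and> is_distributor Q A B M"

lemma dstD:
  assumes "dst A B M"
  shows "is_qcat Q A" "is_qcat Q B"
    and "x \<in> qobj A ==> y \<in> qobj B ==> M y x \<in> hom Q (qty A x) (qty B y)"
    and "x \<in> qobj A ==> y \<in> qobj B ==> y' \<in> qobj B ==> qhom B y' y \<odot> M y x \<sqsubseteq> M y' x"
    and "x \<in> qobj A ==> x' \<in> qobj A ==> y \<in> qobj B ==> M y x \<odot> qhom A x x' \<sqsubseteq> M y x'"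
    and "M \<in> (\<Pi>\<^sub>E y\<in>qobj B. \<Pi>\<^sub>E x\<in>qobj A. hom Q (qty A x) (qty B y))"
  using assms unfolding dst_def is_distributor_def by (blast, blast, fastforce, blast, blast, blast)

lemma dst_ty:
  assumes "dst A B M"
  shows "x \<in> qobj A ==> qty A x \<in> Obj Q" "y \<in> qobj B ==> qty B y \<in> Obj Q"
  using qcatD(1)[OF dstD(1)[OF assms]] qcatD(1)[OF dstD(2)[OF assms]] by blast+

lemma dst_eqI:
  assumes "dst A B M" "dst A B N" "\<And>x y. x \<in> qobj A ==> y \<in> qobj B ==> M y x = N y x"
  shows "M = N"
proof (rule PiE_ext[OF dstD(6)[OF assms(1)] dstD(6)[OF assms(2)]])
  fix y assume y: "y \<in> qobj B"
  show "M y = N y"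
    by (rule PiE_ext[OF PiE_mem[OF dstD(6)[OF assms(1)] y] PiE_mem[OF dstD(6)[OF assms(2)] y]])
      (use assms(3) y in blast)
qed

lemma dst_restrictI:
  assumes "is_qcat Q A" "is_qcat Q B"
    and "\<And>x y. x \<in> qobj A ==> y \<in> qobj B ==> M y x \<in> hom Q (qty A x) (qty B y)"
    and "\<And>x y y'. x \<in> qobj A ==> y \<in> qobj B ==> y' \<in> qobj B ==> qhom B y' y \<odot> M y x \<sqsubseteq> M y' x"
    and "\<And>x x' y. x \<in> qobj A ==> x' \<in> qobj A ==> y \<in> qobj B ==> M y x \<odot> qhom A x x' \<sqsubseteq> M y x'"
  shows "dst A B (\<lambda>y\<in>qobj B. \<lambda>x\<in>qobj A. M y x)"
  unfolding dst_def is_distributor_def using assms by simp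

lemma dst_id: "is_qcat Q A ==> dst A A (qhom A)"
  unfolding dst_def is_distributor_def is_qcat_def by blast

definition dcomp :: "('u, 'o, 'm) qcat => ('u, 'o, 'm) qcat => ('u, 'o, 'm) qcat
    => ('u => 'u => 'm) => ('u => 'u => 'm) => 'u => 'u => 'm" where
  "dcomp A B C N M = (\<lambda>z\<in>qobj C. \<lambda>x\<in>qobj A.
     join Q (qty A x) (qty C z) {N z y \<odot> M y x | y. y \<in> qobj B})"

context
  fixes A B C M N x z
  assumes M: "dst A B M" and N: "dst B C N" and x: "x \<in> qobj A" and z: "z \<in> qobj C"
begin

lemma dcomp_sub: "{N z y \<odot> M y x | y. y \<in> qobj B} \<subseteq> hom Q (qty A x) (qty C z)"
  using comp_in[OF dstD(3)[OF N _ z] dstD(3)[OF M x]] by blast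

lemma dcomp_in: "dcomp A B C N M z x \<in> hom Q (qty A x) (qty C z)"
  using join_in[OF _ _ dcomp_sub] dst_ty[OF M] dst_ty[OF N] x z by (simp add: dcomp_def)

lemma dcomp_upper: "y \<in> qobj B ==> N z y \<odot> M y x \<sqsubseteq> dcomp A B C N M z x"
  using join_upper[OF _ _ _ dcomp_sub, of "N z y \<odot> M y x"] dst_ty[OF M] dst_ty[OF N] x z
  by (auto simp: dcomp_def)

lemma dcomp_le_iff:
  "t \<in> hom Q (qty A x) (qty C z) ==>
    dcomp A B C N M z x \<sqsubseteq> t \<longleftrightarrow> (\<forall>y\<in>qobj B. N z y \<odot> M y x \<sqsubseteq> t)"
  using join_le_iff[OF dcomp_sub] x z by (auto simp: dcomp_def)

lemma comp_dcomp_le_iff: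
  "g \<in> hom Q (qty C z) W ==> t \<in> hom Q (qty A x) W ==>
    g \<odot> dcomp A B C N M z x \<sqsubseteq> t \<longleftrightarrow> (\<forall>y\<in>qobj B. g \<odot> (N z y \<odot> M y x) \<sqsubseteq> t)"
  using comp_join_le_iff[OF dcomp_sub] x z by (auto simp: dcomp_def)

lemma dcomp_comp_le_iff:
  "f \<in> hom Q W (qty A x) ==> t \<in> hom Q W (qty C z) ==>
    dcomp A B C N M z x \<odot> f \<sqsubseteq> t \<longleftrightarrow> (\<forall>y\<in>qobj B. (N z y \<odot> M y x) \<odot> f \<sqsubseteq> t)"
  using join_comp_le_iff[OF dcomp_sub] x z by (auto simp: dcomp_def)

end

lemma dcomp_dst:
  assumes M: "dst A B M" and N: "dst B C N"
  shows "dst A C (dcomp A B C N M)"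
proof -
  note p = dstD(3)[OF M] and q = dstD(3)[OF N]
  note a = qcatD[OF dstD(1)[OF M]] and c = qcatD[OF dstD(2)[OF N]]
  have "qhom C z' z \<odot> dcomp A B C N M z x \<sqsubseteq> dcomp A B C N M z' x"
    if h: "x \<in> qobj A" "z \<in> qobj C" "z' \<in> qobj C" for x z z'
  proof -
    have "qhom C z' z \<odot> (N z y \<odot> M y x) \<sqsubseteq> dcomp A B C N M z' x" if y: "y \<in> qobj B" for y
    proof -
      have "(qhom C z' z \<odot> N z y) \<odot> M y x \<sqsubseteq> N z' y \<odot> M y x"
        using comp_mono_left[OF dstD(4)[OF N y h(2,3)] comp_in[OF c(2)[OF h(2,3)] q[OF y h(2)]] q[OF y h(3)] p[OF h(1) y]] .
      then have "(qhom C z' z \<odot> N z y) \<odot> M y x \<sqsubseteq> dcomp A B C N M z' x"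
        by (rule le_trans[OF _ dcomp_upper[OF M N h(1,3) y]
            comp_in[OF comp_in[OF c(2)[OF h(2,3)] q[OF y h(2)]] p[OF h(1) y]]
            comp_in[OF q[OF y h(3)] p[OF h(1) y]] dcomp_in[OF M N h(1,3)]])
      then show ?thesis using assoc[OF c(2)[OF h(2,3)] q[OF y h(2)] p[OF h(1) y]] by simp
    qed
    then show ?thesis using comp_dcomp_le_iff[OF M N h(1,2) c(2)[OF h(2,3)] dcomp_in[OF M N h(1,3)]] by blast
  qed
  moreover have "dcomp A B C N M z x \<odot> qhom A x x' \<sqsubseteq> dcomp A B C N M z x'"
    if h: "x \<in> qobj A" "x' \<in> qobj A" "z \<in> qobj C" for x x' z
  proof -
    have "(N z y \<odot> M y x) \<odot> qhom A x x' \<sqsubseteq> dcomp A B C N M z x'" if y: "y \<in> qobj B" for y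
    proof -
      have "N z y \<odot> (M y x \<odot> qhom A x x') \<sqsubseteq> N z y \<odot> M y x'"
        using comp_mono_right[OF dstD(5)[OF M h(1,2) y] comp_in[OF p[OF h(1) y] a(2)[OF h(2,1)]] p[OF h(2) y] q[OF y h(3)]] .
      then have "N z y \<odot> (M y x \<odot> qhom A x x') \<sqsubseteq> dcomp A B C N M z x'"
        by (rule le_trans[OF _ dcomp_upper[OF M N h(2,3) y]
            comp_in[OF q[OF y h(3)] comp_in[OF p[OF h(1) y] a(2)[OF h(2,1)]]]
            comp_in[OF q[OF y h(3)] p[OF h(2) y]] dcomp_in[OF M N h(2,3)]])
      then show ?thesis using assoc[OF q[OF y h(3)] p[OF h(1) y] a(2)[OF h(2,1)]] by simp
    qed
    then show ?thesis using dcomp_comp_le_iff[OF M N h(1,3) a(2)[OF h(2,1)] dcomp_in[OF M N h(2,3)]] by blast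
  qed
  moreover have "(\<lambda>z\<in>qobj C. \<lambda>x\<in>qobj A. dcomp A B C N M z x) = dcomp A B C N M"
    unfolding dcomp_def by (intro ext) (simp add: restrict_def)
  ultimately show ?thesis
    using dst_restrictI[OF dstD(1)[OF M] dstD(2)[OF N] dcomp_in[OF M N]] by simp
qed

lemma dst_le_antisym:
  assumes "dst A B M" "dst A B N"
    and "\<And>x y. x \<in> qobj A ==> y \<in> qobj B ==> M y x \<sqsubseteq> N y x"
    and "\<And>x y. x \<in> qobj A ==> y \<in> qobj B ==> N y x \<sqsubseteq> M y x"
  shows "M = N"
  using dst_eqI[OF assms(1,2)] le_antisym[OF dstD(3)[OF assms(1)] dstD(3)[OF assms(2)]] assms(3,4) by blast

lemma dcomp_id_right:
  assumes M: "dst A B M"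
  shows "dcomp A A B M (qhom A) = M"
proof (rule dst_le_antisym[OF dcomp_dst[OF dst_id[OF dstD(1)[OF M]] M] M])
  note a = qcatD[OF dstD(1)[OF M]]
  fix x y assume x: "x \<in> qobj A" and y: "y \<in> qobj B"
  show "dcomp A A B M (qhom A) y x \<sqsubseteq> M y x"
    using dcomp_le_iff[OF dst_id[OF dstD(1)[OF M]] M x y dstD(3)[OF M x y]] dstD(5)[OF M] x y by blast
  have "M y x \<odot> Ide Q (qty A x) \<sqsubseteq> M y x \<odot> qhom A x x"
    using comp_mono_right[OF a(4)[OF x] ide_in[OF a(1)[OF x]] a(2)[OF x x] dstD(3)[OF M x y]] .
  then have "M y x \<sqsubseteq> M y x \<odot> qhom A x x" using idr[OF dstD(3)[OF M x y]] by simp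
  then show "M y x \<sqsubseteq> dcomp A A B M (qhom A) y x"
    by (rule le_trans[OF _ dcomp_upper[OF dst_id[OF dstD(1)[OF M]] M x y x] dstD(3)[OF M x y]
        comp_in[OF dstD(3)[OF M x y] a(2)[OF x x]] dcomp_in[OF dst_id[OF dstD(1)[OF M]] M x y]])
qed

lemma dcomp_id_left:
  assumes M: "dst A B M"
  shows "dcomp A B B (qhom B) M = M"
proof (rule dst_le_antisym[OF dcomp_dst[OF M dst_id[OF dstD(2)[OF M]]] M])
  note a = qcatD[OF dstD(2)[OF M]]
  fix x y assume x: "x \<in> qobj A" and y: "y \<in> qobj B"
  show "dcomp A B B (qhom B) M y x \<sqsubseteq> M y x"
    using dcomp_le_iff[OF M dst_id[OF dstD(2)[OF M]] x y dstD(3)[OF M x y]] dstD(4)[OF M] x y by blast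
  have "Ide Q (qty B y) \<odot> M y x \<sqsubseteq> qhom B y y \<odot> M y x"
    using comp_mono_left[OF a(4)[OF y] ide_in[OF a(1)[OF y]] a(2)[OF y y] dstD(3)[OF M x y]] .
  then have "M y x \<sqsubseteq> qhom B y y \<odot> M y x" using idl[OF dstD(3)[OF M x y]] by simp
  then show "M y x \<sqsubseteq> dcomp A B B (qhom B) M y x"
    by (rule le_trans[OF _ dcomp_upper[OF M dst_id[OF dstD(2)[OF M]] x y y] dstD(3)[OF M x y]
        comp_in[OF a(2)[OF y y] dstD(3)[OF M x y]] dcomp_in[OF M dst_id[OF dstD(2)[OF M]] x y]])
qed

text \<open>An arrow bounds either side exactly if it bounds every triple composite along y and z,
  since composition distributes over joins on both sides.\<close>

lemma dcomp_assoc: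
  assumes M: "dst A B M" and N: "dst B C N" and \<Omega>: "dst C D \<Omega>"
  shows "dcomp A C D \<Omega> (dcomp A B C N M) = dcomp A B D (dcomp B C D \<Omega> N) M"
proof (rule dst_eqI)
  note l = dcomp_dst[OF M N] and r = dcomp_dst[OF N \<Omega>]
  show "dst A D (dcomp A C D \<Omega> (dcomp A B C N M))" "dst A D (dcomp A B D (dcomp B C D \<Omega> N) M)"
    using dcomp_dst[OF l \<Omega>] dcomp_dst[OF M r] .
  fix x w assume x: "x \<in> qobj A" and w: "w \<in> qobj D"
  show "dcomp A C D \<Omega> (dcomp A B C N M) w x = dcomp A B D (dcomp B C D \<Omega> N) M w x"
  proof (rule le_eqI[OF dcomp_in[OF l \<Omega> x w] dcomp_in[OF M r x w]])
    fix t assume t: "t \<in> hom Q (qty A x) (qty D w)"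
    have "dcomp A C D \<Omega> (dcomp A B C N M) w x \<sqsubseteq> t \<longleftrightarrow>
        (\<forall>z\<in>qobj C. \<forall>y\<in>qobj B. \<Omega> w z \<odot> (N z y \<odot> M y x) \<sqsubseteq> t)"
      using dcomp_le_iff[OF l \<Omega> x w t] comp_dcomp_le_iff[OF M N x _ dstD(3)[OF \<Omega> _ w] t] by simp
    also have "\<dots> \<longleftrightarrow> (\<forall>z\<in>qobj C. \<forall>y\<in>qobj B. (\<Omega> w z \<odot> N z y) \<odot> M y x \<sqsubseteq> t)"
      using assoc[OF dstD(3)[OF \<Omega> _ w] dstD(3)[OF N] dstD(3)[OF M x]] by simp
    also have "\<dots> \<longleftrightarrow> dcomp A B D (dcomp B C D \<Omega> N) M w x \<sqsubseteq> t"
      using dcomp_le_iff[OF M r x w t] dcomp_comp_le_iff[OF N \<Omega> _ w dstD(3)[OF M x] t] by auto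
    finally show "dcomp A C D \<Omega> (dcomp A B C N M) w x \<sqsubseteq> t \<longleftrightarrow>
      dcomp A B D (dcomp B C D \<Omega> N) M w x \<sqsubseteq> t" .
  qed
qed

definition dsup :: "('u, 'o, 'm) qcat => ('u, 'o, 'm) qcat => ('u => 'u => 'm) set => 'u => 'u => 'm" where
  "dsup A B P = (\<lambda>y\<in>qobj B. \<lambda>x\<in>qobj A. join Q (qty A x) (qty B y) {M y x | M. M \<in> P})"

context
  fixes A B P
  assumes A: "is_qcat Q A" and B: "is_qcat Q B" and PP: "P \<subseteq> {M. dst A B M}"
begin

lemma dsup_mem: "M \<in> P ==> dst A B M"
  using PP by blast

lemma dsup_sub: "x \<in> qobj A ==> y \<in> qobj B ==> {M y x | M. M \<in> P} \<subseteq> hom Q (qty A x) (qty B y)"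
  using dstD(3)[OF dsup_mem] by blast

lemma dsup_in: "x \<in> qobj A ==> y \<in> qobj B ==> dsup A B P y x \<in> hom Q (qty A x) (qty B y)"
  using join_in[OF _ _ dsup_sub] qcatD(1)[OF A] qcatD(1)[OF B] by (simp add: dsup_def)

lemma dsup_upper: "M \<in> P ==> x \<in> qobj A ==> y \<in> qobj B ==> M y x \<sqsubseteq> dsup A B P y x"
  using join_upper[OF _ _ _ dsup_sub, of "M y x" y x] qcatD(1)[OF A] qcatD(1)[OF B] by (auto simp: dsup_def)

lemma dsup_le_iff:
  "x \<in> qobj A ==> y \<in> qobj B ==> t \<in> hom Q (qty A x) (qty B y) ==>
    dsup A B P y x \<sqsubseteq> t \<longleftrightarrow> (\<forall>M\<in>P. M y x \<sqsubseteq> t)"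
  using join_le_iff[OF dsup_sub] by (auto simp: dsup_def)

lemma comp_dsup_le_iff:
  "x \<in> qobj A ==> y \<in> qobj B ==> g \<in> hom Q (qty B y) W ==> t \<in> hom Q (qty A x) W ==>
    g \<odot> dsup A B P y x \<sqsubseteq> t \<longleftrightarrow> (\<forall>M\<in>P. g \<odot> M y x \<sqsubseteq> t)"
  using comp_join_le_iff[OF dsup_sub] by (auto simp: dsup_def)

lemma dsup_comp_le_iff:
  "x \<in> qobj A ==> y \<in> qobj B ==> f \<in> hom Q W (qty A x) ==> t \<in> hom Q W (qty B y) ==>
    dsup A B P y x \<odot> f \<sqsubseteq> t \<longleftrightarrow> (\<forall>M\<in>P. M y x \<odot> f \<sqsubseteq> t)"
  using join_comp_le_iff[OF dsup_sub] by (auto simp: dsup_def)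

lemma dsup_dst: "dst A B (dsup A B P)"
proof -
  note a = qcatD[OF A] and b = qcatD[OF B]
  have "qhom B y' y \<odot> dsup A B P y x \<sqsubseteq> dsup A B P y' x"
    if h: "x \<in> qobj A" "y \<in> qobj B" "y' \<in> qobj B" for x y y'
  proof -
    have "qhom B y' y \<odot> M y x \<sqsubseteq> dsup A B P y' x" if p: "M \<in> P" for M
      by (rule le_trans[OF dstD(4)[OF dsup_mem[OF p] h] dsup_upper[OF p h(1,3)]
          comp_in[OF b(2)[OF h(2,3)] dstD(3)[OF dsup_mem[OF p] h(1,2)]] dstD(3)[OF dsup_mem[OF p] h(1,3)] dsup_in[OF h(1,3)]])
    then show ?thesis using comp_dsup_le_iff[OF h(1,2) b(2)[OF h(2,3)] dsup_in[OF h(1,3)]] by blast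
  qed
  moreover have "dsup A B P y x \<odot> qhom A x x' \<sqsubseteq> dsup A B P y x'"
    if h: "x \<in> qobj A" "x' \<in> qobj A" "y \<in> qobj B" for x x' y
  proof -
    have "M y x \<odot> qhom A x x' \<sqsubseteq> dsup A B P y x'" if p: "M \<in> P" for M
      by (rule le_trans[OF dstD(5)[OF dsup_mem[OF p] h] dsup_upper[OF p h(2,3)]
          comp_in[OF dstD(3)[OF dsup_mem[OF p] h(1,3)] a(2)[OF h(2,1)]] dstD(3)[OF dsup_mem[OF p] h(2,3)] dsup_in[OF h(2,3)]])
    then show ?thesis using dsup_comp_le_iff[OF h(1,3) a(2)[OF h(2,1)] dsup_in[OF h(2,3)]] by blast
  qed
  moreover have "(\<lambda>z\<in>qobj B. \<lambda>x\<in>qobj A. dsup A B P z x) = dsup A B P"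
    unfolding dsup_def by (intro ext) (simp add: restrict_def)
  ultimately show ?thesis using dst_restrictI[OF A B dsup_in] by simp
qed

end

lemma Dist_simps [simp]:
  "Obj (Dist Q) = {A. is_qcat Q A}"
  "(A, M, B) \<in> Arr (Dist Q) \<longleftrightarrow> dst A B M"
  "Dom (Dist Q) (A, M, B) = A" "Cod (Dist Q) (A, M, B) = B"
  "Ide (Dist Q) A = (A, qhom A, A)"
  "(B', N, C) \<odot>\<^bsub>Dist Q\<^esub> (A, M, B) = (A, dcomp A B' C N M, C)"
  "(A, M, B) \<sqsubseteq>\<^bsub>Dist Q\<^esub> (A', M', B') \<longleftrightarrow> A = A' \<and> B = B' \<and>
     (\<forall>y\<in>qobj B. \<forall>x\<in>qobj A. M y x \<sqsubseteq> M' y x)"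
  by (auto simp: Dist_def dst_def dcomp_def)

lemma hom_Dist: "hom (Dist Q) A B = {(A, M, B) | M. dst A B M}"
  by (auto simp: hom_def)

end

section \<open>The involution on distributors between symmetric categories\<close>

context iqloid
begin

abbreviation "symm \<equiv> symmetric_qcat Q"

definition dinv :: "('u, 'o, 'm) qcat => ('u, 'o, 'm) qcat => ('u => 'u => 'm) => 'u => 'u => 'm" where
  "dinv A B M = (\<lambda>a\<in>qobj A. \<lambda>b\<in>qobj B. Inv Q (M b a))"

lemma symD: "symm A ==> x \<in> qobj A ==> y \<in> qobj A ==> Inv Q (qhom A y x) = qhom A x y"
  unfolding symmetric_qcat_def by metis

lemma dinv_dst:
  assumes M: "dst A B M" and A: "symm A" and B: "symm B"
  shows "dst B A (dinv A B M)"
  unfolding dinv_def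
proof (rule dst_restrictI)
  note p = dstD(3)[OF M] and a = qcatD(2)[OF dstD(1)[OF M]] and b = qcatD(2)[OF dstD(2)[OF M]]
  show "is_qcat Q A" "is_qcat Q B" using dstD(1,2)[OF M] .
  show "Inv Q (M y x) \<in> hom Q (qty B y) (qty A x)" if "y \<in> qobj B" "x \<in> qobj A" for y x
    using inv_in[OF p] that by blast
  show "qhom A x' x \<odot> Inv Q (M y x) \<sqsubseteq> Inv Q (M y x')" if h: "y \<in> qobj B" "x \<in> qobj A" "x' \<in> qobj A" for y x x'
    using inv_mono[OF dstD(5)[OF M h(2,3,1)] comp_in[OF p[OF h(2,1)] a[OF h(3,2)]] p[OF h(3,1)]]
      inv_comp[OF p[OF h(2,1)] a[OF h(3,2)]] symD[OF A h(3,2)] by simp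
  show "Inv Q (M y x) \<odot> qhom B y y' \<sqsubseteq> Inv Q (M y' x)" if h: "y \<in> qobj B" "y' \<in> qobj B" "x \<in> qobj A" for y y' x
    using inv_mono[OF dstD(4)[OF M h(3,1,2)] comp_in[OF b[OF h(1,2)] p[OF h(3,1)]] p[OF h(3,2)]]
      inv_comp[OF b[OF h(1,2)] p[OF h(3,1)]] symD[OF B h(1,2)] by simp
qed

lemma SymDist_simps [simp]:
  "Obj (SymDist Q) = {A. is_qcat Q A \<and> symm A}"
  "(A, M, B) \<in> Arr (SymDist Q) \<longleftrightarrow> dst A B M \<and> symm A \<and> symm B"
  "Dom (SymDist Q) (A, M, B) = A" "Cod (SymDist Q) (A, M, B) = B"
  "Ide (SymDist Q) A = (A, qhom A, A)"
  "(B', N, C) \<odot>\<^bsub>SymDist Q\<^esub> (A, M, B) = (A, dcomp A B' C N M, C)"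
  "(A, M, B) \<sqsubseteq>\<^bsub>SymDist Q\<^esub> (A', M', B') \<longleftrightarrow> A = A' \<and> B = B' \<and>
     (\<forall>y\<in>qobj B. \<forall>x\<in>qobj A. M y x \<sqsubseteq> M' y x)"
  "Inv (SymDist Q) (A, M, B) = (B, dinv A B M, A)"
  by (auto simp: SymDist_with_inv full_sub_def dinv_def)

lemma hom_SymDist: "hom (SymDist Q) A B = {(A, M, B) | M. dst A B M \<and> symm A \<and> symm B}"
  by (auto simp: hom_def)

lemma dinv_dinv: "dst A B M ==> symm A ==> symm B ==> dinv B A (dinv A B M) = M"
  by (rule dst_eqI[OF dinv_dst[OF dinv_dst]]) (auto simp: dinv_def inv_inv dest: dstD(3))

lemma dinv_comp:
  assumes M: "dst A B M" and N: "dst B C N" and s: "symm A" "symm B" "symm C"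
  shows "dinv A C (dcomp A B C N M) = dcomp C B A (dinv A B M) (dinv B C N)"
proof (rule dst_eqI)
  note i = dinv_dst[OF M s(1,2)] dinv_dst[OF N s(2,3)]
  show "dst C A (dinv A C (dcomp A B C N M))" "dst C A (dcomp C B A (dinv A B M) (dinv B C N))"
    using dinv_dst[OF dcomp_dst[OF M N]] dcomp_dst[OF i(2,1)] s by auto
  fix z x assume z: "z \<in> qobj C" and x: "x \<in> qobj A"
  have "Inv Q (dcomp A B C N M z x) = join Q (qty C z) (qty A x) (Inv Q ` {N z y \<odot> M y x | y. y \<in> qobj B})"
    using inv_join[OF _ _ dcomp_sub[OF M N x z]] dst_ty[OF M] dst_ty[OF N] x z by (simp add: dcomp_def)
  also have "Inv Q ` {N z y \<odot> M y x | y. y \<in> qobj B} = {Inv Q (M y x) \<odot> Inv Q (N z y) | y. y \<in> qobj B}"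
    using inv_comp[OF dstD(3)[OF N _ z] dstD(3)[OF M x]] by (auto simp: image_def)
  also have "\<dots> = {dinv A B M x y \<odot> dinv B C N y z | y. y \<in> qobj B}" using x z by (auto simp: dinv_def)
  finally show "dinv A C (dcomp A B C N M) x z = dcomp C B A (dinv A B M) (dinv B C N) x z"
    using x z by (simp add: dcomp_def dinv_def)
qed

lemma SymDist_inv_quantaloid: "is_inv_quantaloid (SymDist Q)"
proof (rule inv_quantaloidI)
  show "is_category (SymDist Q)" unfolding is_category_def hom_SymDist
  proof (intro conjI allI ballI)
    fix f assume f: "f \<in> Arr (SymDist Q)"
    obtain A M B where e: "f = (A, M, B)" by (cases f)
    show "Dom (SymDist Q) f \<in> Obj (SymDist Q)" "Cod (SymDist Q) f \<in> Obj (SymDist Q)"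
      using dstD(1,2)[of A B M] f by (simp_all add: e)
  qed (use dst_id dcomp_dst dcomp_id_left dcomp_id_right dcomp_assoc in auto)
next
  fix A B f assume "f \<in> hom (SymDist Q) A B"
  then obtain M where f: "f = (A, M, B)" and M: "dst A B M" and s: "symm A" "symm B" by (auto simp: hom_SymDist)
  show "f \<sqsubseteq>\<^bsub>SymDist Q\<^esub> f" using le_refl[OF dstD(3)[OF M]] by (simp add: f)
  show "Inv (SymDist Q) f \<in> hom (SymDist Q) B A" "Inv (SymDist Q) (Inv (SymDist Q) f) = f"
    using dinv_dst[OF M s] dinv_dinv[OF M s] s by (simp_all add: f hom_SymDist)
  fix g assume "g \<in> hom (SymDist Q) A B"
  then obtain N where g: "g = (A, N, B)" and N: "dst A B N" by (auto simp: hom_SymDist)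
  show "f \<sqsubseteq>\<^bsub>SymDist Q\<^esub> g ==> g \<sqsubseteq>\<^bsub>SymDist Q\<^esub> f ==> f = g" using dst_le_antisym[OF M N] by (simp add: f g)
  show "f \<sqsubseteq>\<^bsub>SymDist Q\<^esub> g ==> Inv (SymDist Q) f \<sqsubseteq>\<^bsub>SymDist Q\<^esub> Inv (SymDist Q) g"
    using inv_mono[OF _ dstD(3)[OF M] dstD(3)[OF N]] by (simp add: f g dinv_def)
  fix h assume "h \<in> hom (SymDist Q) A B"
  then obtain \<Theta> where h: "h = (A, \<Theta>, B)" and \<Theta>: "dst A B \<Theta>" by (auto simp: hom_SymDist)
  show "f \<sqsubseteq>\<^bsub>SymDist Q\<^esub> g ==> g \<sqsubseteq>\<^bsub>SymDist Q\<^esub> h ==> f \<sqsubseteq>\<^bsub>SymDist Q\<^esub> h"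
    using le_trans[OF _ _ dstD(3)[OF M] dstD(3)[OF N] dstD(3)[OF \<Theta>]] by (auto simp: f g h)
next
  fix A B C f g assume "f \<in> hom (SymDist Q) A B" "g \<in> hom (SymDist Q) B C"
  then show "Inv (SymDist Q) (g \<odot>\<^bsub>SymDist Q\<^esub> f) = Inv (SymDist Q) f \<odot>\<^bsub>SymDist Q\<^esub> Inv (SymDist Q) g"
    using dinv_comp by (auto simp: hom_SymDist)
next
  fix A B S assume o: "A \<in> Obj (SymDist Q)" "B \<in> Obj (SymDist Q)" and S: "S \<subseteq> hom (SymDist Q) A B"
  define P where "P = {M. (A, M, B) \<in> S}"
  have A: "is_qcat Q A" "symm A" and B: "is_qcat Q B" "symm B" using o by simp_all
  have Sf: "(\<forall>f\<in>S. R f) \<longleftrightarrow> (\<forall>M\<in>P. R (A, M, B))" for R using S by (fastforce simp: P_def hom_SymDist)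
  have P: "P \<subseteq> {M. dst A B M}" using S by (auto simp: P_def hom_SymDist)
  note d = dsup_dst[OF A(1) B(1) P]
  have "is_lub (SymDist Q) A B S (A, dsup A B P, B)" unfolding is_lub_def Sf
  proof (intro conjI ballI impI)
    show "(A, dsup A B P, B) \<in> hom (SymDist Q) A B" using d A B by (simp add: hom_SymDist)
    show "(A, M, B) \<sqsubseteq>\<^bsub>SymDist Q\<^esub> (A, dsup A B P, B)" if "M \<in> P" for M using dsup_upper[OF A(1) B(1) P that] by simp
    fix t assume "t \<in> hom (SymDist Q) A B" and le: "\<forall>M\<in>P. (A, M, B) \<sqsubseteq>\<^bsub>SymDist Q\<^esub> t"
    then obtain \<Theta> where t: "t = (A, \<Theta>, B)" "dst A B \<Theta>" by (auto simp: hom_SymDist)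
    show "(A, dsup A B P, B) \<sqsubseteq>\<^bsub>SymDist Q\<^esub> t" using le dsup_le_iff[OF A(1) B(1) P _ _ dstD(3)[OF t(2)]] by (simp add: t)
  qed
  moreover have "g \<odot>\<^bsub>SymDist Q\<^esub> (A, dsup A B P, B) \<sqsubseteq>\<^bsub>SymDist Q\<^esub> t \<longleftrightarrow> (\<forall>f\<in>S. g \<odot>\<^bsub>SymDist Q\<^esub> f \<sqsubseteq>\<^bsub>SymDist Q\<^esub> t)"
    if h: "g \<in> hom (SymDist Q) B C" "t \<in> hom (SymDist Q) A C" for C g t
  proof -
    obtain N \<Theta> where g: "g = (B, N, C)" "dst B C N" and t: "t = (A, \<Theta>, C)" "dst A C \<Theta>" using h by (auto simp: hom_SymDist)
    have "dcomp A B C N (dsup A B P) z x \<sqsubseteq> \<Theta> z x \<longleftrightarrow> (\<forall>M\<in>P. dcomp A B C N M z x \<sqsubseteq> \<Theta> z x)"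
      if x: "x \<in> qobj A" and z: "z \<in> qobj C" for x z
    proof -
      note T = dstD(3)[OF t(2) x z]
      have "dcomp A B C N M z x \<sqsubseteq> \<Theta> z x \<longleftrightarrow> (\<forall>y\<in>qobj B. N z y \<odot> M y x \<sqsubseteq> \<Theta> z x)" if "M \<in> P" for M
        using dcomp_le_iff[OF _ g(2) x z T] P that by blast
      then show ?thesis
        using dcomp_le_iff[OF d g(2) x z T] comp_dsup_le_iff[OF A(1) B(1) P x _ dstD(3)[OF g(2) _ z] T] by auto
    qed
    then show ?thesis unfolding Sf by (auto simp: g t)
  qed
  ultimately show "\<exists>s. is_lub (SymDist Q) A B S s \<and> (\<forall>C. \<forall>g\<in>hom (SymDist Q) B C. \<forall>t\<in>hom (SymDist Q) A C.
      g \<odot>\<^bsub>SymDist Q\<^esub> s \<sqsubseteq>\<^bsub>SymDist Q\<^esub> t \<longleftrightarrow> (\<forall>f\<in>S. g \<odot>\<^bsub>SymDist Q\<^esub> f \<sqsubseteq>\<^bsub>SymDist Q\<^esub> t))" by blast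
qed

end

section \<open>Change of base\<close>

locale base_change = K: iqloid K + L: iqloid L
  for K :: "('o1, 'm1, 'z1) inv_quantaloid_scheme" and L :: "('o2, 'm2, 'z2) inv_quantaloid_scheme" (structure) +
  fixes Fo Fm
  assumes F: "dagger_embedding K L Fo Fm"
begin

lemmas Fe = dagger_embeddingD(1)[OF F]
lemmas Fin = embedding_in[OF Fe]
lemmas Fobj = cat_embeddingD(5)[OF Fe]
lemmas Fide = cat_embeddingD(7)[OF Fe]
lemmas Fcomp = cat_embeddingD(8)[OF Fe]
lemmas Fle = dagger_embeddingD(2)[OF F]
lemmas Finv = dagger_embeddingD(4)[OF F]

lemma Fjoin:
  assumes "X \<in> Obj K" "Y \<in> Obj K" "S \<subseteq> hom K X Y"
  shows "Fm (join K X Y S) = join L (Fo X) (Fo Y) (Fm ` S)"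
  using L.join_eq dagger_embedding_lub[OF F assms K.join_in[OF assms]] K.join_lub[OF assms] by metis

definition bcat :: "('u, 'o1, 'm1) qcat => ('u, 'o2, 'm2) qcat" where
  "bcat A = \<lparr>qobj = qobj A, qty = (\<lambda>x\<in>qobj A. Fo (qty A x)),
     qhom = (\<lambda>y\<in>qobj A. \<lambda>x\<in>qobj A. Fm (qhom A y x))\<rparr>"

definition bdist :: "('u, 'o1, 'm1) qcat => ('u, 'o1, 'm1) qcat => ('u => 'u => 'm1) => 'u => 'u => 'm2" where
  "bdist A B M = (\<lambda>y\<in>qobj B. \<lambda>x\<in>qobj A. Fm (M y x))"

lemma qobj_bcat [simp]: "qobj (bcat A) = qobj A"
  by (simp add: bcat_def)

lemma qty_bcat [simp]: "x \<in> qobj A ==> qty (bcat A) x = Fo (qty A x)"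
  by (simp add: bcat_def)

lemma qhom_bcat [simp]: "x \<in> qobj A ==> y \<in> qobj A ==> qhom (bcat A) y x = Fm (qhom A y x)"
  by (simp add: bcat_def)

lemma bdist_simp [simp]: "x \<in> qobj A ==> y \<in> qobj B ==> bdist A B M y x = Fm (M y x)"
  by (simp add: bdist_def)

lemma bcat_qcat:
  assumes A: "is_qcat K A"
  shows "is_qcat L (bcat A)"
  unfolding is_qcat_def
proof (intro conjI ballI)
  note a = K.qcatD[OF A]
  show "small TYPE('a) (qobj (bcat A))" using A unfolding is_qcat_def by simp
  show "qty (bcat A) \<in> qobj (bcat A) \<rightarrow>\<^sub>E Obj L" using a(1) Fobj by (auto simp: bcat_def)
  show "qhom (bcat A) \<in> (\<Pi>\<^sub>E y\<in>qobj (bcat A). \<Pi>\<^sub>E x\<in>qobj (bcat A). hom L (qty (bcat A) x) (qty (bcat A) y))"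
    using Fin[OF a(2)] by (auto simp: bcat_def)
  show "qhom (bcat A) z y \<odot> qhom (bcat A) y x \<sqsubseteq> qhom (bcat A) z x"
    if "x \<in> qobj (bcat A)" "y \<in> qobj (bcat A)" "z \<in> qobj (bcat A)" for x y z
  proof -
    have o: "x \<in> qobj A" "y \<in> qobj A" "z \<in> qobj A" using that by simp_all
    show ?thesis
      using Fle[OF K.comp_in[OF a(2)[OF o(2,3)] a(2)[OF o(1,2)]] a(2)[OF o(1,3)]] Fcomp[OF a(2)[OF o(2,3)] a(2)[OF o(1,2)]]
        a(3)[OF o] o by simp
  qed
  show "Ide L (qty (bcat A) x) \<sqsubseteq> qhom (bcat A) x x" if "x \<in> qobj (bcat A)" for x
  proof -
    have o: "x \<in> qobj A" using that by simp
    show ?thesis using Fle[OF K.ide_in[OF a(1)[OF o]] a(2)[OF o o]] Fide[OF a(1)[OF o]] a(4)[OF o] o by simp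
  qed
qed

lemma bcat_symm:
  assumes A: "is_qcat K A" and s: "K.symm A"
  shows "L.symm (bcat A)"
proof -
  have "Inv L (Fm (qhom A y x)) = Fm (qhom A x y)" if "x \<in> qobj A" "y \<in> qobj A" for x y
    using Finv[OF K.qcatD(2)[OF A that]] K.symD[OF s that] by simp
  then show ?thesis unfolding symmetric_qcat_def by simp
qed

lemma bdist_dst:
  assumes M: "K.dst A B M"
  shows "L.dst (bcat A) (bcat B) (bdist A B M)"
proof -
  note p = K.dstD(3)[OF M] note a = K.qcatD[OF K.dstD(1)[OF M]] and b = K.qcatD[OF K.dstD(2)[OF M]]
  have "L.dst (bcat A) (bcat B) (\<lambda>y\<in>qobj (bcat B). \<lambda>x\<in>qobj (bcat A). Fm (M y x))"
  proof (rule L.dst_restrictI)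
    show "is_qcat L (bcat A)" "is_qcat L (bcat B)" using bcat_qcat K.dstD(1,2)[OF M] by blast+
    show "Fm (M y x) \<in> hom L (qty (bcat A) x) (qty (bcat B) y)"
      if "x \<in> qobj (bcat A)" "y \<in> qobj (bcat B)" for x y
      using Fin[OF p] that by simp
    show "qhom (bcat B) y' y \<odot> Fm (M y x) \<sqsubseteq> Fm (M y' x)"
      if "x \<in> qobj (bcat A)" "y \<in> qobj (bcat B)" "y' \<in> qobj (bcat B)" for x y y'
    proof -
      have o: "x \<in> qobj A" "y \<in> qobj B" "y' \<in> qobj B" using that by simp_all
      show ?thesis using Fle[OF K.comp_in[OF b(2)[OF o(2,3)] p[OF o(1,2)]] p[OF o(1,3)]]
        Fcomp[OF b(2)[OF o(2,3)] p[OF o(1,2)]] K.dstD(4)[OF M o] o by simp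
    qed
    show "Fm (M y x) \<odot> qhom (bcat A) x x' \<sqsubseteq> Fm (M y x')"
      if "x \<in> qobj (bcat A)" "x' \<in> qobj (bcat A)" "y \<in> qobj (bcat B)" for x x' y
    proof -
      have o: "x \<in> qobj A" "x' \<in> qobj A" "y \<in> qobj B" using that by simp_all
      show ?thesis using Fle[OF K.comp_in[OF p[OF o(1,3)] a(2)[OF o(2,1)]] p[OF o(2,3)]]
        Fcomp[OF p[OF o(1,3)] a(2)[OF o(2,1)]] K.dstD(5)[OF M o] o by simp
    qed
  qed
  then show ?thesis by (simp add: bdist_def)
qed

text \<open>Fullness provides a preimage of each entry separately. The distributor laws for the
  family of preimages hold because the order is reflected.\<close>

lemma bdist_surj:
  assumes A: "is_qcat K A" and B: "is_qcat K B" and T: "L.dst (bcat A) (bcat B) \<Theta>"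
  obtains M where "K.dst A B M" "bdist A B M = \<Theta>"
proof -
  note a = K.qcatD[OF A] and b = K.qcatD[OF B]
  have ex: "\<exists>f. f \<in> hom K (qty A x) (qty B y) \<and> Fm f = \<Theta> y x" if o: "x \<in> qobj A" "y \<in> qobj B" for x y
    using embedding_surj[OF Fe a(1)[OF o(1)] b(1)[OF o(2)]] L.dstD(3)[OF T, of x y] o by auto
  define M where "M y x = (SOME f. f \<in> hom K (qty A x) (qty B y) \<and> Fm f = \<Theta> y x)" for y x
  have p: "M y x \<in> hom K (qty A x) (qty B y)" and e: "Fm (M y x) = \<Theta> y x"
    if "x \<in> qobj A" "y \<in> qobj B" for x y
    using someI_ex[OF ex[OF that]] unfolding M_def by blast+
  have d: "K.dst A B (\<lambda>y\<in>qobj B. \<lambda>x\<in>qobj A. M y x)"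
  proof (rule K.dst_restrictI[OF A B p])
    show "qhom B y' y \<odot>\<^bsub>K\<^esub> M y x \<sqsubseteq>\<^bsub>K\<^esub> M y' x" if o: "x \<in> qobj A" "y \<in> qobj B" "y' \<in> qobj B" for x y y'
      using Fle[OF K.comp_in[OF b(2)[OF o(2,3)] p[OF o(1,2)]] p[OF o(1,3)]]
        Fcomp[OF b(2)[OF o(2,3)] p[OF o(1,2)]] L.dstD(4)[OF T, of x y y'] e o by simp
    show "M y x \<odot>\<^bsub>K\<^esub> qhom A x x' \<sqsubseteq>\<^bsub>K\<^esub> M y x'" if o: "x \<in> qobj A" "x' \<in> qobj A" "y \<in> qobj B" for x x' y
      using Fle[OF K.comp_in[OF p[OF o(1,3)] a(2)[OF o(2,1)]] p[OF o(2,3)]]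
        Fcomp[OF p[OF o(1,3)] a(2)[OF o(2,1)]] L.dstD(5)[OF T, of x x' y] e o by simp
  qed
  moreover have "bdist A B (\<lambda>y\<in>qobj B. \<lambda>x\<in>qobj A. M y x) = \<Theta>"
    by (rule L.dst_eqI[OF bdist_dst[OF d] T]) (simp add: e)
  ultimately show thesis by (rule that)
qed

lemma bdist_comp:
  assumes M: "K.dst A B M" and N: "K.dst B C N"
  shows "bdist A C (K.dcomp A B C N M) = L.dcomp (bcat A) (bcat B) (bcat C) (bdist B C N) (bdist A B M)"
proof (rule L.dst_eqI[OF bdist_dst[OF K.dcomp_dst[OF M N]] L.dcomp_dst[OF bdist_dst[OF M] bdist_dst[OF N]]])
  fix x z assume "x \<in> qobj (bcat A)" "z \<in> qobj (bcat C)"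
  then have o: "x \<in> qobj A" "z \<in> qobj C" by simp_all
  have "Fm ` {N z y \<odot>\<^bsub>K\<^esub> M y x | y. y \<in> qobj B} = {bdist B C N z y \<odot> bdist A B M y x | y. y \<in> qobj B}"
    unfolding Setcompr_eq_image image_image
    by (rule image_cong) (use Fcomp[OF K.dstD(3)[OF N _ o(2)] K.dstD(3)[OF M o(1)]] o in simp_all)
  then show "bdist A C (K.dcomp A B C N M) z x = L.dcomp (bcat A) (bcat B) (bcat C) (bdist B C N) (bdist A B M) z x"
    using Fjoin[OF _ _ K.dcomp_sub[OF M N o]] K.dst_ty[OF M] K.dst_ty[OF N] o
    by (simp add: K.dcomp_def L.dcomp_def)
qed

lemma bdist_inv:
  assumes M: "K.dst A B M" and s: "K.symm A" "K.symm B"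
  shows "bdist B A (K.dinv A B M) = L.dinv (bcat A) (bcat B) (bdist A B M)"
proof (rule L.dst_eqI[OF bdist_dst[OF K.dinv_dst[OF M s]] L.dinv_dst[OF bdist_dst[OF M]]])
  show "L.symm (bcat A)" "L.symm (bcat B)" using bcat_symm s K.dstD(1,2)[OF M] by blast+
qed (use Finv[OF K.dstD(3)[OF M]] in \<open>simp add: K.dinv_def L.dinv_def\<close>)

lemma bdist_id:
  assumes A: "is_qcat K A"
  shows "bdist A A (qhom A) = qhom (bcat A)"
  by (rule L.dst_eqI[OF bdist_dst[OF K.dst_id[OF A]] L.dst_id[OF bcat_qcat[OF A]]]) simp

lemma bdist_le_iff:
  assumes "K.dst A B M" "K.dst A B N" "x \<in> qobj A" "y \<in> qobj B"
  shows "Fm (M y x) \<sqsubseteq> Fm (N y x) \<longleftrightarrow> M y x \<sqsubseteq>\<^bsub>K\<^esub> N y x"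
  using Fle[OF K.dstD(3)[OF assms(1,3,4)] K.dstD(3)[OF assms(2,3,4)]] by blast

lemma bdist_inj:
  assumes "K.dst A B M" "K.dst A B N" "bdist A B M = bdist A B N"
  shows "M = N"
proof (rule K.dst_eqI[OF assms(1,2)])
  fix x y assume o: "x \<in> qobj A" "y \<in> qobj B"
  have "bdist A B M y x = bdist A B N y x" using assms(3) by simp
  then show "M y x = N y x"
    using embedding_inj[OF Fe K.dstD(3)[OF assms(1) o] K.dstD(3)[OF assms(2) o]] o by simp
qed

lemma base_change_embedding:
  "dagger_embedding (SymDist K) (SymDist L) (bcat :: ('u, _, _) qcat => _) (\<lambda>(A, M, B). (bcat A, bdist A B M, bcat B))"
proof -
  interpret SK: iqloid "SymDist K :: (('u, _, _) qcat, _) inv_quantaloid" using K.SymDist_inv_quantaloid by unfold_locales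
  have b: "bij_betw (\<lambda>(A, M, B). (bcat A, bdist A B M, bcat B)) (hom (SymDist K) A B) (hom (SymDist L) (bcat A) (bcat B))"
    if o: "is_qcat K A" "K.symm A" "is_qcat K B" "K.symm B" for A B :: "('u, 'o1, 'm1) qcat"
    unfolding bij_betw_def K.hom_SymDist L.hom_SymDist
  proof (intro conjI equalityI subsetI)
    show "inj_on (\<lambda>(A, M, B). (bcat A, bdist A B M, bcat B)) {(A, M, B) |M. K.dst A B M \<and> K.symm A \<and> K.symm B}"
      by (rule inj_onI) (auto dest: bdist_inj)
    fix g assume "g \<in> {(bcat A, M, bcat B) |M. L.dst (bcat A) (bcat B) M \<and> L.symm (bcat A) \<and> L.symm (bcat B)}"
    then obtain \<Theta> where g: "g = (bcat A, \<Theta>, bcat B)" "L.dst (bcat A) (bcat B) \<Theta>" by blast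
    obtain M where "K.dst A B M" "bdist A B M = \<Theta>" using bdist_surj[OF o(1,3) g(2)] .
    then show "g \<in> (\<lambda>(A, M, B). (bcat A, bdist A B M, bcat B)) ` {(A, M, B) |M. K.dst A B M \<and> K.symm A \<and> K.symm B}"
      using o g(1) by force
  qed (use bdist_dst bcat_symm o in auto)
  show ?thesis unfolding dagger_embedding_def cat_embedding_def
  proof (intro conjI allI ballI)
    fix f :: "('u, 'o1, 'm1) distributor" assume "f \<in> Arr (SymDist K)"
    then show "Dom (SymDist K) f \<in> Obj (SymDist K)" "Cod (SymDist K) f \<in> Obj (SymDist K)"
      using SK.hom_obj[OF Arr_hom] by blast+
  next
    fix A B C :: "('u, 'o1, 'm1) qcat" and f g assume "f \<in> hom (SymDist K) A B" "g \<in> hom (SymDist K) B C"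
    then show "g \<odot>\<^bsub>SymDist K\<^esub> f \<in> hom (SymDist K) A C" using SK.comp_in by blast
  next
    fix A B :: "('u, 'o1, 'm1) qcat" and f assume "f \<in> hom (SymDist K) A B"
    then show "Inv (SymDist K) f \<in> hom (SymDist K) B A" using SK.inv_in by blast
  next
    fix A B :: "('u, 'o1, 'm1) qcat" assume "A \<in> Obj (SymDist K)" "B \<in> Obj (SymDist K)"
    then show "bij_betw (\<lambda>(A, M, B). (bcat A, bdist A B M, bcat B)) (hom (SymDist K) A B) (hom (SymDist L) (bcat A) (bcat B))"
      using b by simp
  qed (auto simp: K.hom_SymDist K.dst_id bcat_qcat bcat_symm bdist_id bdist_comp bdist_inv bdist_le_iff)
qed

text \<open>The hypothesis \<open>dense\<close> says that each identity of L is the join of the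
  arrows u u\<degree>. The category A has as objects the restrictions of objects x of B along
  symmetric left adjoints u from the image of K, with hom-arrows v\<degree> B(y,x) u; these lie
  between images of objects of K and so come from K. The unitary T has entries B(y,x) u: its
  composite T\<degree> T gives back these homs, and T T\<degree> exhausts B by density.\<close>

lemma base_change_dense:
  assumes U: "universe TYPE('u)" and sK: "small TYPE('u) (Obj K)" and sL: "small TYPE('u) (Arr L)"
    and dense: "\<And>l t. l \<in> Obj L ==> t \<in> hom L l l ==>
      (\<And>k u. k \<in> Obj K ==> u \<in> hom L (Fo k) l ==> sym_left_adjoint L u ==> u \<odot> Inv L u \<sqsubseteq> t) ==>
      Ide L l \<sqsubseteq> t"
    and B: "is_qcat L B" "L.symm B"
  shows "\<exists>A :: ('u, 'o1, 'm1) qcat. is_qcat K A \<and> K.symm A \<and> (\<exists>u. unitary (SymDist L) (bcat A) B u)"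
proof -
  note b = L.qcatD[OF B(1)]
  \<comment> \<open>The object k is recorded along with u because it is the type of the new object
    in K, which u reveals only up to \<open>Fo\<close>.\<close>
  define I where "I = {(x, k, u). x \<in> qobj B \<and> k \<in> Obj K \<and> u \<in> hom L (Fo k) (qty B x) \<and> sym_left_adjoint L u}"
  have "I \<subseteq> qobj B \<times> (Obj K \<times> Arr L)" by (auto simp: I_def hom_def)
  moreover have "small TYPE('u) (qobj B)" using B(1) unfolding is_qcat_def by blast
  ultimately have sI: "small TYPE('u) I" using small_Times[OF U _ small_Times[OF U sK sL]] small_subset by blast
  then obtain c :: "'u \<times> 'o1 \<times> 'm2 => 'u" where c: "inj_on c I" using small_inj by blast
  define d where "d = inv_into I c"
  have d: "d (c p) = p" if "p \<in> I" for p using that c by (simp add: d_def)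
  define ob where "ob p = fst p" for p :: "'u \<times> 'o1 \<times> 'm2"
  define ke where "ke p = fst (snd p)" for p :: "'u \<times> 'o1 \<times> 'm2"
  define mo where "mo p = snd (snd p)" for p :: "'u \<times> 'o1 \<times> 'm2"
  have i: "ob p \<in> qobj B" "ke p \<in> Obj K" "mo p \<in> hom L (Fo (ke p)) (qty B (ob p))"
    "Inv L (mo p) \<in> hom L (qty B (ob p)) (Fo (ke p))"
    "Ide L (Fo (ke p)) \<sqsubseteq> Inv L (mo p) \<odot> mo p" "mo p \<odot> Inv L (mo p) \<sqsubseteq> Ide L (qty B (ob p))"
    if "p \<in> I" for p
    using that L.sym_left_adjoint_iff[of "mo p" "Fo (ke p)" "qty B (ob p)"] L.inv_in
    by (auto simp: I_def ob_def ke_def mo_def)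
  define H where "H q p = Inv L (mo q) \<odot> (qhom B (ob q) (ob p) \<odot> mo p)" for q p
  have bh: "qhom B (ob q) (ob p) \<in> hom L (qty B (ob p)) (qty B (ob q))" if "p \<in> I" "q \<in> I" for p q
    using b(2) i(1) that by blast
  have H: "H q p \<in> hom L (Fo (ke p)) (Fo (ke q))" if "p \<in> I" "q \<in> I" for p q
    unfolding H_def by (rule L.comp_in i(3,4) bh that)+
  have ex: "\<exists>f. f \<in> hom K (ke p) (ke q) \<and> Fm f = H q p" if "p \<in> I" "q \<in> I" for p q
    using embedding_surj[OF Fe i(2)[OF that(1)] i(2)[OF that(2)] H[OF that]] by blast
  define g where "g q p = (SOME f. f \<in> hom K (ke p) (ke q) \<and> Fm f = H q p)" for q p
  have g: "g q p \<in> hom K (ke p) (ke q)" and gH: "Fm (g q p) = H q p" if "p \<in> I" "q \<in> I" for p q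
    using someI_ex[OF ex[OF that]] unfolding g_def by blast+
  \<comment> \<open>Between the two hom-arrows of B stands \<open>mo q\<close> after its involute,
    which lies below the identity by the counit. Dually, \<open>HI\<close> rests on the unit of
    \<open>mo p\<close>.\<close>
  have Hcomp: "H r q \<odot> H q p \<sqsubseteq> H r p" if o: "p \<in> I" "q \<in> I" "r \<in> I" for p q r
  proof -
    note t = i(3,4)[OF o(1)] i(3,4)[OF o(2)] i(3,4)[OF o(3)] bh[OF o(1,2)] bh[OF o(2,3)] bh[OF o(1,3)]
      L.ide_in[OF b(1)[OF i(1)[OF o(2)]]]
    let ?X = "qhom B (ob q) (ob p) \<odot> mo p"
    have X: "?X \<in> hom L (Fo (ke p)) (qty B (ob q))" by (rule L.comp_in t)+
    have Y: "(mo q \<odot> Inv L (mo q)) \<odot> ?X \<sqsubseteq> ?X"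
      using L.comp_mono_left[OF i(6)[OF o(2)] _ t(10) X] L.comp_in[OF t(3,4)] L.idl[OF X] by simp
    have "H r q \<odot> H q p = Inv L (mo r) \<odot> (qhom B (ob r) (ob q) \<odot> ((mo q \<odot> Inv L (mo q)) \<odot> ?X))"
      unfolding H_def
      using L.assoc[OF t(6) L.comp_in[OF t(8) t(3)] L.comp_in[OF t(4) X]] L.assoc[OF t(8) t(3) L.comp_in[OF t(4) X]]
        L.assoc[OF t(3) t(4) X] by simp
    also have "\<dots> \<sqsubseteq> Inv L (mo r) \<odot> (qhom B (ob r) (ob q) \<odot> ?X)"
      by (rule L.comp_mono_right[OF L.comp_mono_right[OF Y]] L.comp_in t)+
    finally have 1: "H r q \<odot> H q p \<sqsubseteq> Inv L (mo r) \<odot> ((qhom B (ob r) (ob q) \<odot> qhom B (ob q) (ob p)) \<odot> mo p)"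
      using L.assoc[OF t(8) t(7) t(1)] by simp
    have "\<dots> \<sqsubseteq> H r p" unfolding H_def
      by (rule L.comp_mono_right[OF L.comp_mono_left[OF b(3)]] L.comp_in t i(1) o)+
    then show ?thesis by (rule L.le_trans[OF 1]) (rule L.comp_in t H o)+
  qed
  have HI: "Ide L (Fo (ke p)) \<sqsubseteq> H p p" if o: "p \<in> I" for p
  proof -
    note t = i(3,4)[OF o] bh[OF o o] L.ide_in[OF b(1)[OF i(1)[OF o]]] L.ide_in[OF Fobj[OF i(2)[OF o]]]
    have "Inv L (mo p) \<odot> (Ide L (qty B (ob p)) \<odot> mo p) \<sqsubseteq> H p p" unfolding H_def
      by (rule L.comp_mono_right[OF L.comp_mono_left[OF b(4)]] L.comp_in t i(1) o)+
    then have "Inv L (mo p) \<odot> mo p \<sqsubseteq> H p p" using L.idl[OF t(1)] by simp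
    then show ?thesis by (rule L.le_trans[OF i(5)[OF o]]) (rule L.comp_in t H o)+
  qed
  have HS: "Inv L (H q p) = H p q" if o: "p \<in> I" "q \<in> I" for p q
  proof -
    note t = i(3,4)[OF o(1)] i(3,4)[OF o(2)] bh[OF o] bh[OF o(2,1)]
    show ?thesis unfolding H_def
      using L.inv_comp[OF t(4) L.comp_in[OF t(5) t(1)]] L.inv_comp[OF t(5) t(1)] L.inv_inv[OF t(3)]
        L.symD[OF B(2) i(1)[OF o(1)] i(1)[OF o(2)]] L.assoc[OF t(2,6,3)] by simp
  qed
  define A :: "('u, 'o1, 'm1) qcat" where
    "A = \<lparr>qobj = c ` I, qty = (\<lambda>x\<in>c ` I. ke (d x)), qhom = (\<lambda>y\<in>c ` I. \<lambda>x\<in>c ` I. g (d y) (d x))\<rparr>"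
  have A1: "qobj A = c ` I" "\<And>p. p \<in> I ==> qty A (c p) = ke p"
    "\<And>p q. p \<in> I ==> q \<in> I ==> qhom A (c q) (c p) = g q p"
    by (simp_all add: A_def d)
  have A: "is_qcat K A"
    unfolding is_qcat_def
  proof (intro conjI)
    show "small TYPE('u) (qobj A)" using small_image[OF sI] by (simp add: A_def)
    show "qty A \<in> qobj A \<rightarrow>\<^sub>E Obj K" using i(2) by (auto simp: A_def d)
    show "qhom A \<in> (\<Pi>\<^sub>E y\<in>qobj A. \<Pi>\<^sub>E x\<in>qobj A. hom K (qty A x) (qty A y))"
      using g by (auto simp: A_def d)
    show "\<forall>x\<in>qobj A. \<forall>y\<in>qobj A. \<forall>z\<in>qobj A. qhom A z y \<odot>\<^bsub>K\<^esub> qhom A y x \<sqsubseteq>\<^bsub>K\<^esub> qhom A z x"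
      using Fle[OF K.comp_in[OF g g] g] Fcomp[OF g g] gH Hcomp by (auto simp: A1)
    show "\<forall>x\<in>qobj A. Ide K (qty A x) \<sqsubseteq>\<^bsub>K\<^esub> qhom A x x"
      using Fle[OF K.ide_in g] Fide gH HI i(2) by (auto simp: A1)
  qed
  have As: "K.symm A" unfolding symmetric_qcat_def
  proof (intro ballI)
    fix x y assume "x \<in> qobj A" "y \<in> qobj A"
    then obtain p q where x: "x = c p" "y = c q" and o: "p \<in> I" "q \<in> I" by (auto simp: A1)
    have "Fm (Inv K (g q p)) = Fm (g p q)" using Finv[OF g[OF o]] gH[OF o] gH[OF o(2,1)] HS[OF o] by simp
    then show "qhom A x y = Inv K (qhom A y x)"
      using embedding_inj[OF Fe K.inv_in[OF g[OF o]] g[OF o(2,1)]] by (simp add: x A1 o)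
  qed
  define T where "T = (\<lambda>y\<in>qobj B. \<lambda>x\<in>qobj (bcat A). qhom B y (ob (d x)) \<odot> mo (d x))"
  have T1: "T y (c p) = qhom B y (ob p) \<odot> mo p" if "p \<in> I" "y \<in> qobj B" for p y
    using that by (simp add: T_def A1 d)
  have bA: "qty (bcat A) (c p) = Fo (ke p)" if "p \<in> I" for p using that by (simp add: A1)
  have hA: "qhom (bcat A) (c q) (c p) = H q p" if "p \<in> I" "q \<in> I" for p q using that by (simp add: A1 gH)
  have Td: "L.dst (bcat A) B T" unfolding T_def
  proof (rule L.dst_restrictI[OF bcat_qcat[OF A] B(1)])
    fix x y assume "x \<in> qobj (bcat A)" and y: "y \<in> qobj B"
    then obtain p where x: "x = c p" and p: "p \<in> I" by (auto simp: A1)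
    show "qhom B y (ob (d x)) \<odot> mo (d x) \<in> hom L (qty (bcat A) x) (qty B y)"
      unfolding x d[OF p] bA[OF p] by (rule L.comp_in i(3) b(2) i(1) p y)+
  next
    fix x y y' assume "x \<in> qobj (bcat A)" and y: "y \<in> qobj B" "y' \<in> qobj B"
    then obtain p where x: "x = c p" and p: "p \<in> I" by (auto simp: A1)
    have "(qhom B y' y \<odot> qhom B y (ob p)) \<odot> mo p \<sqsubseteq> qhom B y' (ob p) \<odot> mo p"
      by (rule L.comp_mono_left[OF b(3)] L.comp_in i(3) b(2) i(1) p y)+
    then show "qhom B y' y \<odot> (qhom B y (ob (d x)) \<odot> mo (d x)) \<sqsubseteq> qhom B y' (ob (d x)) \<odot> mo (d x)"
      unfolding x d[OF p] using L.assoc[OF b(2)[OF y] b(2)[OF i(1)[OF p] y(1)] i(3)[OF p]] by simp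
  next
    fix x x' y assume "x \<in> qobj (bcat A)" "x' \<in> qobj (bcat A)" and y: "y \<in> qobj B"
    then obtain p q where x: "x = c p" "x' = c q" and o: "p \<in> I" "q \<in> I" by (auto simp: A1)
    note t = i(3,4)[OF o(1)] i(3,4)[OF o(2)] bh[OF o] bh[OF o(2,1)] b(2)[OF i(1)[OF o(1)] y] b(2)[OF i(1)[OF o(2)] y]
      L.ide_in[OF b(1)[OF i(1)[OF o(1)]]]
    let ?X = "qhom B (ob p) (ob q) \<odot> mo q"
    have X: "?X \<in> hom L (Fo (ke q)) (qty B (ob p))" by (rule L.comp_in t)+
    have Y: "(mo p \<odot> Inv L (mo p)) \<odot> ?X \<sqsubseteq> ?X"
      using L.comp_mono_left[OF i(6)[OF o(1)] L.comp_in[OF t(1,2)] t(9) X] L.idl[OF X] by simp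
    have "(qhom B y (ob p) \<odot> mo p) \<odot> H p q = qhom B y (ob p) \<odot> ((mo p \<odot> Inv L (mo p)) \<odot> ?X)"
      unfolding H_def using L.assoc[OF t(7) t(1) L.comp_in[OF t(2) X]] L.assoc[OF t(1,2) X] by simp
    also have "\<dots> \<sqsubseteq> qhom B y (ob p) \<odot> ?X" by (rule L.comp_mono_right[OF Y] L.comp_in t)+
    finally have 1: "(qhom B y (ob p) \<odot> mo p) \<odot> H p q \<sqsubseteq> (qhom B y (ob p) \<odot> qhom B (ob p) (ob q)) \<odot> mo q"
      using L.assoc[OF t(7) t(6) t(3)] by simp
    have "\<dots> \<sqsubseteq> qhom B y (ob q) \<odot> mo q"
      by (rule L.comp_mono_left[OF b(3)] L.comp_in t i(1) o y)+
    then have "(qhom B y (ob p) \<odot> mo p) \<odot> H p q \<sqsubseteq> qhom B y (ob q) \<odot> mo q"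
      by (rule L.le_trans[OF 1]) (rule L.comp_in t H o)+
    then show "qhom B y (ob (d x)) \<odot> mo (d x) \<odot> qhom (bcat A) x x' \<sqsubseteq> qhom B y (ob (d x')) \<odot> mo (d x')"
      by (simp only: x d[OF o(1)] d[OF o(2)] hA[OF o(2,1)])
  qed
  have bs: "L.symm (bcat A)" using bcat_symm[OF A As] .
  note Ti = L.dinv_dst[OF Td bs B(2)]
  have T2: "L.dinv (bcat A) B T (c p) y = Inv L (mo p) \<odot> qhom B (ob p) y" if o: "p \<in> I" "y \<in> qobj B" for p y
    using L.inv_comp[OF b(2)[OF i(1)[OF o(1)] o(2)] i(3)[OF o(1)]] L.symD[OF B(2) i(1)[OF o(1)] o(2)] o
    by (simp add: L.dinv_def T1 A1)
  have "L.dcomp (bcat A) B (bcat A) (L.dinv (bcat A) B T) T = qhom (bcat A)"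
  proof (rule L.dst_le_antisym[OF L.dcomp_dst[OF Td Ti] L.dst_id[OF bcat_qcat[OF A]]])
    fix x x' assume x0: "x \<in> qobj (bcat A)" "x' \<in> qobj (bcat A)"
    then obtain p q where x: "x = c p" "x' = c q" and o: "p \<in> I" "q \<in> I" by (auto simp: A1)
    note t = i(3,4)[OF o(1)] i(3,4)[OF o(2)] bh[OF o] bh[OF o(2,1)]
    have Hh: "qhom (bcat A) x' x = H q p" using hA[OF o] x by simp
    have HH: "H q p \<in> hom L (qty (bcat A) x) (qty (bcat A) x')" using H[OF o] x bA o by simp
    have e: "L.dinv (bcat A) B T x' y \<odot> T y x = Inv L (mo q) \<odot> ((qhom B (ob q) y \<odot> qhom B y (ob p)) \<odot> mo p)"
      if y: "y \<in> qobj B" for y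
    proof -
      note s = b(2)[OF i(1)[OF o(1)] y] b(2)[OF y i(1)[OF o(2)]]
      show ?thesis using T2[OF o(2) y] T1[OF o(1) y] L.assoc[OF t(4) s(2) L.comp_in[OF s(1) t(1)]] L.assoc[OF s(2,1) t(1)] x by simp
    qed
    have "L.dinv (bcat A) B T x' y \<odot> T y x \<sqsubseteq> H q p" if y: "y \<in> qobj B" for y
      unfolding e[OF y] H_def
      by (rule L.comp_mono_right[OF L.comp_mono_left[OF b(3)]] L.comp_in t i(1) o b(2) y)+
    then show "L.dcomp (bcat A) B (bcat A) (L.dinv (bcat A) B T) T x' x \<sqsubseteq> qhom (bcat A) x' x"
      using L.dcomp_le_iff[OF Td Ti x0 HH] Hh by simp
    have s: "qhom B (ob p) (ob p) \<in> hom L (qty B (ob p)) (qty B (ob p))" "Ide L (qty B (ob p)) \<in> hom L (qty B (ob p)) (qty B (ob p))"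
      using b(2) L.ide_in[OF b(1)] i(1) o by blast+
    have 1: "qhom B (ob q) (ob p) \<odot> Ide L (qty B (ob p)) \<sqsubseteq> qhom B (ob q) (ob p) \<odot> qhom B (ob p) (ob p)"
      by (rule L.comp_mono_right[OF b(4)] t s i(1) o)+
    \<comment> \<open>The term of the join at the object \<open>ob p\<close> of B already suffices,
      because the hom-arrow of B at \<open>ob p\<close> is above the identity.\<close>
    have "H q p \<sqsubseteq> L.dinv (bcat A) B T x' (ob p) \<odot> T (ob p) x"
      unfolding e[OF i(1)[OF o(1)]] H_def
      by (rule L.comp_mono_right[OF L.comp_mono_left[OF 1[unfolded L.idr[OF t(5)]]]] L.comp_in t s)+
    then show "qhom (bcat A) x' x \<sqsubseteq> L.dcomp (bcat A) B (bcat A) (L.dinv (bcat A) B T) T x' x"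
      unfolding Hh
      by (rule L.le_trans[OF _ L.dcomp_upper[OF Td Ti x0 i(1)[OF o(1)]] HH
        L.comp_in[OF L.dstD(3)[OF Ti i(1)[OF o(1)] x0(2)] L.dstD(3)[OF Td x0(1) i(1)[OF o(1)]]] L.dcomp_in[OF Td Ti x0]])
  qed
  moreover have "L.dcomp B (bcat A) B T (L.dinv (bcat A) B T) = qhom B"
  proof (rule L.dst_le_antisym[OF L.dcomp_dst[OF Ti Td] L.dst_id[OF B(1)]])
    fix y y' assume y: "y \<in> qobj B" "y' \<in> qobj B"
    let ?D = "L.dcomp B (bcat A) B T (L.dinv (bcat A) B T) y' y"
    have D: "?D \<in> hom L (qty B y) (qty B y')" using L.dcomp_in[OF Ti Td y] .
    have e: "T y' (c p) \<odot> L.dinv (bcat A) B T (c p) y = qhom B y' (ob p) \<odot> ((mo p \<odot> Inv L (mo p)) \<odot> qhom B (ob p) y)"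
      if p: "p \<in> I" for p
    proof -
      note s = b(2)[OF i(1)[OF p] y(2)] b(2)[OF y(1) i(1)[OF p]] i(3,4)[OF p]
      show ?thesis using T2[OF p y(1)] T1[OF p y(2)] L.assoc[OF s(1,3) L.comp_in[OF s(4,2)]] L.assoc[OF s(3,4,2)] by simp
    qed
    have "T y' x \<odot> L.dinv (bcat A) B T x y \<sqsubseteq> qhom B y' y" if "x \<in> qobj (bcat A)" for x
    proof -
      obtain p where x: "x = c p" and p: "p \<in> I" using \<open>x \<in> qobj (bcat A)\<close> by (auto simp: A1)
      note s = b(2)[OF i(1)[OF p] y(2)] b(2)[OF y(1) i(1)[OF p]] i(3,4)[OF p] L.ide_in[OF b(1)[OF i(1)[OF p]]] b(2)[OF y]
      have "(mo p \<odot> Inv L (mo p)) \<odot> qhom B (ob p) y \<sqsubseteq> qhom B (ob p) y"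
        using L.comp_mono_left[OF i(6)[OF p] L.comp_in[OF s(3,4)] s(5,2)] L.idl[OF s(2)] by simp
      note mono1 = this
    have "qhom B y' (ob p) \<odot> ((mo p \<odot> Inv L (mo p)) \<odot> qhom B (ob p) y) \<sqsubseteq> qhom B y' (ob p) \<odot> qhom B (ob p) y"
        by (rule L.comp_mono_right[OF mono1] L.comp_in s)+
      then show ?thesis unfolding x e[OF p]
        by (rule L.le_trans[OF _ b(3)[OF y(1) i(1)[OF p] y(2)]]) (rule L.comp_in s)+
    qed
    then show "?D \<sqsubseteq> qhom B y' y" using L.dcomp_le_iff[OF Ti Td y b(2)[OF y]] by blast
    \<comment> \<open>Density is applied at the type of y. Each u u\<degree> in S comes from an
      object (y, k, u) of A, and the term of T T\<degree> at this object is B(y',y) u u\<degree>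
      B(y,y), which is above B(y',y) u u\<degree>.\<close>
    define S where "S = {u \<odot> Inv L u | k u. k \<in> Obj K \<and> u \<in> hom L (Fo k) (qty B y) \<and> sym_left_adjoint L u}"
    have S: "S \<subseteq> hom L (qty B y) (qty B y)" using L.comp_in L.inv_in by (auto simp: S_def)
    note jS = L.join_in[OF b(1)[OF y(1)] b(1)[OF y(1)] S]
    have IS: "Ide L (qty B y) \<sqsubseteq> join L (qty B y) (qty B y) S"
      by (rule dense[OF b(1)[OF y(1)] jS], rule L.join_upper[OF _ b(1)[OF y(1)] b(1)[OF y(1)] S]) (auto simp: S_def)
    have "qhom B y' y \<odot> f \<sqsubseteq> ?D" if "f \<in> S" for f
    proof -
      obtain k u where f: "f = u \<odot> Inv L u" and p: "(y, k, u) \<in> I" using \<open>f \<in> S\<close> y by (auto simp: S_def I_def)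
      let ?p = "(y, k, u)"
      have s: "qhom B y' y \<in> hom L (qty B y) (qty B y')" "qhom B y y \<in> hom L (qty B y) (qty B y)"
        "Ide L (qty B y) \<in> hom L (qty B y) (qty B y)" "f \<in> hom L (qty B y) (qty B y)"
        using b(2) L.ide_in[OF b(1)] y S \<open>f \<in> S\<close> by blast+
      have pp: "ob ?p = y" "mo ?p = u" by (simp_all add: ob_def mo_def)
      have "f \<odot> Ide L (qty B y) \<sqsubseteq> f \<odot> qhom B y y" by (rule L.comp_mono_right[OF b(4)] s y)+
      then have mono1: "f \<sqsubseteq> f \<odot> qhom B y y" using L.idr[OF s(4)] by simp
      have "qhom B y' y \<odot> f \<sqsubseteq> qhom B y' y \<odot> (f \<odot> qhom B y y)"
        by (rule L.comp_mono_right[OF mono1] L.comp_in s)+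
      moreover have "\<dots> = T y' (c ?p) \<odot> L.dinv (bcat A) B T (c ?p) y" using e[OF p] by (simp add: pp f)
      moreover have "\<dots> \<sqsubseteq> ?D" using L.dcomp_upper[OF Ti Td y, of "c ?p"] p by (simp add: A1)
      ultimately have "qhom B y' y \<odot> f \<sqsubseteq> qhom B y' y \<odot> (f \<odot> qhom B y y)"
        "qhom B y' y \<odot> (f \<odot> qhom B y y) \<sqsubseteq> ?D" by simp_all
      then show ?thesis by (rule L.le_trans) (rule L.comp_in s D)+
    qed
    then have 1: "qhom B y' y \<odot> join L (qty B y) (qty B y) S \<sqsubseteq> ?D"
      using L.comp_join_le_iff[OF S b(2)[OF y] D] by blast
    have "qhom B y' y \<odot> Ide L (qty B y) \<sqsubseteq> qhom B y' y \<odot> join L (qty B y) (qty B y) S"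
      by (rule L.comp_mono_right[OF IS] jS b(2) y L.ide_in b(1))+
    then have "qhom B y' y \<sqsubseteq> qhom B y' y \<odot> join L (qty B y) (qty B y) S" using L.idr[OF b(2)[OF y]] by simp
    then show "qhom B y' y \<sqsubseteq> ?D" by (rule L.le_trans[OF _ 1]) (rule L.comp_in jS D b(2) y)+
  qed
  ultimately have "unitary (SymDist L) (bcat A) B (bcat A, T, B)"
    unfolding unitary_def using Td B bs by (auto simp: L.hom_SymDist)
  then show ?thesis using A As by blast
qed

end

section \<open>Symmetric completion\<close>

context iqloid
begin

lemma sym_left_adjoint_SymDist_iff:
  assumes M: "dst A B M" and s: "symm A" "symm B"
  shows "sym_left_adjoint (SymDist Q) (A, M, B) \<longleftrightarrow>
    (\<forall>x\<in>qobj A. \<forall>x'\<in>qobj A. qhom A x' x \<sqsubseteq> dcomp A B A (dinv A B M) M x' x) \<and>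
    (\<forall>y\<in>qobj B. \<forall>y'\<in>qobj B. dcomp B A B M (dinv A B M) y' y \<sqsubseteq> qhom B y' y)"
proof -
  interpret S: iqloid "SymDist Q :: (('a, 'o, 'm) qcat, _) inv_quantaloid"
    using SymDist_inv_quantaloid by unfold_locales
  have "(A, M, B) \<in> hom (SymDist Q) A B" using assms by (simp add: hom_SymDist)
  then show ?thesis using S.sym_left_adjoint_iff[of "(A, M, B)" A B] by auto
qed

lemma unitary_SymDistI:
  assumes M: "dst A B M" and s: "symm A" "symm B"
    and "dcomp A B A (dinv A B M) M = qhom A" "dcomp B A B M (dinv A B M) = qhom B"
  shows "unitary (SymDist Q) A B (A, M, B)"
  using assms unfolding unitary_def by (simp add: hom_SymDist)

text \<open>Unit and counit read column by column. The unit is expressed through upper bounds t, the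
  form in which \<open>completion\<close> states it for a single column, that is for a distributor
  out of one point.\<close>

lemma sym_left_adjoint_SymDistD:
  assumes M: "dst A B M" and s: "symm A" "symm B" and a: "sym_left_adjoint (SymDist Q) (A, M, B)"
  shows "x \<in> qobj A ==> t \<in> hom Q (qty A x) (qty A x) ==>
      (\<And>y. y \<in> qobj B ==> Inv Q (M y x) \<odot> M y x \<sqsubseteq> t) ==> Ide Q (qty A x) \<sqsubseteq> t"
    and "x \<in> qobj A ==> y \<in> qobj B ==> y' \<in> qobj B ==> M y' x \<odot> Inv Q (M y x) \<sqsubseteq> qhom B y' y"
proof -
  note i = dinv_dst[OF M s] note u = a[unfolded sym_left_adjoint_SymDist_iff[OF M s]]
  note q = qcatD[OF dstD(1)[OF M]] and b = qcatD[OF dstD(2)[OF M]]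
  {
    assume x: "x \<in> qobj A" and t: "t \<in> hom Q (qty A x) (qty A x)"
      and "\<And>y. y \<in> qobj B ==> Inv Q (M y x) \<odot> M y x \<sqsubseteq> t"
    then have "dcomp A B A (dinv A B M) M x x \<sqsubseteq> t"
      using dcomp_le_iff[OF M i x x t] by (simp add: dinv_def)
    moreover have "qhom A x x \<sqsubseteq> dcomp A B A (dinv A B M) M x x" using u x by blast
    ultimately have "qhom A x x \<sqsubseteq> t" using le_trans[OF _ _ q(2)[OF x x] dcomp_in[OF M i x x] t] by blast
    then show "Ide Q (qty A x) \<sqsubseteq> t" using le_trans[OF q(4)[OF x] _ ide_in[OF q(1)[OF x]] q(2)[OF x x] t] by blast
  }
  assume x: "x \<in> qobj A" and y: "y \<in> qobj B" "y' \<in> qobj B"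
  have "M y' x \<odot> dinv A B M x y \<sqsubseteq> qhom B y' y"
    using dcomp_le_iff[OF i M y b(2)[OF y]] u x y by blast
  then show "M y' x \<odot> Inv Q (M y x) \<sqsubseteq> qhom B y' y" using x y by (simp add: dinv_def)
qed

text \<open>The action of B on the representing family makes the object map functorial: B(y,x) is
  below A(Fy,Fy) B(y,x), which is below A(Fy,Fx).\<close>

lemma represented_qfunctor:
  assumes A: "is_qcat Q A" and F: "F \<in> qobj B \<rightarrow>\<^sub>E qobj A" "\<And>b. b \<in> qobj B ==> qty A (F b) = qty B b"
    and d: "dst B A (\<lambda>a\<in>qobj A. \<lambda>b\<in>qobj B. qhom A a (F b))"
  shows "is_qfunctor Q B A F"
  unfolding is_qfunctor_def
proof (intro conjI ballI)
  fix x y assume o: "x \<in> qobj B" "y \<in> qobj B"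
  have Fo: "F x \<in> qobj A" "F y \<in> qobj A" using F(1) o by auto
  note a = qcatD[OF A] note B = qcatD(2)[OF dstD(1)[OF d]]
  have t: "qhom A (F y) (F y) \<in> hom Q (qty B y) (qty B y)" "qhom A (F y) (F x) \<in> hom Q (qty B x) (qty B y)"
    using a(2)[OF Fo(2,2)] a(2)[OF Fo] F(2) o by simp_all
  have 1: "qhom A (F y) (F y) \<odot> qhom B y x \<sqsubseteq> qhom A (F y) (F x)"
    using dstD(5)[OF d o(2,1) Fo(2)] Fo o by simp
  have "Ide Q (qty B y) \<odot> qhom B y x \<sqsubseteq> qhom A (F y) (F y) \<odot> qhom B y x"
    using comp_mono_left[OF _ _ t(1) B[OF o]] a(4)[OF Fo(2)] ide_in[OF qcatD(1)[OF dstD(1)[OF d] o(2)]] F(2) o by simp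
  then have "qhom B y x \<sqsubseteq> qhom A (F y) (F y) \<odot> qhom B y x" using idl[OF B[OF o]] by simp
  then show "qhom B y x \<sqsubseteq> qhom A (F y) (F x)"
    using le_trans[OF _ 1 B[OF o] comp_in[OF t(1) B[OF o]] t(2)] by blast
qed (use F in auto)

text \<open>
  The objects of the completion are the symmetric left adjoint distributors from one-point
  categories into \<open>A\<close>; there is a small set of them.
\<close>

lemma completion:
  fixes A :: "('u, 'o, 'm) qcat"
  assumes U: "universe TYPE('u)" and sQ: "small TYPE('u) (Obj Q)" "small TYPE('u) (Arr Q)"
    and A: "is_qcat Q A" "symm A"
  shows "\<exists>A' :: ('u, 'o, 'm) qcat. is_qcat Q A' \<and> symm A' \<and> symmetrically_complete Q A' \<and>
    (\<exists>u. unitary (SymDist Q) A' A u)"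
proof -
  note a = qcatD[OF A(1)]
  \<comment> \<open>The last three conditions on the column \<phi> are the action of A, the counit,
    and the unit expressed by upper bounds.\<close>
  define S where "S = {(X, \<phi>). X \<in> Obj Q \<and> \<phi> \<in> (\<Pi>\<^sub>E a\<in>qobj A. hom Q X (qty A a)) \<and>
    (\<forall>x\<in>qobj A. \<forall>y\<in>qobj A. qhom A x y \<odot> \<phi> y \<sqsubseteq> \<phi> x) \<and>
    (\<forall>x\<in>qobj A. \<forall>y\<in>qobj A. \<phi> x \<odot> Inv Q (\<phi> y) \<sqsubseteq> qhom A x y) \<and>
    (\<forall>t\<in>hom Q X X. (\<forall>x\<in>qobj A. Inv Q (\<phi> x) \<odot> \<phi> x \<sqsubseteq> t) --> Ide Q X \<sqsubseteq> t)}"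
  have "S \<subseteq> Obj Q \<times> (qobj A \<rightarrow>\<^sub>E Arr Q)" by (auto simp: S_def hom_def PiE_def Pi_def)
  moreover have "small TYPE('u) (qobj A)" using A(1) unfolding is_qcat_def by blast
  ultimately have sS: "small TYPE('u) S"
    using small_Times[OF U sQ(1) small_PiE[OF U _ sQ(2)]] small_subset by blast
  then obtain c :: "'o \<times> ('u => 'm) => 'u" where c: "inj_on c S" using small_inj by blast
  define d where "d = inv_into S c"
  have d: "d (c p) = p" if "p \<in> S" for p using that c by (simp add: d_def)
  have p2: "snd p x \<in> hom Q (fst p) (qty A x)" if "p \<in> S" "x \<in> qobj A" for p x
    using that by (auto simp: S_def)
  have p: "fst p \<in> Obj Q" "x \<in> qobj A ==> snd p x \<in> hom Q (fst p) (qty A x)"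
    "x \<in> qobj A ==> Inv Q (snd p x) \<in> hom Q (qty A x) (fst p)"
    "x \<in> qobj A ==> y \<in> qobj A ==> qhom A x y \<odot> snd p y \<sqsubseteq> snd p x"
    "x \<in> qobj A ==> y \<in> qobj A ==> snd p x \<odot> Inv Q (snd p y) \<sqsubseteq> qhom A x y"
    "t \<in> hom Q (fst p) (fst p) ==> (\<And>x. x \<in> qobj A ==> Inv Q (snd p x) \<odot> snd p x \<sqsubseteq> t) ==> Ide Q (fst p) \<sqsubseteq> t"
    if "p \<in> S" for p x y t
    using that p2 inv_in[OF p2] by (auto simp: S_def)
  define G where "G q p = {Inv Q (snd q x) \<odot> snd p x | x. x \<in> qobj A}" for q p :: "'o \<times> ('u => 'm)"
  have G: "G q p \<subseteq> hom Q (fst p) (fst q)" if "p \<in> S" "q \<in> S" for p q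
    unfolding G_def using comp_in[OF p(3)[OF that(2)] p(2)[OF that(1)]] by blast
  \<comment> \<open>The hom-arrow from p to q is the composite of the distributor p with the right
    adjoint of q, the join of q(x)\<degree> p(x).\<close>
  define H where "H q p = join Q (fst p) (fst q) (G q p)" for q p
  have H: "H q p \<in> hom Q (fst p) (fst q)" if "p \<in> S" "q \<in> S" for p q
    unfolding H_def using join_in[OF p(1)[OF that(1)] p(1)[OF that(2)] G[OF that]] .
  \<comment> \<open>By the counit of q, q(x) q(y)\<degree> p(y) is below A(x,y) p(y), which is below
    p(x) because p is a distributor. So T is a distributor, and composition in the completion
    follows.\<close>
  have key: "snd q x \<odot> H q p \<sqsubseteq> snd p x" if o: "p \<in> S" "q \<in> S" and x: "x \<in> qobj A" for p q x
  proof -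
    have "snd q x \<odot> (Inv Q (snd q y) \<odot> snd p y) \<sqsubseteq> snd p x" if y: "y \<in> qobj A" for y
    proof -
      note t = p(2)[OF o(2) x] p(3)[OF o(2) y] p(2)[OF o(1) y] p(2)[OF o(1) x] a(2)[OF y x]
      have "(snd q x \<odot> Inv Q (snd q y)) \<odot> snd p y \<sqsubseteq> qhom A x y \<odot> snd p y"
        by (rule comp_mono_left[OF p(5)] comp_in t o x y)+
      then show ?thesis unfolding assoc[OF t(1-3)]
        by (rule le_trans[OF _ p(4)[OF o(1) x y] comp_in[OF t(1) comp_in[OF t(2,3)]] comp_in[OF t(5,3)] t(4)])
    qed
    then show ?thesis unfolding H_def
      using comp_join_le_iff[OF G[OF o] p(2)[OF o(2) x] p(2)[OF o(1) x]] by (auto simp: G_def)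
  qed
  have Hup: "Inv Q (snd q x) \<odot> snd p x \<sqsubseteq> H q p" if o: "p \<in> S" "q \<in> S" and x: "x \<in> qobj A" for p q x
    unfolding H_def by (rule join_upper[OF _ p(1)[OF o(1)] p(1)[OF o(2)] G[OF o]]) (use x in \<open>auto simp: G_def\<close>)
  have HH: "H r q \<odot> H q p \<sqsubseteq> H r p" if o: "p \<in> S" "q \<in> S" "r \<in> S" for p q r
  proof -
    have "(Inv Q (snd r x) \<odot> snd q x) \<odot> H q p \<sqsubseteq> H r p" if x: "x \<in> qobj A" for x
    proof -
      note t = p(3)[OF o(3) x] p(2)[OF o(2) x] H[OF o(1,2)] p(2)[OF o(1) x] H[OF o(1,3)]
      have "Inv Q (snd r x) \<odot> (snd q x \<odot> H q p) \<sqsubseteq> Inv Q (snd r x) \<odot> snd p x"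
        by (rule comp_mono_right[OF key] comp_in t o x)+
      then show ?thesis unfolding assoc[OF t(1-3)]
        by (rule le_trans[OF _ Hup[OF o(1,3) x] comp_in[OF t(1) comp_in[OF t(2,3)]] comp_in[OF t(1,4)] t(5)])
    qed
    then show ?thesis unfolding H_def[of r q]
      using join_comp_le_iff[OF G[OF o(2,3)] H[OF o(1,2)] H[OF o(1,3)]] by (auto simp: G_def)
  qed
  have HI: "Ide Q (fst p) \<sqsubseteq> H p p" if o: "p \<in> S" for p
    by (rule p(6)[OF o H[OF o o] Hup[OF o o]])
  have HS: "Inv Q (H q p) = H p q" if o: "p \<in> S" "q \<in> S" for p q
  proof -
    have "Inv Q ` G q p = G p q" unfolding G_def Setcompr_eq_image image_image
      by (rule image_cong) (use inv_comp[OF p(3)[OF o(2)] p(2)[OF o(1)]] inv_inv[OF p(2)[OF o(2)]] in simp_all)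
    then show ?thesis unfolding H_def using inv_join[OF p(1)[OF o(1)] p(1)[OF o(2)] G[OF o]] by simp
  qed
  define A' :: "('u, 'o, 'm) qcat" where
    "A' = \<lparr>qobj = c ` S, qty = (\<lambda>x\<in>c ` S. fst (d x)), qhom = (\<lambda>y\<in>c ` S. \<lambda>x\<in>c ` S. H (d y) (d x))\<rparr>"
  have A1: "qobj A' = c ` S" "\<And>p. p \<in> S ==> qty A' (c p) = fst p"
    "\<And>p q. p \<in> S ==> q \<in> S ==> qhom A' (c q) (c p) = H q p"
    by (simp_all add: A'_def d)
  have A': "is_qcat Q A'"
    unfolding is_qcat_def
  proof (intro conjI)
    show "small TYPE('u) (qobj A')" using small_image[OF sS] by (simp add: A'_def)
    show "qty A' \<in> qobj A' \<rightarrow>\<^sub>E Obj Q" using p(1) by (auto simp: A'_def d)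
    show "qhom A' \<in> (\<Pi>\<^sub>E y\<in>qobj A'. \<Pi>\<^sub>E x\<in>qobj A'. hom Q (qty A' x) (qty A' y))"
      using H by (auto simp: A'_def d)
  qed (use HH HI in \<open>auto simp: A1\<close>)
  have As: "symm A'" unfolding symmetric_qcat_def using HS by (auto simp: A1)
  define T where "T = (\<lambda>y\<in>qobj A. \<lambda>x\<in>qobj A'. snd (d x) y)"
  have T1: "T y (c p) = snd p y" if "p \<in> S" "y \<in> qobj A" for p y using that by (simp add: T_def A1 d)
  have Td: "dst A' A T" unfolding T_def
    by (rule dst_restrictI[OF A' A(1)]) (use p(2,4) key in \<open>auto simp: A1 d\<close>)
  note Ti = dinv_dst[OF Td As A(2)]
  have T2: "dinv A' A T (c p) y = Inv Q (snd p y)" if "p \<in> S" "y \<in> qobj A" for p y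
    using that by (simp add: dinv_def A1 T1)
  have D: "dcomp B A A' (dinv A' A T) M (c q) b = join Q (qty B b) (fst q) {Inv Q (snd q x) \<odot> M x b | x. x \<in> qobj A}"
    if "q \<in> S" "b \<in> qobj B" for B q b M
  proof -
    have "{dinv A' A T (c q) y \<odot> M y b | y. y \<in> qobj A} = {Inv Q (snd q x) \<odot> M x b | x. x \<in> qobj A}"
      unfolding Setcompr_eq_image by (rule image_cong) (use T2 that in simp_all)
    then show ?thesis using that by (simp add: dcomp_def A1)
  qed
  have D1: "dcomp A' A A' (dinv A' A T) T = qhom A'"
  proof (rule dst_eqI[OF dcomp_dst[OF Td Ti] dst_id[OF A']])
    fix x y assume "x \<in> qobj A'" "y \<in> qobj A'"
    then obtain p q where x: "x = c p" "y = c q" and o: "p \<in> S" "q \<in> S" by (auto simp: A1)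
    have "{Inv Q (snd q x) \<odot> T x (c p) | x. x \<in> qobj A} = G q p"
      unfolding G_def Setcompr_eq_image by (rule image_cong) (use T1 o in simp_all)
    then show "dcomp A' A A' (dinv A' A T) T y x = qhom A' y x"
      using D[OF o(2), of "c p" A' T] o by (simp add: x A1 H_def)
  qed
  have D2: "dcomp A A' A T (dinv A' A T) = qhom A"
  proof (rule dst_le_antisym[OF dcomp_dst[OF Ti Td] dst_id[OF A(1)]])
    fix x y assume o: "x \<in> qobj A" "y \<in> qobj A"
    have "T y z \<odot> dinv A' A T z x \<sqsubseteq> qhom A y x" if "z \<in> qobj A'" for z
      using that p(5) T1 T2 o by (auto simp: A1)
    then show "dcomp A A' A T (dinv A' A T) y x \<sqsubseteq> qhom A y x"
      using dcomp_le_iff[OF Ti Td o a(2)[OF o]] by blast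
    \<comment> \<open>The representable column at x. It is one of the objects of the completion, and
      the term at r already bounds A(y,x) from above, as in the Yoneda lemma.\<close>
    define r where "r = (qty A x, \<lambda>z\<in>qobj A. qhom A z x)"
    note t = a(2)[OF o(1,1)] ide_in[OF a(1)[OF o(1)]] a(2)[OF o]
    have "Ide Q (qty A x) \<odot> qhom A x x \<sqsubseteq> qhom A x x \<odot> qhom A x x"
      by (rule comp_mono_left[OF a(4)] t o)+
    then have "qhom A x x \<sqsubseteq> qhom A x x \<odot> qhom A x x" using idl[OF t(1)] by simp
    then have 1: "Ide Q (qty A x) \<sqsubseteq> qhom A x x \<odot> qhom A x x"
      by (rule le_trans[OF a(4)[OF o(1)] _ t(2,1) comp_in[OF t(1,1)]])
    have "r \<in> S" unfolding S_def
    proof (simp add: r_def, intro conjI ballI impI)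
      fix t assume t': "t \<in> hom Q (qty A x) (qty A x)" "\<forall>z\<in>qobj A. Inv Q (qhom A z x) \<odot> qhom A z x \<sqsubseteq> t"
      then have "qhom A x x \<odot> qhom A x x \<sqsubseteq> t" using symD[OF A(2) o(1,1)] o by auto
      then show "Ide Q (qty A x) \<sqsubseteq> t" by (rule le_trans[OF 1 _ t(2) comp_in[OF t(1,1)] t'(1)])
    qed (use a o symD[OF A(2)] in auto)
    then have "T y (c r) \<odot> dinv A' A T (c r) x \<sqsubseteq> dcomp A A' A T (dinv A' A T) y x"
      using dcomp_upper[OF Ti Td o, of "c r"] by (simp add: A1)
    then have 2: "qhom A y x \<odot> qhom A x x \<sqsubseteq> dcomp A A' A T (dinv A' A T) y x"
      using T1[OF \<open>r \<in> S\<close>] T2[OF \<open>r \<in> S\<close>] o symD[OF A(2) o(1,1)] by (simp add: r_def)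
    have "qhom A y x \<odot> Ide Q (qty A x) \<sqsubseteq> qhom A y x \<odot> qhom A x x"
      by (rule comp_mono_right[OF a(4)] t o)+
    then have "qhom A y x \<sqsubseteq> qhom A y x \<odot> qhom A x x" using idr[OF t(3)] by simp
    then show "qhom A y x \<sqsubseteq> dcomp A A' A T (dinv A' A T) y x"
      by (rule le_trans[OF _ 2 t(3) comp_in[OF t(3,1)] dcomp_in[OF Ti Td o]])
  qed
  have un: "unitary (SymDist Q) A' A (A', T, A)" using unitary_SymDistI[OF Td As A(2) D1 D2] .
  interpret SD: iqloid "SymDist Q :: (('u, 'o, 'm) qcat, _) inv_quantaloid"
    using SymDist_inv_quantaloid by unfold_locales
  have "symmetrically_complete Q A'" unfolding symmetrically_complete_def
  proof (intro allI impI)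
    fix B :: "('u, 'o, 'm) qcat" and \<Xi> assume sl: "sym_left_adjoint (SymDist Q) (B, \<Xi>, A')"
    then have "(B, \<Xi>, A') \<in> Arr (SymDist Q)" unfolding sym_left_adjoint_def adjoint_def by blast
    then have X: "dst B A' \<Xi>" and Bs: "symm B" by simp_all
    have B: "is_qcat Q B" using dstD(1)[OF X] .
    \<comment> \<open>Composing \<Xi> with the unitary T yields a symmetric left adjoint into A;
      each of its columns satisfies the conditions defining S and is therefore an object of the
      completion. These columns are the values of the representing functor.\<close>
    define L where "L = dcomp B A' A T \<Xi>"
    have L: "dst B A L" using dcomp_dst[OF X Td] by (simp add: L_def)
    have "sym_left_adjoint (SymDist Q) ((A', T, A) \<odot>\<^bsub>SymDist Q\<^esub> (B, \<Xi>, A'))"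
      by (rule SD.sym_left_adjoint_comp[OF _ sl _ SD.unitary_sym_left_adjoint[OF un]])
        (use X Bs As A(2) Td in \<open>auto simp: hom_SymDist\<close>)
    then have slL: "sym_left_adjoint (SymDist Q) (B, L, A)" by (simp add: L_def)
    note s = sym_left_adjoint_SymDistD[OF L Bs A(2) slL]
    define \<sigma> where "\<sigma> b = (qty B b, \<lambda>x\<in>qobj A. L x b)" for b
    have \<sigma>: "\<sigma> b \<in> S" if b: "b \<in> qobj B" for b
      unfolding S_def \<sigma>_def using qcatD(1)[OF B b] dstD(3)[OF L b] dstD(4)[OF L b] s[OF b] by auto
    define F where "F = (\<lambda>b\<in>qobj B. c (\<sigma> b))"
    \<comment> \<open>Cancelling T\<degree> T recovers \<Xi> as T\<degree> L. Its entry at q and b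
      is thus the join of the q(x)\<degree> L(x,b), which is by definition the hom-arrow from the
      column at b to q.\<close>
    have "\<Xi> = dcomp B A' A' (dcomp A' A A' (dinv A' A T) T) \<Xi>" using D1 dcomp_id_left[OF X] by simp
    also have "\<dots> = dcomp B A A' (dinv A' A T) L" using dcomp_assoc[OF X Td Ti] by (simp add: L_def)
    finally have XL: "\<Xi> = dcomp B A A' (dinv A' A T) L" .
    have e: "\<Xi> x b = qhom A' x (F b)" if x: "x \<in> qobj A'" and b: "b \<in> qobj B" for x b
    proof -
      obtain q where q: "x = c q" "q \<in> S" using x by (auto simp: A1)
      have "{Inv Q (snd q x) \<odot> L x b | x. x \<in> qobj A} = G q (\<sigma> b)"
        unfolding G_def Setcompr_eq_image by (rule image_cong) (simp_all add: \<sigma>_def)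
      then have "\<Xi> x b = H q (\<sigma> b)" using D[OF q(2) b, of L] XL by (simp add: q H_def \<sigma>_def)
      then show ?thesis using q \<sigma>[OF b] b by (simp add: F_def A1)
    qed
    have X2: "\<Xi> = (\<lambda>a\<in>qobj A'. \<lambda>b\<in>qobj B. qhom A' a (F b))"
    proof (rule PiE_ext[OF dstD(6)[OF X]])
      show "(\<lambda>a\<in>qobj A'. \<lambda>b\<in>qobj B. qhom A' a (F b)) \<in> (\<Pi>\<^sub>E y\<in>qobj A'. \<Pi>\<^sub>E x\<in>qobj B. hom Q (qty B x) (qty A' y))"
        using e dstD(3)[OF X] by auto
      fix x assume x: "x \<in> qobj A'"
      have "\<Xi> x \<in> (\<Pi>\<^sub>E b\<in>qobj B. hom Q (qty B b) (qty A' x))" using PiE_mem[OF dstD(6)[OF X] x] .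
      then show "\<Xi> x = (\<lambda>a\<in>qobj A'. \<lambda>b\<in>qobj B. qhom A' a (F b)) x"
        using e[OF x] x by (auto simp: PiE_def extensional_def fun_eq_iff)
    qed
    have F: "F \<in> qobj B \<rightarrow>\<^sub>E qobj A'" "\<And>b. b \<in> qobj B ==> qty A' (F b) = qty B b"
      using \<sigma> by (auto simp: F_def A1) (simp add: \<sigma>_def)
    have "is_qfunctor Q B A' F" using represented_qfunctor[OF A' F] X X2 by simp
    then show "\<exists>F. is_qfunctor Q B A' F \<and> (B, \<Xi>, A') = represented B A' F"
      using X2 unfolding represented_def by blast
  qed
  then show ?thesis using A' As un by blast
qed

lemma SymDist_sc_equivalence:
  assumes U: "universe TYPE('u)" and sQ: "small TYPE('u) (Obj Q)" "small TYPE('u) (Arr Q)"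
  shows "dagger_equivalence (SymDist_sc Q :: (('u, 'o, 'm) qcat, _) inv_quantaloid) (SymDist Q) (\<lambda>A. A) (\<lambda>M. M)"
  unfolding dagger_equivalence_def SymDist_sc_def
  using dagger_embedding_full_sub[OF SymDist_inv_quantaloid] completion[OF U sQ] by fastforce

section \<open>Functors as symmetric left adjoint distributors\<close>

lemma qfunctorD:
  assumes "is_qfunctor Q A B F"
  shows "F \<in> qobj A \<rightarrow>\<^sub>E qobj B" "x \<in> qobj A ==> F x \<in> qobj B" "x \<in> qobj A ==> qty B (F x) = qty A x"
    "x \<in> qobj A ==> y \<in> qobj A ==> qhom A y x \<sqsubseteq> qhom B (F y) (F x)"
  using assms unfolding is_qfunctor_def by auto

definition rep :: "('u, 'o, 'm) qcat => ('u, 'o, 'm) qcat => ('u => 'u) => 'u => 'u => 'm" where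
  "rep B A F = (\<lambda>a\<in>qobj A. \<lambda>b\<in>qobj B. qhom A a (F b))"

lemma represented_rep: "represented B A F = (B, rep B A F, A)"
  by (simp add: represented_def rep_def)

lemma rep_simp [simp]: "a \<in> qobj A ==> b \<in> qobj B ==> rep B A F a b = qhom A a (F b)"
  by (simp add: rep_def)

context
  fixes A B :: "('u, 'o, 'm) qcat"
  assumes A: "is_qcat Q A" and B: "is_qcat Q B"
begin

lemma rep_dst:
  assumes F: "is_qfunctor Q A B F"
  shows "dst A B (rep A B F)"
  unfolding rep_def
proof (rule dst_restrictI[OF A B])
  note f = qfunctorD[OF F] note b = qcatD[OF B] and a = qcatD[OF A]
  show "qhom B y (F x) \<in> hom Q (qty A x) (qty B y)" if "x \<in> qobj A" "y \<in> qobj B" for x y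
    using b(2)[OF f(2) that(2)] f(3) that by simp
  show "qhom B y' y \<odot> qhom B y (F x) \<sqsubseteq> qhom B y' (F x)" if "x \<in> qobj A" "y \<in> qobj B" "y' \<in> qobj B" for x y y'
    using b(3) f(2) that by blast
  show "qhom B y (F x) \<odot> qhom A x x' \<sqsubseteq> qhom B y (F x')" if o: "x \<in> qobj A" "x' \<in> qobj A" "y \<in> qobj B" for x x' y
  proof -
    have t: "qhom B y (F x) \<in> hom Q (qty A x) (qty B y)" "qhom B y (F x') \<in> hom Q (qty A x') (qty B y)"
      "qhom B (F x) (F x') \<in> hom Q (qty A x') (qty A x)" "qhom A x x' \<in> hom Q (qty A x') (qty A x)"
      using b(2)[OF f(2) o(3)] b(2)[OF f(2) f(2)] f(3) a(2) o by auto
    have "qhom B y (F x) \<odot> qhom A x x' \<sqsubseteq> qhom B y (F x) \<odot> qhom B (F x) (F x')"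
      by (rule comp_mono_right[OF f(4)] t o)+
    then show ?thesis
      by (rule le_trans[OF _ b(3)[OF f(2)[OF o(2)] f(2)[OF o(1)] o(3)] comp_in[OF t(1,4)] comp_in[OF t(1,3)] t(2)])
  qed
qed

lemma rep_le:
  assumes F: "is_qfunctor Q A B F" and G: "is_qfunctor Q A B G" and le: "qfunctor_le Q A B F G"
    and o: "x \<in> qobj A" "y \<in> qobj B"
  shows "qhom B y (F x) \<sqsubseteq> qhom B y (G x)"
proof -
  note f = qfunctorD[OF F] and g = qfunctorD[OF G] note b = qcatD[OF B]
  have t: "qhom B y (F x) \<in> hom Q (qty A x) (qty B y)" "qhom B y (G x) \<in> hom Q (qty A x) (qty B y)"
      "qhom B (F x) (G x) \<in> hom Q (qty A x) (qty A x)" "Ide Q (qty A x) \<in> hom Q (qty A x) (qty A x)"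
    using b(2)[OF f(2) o(2)] b(2)[OF g(2) o(2)] b(2)[OF g(2) f(2)] f(3) g(3) ide_in[OF qcatD(1)[OF A]] o by auto
  have "Ide Q (qty A x) \<sqsubseteq> qhom B (F x) (G x)" using le o unfolding qfunctor_le_def by blast
  then have "qhom B y (F x) \<odot> Ide Q (qty A x) \<sqsubseteq> qhom B y (F x) \<odot> qhom B (F x) (G x)"
    using comp_mono_right t by blast
  then have "qhom B y (F x) \<sqsubseteq> qhom B y (F x) \<odot> qhom B (F x) (G x)" using idr[OF t(1)] by simp
  then show ?thesis
    by (rule le_trans[OF _ b(3)[OF g(2)[OF o(1)] f(2)[OF o(1)] o(2)] t(1) comp_in[OF t(1,3)] t(2)])
qed

text \<open>The Yoneda lemma: equal families are evaluated at F x and at G x, where one side is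
  above an identity. Isomorphism classes of functors are hence the fibres of
  \<open>rep\<close>.\<close>

lemma rep_eq_iff:
  assumes F: "is_qfunctor Q A B F" and G: "is_qfunctor Q A B G"
  shows "rep A B F = rep A B G \<longleftrightarrow> qfunctor_iso Q A B F G"
proof
  assume e: "rep A B F = rep A B G"
  have "Ide Q (qty A x) \<sqsubseteq> qhom B (F x) (G x)" "Ide Q (qty A x) \<sqsubseteq> qhom B (G x) (F x)" if x: "x \<in> qobj A" for x
  proof -
    note o = qfunctorD(2,3)[OF F x] qfunctorD(2,3)[OF G x]
    have "qhom B (F x) (F x) = qhom B (F x) (G x)" "qhom B (G x) (F x) = qhom B (G x) (G x)"
      using fun_cong[OF fun_cong[OF e, of "F x"], of x] fun_cong[OF fun_cong[OF e, of "G x"], of x] o x by simp_all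
    then show "Ide Q (qty A x) \<sqsubseteq> qhom B (F x) (G x)" "Ide Q (qty A x) \<sqsubseteq> qhom B (G x) (F x)"
      using qcatD(4)[OF B o(1)] qcatD(4)[OF B o(3)] o by simp_all
  qed
  then show "qfunctor_iso Q A B F G" unfolding qfunctor_iso_def qfunctor_le_def by blast
next
  assume i: "qfunctor_iso Q A B F G"
  show "rep A B F = rep A B G"
    by (rule dst_le_antisym[OF rep_dst[OF F] rep_dst[OF G]])
      (use rep_le[OF F G] rep_le[OF G F] i in \<open>simp_all add: qfunctor_iso_def\<close>)
qed

lemma qfunctor_class_eq:
  assumes F: "is_qfunctor Q A B F"
  shows "qfunctor_class Q A B F = {G. is_qfunctor Q A B G \<and> rep A B G = rep A B F}"
  unfolding qfunctor_class_def using rep_eq_iff[OF F] by (intro Collect_cong) metis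

text \<open>The unit is witnessed by the term at the object F x' itself, the counit is composition
  in B. Symmetry of B makes the involute of A(-,F-) the usual right adjoint.\<close>

lemma rep_sym_left_adjoint:
  assumes F: "is_qfunctor Q A B F" and s: "symm A" "symm B"
  shows "sym_left_adjoint (SymDist Q) (A, rep A B F, B)"
  unfolding sym_left_adjoint_SymDist_iff[OF rep_dst[OF F] s]
proof (intro conjI ballI)
  note f = qfunctorD[OF F] note b = qcatD[OF B] note d = rep_dst[OF F] note i = dinv_dst[OF d s]
  fix x x' assume o: "x \<in> qobj A" "x' \<in> qobj A"
  have t: "qhom B (F x') (F x) \<in> hom Q (qty A x) (qty A x')" "qhom B (F x') (F x') \<in> hom Q (qty A x') (qty A x')"
    "Ide Q (qty A x') \<in> hom Q (qty A x') (qty A x')"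
    using b(2)[OF f(2) f(2)] f(3) o ide_in[OF qcatD(1)[OF A]] by auto
  have "Ide Q (qty A x') \<odot> qhom B (F x') (F x) \<sqsubseteq> qhom B (F x') (F x') \<odot> qhom B (F x') (F x)"
    using comp_mono_left[OF _ t(3,2,1)] b(4)[OF f(2)[OF o(2)]] f(3)[OF o(2)] by simp
  then have 1: "qhom B (F x') (F x) \<sqsubseteq> qhom B (F x') (F x') \<odot> qhom B (F x') (F x)" using idl[OF t(1)] by simp
  have 2: "dinv A B (rep A B F) x' (F x') = qhom B (F x') (F x')"
    using symD[OF s(2) f(2)[OF o(2)] f(2)[OF o(2)]] o f(2) by (simp add: dinv_def)
  have "qhom B (F x') (F x') \<odot> qhom B (F x') (F x) \<sqsubseteq> dcomp A B A (dinv A B (rep A B F)) (rep A B F) x' x"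
    using dcomp_upper[OF d i o f(2)[OF o(2)]] f(2) o unfolding 2 by simp
  then have "qhom B (F x') (F x) \<sqsubseteq> dcomp A B A (dinv A B (rep A B F)) (rep A B F) x' x"
    by (rule le_trans[OF 1 _ t(1) comp_in[OF t(2,1)] dcomp_in[OF d i o]])
  then show "qhom A x' x \<sqsubseteq> dcomp A B A (dinv A B (rep A B F)) (rep A B F) x' x"
    by (rule le_trans[OF f(4)[OF o] _ qcatD(2)[OF A o] t(1) dcomp_in[OF d i o]])
next
  note f = qfunctorD[OF F] note b = qcatD[OF B] note d = rep_dst[OF F] note i = dinv_dst[OF d s]
  fix y y' assume o: "y \<in> qobj B" "y' \<in> qobj B"
  have "rep A B F y' x \<odot> dinv A B (rep A B F) x y \<sqsubseteq> qhom B y' y" if x: "x \<in> qobj A" for x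
    using b(3)[OF o(1) f(2)[OF x] o(2)] symD[OF s(2) f(2)[OF x] o(1)] x o by (simp add: dinv_def)
  then show "dcomp B A B (rep A B F) (dinv A B (rep A B F)) y' y \<sqsubseteq> qhom B y' y"
    using dcomp_le_iff[OF i d o b(2)[OF o]] by blast
qed

end

lemma qfunctor_compose:
  assumes c: "is_qcat Q A" "is_qcat Q B" "is_qcat Q C" and F: "is_qfunctor Q A B F" and G: "is_qfunctor Q B C G"
  shows "is_qfunctor Q A C (compose (qobj A) G F)"
  unfolding is_qfunctor_def
proof (intro conjI ballI)
  note f = qfunctorD[OF F] and g = qfunctorD[OF G] note a = qcatD(2)[OF c(1)] and b = qcatD(2)[OF c(2)] and cc = qcatD(2)[OF c(3)]
  show "compose (qobj A) G F \<in> qobj A \<rightarrow>\<^sub>E qobj C" using f g by (auto simp: compose_def)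
  show "qty C (compose (qobj A) G F x) = qty A x" if "x \<in> qobj A" for x using f g that by (simp add: compose_def)
  fix x y assume o: "x \<in> qobj A" "y \<in> qobj A"
  have "qhom A y x \<in> hom Q (qty A x) (qty A y)" "qhom B (F y) (F x) \<in> hom Q (qty A x) (qty A y)"
    "qhom C (G (F y)) (G (F x)) \<in> hom Q (qty A x) (qty A y)"
    using a[OF o] b[OF f(2) f(2)] cc[OF g(2)[OF f(2)] g(2)[OF f(2)]] f(2,3) g(3) o by auto
  then show "qhom A y x \<sqsubseteq> qhom C (compose (qobj A) G F y) (compose (qobj A) G F x)"
    using le_trans[OF f(4)[OF o] g(4)[OF f(2)[OF o(1)] f(2)[OF o(2)]]] o by (simp add: compose_def)
qed

text \<open>The join over y is attained at y = F x, where the hom-arrow of B is above the identity;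
  the other terms lie below by functoriality of G.\<close>

lemma rep_compose:
  assumes c: "is_qcat Q A" "is_qcat Q B" "is_qcat Q C" and F: "is_qfunctor Q A B F" and G: "is_qfunctor Q B C G"
  shows "rep A C (compose (qobj A) G F) = dcomp A B C (rep B C G) (rep A B F)"
proof (rule dst_le_antisym)
  note f = qfunctorD[OF F] and g = qfunctorD[OF G] note cc = qcatD[OF c(3)]
  note GF = qfunctor_compose[OF c F G] note dF = rep_dst[OF c(1,2) F] note dG = rep_dst[OF c(2,3) G]
  show "dst A C (rep A C (compose (qobj A) G F))" "dst A C (dcomp A B C (rep B C G) (rep A B F))"
    using rep_dst[OF c(1,3) GF] dcomp_dst[OF dF dG] .
  fix x z assume o: "x \<in> qobj A" "z \<in> qobj C"
  have e: "rep A C (compose (qobj A) G F) z x = qhom C z (G (F x))" using o by (simp add: compose_def)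
  have t: "qhom C z (G (F x)) \<in> hom Q (qty A x) (qty C z)"
    using cc(2)[OF g(2)[OF f(2)[OF o(1)]] o(2)] f(2,3) g(3) o by simp
  have "rep B C G z y \<odot> rep A B F y x \<sqsubseteq> qhom C z (G (F x))" if y: "y \<in> qobj B" for y
  proof -
    have s: "qhom C z (G y) \<in> hom Q (qty B y) (qty C z)" "qhom B y (F x) \<in> hom Q (qty A x) (qty B y)"
      "qhom C (G y) (G (F x)) \<in> hom Q (qty A x) (qty B y)"
      using cc(2)[OF g(2)[OF y] o(2)] qcatD(2)[OF c(2) f(2) y] cc(2)[OF g(2)[OF f(2)] g(2)[OF y]] f(2,3) g(3) o y by auto
    have "qhom C z (G y) \<odot> qhom B y (F x) \<sqsubseteq> qhom C z (G y) \<odot> qhom C (G y) (G (F x))"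
      using comp_mono_right[OF g(4)[OF f(2)[OF o(1)] y] s(2,3,1)] .
    then have "qhom C z (G y) \<odot> qhom B y (F x) \<sqsubseteq> qhom C z (G (F x))"
      by (rule le_trans[OF _ cc(3)[OF g(2)[OF f(2)[OF o(1)]] g(2)[OF y] o(2)] comp_in[OF s(1,2)] comp_in[OF s(1,3)] t])
    then show ?thesis using y o by simp
  qed
  then show "dcomp A B C (rep B C G) (rep A B F) z x \<sqsubseteq> rep A C (compose (qobj A) G F) z x"
    unfolding e using dcomp_le_iff[OF dF dG o t] by blast
  have s: "qhom B (F x) (F x) \<in> hom Q (qty A x) (qty A x)" "Ide Q (qty A x) \<in> hom Q (qty A x) (qty A x)"
    using qcatD(2)[OF c(2) f(2) f(2)] f(3) o ide_in[OF qcatD(1)[OF c(1)]] by auto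
  have "Ide Q (qty A x) \<sqsubseteq> qhom B (F x) (F x)" using qcatD(4)[OF c(2) f(2)[OF o(1)]] f(3) o by simp
  then have "qhom C z (G (F x)) \<odot> Ide Q (qty A x) \<sqsubseteq> qhom C z (G (F x)) \<odot> qhom B (F x) (F x)"
    using comp_mono_right s t by blast
  then have "qhom C z (G (F x)) \<sqsubseteq> qhom C z (G (F x)) \<odot> qhom B (F x) (F x)" using idr[OF t] by simp
  moreover have "qhom C z (G (F x)) \<odot> qhom B (F x) (F x) \<sqsubseteq> dcomp A B C (rep B C G) (rep A B F) z x"
    using dcomp_upper[OF dF dG o f(2)[OF o(1)]] f(2) o by simp
  ultimately show "rep A C (compose (qobj A) G F) z x \<sqsubseteq> dcomp A B C (rep B C G) (rep A B F) z x"
    unfolding e using le_trans[OF _ _ t comp_in[OF t s(1)] dcomp_in[OF dF dG o]] by blast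
qed

lemma qfunctor_id: "is_qcat Q A ==> is_qfunctor Q A A (\<lambda>x\<in>qobj A. x)"
  unfolding is_qfunctor_def using le_refl[OF qcatD(2)] by auto

lemma rep_id: "is_qcat Q A ==> rep A A (\<lambda>x\<in>qobj A. x) = qhom A"
  by (rule dst_eqI[OF rep_dst[OF _ _ qfunctor_id] dst_id]) auto

lemma SymCat_simps [simp]:
  "Obj (SymCat Q) = {A. is_qcat Q A \<and> symm A}"
  "Dom (SymCat Q) (A, f, B) = A" "Cod (SymCat Q) (A, f, B) = B"
  "Ide (SymCat Q) A = (A, qfunctor_class Q A A (\<lambda>x\<in>qobj A. x), A)"
  "(B', g, C) \<odot>\<^bsub>SymCat Q\<^esub> (A, f, B) = (A, \<Union>F\<in>f. \<Union>G\<in>g. qfunctor_class Q A C (compose (qobj A) G F), C)"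
  by (auto simp: SymCat_def)

lemma hom_SymCat: "hom (SymCat Q) A B =
    {(A, qfunctor_class Q A B F, B) | F. is_qcat Q A \<and> symm A \<and> is_qcat Q B \<and> symm B \<and> is_qfunctor Q A B F}"
  by (auto simp: hom_def SymCat_def)

text \<open>Composition of classes is a union over all representatives. By
  \<open>rep_compose\<close> the class of the composite depends only on the represented
  distributors, so all members of the union coincide.\<close>

lemma SymCat_comp:
  assumes c: "is_qcat Q A" "is_qcat Q B" "is_qcat Q C" and F: "is_qfunctor Q A B F" and G: "is_qfunctor Q B C G"
  shows "(B, qfunctor_class Q B C G, C) \<odot>\<^bsub>SymCat Q\<^esub> (A, qfunctor_class Q A B F, B) =
    (A, qfunctor_class Q A C (compose (qobj A) G F), C)"
proof -
  have *: "qfunctor_class Q A C (compose (qobj A) G' F') = qfunctor_class Q A C (compose (qobj A) G F)"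
    if h: "F' \<in> qfunctor_class Q A B F" "G' \<in> qfunctor_class Q B C G" for F' G'
  proof -
    have F': "is_qfunctor Q A B F'" "rep A B F' = rep A B F" using h(1) unfolding qfunctor_class_eq[OF c(1,2) F] by blast+
    have G': "is_qfunctor Q B C G'" "rep B C G' = rep B C G" using h(2) unfolding qfunctor_class_eq[OF c(2,3) G] by blast+
    show ?thesis
      using qfunctor_class_eq[OF c(1,3) qfunctor_compose[OF c F G]] qfunctor_class_eq[OF c(1,3) qfunctor_compose[OF c F'(1) G'(1)]]
        rep_compose[OF c F G] rep_compose[OF c F'(1) G'(1)] F'(2) G'(2) by simp
  qed
  have "(\<Union>F'\<in>qfunctor_class Q A B F. \<Union>G'\<in>qfunctor_class Q B C G. qfunctor_class Q A C (compose (qobj A) G' F')) =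
      (\<Union>F'\<in>qfunctor_class Q A B F. \<Union>G'\<in>qfunctor_class Q B C G. qfunctor_class Q A C (compose (qobj A) G F))"
    by (intro SUP_cong refl *)
  moreover have "qfunctor_class Q A B F \<noteq> {}" "qfunctor_class Q B C G \<noteq> {}"
    using qfunctor_class_eq[OF c(1,2) F] qfunctor_class_eq[OF c(2,3) G] F G by blast+
  ultimately show ?thesis by simp
qed

text \<open>The chosen representative is immaterial because \<open>rep\<close> is constant on
  isomorphism classes; see \<open>repm_class\<close>.\<close>

definition repm :: "('u, 'o, 'm) qfunctor_arrow => ('u, 'o, 'm) distributor" where
  "repm = (\<lambda>(A, f, B). (A, rep A B (SOME F. F \<in> f), B))"

lemma repm_class:
  assumes c: "is_qcat Q A" "is_qcat Q B" and F: "is_qfunctor Q A B F"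
  shows "repm (A, qfunctor_class Q A B F, B) = (A, rep A B F, B)"
proof -
  have "F \<in> qfunctor_class Q A B F" using F by (simp add: qfunctor_class_eq[OF c F])
  then have "(SOME G. G \<in> qfunctor_class Q A B F) \<in> qfunctor_class Q A B F"
    by (rule someI[where P = "\<lambda>G. G \<in> qfunctor_class Q A B F"])
  then show ?thesis using qfunctor_class_eq[OF c F] by (simp add: repm_def)
qed

text \<open>Faithfulness is \<open>rep_eq_iff\<close> in terms of classes, and fullness is precisely
  symmetric completeness of the codomain.\<close>

lemma SymCat_sc_embedding:
  "cat_embedding (SymCat_sc Q :: (('u, 'o, 'm) qcat, _) category) (sym_maps (SymDist Q)) (\<lambda>A. A) repm"
  unfolding cat_embedding_def SymCat_sc_def hom_full_sub
proof (intro conjI allI ballI)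
  let ?C = "full_sub (symmetrically_complete Q) (SymCat Q :: (('u, 'o, 'm) qcat, _) category)"
  fix f assume "f \<in> Arr ?C"
  then show "Dom ?C f \<in> Obj ?C" "Cod ?C f \<in> Obj ?C" by (auto simp: full_sub_def SymCat_def)
next
  fix A B :: "('u, 'o, 'm) qcat" assume "A \<in> Obj (full_sub (symmetrically_complete Q) (SymCat Q))"
    "B \<in> Obj (full_sub (symmetrically_complete Q) (SymCat Q))"
  then have c: "is_qcat Q A" "symm A" "is_qcat Q B" "symm B" "symmetrically_complete Q A" "symmetrically_complete Q B" by auto
  have "inj_on repm (hom (SymCat Q) A B)"
    by (rule inj_onI) (auto simp: hom_SymCat repm_class, auto simp: qfunctor_class_eq)
  moreover have "repm ` hom (SymCat Q) A B = hom (sym_maps (SymDist Q)) A B"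
    unfolding hom_sym_maps hom_SymDist
  proof (intro equalityI subsetI)
    fix f assume "f \<in> {f \<in> {(A, M, B) |M. dst A B M \<and> symm A \<and> symm B}. sym_left_adjoint (SymDist Q) f}"
    then obtain M where f: "f = (A, M, B)" "sym_left_adjoint (SymDist Q) (A, M, B)" by auto
    obtain F where F: "is_qfunctor Q A B F" "(A, M, B) = represented A B F"
      using c(6) f(2) unfolding symmetrically_complete_def by blast
    have "f = repm (A, qfunctor_class Q A B F, B)" using F f(1) repm_class[OF c(1,3)] by (simp add: represented_rep)
    then show "f \<in> repm ` hom (SymCat Q) A B" using F c unfolding hom_SymCat by blast
  qed (auto simp: hom_SymCat repm_class rep_dst rep_sym_left_adjoint)
  ultimately show "bij_betw repm (if symmetrically_complete Q A \<and> symmetrically_complete Q B then hom (SymCat Q) A B else {})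
      (hom (sym_maps (SymDist Q)) A B)"
    using c by (simp add: bij_betw_def)
next
  fix A B C :: "('u, 'o, 'm) qcat" and f g
  assume "f \<in> (if symmetrically_complete Q A \<and> symmetrically_complete Q B then hom (SymCat Q) A B else {})"
    "g \<in> (if symmetrically_complete Q B \<and> symmetrically_complete Q C then hom (SymCat Q) B C else {})"
  then have s: "symmetrically_complete Q A" "symmetrically_complete Q C" and "f \<in> hom (SymCat Q) A B" "g \<in> hom (SymCat Q) B C"
    by (auto split: if_splits)
  then obtain F G where c: "is_qcat Q A" "is_qcat Q B" "is_qcat Q C" and sy: "symm A" "symm C"
    and F: "is_qfunctor Q A B F" "f = (A, qfunctor_class Q A B F, B)"
    and G: "is_qfunctor Q B C G" "g = (B, qfunctor_class Q B C G, C)" by (auto simp: hom_SymCat)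
  have e: "g \<odot>\<^bsub>SymCat Q\<^esub> f = (A, qfunctor_class Q A C (compose (qobj A) G F), C)"
    unfolding F(2) G(2) using SymCat_comp[OF c F(1) G(1)] .
  note GF = qfunctor_compose[OF c F(1) G(1)]
  show "g \<odot>\<^bsub>full_sub (symmetrically_complete Q) (SymCat Q)\<^esub> f
      \<in> (if symmetrically_complete Q A \<and> symmetrically_complete Q C then hom (SymCat Q) A C else {})"
    using s c sy GF unfolding full_sub_simps e hom_SymCat by auto
  show "repm (g \<odot>\<^bsub>full_sub (symmetrically_complete Q) (SymCat Q)\<^esub> f) = repm g \<odot>\<^bsub>sym_maps (SymDist Q)\<^esub> repm f"
    unfolding full_sub_simps e unfolding F(2) G(2)
    using repm_class[OF c(1,3) GF] repm_class[OF c(1,2) F(1)] repm_class[OF c(2,3) G(1)] rep_compose[OF c F(1) G(1)] by simp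
next
  fix A :: "('u, 'o, 'm) qcat" assume "A \<in> Obj (full_sub (symmetrically_complete Q) (SymCat Q))"
  then have c: "is_qcat Q A" "symm A" "symmetrically_complete Q A" by auto
  then show "Ide (full_sub (symmetrically_complete Q) (SymCat Q)) A
      \<in> (if symmetrically_complete Q A \<and> symmetrically_complete Q A then hom (SymCat Q) A A else {})"
    using qfunctor_id by (auto simp: hom_SymCat)
  show "repm (Ide (full_sub (symmetrically_complete Q) (SymCat Q)) A) = Ide (sym_maps (SymDist Q)) A"
    using repm_class[OF c(1,1) qfunctor_id[OF c(1)]] rep_id[OF c(1)] by simp
  show "A \<in> Obj (sym_maps (SymDist Q))" using c by simp
qed

lemma SymCat_sc_category: "is_category (SymCat_sc Q)"
proof -
  interpret SD: iqloid "SymDist Q" using SymDist_inv_quantaloid by unfold_locales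
  show ?thesis using embedding_is_category[OF SymCat_sc_embedding SD.sym_maps_category] .
qed

lemma SymCat_sc_equiv:
  assumes U: "universe TYPE('u)" and sQ: "small TYPE('u) (Obj Q)" "small TYPE('u) (Arr Q)"
  shows "category_equiv (SymCat_sc Q :: (('u, 'o, 'm) qcat, _) category)
    (sym_maps (SymDist Q :: (('u, 'o, 'm) qcat, _) inv_quantaloid))"
proof (rule embedding_equiv[OF SymCat_sc_embedding])
  interpret SD: iqloid "SymDist Q :: (('u, 'o, 'm) qcat, _) inv_quantaloid"
    using SymDist_inv_quantaloid by unfold_locales
  show c: "is_category (sym_maps (SymDist Q :: (('u, 'o, 'm) qcat, _) inv_quantaloid))" using SD.sym_maps_category .
  fix Y :: "('u, 'o, 'm) qcat" assume "Y \<in> Obj (sym_maps (SymDist Q))"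
  then obtain X u where X: "is_qcat Q X" "symm X" "symmetrically_complete Q X" and u: "unitary (SymDist Q) X Y u"
    using completion[OF U sQ, of Y] by auto
  have "is_iso (sym_maps (SymDist Q)) u" "u \<in> hom (sym_maps (SymDist Q)) X Y"
    using SD.unitary_is_iso[OF u] .
  then show "\<exists>X\<in>Obj (SymCat_sc Q). \<exists>u\<in>hom (sym_maps (SymDist Q)) X Y. is_iso (sym_maps (SymDist Q)) u"
    using X unfolding SymCat_sc_def by auto
qed

end

section \<open>Splitting symmetric idempotents\<close>

locale splitting_of = iqloid Q for Q :: "('o, 'm) inv_quantaloid" (structure) +
  fixes E :: "'m set"
  assumes E: "\<And>e. e \<in> E ==> sym_idempotent Q e"
begin

abbreviation "SE \<equiv> splitting Q E"

lemma idemD: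
  assumes "e \<in> E"
  shows "e \<in> hom Q (Dom Q e) (Dom Q e)" "e \<odot> e = e" "Inv Q e = e" "Dom Q e \<in> Obj Q"
  using E[OF assms] hom_obj[OF Arr_hom, of e] unfolding sym_idempotent_def by (auto simp: hom_def)

lemma SE_simps [simp]:
  "Obj SE = E"
  "Dom SE (e, x, f) = e" "Cod SE (e, x, f) = f"
  "Ide SE e = (e, e, e)"
  "(f', y, g) \<odot>\<^bsub>SE\<^esub> (e, x, f) = (e, y \<odot> x, g)"
  "(e, x, f) \<sqsubseteq>\<^bsub>SE\<^esub> (e', x', f') \<longleftrightarrow> e = e' \<and> f = f' \<and> x \<sqsubseteq> x'"
  "Inv SE (e, x, f) = (f, Inv Q x, e)"
  by (auto simp: splitting_def)

text \<open>The middle components of the triples, so that composites and joins can be computed in Q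
  without carrying the ends along.\<close>

definition shom :: "'m => 'm => 'm set" where
  "shom e f = {x \<in> hom Q (Dom Q e) (Dom Q f). e \<in> E \<and> f \<in> E \<and> f \<odot> x = x \<and> x \<odot> e = x}"

lemma Arr_SE [simp]: "(e, x, f) \<in> Arr SE \<longleftrightarrow> x \<in> shom e f"
  by (auto simp: splitting_def shom_def)

lemma hom_SE: "hom SE e f = {(e, x, f) | x. x \<in> shom e f}"
  by (auto simp: hom_def[of SE])

lemma shomD:
  assumes "x \<in> shom e f"
  shows "e \<in> E" "f \<in> E" "x \<in> hom Q (Dom Q e) (Dom Q f)" "f \<odot> x = x" "x \<odot> e = x"
  using assms unfolding shom_def by auto

lemma shom_comp:
  assumes x: "x \<in> shom e f" and y: "y \<in> shom f g"
  shows "y \<odot> x \<in> shom e g"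
  using shomD[OF x] shomD[OF y] comp_in[OF shomD(3)[OF y] shomD(3)[OF x]]
    assoc[OF idemD(1)[OF shomD(2)[OF y]] shomD(3)[OF y] shomD(3)[OF x]]
    assoc[OF shomD(3)[OF y] shomD(3)[OF x] idemD(1)[OF shomD(1)[OF x]]]
  by (simp add: shom_def)

lemma shom_inv:
  assumes x: "x \<in> shom e f"
  shows "Inv Q x \<in> shom f e"
  using shomD[OF x] inv_in[OF shomD(3)[OF x]] inv_comp[OF shomD(3)[OF x] idemD(1)[OF shomD(1)[OF x]]]
    inv_comp[OF idemD(1)[OF shomD(2)[OF x]] shomD(3)[OF x]] idemD(3)[OF shomD(1)[OF x]] idemD(3)[OF shomD(2)[OF x]]
  by (simp add: shom_def)

text \<open>Composition with f maps P onto itself, so f composed with the join is again a supremum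
  of P and equals it by uniqueness; likewise for e. Hence suprema in the splitting are those of
  Q.\<close>

lemma shom_join:
  assumes e: "e \<in> E" "f \<in> E" and P: "P \<subseteq> shom e f"
  shows "join Q (Dom Q e) (Dom Q f) P \<in> shom e f"
proof -
  have P': "P \<subseteq> hom Q (Dom Q e) (Dom Q f)" using P shomD(3) by blast
  note l = join_lub[OF idemD(4)[OF e(1)] idemD(4)[OF e(2)] P']
  have P3: "f \<odot> x = x" "x \<odot> e = x" if "x \<in> P" for x using shomD(4,5)[of x e f] that P by blast+
  have "(\<lambda>x. f \<odot> x) ` P = P" "(\<lambda>x. x \<odot> e) ` P = P"
    using P3 by (simp_all cong: image_cong_simp)
  then have "is_lub Q (Dom Q e) (Dom Q f) P (f \<odot> join Q (Dom Q e) (Dom Q f) P)"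
    "is_lub Q (Dom Q e) (Dom Q f) P (join Q (Dom Q e) (Dom Q f) P \<odot> e)"
    using lub_comp_left[OF l P' idemD(1)[OF e(2)]] lub_comp_right[OF l P' idemD(1)[OF e(1)]] by simp_all
  from this[THEN lub_unique[OF _ l]] show ?thesis
    using join_in[OF idemD(4)[OF e(1)] idemD(4)[OF e(2)] P'] e by (simp add: shom_def)
qed

lemma SE_inv_quantaloid: "is_inv_quantaloid SE"
proof (rule inv_quantaloidI)

  show "is_category SE" unfolding is_category_def
  proof (intro conjI allI ballI)
    fix x assume "x \<in> Arr SE"
    then obtain e y f where "x = (e, y, f)" "y \<in> shom e f" using Arr_hom[of x SE] unfolding hom_SE by blast
    then show "Dom SE x \<in> Obj SE" "Cod SE x \<in> Obj SE" using shomD(1,2) by auto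
  next
    fix e assume "e \<in> Obj SE"
    then show "Ide SE e \<in> hom SE e e" using idemD[of e] by (simp add: hom_SE shom_def)
  next
    fix e f g h x y z assume "x \<in> hom SE e f" "y \<in> hom SE f g" "z \<in> hom SE g h"
    then show "z \<odot>\<^bsub>SE\<^esub> (y \<odot>\<^bsub>SE\<^esub> x) = z \<odot>\<^bsub>SE\<^esub> y \<odot>\<^bsub>SE\<^esub> x"
      using assoc[OF shomD(3) shomD(3) shomD(3)] by (auto simp: hom_SE)
  qed (use shom_comp shomD in \<open>auto simp: hom_SE\<close>)
next
  fix e f x assume "x \<in> hom SE e f"
  then obtain a where x: "x = (e, a, f)" "a \<in> shom e f" by (auto simp: hom_SE)
  note a = shomD(3)[OF x(2)]
  show "x \<sqsubseteq>\<^bsub>SE\<^esub> x" using le_refl[OF a] x(1) by simp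
  show "Inv SE x \<in> hom SE f e" "Inv SE (Inv SE x) = x" using shom_inv[OF x(2)] inv_inv[OF a] by (simp_all add: x(1) hom_SE)
  fix y assume "y \<in> hom SE e f"
  then obtain b where y: "y = (e, b, f)" "b \<in> shom e f" by (auto simp: hom_SE)
  note b = shomD(3)[OF y(2)]
  show "x \<sqsubseteq>\<^bsub>SE\<^esub> y ==> y \<sqsubseteq>\<^bsub>SE\<^esub> x ==> x = y" using le_antisym[OF a b] by (simp add: x(1) y(1))
  show "x \<sqsubseteq>\<^bsub>SE\<^esub> y ==> Inv SE x \<sqsubseteq>\<^bsub>SE\<^esub> Inv SE y" using inv_mono[OF _ a b] by (simp add: x(1) y(1))
  show "x \<sqsubseteq>\<^bsub>SE\<^esub> y ==> y \<sqsubseteq>\<^bsub>SE\<^esub> z ==> x \<sqsubseteq>\<^bsub>SE\<^esub> z" if "z \<in> hom SE e f" for z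
    using that le_trans[OF _ _ a b shomD(3)] by (auto simp: x(1) y(1) hom_SE)
next
  fix e f g x y assume "x \<in> hom SE e f" "y \<in> hom SE f g"
  then show "Inv SE (y \<odot>\<^bsub>SE\<^esub> x) = Inv SE x \<odot>\<^bsub>SE\<^esub> Inv SE y"
    using inv_comp[OF shomD(3) shomD(3)] by (auto simp: hom_SE)
next
  fix e f S assume o: "e \<in> Obj SE" "f \<in> Obj SE" and S: "S \<subseteq> hom SE e f"
  define P where "P = {x. (e, x, f) \<in> S}"
  have e: "e \<in> E" "f \<in> E" using o by simp_all
  have Sf: "(\<forall>x\<in>S. R x) \<longleftrightarrow> (\<forall>x\<in>P. R (e, x, f))" for R using S by (fastforce simp: P_def hom_SE)
  have P: "P \<subseteq> shom e f" using S by (auto simp: P_def hom_SE)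
  then have P': "P \<subseteq> hom Q (Dom Q e) (Dom Q f)" using shomD(3) by blast
  let ?j = "join Q (Dom Q e) (Dom Q f) P"
  have "is_lub SE e f S (e, ?j, f)" unfolding is_lub_def Sf
    using shom_join[OF e P] join_upper[OF _ idemD(4)[OF e(1)] idemD(4)[OF e(2)] P'] join_le_iff[OF P' shomD(3)]
    by (auto simp: hom_SE)
  moreover have "g \<odot>\<^bsub>SE\<^esub> (e, ?j, f) \<sqsubseteq>\<^bsub>SE\<^esub> t \<longleftrightarrow> (\<forall>x\<in>S. g \<odot>\<^bsub>SE\<^esub> x \<sqsubseteq>\<^bsub>SE\<^esub> t)"
    if h: "g \<in> hom SE f k" "t \<in> hom SE e k" for g t k
    unfolding Sf using h comp_join_le_iff[OF P' shomD(3) shomD(3)] by (auto simp: hom_SE)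
  ultimately show "\<exists>s. is_lub SE e f S s \<and> (\<forall>k. \<forall>g\<in>hom SE f k. \<forall>t\<in>hom SE e k. g \<odot>\<^bsub>SE\<^esub> s \<sqsubseteq>\<^bsub>SE\<^esub> t \<longleftrightarrow> (\<forall>x\<in>S. g \<odot>\<^bsub>SE\<^esub> x \<sqsubseteq>\<^bsub>SE\<^esub> t))" by blast
qed

text \<open>Between identities the equations of the splitting hold for every arrow, so the homs are
  those of Q. This is where E containing the identities enters.\<close>

lemma splitting_embedding:
  assumes I: "\<forall>X\<in>Obj Q. Ide Q X \<in> E"
  shows "dagger_embedding Q SE (Ide Q) (\<lambda>x. (Ide Q (Dom Q x), x, Ide Q (Cod Q x)))"
proof -
  have D: "Dom Q (Ide Q X) = X" if "X \<in> Obj Q" for X using homD(2)[OF ide_in[OF that]] .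
  have h: "shom (Ide Q X) (Ide Q Y) = hom Q X Y" if "X \<in> Obj Q" "Y \<in> Obj Q" for X Y
    using I that idl idr by (auto simp: shom_def D)
  have b: "bij_betw (\<lambda>x. (Ide Q (Dom Q x), x, Ide Q (Cod Q x))) (hom Q X Y) (hom SE (Ide Q X) (Ide Q Y))"
    if "X \<in> Obj Q" "Y \<in> Obj Q" for X Y
  proof -
    have "(\<lambda>x. (Ide Q (Dom Q x), x, Ide Q (Cod Q x))) ` hom Q X Y = hom SE (Ide Q X) (Ide Q Y)"
      unfolding hom_SE h[OF that] by (auto simp: image_def homD(2,3)[of _ Q])
    then show ?thesis unfolding bij_betw_def by (auto intro: inj_onI)
  qed
  have o: "Dom Q f \<in> Obj Q" "Cod Q f \<in> Obj Q" if "f \<in> Arr Q" for f using hom_obj[OF Arr_hom[OF that]] .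
  have dc: "Dom Q f = X" "Cod Q f = Y" if "f \<in> hom Q X Y" for f X Y using homD(2,3)[OF that] .
  show ?thesis unfolding dagger_embedding_def cat_embedding_def
  proof (intro conjI allI ballI)
    fix X Y Z f g assume h: "f \<in> hom Q X Y" "g \<in> hom Q Y Z"
    show "g \<odot> f \<in> hom Q X Z" using comp_in[OF h(2,1)] .
    show "(Ide Q (Dom Q (g \<odot> f)), g \<odot> f, Ide Q (Cod Q (g \<odot> f))) =
      (Ide Q (Dom Q g), g, Ide Q (Cod Q g)) \<odot>\<^bsub>SE\<^esub> (Ide Q (Dom Q f), f, Ide Q (Cod Q f))"
      using dc[OF h(1)] dc[OF h(2)] dc[OF comp_in[OF h(2,1)]] by simp
  next
    fix X Y f assume h: "f \<in> hom Q X Y"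
    show "Inv Q f \<in> hom Q Y X" using inv_in[OF h] .
    show "(Ide Q (Dom Q (Inv Q f)), Inv Q f, Ide Q (Cod Q (Inv Q f))) = Inv SE (Ide Q (Dom Q f), f, Ide Q (Cod Q f))"
      using dc[OF h] dc[OF inv_in[OF h]] by simp
  next
    fix X Y f g assume h: "f \<in> hom Q X Y" "g \<in> hom Q X Y"
    show "(f \<sqsubseteq> g) = ((Ide Q (Dom Q f), f, Ide Q (Cod Q f)) \<sqsubseteq>\<^bsub>SE\<^esub> (Ide Q (Dom Q g), g, Ide Q (Cod Q g)))"
      using dc[OF h(1)] dc[OF h(2)] by simp
  next
    fix X assume X: "X \<in> Obj Q"
    show "(Ide Q (Dom Q (Ide Q X)), Ide Q X, Ide Q (Cod Q (Ide Q X))) = Ide SE (Ide Q X)"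
      using dc[OF ide_in[OF X]] by simp
  qed (use I o ide_in b in simp_all)
qed

text \<open>
  If every arrow is a join of \<open>f g\<degree>\<close> with \<open>f\<close>, \<open>g\<close> symmetric left adjoints, each idempotent \<open>e\<close> is
  covered by the symmetric left adjoints \<open>e f : 1 \<rightarrow> e\<close> where \<open>f g\<degree> \<le> e\<close>: then \<open>f f\<degree> \<le> e\<close>, so that
  \<open>f g\<degree> \<le> (f f\<degree>)(f f\<degree>)(f g\<degree>) \<le> (e f)(e f)\<degree>\<close>.
\<close>

lemma splitting_dense:
  assumes tab: "\<And>X Y q t. q \<in> hom Q X Y ==> t \<in> hom Q X Y ==>
      (\<And>W f g. f \<in> hom Q W Y ==> g \<in> hom Q W X ==> sym_left_adjoint Q f ==> sym_left_adjoint Q g ==>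
        f \<odot> Inv Q g \<sqsubseteq> q ==> f \<odot> Inv Q g \<sqsubseteq> t) ==> q \<sqsubseteq> t"
    and I: "\<forall>X\<in>Obj Q. Ide Q X \<in> E"
    and e: "e \<in> E" and t: "t \<in> hom SE e e"
    and le: "\<And>X u. X \<in> Obj Q ==> u \<in> hom SE (Ide Q X) e ==> sym_left_adjoint SE u ==> u \<odot>\<^bsub>SE\<^esub> Inv SE u \<sqsubseteq>\<^bsub>SE\<^esub> t"
  shows "Ide SE e \<sqsubseteq>\<^bsub>SE\<^esub> t"
proof -
  interpret S: iqloid SE using SE_inv_quantaloid by unfold_locales
  note ee = idemD[OF e]
  obtain y where t: "t = (e, y, e)" "y \<in> shom e e" using t by (auto simp: hom_SE)
  note y = shomD(3)[OF t(2)]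
  have "e \<sqsubseteq> y"
  proof (rule tab[OF ee(1) y])
    fix W f g assume f: "f \<in> hom Q W (Dom Q e)" "sym_left_adjoint Q f" and g: "g \<in> hom Q W (Dom Q e)" "sym_left_adjoint Q g"
      and fg: "f \<odot> Inv Q g \<sqsubseteq> e"
    note W = hom_obj(1)[OF f(1)]
    note m = f(1) g(1) inv_in[OF f(1)] inv_in[OF g(1)] ee(1) ide_in[OF W] ide_in[OF ee(4)] comp_in
    have af: "Ide Q W \<sqsubseteq> Inv Q f \<odot> f" "f \<odot> Inv Q f \<sqsubseteq> Ide Q (Dom Q e)"
      and ag: "Ide Q W \<sqsubseteq> Inv Q g \<odot> g"
      using f g sym_left_adjoint_iff by blast+
    have fg': "Inv Q (f \<odot> Inv Q g) = g \<odot> Inv Q f" using inv_comp[OF f(1) inv_in[OF g(1)]] inv_inv[OF g(1)] by simp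
    have gf: "g \<odot> Inv Q f \<sqsubseteq> e"
      using inv_mono[OF fg comp_in[OF f(1) inv_in[OF g(1)]] ee(1)] fg' ee(3) by simp
    define p where "p = f \<odot> Inv Q f"
    have p: "p \<in> hom Q (Dom Q e) (Dom Q e)" unfolding p_def by (rule m)+
    have "f \<odot> (Ide Q W \<odot> Inv Q f) \<sqsubseteq> f \<odot> ((Inv Q g \<odot> g) \<odot> Inv Q f)"
      by (rule comp_mono_right[OF comp_mono_left[OF ag]] m)+
    then have 1: "p \<sqsubseteq> (f \<odot> Inv Q g) \<odot> (g \<odot> Inv Q f)"
      unfolding idl[OF m(3)] p_def using assoc[OF m(4,2,3)] assoc[OF m(1,4) comp_in[OF m(2,3)]] by simp
    have "(f \<odot> Inv Q g) \<odot> (g \<odot> Inv Q f) \<sqsubseteq> e \<odot> e" by (rule comp_mono[OF fg gf] m)+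
    then have pe: "p \<sqsubseteq> e" unfolding ee(2) by (rule le_trans[OF 1 _ p _ ee(1)]) (rule m)+
    have pf: "f \<sqsubseteq> p \<odot> f"
    proof -
      have "f \<odot> Ide Q W \<sqsubseteq> f \<odot> (Inv Q f \<odot> f)" by (rule comp_mono_right[OF af(1)] m)+
      then show ?thesis using idr[OF f(1)] assoc[OF m(1,3,1)] by (simp add: p_def)
    qed
    \<comment> \<open>The symmetric left adjoint to which \<open>le\<close> is applied: f \<le> v
      gives its unit, and v v\<degree> = e p e \<le> e is its counit, since e is the identity on
      itself in the splitting.\<close>
    define v where "v = e \<odot> f"
    have v: "v \<in> hom Q W (Dom Q e)" unfolding v_def by (rule m)+
    have vi: "Inv Q v = Inv Q f \<odot> e" using inv_comp[OF ee(1) f(1)] ee(3) by (simp add: v_def)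
    have fv: "f \<sqsubseteq> v" unfolding v_def
      by (rule le_trans[OF pf comp_mono_left[OF pe p ee(1) f(1)]]) (rule m p)+
    have vs: "v \<in> shom (Ide Q W) e"
      using v e I W idr[OF v] homD(2)[OF ide_in[OF W]] assoc[OF ee(1,1) f(1)] ee(2) by (simp add: shom_def v_def)
    have ifv: "Inv Q f \<sqsubseteq> Inv Q v" using inv_mono[OF fv f(1) v] .
    have "Inv Q f \<odot> f \<sqsubseteq> Inv Q v \<odot> v" using comp_mono[OF ifv fv m(3) inv_in[OF v] f(1) v] .
    then have a1: "Ide Q W \<sqsubseteq> Inv Q v \<odot> v"
      by (rule le_trans[OF af(1) _ m(6) comp_in[OF m(3,1)] comp_in[OF inv_in[OF v] v]])
    have vv: "v \<odot> Inv Q v = e \<odot> (p \<odot> e)"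
      unfolding vi unfolding v_def p_def using assoc[OF m(5,1) comp_in[OF m(3,5)]] assoc[OF m(1,3,5)] by simp
    have "e \<odot> (p \<odot> e) \<sqsubseteq> e \<odot> (e \<odot> e)" by (rule comp_mono_right[OF comp_mono_left[OF pe]] m p)+
    then have a2: "v \<odot> Inv Q v \<sqsubseteq> e" using vv ee(2) by simp
    have vh: "(Ide Q W, v, e) \<in> hom SE (Ide Q W) e" using vs by (simp add: hom_SE)
    have "sym_left_adjoint SE (Ide Q W, v, e)" using S.sym_left_adjoint_iff[OF vh] a1 a2 by simp
    from le[OF W vh this] have vy: "v \<odot> Inv Q v \<sqsubseteq> y" by (simp add: t)
    have p2: "p \<sqsubseteq> p \<odot> p"
    proof -
      have "f \<odot> Inv Q f \<sqsubseteq> (p \<odot> f) \<odot> Inv Q f" by (rule comp_mono_left[OF pf] m p)+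
      then show ?thesis using assoc[OF p m(1,3)] by (simp add: p_def)
    qed
    have "f \<odot> Inv Q g \<sqsubseteq> (p \<odot> f) \<odot> Inv Q g" by (rule comp_mono_left[OF pf] m p)+
    then have 3: "f \<odot> Inv Q g \<sqsubseteq> p \<odot> (f \<odot> Inv Q g)" using assoc[OF p m(1,4)] by simp
    have 4: "p \<odot> (f \<odot> Inv Q g) \<sqsubseteq> (p \<odot> p) \<odot> e" by (rule comp_mono[OF p2 fg] m p)+
    have "(p \<odot> p) \<odot> e \<sqsubseteq> (e \<odot> p) \<odot> e" by (rule comp_mono_left[OF comp_mono_left[OF pe]] m p)+
    then have "(p \<odot> p) \<odot> e \<sqsubseteq> v \<odot> Inv Q v" using assoc[OF ee(1) p ee(1)] vv by simp
    then have 5: "(p \<odot> p) \<odot> e \<sqsubseteq> y" by (rule le_trans[OF _ vy _ _ y]) (rule m p v inv_in)+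
    have "p \<odot> (f \<odot> Inv Q g) \<sqsubseteq> y" by (rule le_trans[OF 4 5 _ _ y]) (rule m p)+
    then show "f \<odot> Inv Q g \<sqsubseteq> y" by (rule le_trans[OF 3 _ _ _ y]) (rule m p)+
  qed
  then show ?thesis by (simp add: t)
qed

end

section \<open>The involutive quantaloid of closed cribles\<close>

locale site =
  fixes C :: "('o, 'm) category" (structure) and J :: "'o => 'm set set"
  assumes site: "is_site C J"
begin

lemma cat: "is_category C"
  using site unfolding is_site_def by blast

lemmas hom_obj = cat_hom_obj[OF cat]
lemmas ide_in = cat_ide[OF cat]
lemmas comp_in = cat_comp[OF cat]
lemmas idr = cat_idr[OF cat]
lemmas idl = cat_idl[OF cat]
lemmas assoc = cat_assoc[OF cat]

lemma J_sieve: "X \<in> Obj C ==> S \<in> J X ==> sieve C X S"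
  and J_max: "X \<in> Obj C ==> {f \<in> Arr C. Cod C f = X} \<in> J X"
  and J_pull: "X \<in> Obj C ==> S \<in> J X ==> f \<in> hom C V X ==> pullback_sieve C f S \<in> J V"
  and J_trans: "X \<in> Obj C ==> S \<in> J X ==> sieve C X T ==>
    (\<And>f. f \<in> S ==> pullback_sieve C f T \<in> J (Dom C f)) ==> T \<in> J X"
proof -
  have G: "grothendieck_topology C J" using site unfolding is_site_def by blast
  show "X \<in> Obj C ==> S \<in> J X ==> sieve C X S"
    using G[unfolded grothendieck_topology_def, THEN conjunct1] by blast
  show "X \<in> Obj C ==> {f \<in> Arr C. Cod C f = X} \<in> J X"
    using G[unfolded grothendieck_topology_def, THEN conjunct2, THEN conjunct1] by blast
  show "X \<in> Obj C ==> S \<in> J X ==> f \<in> hom C V X ==> pullback_sieve C f S \<in> J V"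
    using G[unfolded grothendieck_topology_def, THEN conjunct2, THEN conjunct2, THEN conjunct1] homD[of f C V X] by blast
  show "X \<in> Obj C ==> S \<in> J X ==> sieve C X T ==>
    (\<And>f. f \<in> S ==> pullback_sieve C f T \<in> J (Dom C f)) ==> T \<in> J X"
    using G[unfolded grothendieck_topology_def, THEN conjunct2, THEN conjunct2, THEN conjunct2] by blast
qed

lemma sieveD:
  assumes "sieve C X S" "f \<in> S"
  shows "f \<in> hom C (Dom C f) X" "g \<in> hom C V (Dom C f) ==> f \<odot> g \<in> S"
  using assms unfolding sieve_def hom_def by auto

lemma sieveI:
  assumes "\<And>f. f \<in> S ==> f \<in> hom C (Dom C f) X"
    and "\<And>U V f g. f \<in> S ==> f \<in> hom C U X ==> g \<in> hom C V U ==> f \<odot> g \<in> S"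
  shows "sieve C X S"
  unfolding sieve_def
proof (intro conjI subsetI ballI impI)
  show "f \<in> {f \<in> Arr C. Cod C f = X}" if "f \<in> S" for f using assms(1)[OF that] by (simp add: hom_def)
  show "f \<odot> g \<in> S" if "f \<in> S" "g \<in> Arr C" "Cod C g = Dom C f" for f g
    using assms(2)[OF that(1) assms(1)[OF that(1)], of g "Dom C g"] that by (simp add: hom_def)
qed

text \<open>Pulled back along a member of the smaller covering sieve, the larger sieve becomes
  maximal; transitivity of the topology concludes.\<close>

lemma J_up:
  assumes X: "X \<in> Obj C" and S: "S \<in> J X" and ST: "S \<subseteq> T" and T: "sieve C X T"
  shows "T \<in> J X"
proof (rule J_trans[OF X S T])
  fix f assume f: "f \<in> S"
  have h: "f \<in> hom C (Dom C f) X" using sieveD(1)[OF T] f ST by blast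
  have "pullback_sieve C f T = {g \<in> Arr C. Cod C g = Dom C f}"
    using sieveD(2)[OF T, of f] f ST Arr_hom[of _ C] unfolding pullback_sieve_def by force
  then show "pullback_sieve C f T \<in> J (Dom C f)" using J_max[OF hom_obj(1)[OF h]] by simp
qed

text \<open>Local truth on U: the predicate holds throughout some covering sieve. It may be any
  predicate on arrows; only if it is stable under precomposition is its own extent a covering sieve
  (\<open>cov_sieve\<close>).\<close>

definition cov :: "'o => ('m => bool) => bool" where
  "cov U P \<longleftrightarrow> (\<exists>S\<in>J U. \<forall>s\<in>S. P s)"

lemma cov_all:
  assumes "U \<in> Obj C" "\<And>V s. s \<in> hom C V U ==> P s"
  shows "cov U P"
  unfolding cov_def
proof (rule bexI[OF _ J_max[OF assms(1)]], rule ballI)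
  show "P s" if "s \<in> {f \<in> Arr C. Cod C f = U}" for s
    using assms(2)[of s "Dom C s"] that by (simp add: hom_def)
qed

lemma cov_mono:
  assumes "cov U P" "U \<in> Obj C" "\<And>V s. s \<in> hom C V U ==> P s ==> P' s"
  shows "cov U P'"
proof -
  obtain S where S: "S \<in> J U" "\<forall>s\<in>S. P s" using assms(1) unfolding cov_def by blast
  have "P' s" if "s \<in> S" for s
    using assms(3)[OF sieveD(1)[OF J_sieve[OF assms(2) S(1)] that]] S(2) that by blast
  then show ?thesis using S(1) unfolding cov_def by blast
qed

lemma cov_pull:
  assumes "cov U P" "f \<in> hom C V U"
  shows "cov V (\<lambda>s. P (f \<odot> s))"
proof -
  obtain S where "S \<in> J U" "\<forall>s\<in>S. P s" using assms(1) unfolding cov_def by blast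
  then show ?thesis unfolding cov_def
    using J_pull[OF hom_obj(2)[OF assms(2)] _ assms(2)] by (intro bexI[of _ "pullback_sieve C f S"]) (auto simp: pullback_sieve_def)
qed

lemma cov_sieve:
  assumes U: "U \<in> Obj C" and c: "cov U P"
    and down: "\<And>V W s t. s \<in> hom C V U ==> P s ==> t \<in> hom C W V ==> P (s \<odot> t)"
  shows "{s \<in> Arr C. Cod C s = U \<and> P s} \<in> J U"
proof -
  obtain S where S: "S \<in> J U" "\<forall>s\<in>S. P s" using c unfolding cov_def by blast
  show ?thesis
  proof (rule J_up[OF U S(1)])
    show "S \<subseteq> {s \<in> Arr C. Cod C s = U \<and> P s}" using S sieveD(1)[OF J_sieve[OF U S(1)]] by (auto simp: hom_def)
    show "sieve C U {s \<in> Arr C. Cod C s = U \<and> P s}"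
    proof (rule sieveI)
      fix W V f g assume h: "f \<in> {s \<in> Arr C. Cod C s = U \<and> P s}" "f \<in> hom C W U" "g \<in> hom C V W"
      then show "f \<odot> g \<in> {s \<in> Arr C. Cod C s = U \<and> P s}"
        using down[OF h(2) _ h(3)] homD[OF comp_in[OF h(2,3)]] by simp
    qed (auto simp: hom_def)
  qed
qed

text \<open>The transitivity axiom of the topology in terms of local truth: what holds locally on a
  cover holds locally. The hypothesis \<open>down\<close> makes the extent of P' a sieve, to which
  that axiom applies.\<close>

lemma cov_trans:
  assumes c: "cov U P" and U: "U \<in> Obj C"
    and step: "\<And>V s. s \<in> hom C V U ==> P s ==> cov V (\<lambda>t. P' (s \<odot> t))"
    and down: "\<And>V W s t. s \<in> hom C V U ==> P' s ==> t \<in> hom C W V ==> P' (s \<odot> t)"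
  shows "cov U P'"
proof -
  obtain S where S: "S \<in> J U" "\<forall>s\<in>S. P s" using c unfolding cov_def by blast
  let ?T = "{s \<in> Arr C. Cod C s = U \<and> P' s}"
  have "?T \<in> J U"
  proof (rule J_trans[OF U S(1)])
    show T: "sieve C U ?T"
    proof (rule sieveI)
      fix W V f g assume h: "f \<in> ?T" "f \<in> hom C W U" "g \<in> hom C V W"
      then show "f \<odot> g \<in> ?T" using down[OF h(2) _ h(3)] homD[OF comp_in[OF h(2,3)]] by simp
    qed (auto simp: hom_def)
    fix f assume f: "f \<in> S"
    have h: "f \<in> hom C (Dom C f) U" using sieveD(1)[OF J_sieve[OF U S(1)] f] .
    have "cov (Dom C f) (\<lambda>t. P' (f \<odot> t))" using step[OF h] S f by blast
    then have "{s \<in> Arr C. Cod C s = Dom C f \<and> P' (f \<odot> s)} \<in> J (Dom C f)"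
    proof (rule cov_sieve[OF hom_obj(1)[OF h]])
      show "P' (f \<odot> (s \<odot> t))" if "s \<in> hom C V (Dom C f)" "P' (f \<odot> s)" "t \<in> hom C W V" for V W s t
        using down[OF comp_in[OF h that(1)] that(2,3)] assoc[OF h that(1,3)] by simp
    qed
    moreover have "{s \<in> Arr C. Cod C s = Dom C f \<and> P' (f \<odot> s)} = pullback_sieve C f ?T"
      using comp_in[OF h, of _ "Dom C _"] unfolding pullback_sieve_def hom_def by auto
    ultimately show "pullback_sieve C f ?T \<in> J (Dom C f)" by simp
  qed
  then show ?thesis unfolding cov_def by (intro bexI[of _ ?T]) simp_all
qed

text \<open>The intersection of two covering sieves is covering: pulled back along an arrow of the
  first, it agrees with the pullback of the second.\<close>

lemma cov_conj:
  assumes c: "cov U P" "cov U P'" and U: "U \<in> Obj C"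
  shows "cov U (\<lambda>s. P s \<and> P' s)"
proof -
  obtain S where S: "S \<in> J U" "\<forall>s\<in>S. P s" using c unfolding cov_def by blast
  obtain S' where S': "S' \<in> J U" "\<forall>s\<in>S'. P' s" using c unfolding cov_def by blast
  have "cov U (\<lambda>s. s \<in> S \<and> s \<in> S')"
  proof (rule cov_trans[OF _ U])
    show "cov U (\<lambda>s. s \<in> S)" using S unfolding cov_def by blast
    have "cov U (\<lambda>s. s \<in> S')" using S' unfolding cov_def by blast
    then show "cov V (\<lambda>t. s \<odot> t \<in> S \<and> s \<odot> t \<in> S')" if "s \<in> hom C V U" "s \<in> S" for V s
      using cov_mono[OF cov_pull[OF _ that(1)] hom_obj(1)[OF that(1)]] sieveD(2)[OF J_sieve[OF U S(1)] that(2)] homD(2)[OF that(1)] by simp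
    show "s \<odot> t \<in> S \<and> s \<odot> t \<in> S'" if "s \<in> hom C V U" "s \<in> S \<and> s \<in> S'" "t \<in> hom C W V" for V W s t
      using sieveD(2)[OF J_sieve[OF U S(1)]] sieveD(2)[OF J_sieve[OF U S'(1)]] that homD(2)[OF that(1)] by blast
  qed
  then show ?thesis by (rule cov_mono[OF _ U]) (use S S' in blast)
qed

definition cc :: "'o => 'o => ('m \<times> 'm) set => bool" where
  "cc X Y R \<longleftrightarrow> X \<in> Obj C \<and> Y \<in> Obj C \<and> closed_crible C J X Y R"

lemma ccD:
  assumes R: "cc X Y R"
  shows "X \<in> Obj C" "Y \<in> Obj C"
    and "(f, g) \<in> R ==> \<exists>U. f \<in> hom C U Y \<and> g \<in> hom C U X"
    and "(f, g) \<in> R ==> f \<in> hom C U Y ==> s \<in> hom C V U ==> (f \<odot> s, g \<odot> s) \<in> R"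
    and "f \<in> hom C U Y ==> g \<in> hom C U X ==> cov U (\<lambda>s. (f \<odot> s, g \<odot> s) \<in> R) ==> (f, g) \<in> R"
proof -
  show "X \<in> Obj C" "Y \<in> Obj C" using R unfolding cc_def by auto
  have R1: "R \<subseteq> spans C X Y" and R2: "\<forall>(f, g)\<in>R. \<forall>s\<in>Arr C. Cod C s = Dom C f --> (f \<odot> s, g \<odot> s) \<in> R"
    and R3: "\<forall>(f, g)\<in>spans C X Y. {s \<in> Arr C. Cod C s = Dom C f \<and> (f \<odot> s, g \<odot> s) \<in> R} \<in> J (Dom C f) --> (f, g) \<in> R"
    using R unfolding cc_def closed_crible_def by blast+
  show sp: "\<exists>U. f \<in> hom C U Y \<and> g \<in> hom C U X" if "(f, g) \<in> R" for f g
    using R1 that unfolding spans_def by blast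
  show rs: "(f \<odot> s, g \<odot> s) \<in> R" if "(f, g) \<in> R" "f \<in> hom C U Y" "s \<in> hom C V U" for f g s U V
    using R2 that unfolding hom_def by fastforce
  show "(f, g) \<in> R" if h: "f \<in> hom C U Y" "g \<in> hom C U X" "cov U (\<lambda>s. (f \<odot> s, g \<odot> s) \<in> R)" for f g U
  proof -
    have "{s \<in> Arr C. Cod C s = U \<and> (f \<odot> s, g \<odot> s) \<in> R} \<in> J U"
    proof (rule cov_sieve[OF hom_obj(1)[OF h(1)] h(3)])
      show "(f \<odot> (s \<odot> t), g \<odot> (s \<odot> t)) \<in> R" if "s \<in> hom C V U" "(f \<odot> s, g \<odot> s) \<in> R" "t \<in> hom C W V" for V W s t
        using rs[OF that(2) comp_in[OF h(1) that(1)] that(3)] assoc[OF h(1) that(1,3)] assoc[OF h(2) that(1,3)] by simp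
    qed
    moreover have "(f, g) \<in> spans C X Y" using h unfolding spans_def hom_def by auto
    ultimately show ?thesis using R3 homD(2)[OF h(1)] by auto
  qed
qed

lemma ccI:
  assumes X: "X \<in> Obj C" "Y \<in> Obj C"
    and sp: "\<And>f g. (f, g) \<in> R ==> \<exists>U. f \<in> hom C U Y \<and> g \<in> hom C U X"
    and rs: "\<And>U V f g s. (f, g) \<in> R ==> f \<in> hom C U Y ==> g \<in> hom C U X ==> s \<in> hom C V U ==> (f \<odot> s, g \<odot> s) \<in> R"
    and lo: "\<And>U f g. f \<in> hom C U Y ==> g \<in> hom C U X ==> cov U (\<lambda>s. (f \<odot> s, g \<odot> s) \<in> R) ==> (f, g) \<in> R"
  shows "cc X Y R"
  unfolding cc_def closed_crible_def
proof (intro conjI X ballI impI, safe)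
  show s: "(f, g) \<in> spans C X Y" if "(f, g) \<in> R" for f g
    using sp[OF that] unfolding spans_def hom_def by auto
  show "(f \<odot> s, g \<odot> s) \<in> R" if "(f, g) \<in> R" "s \<in> Arr C" "Cod C s = Dom C f" for f g s
    using rs[OF that(1), of "Dom C f" s "Dom C s"] s[OF that(1)] that(2,3) unfolding spans_def hom_def by auto
  show "(f, g) \<in> R" if "(f, g) \<in> spans C X Y" "{s \<in> Arr C. Cod C s = Dom C f \<and> (f \<odot> s, g \<odot> s) \<in> R} \<in> J (Dom C f)" for f g
  proof -
    have "cov (Dom C f) (\<lambda>s. (f \<odot> s, g \<odot> s) \<in> R)" unfolding cov_def by (rule bexI[OF _ that(2)]) simp
    then show ?thesis using lo[of f "Dom C f" g] that(1) unfolding spans_def by simp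
  qed
qed

definition crible :: "'o => 'o => ('m \<times> 'm) set => bool" where
  "crible X Y T \<longleftrightarrow> X \<in> Obj C \<and> Y \<in> Obj C \<and> (\<forall>f g. (f, g) \<in> T --> (\<exists>U. f \<in> hom C U Y \<and> g \<in> hom C U X)) \<and>
    (\<forall>U V f g s. (f, g) \<in> T --> f \<in> hom C U Y --> s \<in> hom C V U --> (f \<odot> s, g \<odot> s) \<in> T)"

text \<open>One step of local closure. For a crible it is already closed (\<open>lc_cc\<close>):
  spans that are locally in it are locally locally in T, hence locally in T by
  \<open>cov_trans\<close>.\<close>

definition lc :: "'o => 'o => ('m \<times> 'm) set => ('m \<times> 'm) set" where
  "lc X Y T = {(f, g). \<exists>U. f \<in> hom C U Y \<and> g \<in> hom C U X \<and> cov U (\<lambda>s. (f \<odot> s, g \<odot> s) \<in> T)}"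

lemma lc_iff: "f \<in> hom C U Y ==> g \<in> hom C U X ==> (f, g) \<in> lc X Y T \<longleftrightarrow> cov U (\<lambda>s. (f \<odot> s, g \<odot> s) \<in> T)"
proof -
  assume f: "f \<in> hom C U Y" and g: "g \<in> hom C U X"
  have eq: "V = U" if "f \<in> hom C V Y" for V using homD(2)[OF that] homD(2)[OF f] by simp
  show ?thesis unfolding lc_def mem_Collect_eq prod.case
  proof (intro iffI)
    assume "\<exists>V. f \<in> hom C V Y \<and> g \<in> hom C V X \<and> cov V (\<lambda>s. (f \<odot> s, g \<odot> s) \<in> T)"
    then show "cov U (\<lambda>s. (f \<odot> s, g \<odot> s) \<in> T)" by (elim exE conjE) (drule eq, simp)
  next
    assume "cov U (\<lambda>s. (f \<odot> s, g \<odot> s) \<in> T)"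
    then show "\<exists>V. f \<in> hom C V Y \<and> g \<in> hom C V X \<and> cov V (\<lambda>s. (f \<odot> s, g \<odot> s) \<in> T)"
      by (intro exI[of _ U] conjI f g)
  qed
qed

lemma lc_upper: "crible X Y T ==> T \<subseteq> lc X Y T"
proof safe
  fix f g assume T: "crible X Y T" and h: "(f, g) \<in> T"
  then obtain U where U: "f \<in> hom C U Y" "g \<in> hom C U X" unfolding crible_def by blast
  have "cov U (\<lambda>s. (f \<odot> s, g \<odot> s) \<in> T)"
    by (rule cov_all[OF hom_obj(1)[OF U(1)]]) (use T h U in \<open>unfold crible_def, blast\<close>)
  then show "(f, g) \<in> lc X Y T" using lc_iff[OF U] by blast
qed

lemma lc_least: "T \<subseteq> R ==> cc X Y R ==> lc X Y T \<subseteq> R"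
proof safe
  fix f g assume TR: "T \<subseteq> R" and R: "cc X Y R" and h: "(f, g) \<in> lc X Y T"
  then obtain U where U: "f \<in> hom C U Y" "g \<in> hom C U X" "cov U (\<lambda>s. (f \<odot> s, g \<odot> s) \<in> T)"
    unfolding lc_def by blast
  show "(f, g) \<in> R"
    by (rule ccD(5)[OF R U(1,2)], rule cov_mono[OF U(3) hom_obj(1)[OF U(1)]]) (use TR in blast)
qed

lemma lc_cc:
  assumes T: "crible X Y T"
  shows "cc X Y (lc X Y T)"
proof (rule ccI)
  show "X \<in> Obj C" "Y \<in> Obj C" using T unfolding crible_def by blast+
  show "\<exists>U. f \<in> hom C U Y \<and> g \<in> hom C U X" if "(f, g) \<in> lc X Y T" for f g
    using that unfolding lc_def by blast
next
  fix U V f g s assume h: "(f, g) \<in> lc X Y T" "f \<in> hom C U Y" "g \<in> hom C U X" "s \<in> hom C V U"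
  have "cov V (\<lambda>t. (f \<odot> (s \<odot> t), g \<odot> (s \<odot> t)) \<in> T)"
    using cov_pull[OF _ h(4)] h(1) lc_iff[OF h(2,3)] by blast
  then have "cov V (\<lambda>t. ((f \<odot> s) \<odot> t, (g \<odot> s) \<odot> t) \<in> T)"
    by (rule cov_mono[OF _ hom_obj(1)[OF h(4)]]) (use assoc[OF h(2,4)] assoc[OF h(3,4)] in simp)
  then show "(f \<odot> s, g \<odot> s) \<in> lc X Y T" using lc_iff[OF comp_in[OF h(2,4)] comp_in[OF h(3,4)]] by blast
next
  fix U f g assume h: "f \<in> hom C U Y" "g \<in> hom C U X" "cov U (\<lambda>s. (f \<odot> s, g \<odot> s) \<in> lc X Y T)"
  have "cov U (\<lambda>s. (f \<odot> s, g \<odot> s) \<in> T)"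
  proof (rule cov_trans[OF h(3) hom_obj(1)[OF h(1)]])
    fix V s assume s: "s \<in> hom C V U" "(f \<odot> s, g \<odot> s) \<in> lc X Y T"
    then have "cov V (\<lambda>t. ((f \<odot> s) \<odot> t, (g \<odot> s) \<odot> t) \<in> T)"
      using lc_iff[OF comp_in[OF h(1) s(1)] comp_in[OF h(2) s(1)]] by blast
    then show "cov V (\<lambda>t. (f \<odot> (s \<odot> t), g \<odot> (s \<odot> t)) \<in> T)"
      by (rule cov_mono[OF _ hom_obj(1)[OF s(1)]]) (use assoc[OF h(1) s(1)] assoc[OF h(2) s(1)] in simp)
  next
    fix V W s t assume s: "s \<in> hom C V U" "(f \<odot> s, g \<odot> s) \<in> T" "t \<in> hom C W V"
    then have "((f \<odot> s) \<odot> t, (g \<odot> s) \<odot> t) \<in> T"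
      using T comp_in[OF h(1) s(1)] unfolding crible_def by blast
    then show "(f \<odot> (s \<odot> t), g \<odot> (s \<odot> t)) \<in> T" using assoc[OF h(1) s(1,3)] assoc[OF h(2) s(1,3)] by simp
  qed
  then show "(f, g) \<in> lc X Y T" using lc_iff[OF h(1,2)] by blast
qed

text \<open>The closure as an explicit set. The generators G may fail to be stable under
  precomposition, as does the single span of identities, so the crible T they generate is
  interposed.\<close>

lemma crible_closure_eq:
  assumes T: "crible X Y T" and G: "G \<subseteq> T" "\<And>R. cc X Y R ==> G \<subseteq> R ==> T \<subseteq> R"
  shows "crible_closure C J X Y G = lc X Y T"
proof -
  have c: "cc X Y (lc X Y T)" using lc_cc[OF T] .
  have X: "X \<in> Obj C" "Y \<in> Obj C" using ccD[OF c] by blast+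
  have "lc X Y T \<subseteq> R" if "closed_crible C J X Y R" "G \<subseteq> R" for R
    using lc_least[OF G(2)] that X unfolding cc_def by blast
  moreover have "closed_crible C J X Y (lc X Y T)" "G \<subseteq> lc X Y T"
    using c lc_upper[OF T] G(1) unfolding cc_def by blast+
  ultimately show ?thesis unfolding crible_closure_def by blast
qed

definition cidt :: "'o => ('m \<times> 'm) set" where
  "cidt X = {(f, f) | U f. f \<in> hom C U X}"

definition cid :: "'o => ('m \<times> 'm) set" where
  "cid X = lc X X (cidt X)"

lemma cidt_crible: "X \<in> Obj C ==> crible X X (cidt X)"
  unfolding crible_def cidt_def using comp_in by fastforce

lemma cid_cc: "X \<in> Obj C ==> cc X X (cid X)"
  unfolding cid_def by (rule lc_cc[OF cidt_crible])

lemma cid_refl: "f \<in> hom C U X ==> (f, f) \<in> cid X"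
  unfolding cid_def by (rule subsetD[OF lc_upper[OF cidt_crible[OF hom_obj(2)]]]) (auto simp: cidt_def)

lemma cid_least: "cc X X R ==> (\<And>U f. f \<in> hom C U X ==> (f, f) \<in> R) ==> cid X \<subseteq> R"
  unfolding cid_def by (rule lc_least) (auto simp: cidt_def)

definition ccompt :: "('m \<times> 'm) set => ('m \<times> 'm) set => ('m \<times> 'm) set" where
  "ccompt S R = {(h, g) | h g. \<exists>f. (h, f) \<in> S \<and> (f, g) \<in> R}"

definition ccomp :: "'o => 'o => ('m \<times> 'm) set => ('m \<times> 'm) set => ('m \<times> 'm) set" where
  "ccomp X Z S R = lc X Z (ccompt S R)"

lemma ccompt_crible:
  assumes R: "cc X Y R" and S: "cc Y Z S"
  shows "crible X Z (ccompt S R)"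
  unfolding crible_def
proof (intro conjI allI impI)
  show "X \<in> Obj C" "Z \<in> Obj C" using ccD[OF R] ccD[OF S] by blast+
  have *: "\<exists>f U. (h, f) \<in> S \<and> (f, g) \<in> R \<and> h \<in> hom C U Z \<and> f \<in> hom C U Y \<and> g \<in> hom C U X"
    if hg: "(h, g) \<in> ccompt S R" for h g
  proof -
    obtain f where f: "(h, f) \<in> S" "(f, g) \<in> R" using hg unfolding ccompt_def by blast
    obtain U where U: "h \<in> hom C U Z" "f \<in> hom C U Y" using ccD(3)[OF S f(1)] by blast
    obtain V where V: "f \<in> hom C V Y" "g \<in> hom C V X" using ccD(3)[OF R f(2)] by blast
    have "U = V" using homD(2)[OF U(2)] homD(2)[OF V(1)] by simp
    then show ?thesis using f U V by blast
  qed
  show "\<exists>U. h \<in> hom C U Z \<and> g \<in> hom C U X" if "(h, g) \<in> ccompt S R" for h g using *[OF that] by blast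
  show "(h \<odot> s, g \<odot> s) \<in> ccompt S R" if hh: "(h, g) \<in> ccompt S R" "h \<in> hom C U Z" "s \<in> hom C V U" for h g s U V
  proof -
    obtain f U' where f: "(h, f) \<in> S" "(f, g) \<in> R" "h \<in> hom C U' Z" "f \<in> hom C U' Y" using *[OF hh(1)] by blast
    have "U' = U" using homD(2)[OF f(3)] homD(2)[OF hh(2)] by simp
    then show ?thesis using ccD(4)[OF S f(1) hh(2,3)] ccD(4)[OF R f(2) _ hh(3)] f(4) unfolding ccompt_def by blast
  qed
qed

lemma ccomp_cc: "cc X Y R ==> cc Y Z S ==> cc X Z (ccomp X Z S R)"
  unfolding ccomp_def by (rule lc_cc[OF ccompt_crible])

lemma ccompI: "cc X Y R ==> cc Y Z S ==> (h, f) \<in> S ==> (f, g) \<in> R ==> (h, g) \<in> ccomp X Z S R"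
  unfolding ccomp_def using lc_upper[OF ccompt_crible] unfolding ccompt_def by blast

lemma ccomp_iff:
  assumes "h \<in> hom C U Z" "g \<in> hom C U X"
  shows "(h, g) \<in> ccomp X Z S R \<longleftrightarrow> cov U (\<lambda>s. \<exists>f. (h \<odot> s, f) \<in> S \<and> (f, g \<odot> s) \<in> R)"
  unfolding ccomp_def lc_iff[OF assms] by (simp add: ccompt_def)

lemma ccomp_least:
  assumes "cc X Z W" "\<And>h f g. (h, f) \<in> S ==> (f, g) \<in> R ==> (h, g) \<in> W"
  shows "ccomp X Z S R \<subseteq> W"
  unfolding ccomp_def by (rule lc_least[OF _ assms(1)]) (use assms(2) in \<open>auto simp: ccompt_def\<close>)

text \<open>A composite with lc G is bounded by testing on G alone: a span of lc G is locally in G,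
  and the closed crible W absorbs local membership. \<open>ccomp_least3\<close> is the mirror image
  for the left factor.\<close>

lemma ccomp_least2:
  assumes W: "cc X Z W" and T: "cc Y Z T" and R: "cc X Y (lc X Y G)"
    and st: "\<And>k h g. (k, h) \<in> T ==> (h, g) \<in> G ==> (k, g) \<in> W"
  shows "ccomp X Z T (lc X Y G) \<subseteq> W"
proof (rule ccomp_least[OF W])
  fix k h g assume kh: "(k, h) \<in> T" and hg: "(h, g) \<in> lc X Y G"
  obtain U where U: "h \<in> hom C U Y" "g \<in> hom C U X" "cov U (\<lambda>s. (h \<odot> s, g \<odot> s) \<in> G)"
    using hg unfolding lc_def by blast
  obtain V where V: "k \<in> hom C V Z" "h \<in> hom C V Y" using ccD(3)[OF T kh] by blast
  have k: "k \<in> hom C U Z" using V homD(2)[OF V(2)] homD(2)[OF U(1)] by simp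
  show "(k, g) \<in> W"
    by (rule ccD(5)[OF W k U(2)], rule cov_mono[OF U(3) hom_obj(1)[OF U(1)]])
      (use st ccD(4)[OF T kh k] in blast)
qed

lemma ccomp_least3:
  assumes W: "cc X Z W" and R: "cc X Y R" and T: "cc Y Z (lc Y Z G)"
    and st: "\<And>k h g. (k, h) \<in> G ==> (h, g) \<in> R ==> (k, g) \<in> W"
  shows "ccomp X Z (lc Y Z G) R \<subseteq> W"
proof (rule ccomp_least[OF W])
  fix k h g assume kh: "(k, h) \<in> lc Y Z G" and hg: "(h, g) \<in> R"
  obtain U where U: "k \<in> hom C U Z" "h \<in> hom C U Y" "cov U (\<lambda>s. (k \<odot> s, h \<odot> s) \<in> G)"
    using kh unfolding lc_def by blast
  obtain V where V: "h \<in> hom C V Y" "g \<in> hom C V X" using ccD(3)[OF R hg] by blast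
  have g: "g \<in> hom C U X" using V homD(2)[OF V(1)] homD(2)[OF U(2)] by simp
  show "(k, g) \<in> W"
    by (rule ccD(5)[OF W U(1) g], rule cov_mono[OF U(3) hom_obj(1)[OF U(1)]])
      (use st ccD(4)[OF R hg U(2)] in blast)
qed

lemma ccomp_assoc:
  assumes R: "cc W X R" and S: "cc X Y S" and T: "cc Y Z T"
  shows "ccomp W Z T (ccomp W Y S R) = ccomp W Z (ccomp X Z T S) R"
proof
  note SR = ccomp_cc[OF R S] and TS = ccomp_cc[OF S T]
  show "ccomp W Z T (ccomp W Y S R) \<subseteq> ccomp W Z (ccomp X Z T S) R"
    unfolding ccomp_def[of W Y S R]
  proof (rule ccomp_least2[OF ccomp_cc[OF R TS] T SR[unfolded ccomp_def]])
    fix k h g assume "(k, h) \<in> T" "(h, g) \<in> ccompt S R"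
    then obtain f where "(k, h) \<in> T" "(h, f) \<in> S" "(f, g) \<in> R" unfolding ccompt_def by blast
    then show "(k, g) \<in> ccomp W Z (ccomp X Z T S) R" using ccompI[OF R TS] ccompI[OF S T] by blast
  qed
  show "ccomp W Z (ccomp X Z T S) R \<subseteq> ccomp W Z T (ccomp W Y S R)"
    unfolding ccomp_def[of X Z T S]
  proof (rule ccomp_least3[OF ccomp_cc[OF SR T] R TS[unfolded ccomp_def]])
    fix k h g assume "(k, h) \<in> ccompt T S" "(h, g) \<in> R"
    then obtain f where "(k, f) \<in> T" "(f, h) \<in> S" "(h, g) \<in> R" unfolding ccompt_def by blast
    then show "(k, g) \<in> ccomp W Z T (ccomp W Y S R)" using ccompI[OF SR T] ccompI[OF R S] by blast
  qed
qed

lemma ccomp_idr: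
  assumes R: "cc X Y R"
  shows "ccomp X Y R (cid X) = R"
proof
  note X = ccD(1)[OF R]
  show "ccomp X Y R (cid X) \<subseteq> R" unfolding cid_def
    by (rule ccomp_least2[OF R R cid_cc[OF X, unfolded cid_def]]) (auto simp: cidt_def)
  show "R \<subseteq> ccomp X Y R (cid X)"
  proof safe
    fix f g assume h: "(f, g) \<in> R"
    then obtain U where "g \<in> hom C U X" using ccD(3)[OF R] by blast
    then show "(f, g) \<in> ccomp X Y R (cid X)" using ccompI[OF cid_cc[OF X] R h cid_refl] by blast
  qed
qed

lemma ccomp_idl:
  assumes R: "cc X Y R"
  shows "ccomp X Y (cid Y) R = R"
proof
  note Y = ccD(2)[OF R]
  show "ccomp X Y (cid Y) R \<subseteq> R" unfolding cid_def
    by (rule ccomp_least3[OF R R cid_cc[OF Y, unfolded cid_def]]) (auto simp: cidt_def)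
  show "R \<subseteq> ccomp X Y (cid Y) R"
  proof safe
    fix f g assume h: "(f, g) \<in> R"
    then obtain U where "f \<in> hom C U Y" using ccD(3)[OF R] by blast
    then show "(f, g) \<in> ccomp X Y (cid Y) R" using ccompI[OF R cid_cc[OF Y] cid_refl h] by blast
  qed
qed

lemma cc_swap:
  assumes R: "cc X Y R"
  shows "cc Y X (prod.swap ` R)"
proof (rule ccI[OF ccD(2,1)[OF R]])
  show "\<exists>U. f \<in> hom C U X \<and> g \<in> hom C U Y" if "(f, g) \<in> prod.swap ` R" for f g using ccD(3)[OF R] that by fastforce
  show "(f \<odot> s, g \<odot> s) \<in> prod.swap ` R" if "(f, g) \<in> prod.swap ` R" "f \<in> hom C U X" "g \<in> hom C U Y" "s \<in> hom C V U" for f g s U V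
    using ccD(4)[OF R _ that(3,4), of f] that(1) by force
  show "(f, g) \<in> prod.swap ` R" if "f \<in> hom C U X" "g \<in> hom C U Y" "cov U (\<lambda>s. (f \<odot> s, g \<odot> s) \<in> prod.swap ` R)" for f g U
  proof -
    have "cov U (\<lambda>s. (g \<odot> s, f \<odot> s) \<in> R)" by (rule cov_mono[OF that(3) hom_obj(1)[OF that(1)]]) auto
    then show ?thesis using ccD(5)[OF R that(2,1)] by force
  qed
qed

text \<open>Reversal of spans is imposed here as the involution; \<open>canonical_inv\<close> below
  identifies it with the image of the canonical involution of \<open>Q\<close>.\<close>

definition crib :: "('o, 'o \<times> ('m \<times> 'm) set \<times> 'o) inv_quantaloid" where
  "crib = with_inv (crible_quantaloid C J) (\<lambda>(X, R, Y). (Y, prod.swap ` R, X))"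

lemma crib_simps [simp]:
  "Obj crib = Obj C"
  "(X, R, Y) \<in> Arr crib \<longleftrightarrow> cc X Y R"
  "Dom crib (X, R, Y) = X" "Cod crib (X, R, Y) = Y"
  "(X, R, Y) \<sqsubseteq>\<^bsub>crib\<^esub> (X', R', Y') \<longleftrightarrow> X = X' \<and> Y = Y' \<and> R \<subseteq> R'"
  "Inv crib (X, R, Y) = (Y, prod.swap ` R, X)"
  by (auto simp: crib_def crible_quantaloid_def cc_def)

lemma crib_ide [simp]: "X \<in> Obj C ==> Ide crib X = (X, cid X, X)"
proof -
  assume X: "X \<in> Obj C"
  have "crible_closure C J X X {(Ide C X, Ide C X)} = cid X" unfolding cid_def
  proof (rule crible_closure_eq[OF cidt_crible[OF X]])
    show "{(Ide C X, Ide C X)} \<subseteq> cidt X" using ide_in[OF X] by (auto simp: cidt_def)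
    show "cidt X \<subseteq> R" if "cc X X R" "{(Ide C X, Ide C X)} \<subseteq> R" for R
    proof
      fix x assume "x \<in> cidt X"
      then obtain U f where x: "x = (f, f)" "f \<in> hom C U X" by (auto simp: cidt_def)
      show "x \<in> R" using ccD(4)[OF that(1) _ ide_in[OF X] x(2), of "Ide C X"] that(2) idl[OF x(2)] x(1) by auto
    qed
  qed
  then show ?thesis by (simp add: crib_def crible_quantaloid_def)
qed

lemma crib_comp [simp]: "cc X Y R ==> cc Y Z S ==> (Y, S, Z) \<odot>\<^bsub>crib\<^esub> (X, R, Y) = (X, ccomp X Z S R, Z)"
  using crible_closure_eq[OF ccompt_crible, of X Y R Z S "ccompt S R"]
  by (simp add: crib_def crible_quantaloid_def ccomp_def ccompt_def)

lemma hom_crib: "hom crib X Y = {(X, R, Y) | R. cc X Y R}"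
  by (auto simp: hom_def[of crib])

lemma union_crible: "X \<in> Obj C ==> Y \<in> Obj C ==> \<forall>R\<in>P. cc X Y R ==> crible X Y (\<Union>P)"
  unfolding crible_def using ccD(3,4) by (meson UnionE UnionI)

lemma ccomp_swap:
  assumes c: "cc X Y R" "cc Y Z S"
  shows "prod.swap ` ccomp X Z S R = ccomp Z X (prod.swap ` R) (prod.swap ` S)"
proof -
  \<comment> \<open>One inclusion, for arbitrary cribles. Applied to the reversed cribles in
    opposite order it also yields the converse.\<close>
  have sw: "prod.swap ` ccomp X Z S R \<subseteq> ccomp Z X (prod.swap ` R) (prod.swap ` S)" if c: "cc X Y R" "cc Y Z S" for X Y Z R S
  proof -
    have "ccomp X Z S R \<subseteq> prod.swap ` ccomp Z X (prod.swap ` R) (prod.swap ` S)"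
    proof (rule ccomp_least[OF cc_swap[OF ccomp_cc[OF cc_swap[OF c(2)] cc_swap[OF c(1)]]]])
      fix h f g assume "(h, f) \<in> S" "(f, g) \<in> R"
      then have "(g, h) \<in> ccomp Z X (prod.swap ` R) (prod.swap ` S)"
        using ccompI[OF cc_swap[OF c(2)] cc_swap[OF c(1)], of g f h] by force
      then show "(h, g) \<in> prod.swap ` ccomp Z X (prod.swap ` R) (prod.swap ` S)" by force
    qed
    then show ?thesis by force
  qed
  have ss: "prod.swap ` prod.swap ` R = R" for R :: "('m \<times> 'm) set" by force
  have "prod.swap ` ccomp Z X (prod.swap ` R) (prod.swap ` S) \<subseteq> ccomp X Z S R"
    using sw[OF cc_swap[OF c(2)] cc_swap[OF c(1)]] unfolding ss .
  then have "ccomp Z X (prod.swap ` R) (prod.swap ` S) \<subseteq> prod.swap ` ccomp X Z S R" using ss by blast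
  then show ?thesis using sw[OF c] by blast
qed

lemma crib_inv_quantaloid: "is_inv_quantaloid crib"
proof (rule inv_quantaloidI)
  show "is_category crib" unfolding is_category_def
  proof (intro conjI allI ballI)
    fix f assume "f \<in> Arr crib"
    then show "Dom crib f \<in> Obj crib" "Cod crib f \<in> Obj crib" by (cases f; use ccD(1,2) in fastforce)+
  next
    fix X Y f assume "f \<in> hom crib X Y"
    then obtain R where f: "f = (X, R, Y)" "cc X Y R" by (auto simp: hom_crib)
    note X = ccD(1,2)[OF f(2)]
    show "f \<odot>\<^bsub>crib\<^esub> Ide crib X = f" "Ide crib Y \<odot>\<^bsub>crib\<^esub> f = f"
      using crib_comp[OF cid_cc[OF X(1)] f(2)] crib_comp[OF f(2) cid_cc[OF X(2)]]
        ccomp_idl[OF f(2)] ccomp_idr[OF f(2)] X f(1) by simp_all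
  next
    fix W X Y Z f g h assume "f \<in> hom crib W X" "g \<in> hom crib X Y" "h \<in> hom crib Y Z"
    then obtain R S T where e: "f = (W, R, X)" "g = (X, S, Y)" "h = (Y, T, Z)" and c: "cc W X R" "cc X Y S" "cc Y Z T"
      by (auto simp: hom_crib)
    show "h \<odot>\<^bsub>crib\<^esub> (g \<odot>\<^bsub>crib\<^esub> f) = h \<odot>\<^bsub>crib\<^esub> g \<odot>\<^bsub>crib\<^esub> f"
      using crib_comp[OF c(1,2)] crib_comp[OF c(2,3)] crib_comp[OF ccomp_cc[OF c(1,2)] c(3)]
        crib_comp[OF c(1) ccomp_cc[OF c(2,3)]] ccomp_assoc[OF c] by (simp add: e)
  qed (use cid_cc ccomp_cc in \<open>auto simp: hom_crib\<close>)
next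
  fix X Y f assume "f \<in> hom crib X Y"
  then obtain R where f: "f = (X, R, Y)" "cc X Y R" by (auto simp: hom_crib)
  show "f \<sqsubseteq>\<^bsub>crib\<^esub> f" by (simp add: f(1))
  show "Inv crib f \<in> hom crib Y X" "Inv crib (Inv crib f) = f" using cc_swap[OF f(2)] by (auto simp: f(1) hom_crib image_image)
next
  fix X Y Z f g assume "f \<in> hom crib X Y" "g \<in> hom crib Y Z"
  then obtain R S where f: "f = (X, R, Y)" "g = (Y, S, Z)" and c: "cc X Y R" "cc Y Z S" by (auto simp: hom_crib)
  show "Inv crib (g \<odot>\<^bsub>crib\<^esub> f) = Inv crib f \<odot>\<^bsub>crib\<^esub> Inv crib g"
    using ccomp_swap[OF c] c cc_swap[OF c(1)] cc_swap[OF c(2)] by (simp add: f)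
next
  fix X Y S assume o: "X \<in> Obj crib" "Y \<in> Obj crib" and S: "S \<subseteq> hom crib X Y"
  define P where "P = {R. (X, R, Y) \<in> S}"
  have X: "X \<in> Obj C" "Y \<in> Obj C" using o by simp_all
  have Sf: "(\<forall>f\<in>S. K f) \<longleftrightarrow> (\<forall>R\<in>P. K (X, R, Y))" for K using S by (fastforce simp: P_def hom_crib)
  have P: "\<forall>R\<in>P. cc X Y R" using S by (auto simp: P_def hom_crib)
  note u = union_crible[OF X P] note j = lc_cc[OF u]
  have up: "R \<subseteq> lc X Y (\<Union>P)" if "R \<in> P" for R using lc_upper[OF u] that by blast
  have "is_lub crib X Y S (X, lc X Y (\<Union>P), Y)" unfolding is_lub_def Sf
  proof (intro conjI ballI impI)
    show "(X, lc X Y (\<Union>P), Y) \<in> hom crib X Y" using j by (simp add: hom_crib)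
    show "(X, R, Y) \<sqsubseteq>\<^bsub>crib\<^esub> (X, lc X Y (\<Union>P), Y)" if "R \<in> P" for R using up[OF that] by simp
    fix t assume t: "t \<in> hom crib X Y" "\<forall>R\<in>P. (X, R, Y) \<sqsubseteq>\<^bsub>crib\<^esub> t"
    then obtain W where W: "t = (X, W, Y)" "cc X Y W" by (auto simp: hom_crib)
    have "\<Union>P \<subseteq> W" using t(2) by (auto simp: W(1))
    then show "(X, lc X Y (\<Union>P), Y) \<sqsubseteq>\<^bsub>crib\<^esub> t" using lc_least[OF _ W(2)] by (simp add: W(1))
  qed
  moreover have "g \<odot>\<^bsub>crib\<^esub> (X, lc X Y (\<Union>P), Y) \<sqsubseteq>\<^bsub>crib\<^esub> t \<longleftrightarrow> (\<forall>f\<in>S. g \<odot>\<^bsub>crib\<^esub> f \<sqsubseteq>\<^bsub>crib\<^esub> t)"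
    if h: "g \<in> hom crib Y Z" "t \<in> hom crib X Z" for Z g t
  proof -
    obtain T W where g: "g = (Y, T, Z)" "cc Y Z T" and t: "t = (X, W, Z)" "cc X Z W" using h by (auto simp: hom_crib)
    have "ccomp X Z T (lc X Y (\<Union>P)) \<subseteq> W \<longleftrightarrow> (\<forall>R\<in>P. ccomp X Z T R \<subseteq> W)"
    proof
      assume a: "ccomp X Z T (lc X Y (\<Union>P)) \<subseteq> W"
      show "\<forall>R\<in>P. ccomp X Z T R \<subseteq> W"
        by (intro ballI ccomp_least[OF t(2)]) (use a ccompI[OF j g(2)] up in blast)
    next
      assume a: "\<forall>R\<in>P. ccomp X Z T R \<subseteq> W"
      show "ccomp X Z T (lc X Y (\<Union>P)) \<subseteq> W"
        by (rule ccomp_least2[OF t(2) g(2) j]) (use a P ccompI[OF _ g(2)] in blast)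
    qed
    then show ?thesis unfolding Sf using P j g(2) by (simp add: g(1) t(1))
  qed
  ultimately show "\<exists>s. is_lub crib X Y S s \<and> (\<forall>Z. \<forall>g\<in>hom crib Y Z. \<forall>t\<in>hom crib X Z. g \<odot>\<^bsub>crib\<^esub> s \<sqsubseteq>\<^bsub>crib\<^esub> t \<longleftrightarrow> (\<forall>f\<in>S. g \<odot>\<^bsub>crib\<^esub> f \<sqsubseteq>\<^bsub>crib\<^esub> t))" by blast
qed (auto 0 4 simp: hom_crib)

end

section \<open>Graphs of arrows of the site and tabulation of cribles by spans\<close>

context site
begin

sublocale crib: iqloid crib
  using crib_inv_quantaloid by unfold_locales

abbreviation cmp (infixl "\<bullet>" 70) where "g \<bullet> f \<equiv> g \<odot>\<^bsub>crib\<^esub> f"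
abbreviation leq (infix "\<preceq>" 50) where "f \<preceq> g \<equiv> f \<sqsubseteq>\<^bsub>crib\<^esub> g"

text \<open>The graph of f: the closed crible generated by the span (f, 1). It is the embedding of
  the site into symmetric left adjoints.\<close>

definition gr :: "'o => 'o => 'm => ('m \<times> 'm) set" where
  "gr U X f = lc U X {(f \<odot> t, t) | V t. t \<in> hom C V U}"

context
  fixes U X f
  assumes f: "f \<in> hom C U X"
begin

lemma gr_crible: "crible U X {(f \<odot> t, t) | V t. t \<in> hom C V U}"
  unfolding crible_def
proof (intro conjI allI impI)
  fix W V a b s assume h: "(a, b) \<in> {(f \<odot> t, t) | V t. t \<in> hom C V U}" "a \<in> hom C W X" "s \<in> hom C V W"
  then obtain V' where b: "a = f \<odot> b" "b \<in> hom C V' U" by blast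
  have "V' = W" using homD(2)[OF comp_in[OF f b(2)]] homD(2)[OF h(2)] b(1) by simp
  then show "(a \<odot> s, b \<odot> s) \<in> {(f \<odot> t, t) | V t. t \<in> hom C V U}"
  proof -
    have "b \<odot> s \<in> hom C V U" using comp_in[OF b(2)] h(3) \<open>V' = W\<close> by simp
    moreover have "(a \<odot> s, b \<odot> s) = (f \<odot> (b \<odot> s), b \<odot> s)" using assoc[OF f b(2)] h(3) \<open>V' = W\<close> b(1) by simp
    ultimately show ?thesis by blast
  qed
qed (use hom_obj[OF f] comp_in[OF f] in auto)

lemma gr_cc: "cc U X (gr U X f)"
  unfolding gr_def by (rule lc_cc[OF gr_crible])

lemma gr_in: "(U, gr U X f, X) \<in> hom crib U X"
  using gr_cc by (simp add: hom_crib)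

lemma grI: "t \<in> hom C V U ==> (f \<odot> t, t) \<in> gr U X f"
  unfolding gr_def by (rule subsetD[OF lc_upper[OF gr_crible]]) blast

lemma grD:
  assumes "(a, b) \<in> gr U X f" "a \<in> hom C V X" "b \<in> hom C V U"
  shows "cov V (\<lambda>s. a \<odot> s = f \<odot> (b \<odot> s))"
proof -
  have "cov V (\<lambda>s. (a \<odot> s, b \<odot> s) \<in> {(f \<odot> t, t) | V t. t \<in> hom C V U})"
    using assms lc_iff unfolding gr_def by blast
  then show ?thesis by (rule cov_mono[OF _ hom_obj(1)[OF assms(2)]]) auto
qed

end

lemma cc_spanE:
  assumes "cc X Y R" "(f, g) \<in> R"
  obtains U where "f \<in> hom C U Y" "g \<in> hom C U X"
  using ccD(3)[OF assms] by blast

lemma cc_span2: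
  assumes "cc X Y R" "(f, g) \<in> R"
  shows "f \<in> hom C U Y ==> g \<in> hom C U X" "g \<in> hom C U X ==> f \<in> hom C U Y"
  using cc_spanE[OF assms] homD(2) by metis+

text \<open>A span (k, l) linked through h by the two graphs is locally (f h s, g h s), a
  restriction of (f, g). With g = f and W the identity this is the counit for a graph; in general it
  bounds one term of a tabulation.\<close>

lemma gr_span:
  assumes f: "f \<in> hom C U Y" and g: "g \<in> hom C U X" and W: "cc X Y W" and fg: "(f, g) \<in> W"
  shows "ccomp X Y (gr U Y f) (prod.swap ` gr U X g) \<subseteq> W"
proof (rule ccomp_least[OF W])
  fix k h l assume h: "(k, h) \<in> gr U Y f" "(h, l) \<in> prod.swap ` gr U X g"
  then have hl: "(l, h) \<in> gr U X g" by auto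
  obtain V where k: "k \<in> hom C V Y" "h \<in> hom C V U" using cc_spanE[OF gr_cc[OF f] h(1)] .
  have l: "l \<in> hom C V X" using cc_span2(2)[OF gr_cc[OF g] hl k(2)] .
  have "cov V (\<lambda>s. k \<odot> s = f \<odot> (h \<odot> s) \<and> l \<odot> s = g \<odot> (h \<odot> s))"
    using cov_conj[OF grD[OF f h(1) k] grD[OF g hl l k(2)] hom_obj(1)[OF l]] .
  then have "cov V (\<lambda>s. (k \<odot> s, l \<odot> s) \<in> W)"
    by (rule cov_mono[OF _ hom_obj(1)[OF l]]) (simp add: ccD(4)[OF W fg f comp_in[OF k(2)]])
  then show "(k, l) \<in> W" by (rule ccD(5)[OF W k(1) l])
qed

lemma gr_sla:
  assumes f: "f \<in> hom C U X"
  shows "sym_left_adjoint crib (U, gr U X f, X)"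
proof -
  note c = gr_cc[OF f] note s = cc_swap[OF c] note o = hom_obj[OF f]
  have "cid U \<subseteq> ccomp U U (prod.swap ` gr U X f) (gr U X f)"
  proof (rule cid_least[OF ccomp_cc[OF c s]])
    fix V t assume "t \<in> hom C V U"
    then show "(t, t) \<in> ccomp U U (prod.swap ` gr U X f) (gr U X f)"
      using ccompI[OF c s _ grI[OF f], of t t V] grI[OF f] by force
  qed
  moreover have "ccomp X X (gr U X f) (prod.swap ` gr U X f) \<subseteq> cid X"
    using gr_span[OF f f cid_cc[OF o(2)] cid_refl[OF f]] .
  ultimately show ?thesis
    using crib.sym_left_adjoint_iff[OF gr_in[OF f]] crib_comp[OF c s] crib_comp[OF s c] o by simp
qed

text \<open>A closed crible is the join, over its spans (f, g), of the composites of the graph of f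
  with the reversed graph of g. Each such composite contains (f, g), through the identity in the
  middle.\<close>

lemma crib_tabular:
  assumes q: "q \<in> hom crib X Y" and t: "t \<in> hom crib X Y"
    and le: "\<And>U f g. U \<in> Obj C ==> f \<in> hom crib U Y ==> g \<in> hom crib U X ==> sym_left_adjoint crib f ==>
      sym_left_adjoint crib g ==> f \<bullet> Inv crib g \<preceq> q ==> f \<bullet> Inv crib g \<preceq> t"
  shows "q \<preceq> t"
proof -
  obtain R T where q: "q = (X, R, Y)" "cc X Y R" and t: "t = (X, T, Y)" "cc X Y T" using q t by (auto simp: hom_crib)
  have "R \<subseteq> T"
  proof safe
    fix f g assume fg: "(f, g) \<in> R"
    then obtain U where f: "f \<in> hom C U Y" and g: "g \<in> hom C U X" using cc_spanE[OF q(2)] by blast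
    note U = hom_obj(1)[OF f]
    note c = crib_comp[OF cc_swap[OF gr_cc[OF g]] gr_cc[OF f]]
    have "ccomp X Y (gr U Y f) (prod.swap ` gr U X g) \<subseteq> T"
      using le[OF U gr_in[OF f] gr_in[OF g] gr_sla[OF f] gr_sla[OF g]] gr_span[OF f g q(2) fg] c by (simp add: q t)
    moreover have "(f, g) \<in> ccomp X Y (gr U Y f) (prod.swap ` gr U X g)"
      using ccompI[OF cc_swap[OF gr_cc[OF g]] gr_cc[OF f], of f "Ide C U" g] grI[OF f ide_in[OF U]] grI[OF g ide_in[OF U]]
        idr[OF f] idr[OF g] by force
    ultimately show "(f, g) \<in> T" by blast
  qed
  then show ?thesis by (simp add: q t)
qed

end

text \<open>
  A left adjoint distributor from a one-point category into a symmetric category is a pair of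
  families \<open>\<phi>\<close>, \<open>\<psi>\<close> as below; the property says that it is symmetric.
\<close>

definition bilateral :: "'i itself => ('o, 'm, 'z) inv_quantaloid_scheme => bool" where
  "bilateral _ L \<longleftrightarrow> (\<forall>I t U \<phi> \<psi> A. U \<in> Obj L -->
     (\<forall>i\<in>I. \<phi> i \<in> hom L U (t i) \<and> \<psi> i \<in> hom L (t i) U) -->
     (\<forall>i\<in>I. \<forall>j\<in>I. A i j \<in> hom L (t j) (t i) \<and> Inv L (A i j) = A j i \<and> \<phi> i \<odot>\<^bsub>L\<^esub> \<psi> j \<sqsubseteq>\<^bsub>L\<^esub> A i j \<and>
       \<psi> i \<odot>\<^bsub>L\<^esub> A i j \<sqsubseteq>\<^bsub>L\<^esub> \<psi> j \<and> A i j \<odot>\<^bsub>L\<^esub> \<phi> j \<sqsubseteq>\<^bsub>L\<^esub> \<phi> i) -->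
     (\<forall>w\<in>hom L U U. (\<forall>i\<in>I. \<psi> i \<odot>\<^bsub>L\<^esub> \<phi> i \<sqsubseteq>\<^bsub>L\<^esub> w) --> Ide L U \<sqsubseteq>\<^bsub>L\<^esub> w) -->
     (\<forall>i\<in>(I :: 'i set). \<psi> i = Inv L (\<phi> i)))"

text \<open>
  Locally the unit provides \<open>j\<close> and \<open>h\<close> with \<open>(g, h) \<in> \<psi> j\<close> and \<open>(h, g) \<in> \<phi> j\<close>. If \<open>(f, g) \<in> \<phi> i\<close>, the
  counit gives \<open>(f, h) \<in> A i j\<close>, so \<open>(h, f) \<in> A j i\<close> by symmetry and \<open>(g, f) \<in> \<psi> i\<close>; the converse
  is dual.
\<close>

lemma (in site) crib_bilateral: "bilateral TYPE('i) crib"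
  unfolding bilateral_def
proof (intro allI impI ballI)
  fix I :: "'i set" and t U \<phi> \<psi> A i
  assume U: "U \<in> Obj crib" and 1: "\<forall>i\<in>I. \<phi> i \<in> hom crib U (t i) \<and> \<psi> i \<in> hom crib (t i) U"
    and 2: "\<forall>i\<in>I. \<forall>j\<in>I. A i j \<in> hom crib (t j) (t i) \<and> Inv crib (A i j) = A j i \<and> \<phi> i \<bullet> \<psi> j \<preceq> A i j \<and>
       \<psi> i \<bullet> A i j \<preceq> \<psi> j \<and> A i j \<bullet> \<phi> j \<preceq> \<phi> i"
    and 3: "\<forall>w\<in>hom crib U U. (\<forall>i\<in>I. \<psi> i \<bullet> \<phi> i \<preceq> w) --> Ide crib U \<preceq> w"
    and i: "i \<in> I"
  define p where "p i = fst (snd (\<phi> i))" for i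
  define q where "q i = fst (snd (\<psi> i))" for i
  define a where "a i j = fst (snd (A i j))" for i j
  have p: "\<phi> i = (U, p i, t i)" "cc U (t i) (p i)" and q: "\<psi> i = (t i, q i, U)" "cc (t i) U (q i)" if "i \<in> I" for i
    using 1 that by (auto simp: p_def q_def hom_crib)
  have a: "A i j = (t j, a i j, t i)" "cc (t j) (t i) (a i j)" if "i \<in> I" "j \<in> I" for i j
    using 2[rule_format, OF that, THEN conjunct1] by (auto simp: a_def hom_crib)
  have as: "(g, f) \<in> a j i" if "(f, g) \<in> a i j" "i \<in> I" "j \<in> I" for f g i j
  proof -
    have "(t i, prod.swap ` a i j, t j) = (t i, a j i, t j)"
      using 2 that(2,3) by (metis a(1) crib_simps(6))
    then show ?thesis using that(1) by auto
  qed
  have pq: "(f, h) \<in> a i j" if h: "(f, g) \<in> p i" "(g, h) \<in> q j" "i \<in> I" "j \<in> I" for f g h i j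
  proof -
    have "\<phi> i \<bullet> \<psi> j \<preceq> A i j" using 2 h(3,4) by blast
    then have "ccomp (t j) (t i) (p i) (q j) \<subseteq> a i j"
      using crib_comp[OF q(2)[OF h(4)] p(2)[OF h(3)]] p(1)[OF h(3)] q(1)[OF h(4)] a(1)[OF h(3,4)] by simp
    then show ?thesis using ccompI[OF q(2)[OF h(4)] p(2)[OF h(3)] h(1,2)] by blast
  qed
  have qa: "(f, h) \<in> q j" if h: "(f, g) \<in> q i" "(g, h) \<in> a i j" "i \<in> I" "j \<in> I" for f g h i j
  proof -
    have "\<psi> i \<bullet> A i j \<preceq> \<psi> j" using 2 h(3,4) by blast
    then have "ccomp (t j) U (q i) (a i j) \<subseteq> q j"
      using crib_comp[OF a(2)[OF h(3,4)] q(2)[OF h(3)]] q(1)[OF h(3)] q(1)[OF h(4)] a(1)[OF h(3,4)] by simp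
    then show ?thesis using ccompI[OF a(2)[OF h(3,4)] q(2)[OF h(3)] h(1,2)] by blast
  qed
  have ap: "(f, h) \<in> p i" if h: "(f, g) \<in> a i j" "(g, h) \<in> p j" "i \<in> I" "j \<in> I" for f g h i j
  proof -
    have "A i j \<bullet> \<phi> j \<preceq> \<phi> i" using 2 h(3,4) by blast
    then have "ccomp U (t i) (a i j) (p j) \<subseteq> p i"
      using crib_comp[OF p(2)[OF h(4)] a(2)[OF h(3,4)]] p(1)[OF h(3)] p(1)[OF h(4)] a(1)[OF h(3,4)] by simp
    then show ?thesis using ccompI[OF p(2)[OF h(4)] a(2)[OF h(3,4)] h(1,2)] by blast
  qed
  \<comment> \<open>The local closure of this union is the join of the composites \<psi> i \<phi> i,
    hence the sharpest bound w to which the unit hypothesis \<open>3\<close> applies.\<close>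
  define T where "T = (\<Union>i\<in>I. ccomp U U (q i) (p i))"
  have Ti: "cc U U (ccomp U U (q i) (p i))" if "i \<in> I" for i using ccomp_cc[OF p(2)[OF that] q(2)[OF that]] .
  have T: "crible U U T" unfolding T_def by (rule union_crible) (use U Ti in auto)
  have "Ide crib U \<preceq> (U, lc U U T, U)"
  proof (rule 3[rule_format])
    show "(U, lc U U T, U) \<in> hom crib U U" using lc_cc[OF T] by (simp add: hom_crib)
    show "\<psi> i \<bullet> \<phi> i \<preceq> (U, lc U U T, U)" if "i \<in> I" for i
      using lc_upper[OF T] that crib_comp[OF p(2)[OF that] q(2)[OF that]] p(1)[OF that] q(1)[OF that] by (auto simp: T_def)
  qed
  then have id: "(Ide C U, Ide C U) \<in> lc U U T" using cid_refl[OF ide_in, of U] U by auto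
  have ne: "cov V (\<lambda>s. \<exists>j\<in>I. \<exists>h. (g \<odot> s, h) \<in> q j \<and> (h, g \<odot> s) \<in> p j)" if g: "g \<in> hom C V U" for g V
  proof (rule cov_trans)
    note UU = hom_obj(2)[OF g]
    have "cov U (\<lambda>s. (s, s) \<in> T)"
      using id lc_iff[OF ide_in[OF UU] ide_in[OF UU]] cov_mono[OF _ UU, of "\<lambda>s. (Ide C U \<odot> s, Ide C U \<odot> s) \<in> T"] idl by auto
    from cov_pull[OF this g] show "cov V (\<lambda>s. (g \<odot> s, g \<odot> s) \<in> T)" .
    show "V \<in> Obj C" using hom_obj(1)[OF g] .
    show "cov W (\<lambda>t. \<exists>j\<in>I. \<exists>h. (g \<odot> (s \<odot> t), h) \<in> q j \<and> (h, g \<odot> (s \<odot> t)) \<in> p j)"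
      if s: "s \<in> hom C W V" "(g \<odot> s, g \<odot> s) \<in> T" for W s
    proof -
      obtain j where j: "j \<in> I" "(g \<odot> s, g \<odot> s) \<in> ccomp U U (q j) (p j)" using s(2) by (auto simp: T_def)
      have "cov W (\<lambda>t. \<exists>h. ((g \<odot> s) \<odot> t, h) \<in> q j \<and> (h, (g \<odot> s) \<odot> t) \<in> p j)"
        using j(2) ccomp_iff[OF comp_in[OF g s(1)] comp_in[OF g s(1)]] by blast
      then show ?thesis by (rule cov_mono[OF _ hom_obj(1)[OF s(1)]]) (use j(1) assoc[OF g s(1)] in auto)
    qed
    show "\<exists>j\<in>I. \<exists>h. (g \<odot> (s \<odot> t), h) \<in> q j \<and> (h, g \<odot> (s \<odot> t)) \<in> p j"
      if s: "s \<in> hom C W V" "\<exists>j\<in>I. \<exists>h. (g \<odot> s, h) \<in> q j \<and> (h, g \<odot> s) \<in> p j" "t \<in> hom C X W" for W X s t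
    proof -
      obtain j h where j: "j \<in> I" "(g \<odot> s, h) \<in> q j" "(h, g \<odot> s) \<in> p j" using s(2) by blast
      note gs = comp_in[OF g s(1)] note h = cc_span2(1)[OF q(2)[OF j(1)] j(2) gs]
      show ?thesis using ccD(4)[OF q(2)[OF j(1)] j(2) gs s(3)] ccD(4)[OF p(2)[OF j(1)] j(3) h s(3)]
          assoc[OF g s(1,3)] j(1) by auto
    qed
  qed
  have "(g, f) \<in> q i \<longleftrightarrow> (f, g) \<in> p i" for f g
  proof
    assume fg: "(f, g) \<in> p i"
    obtain V where f: "f \<in> hom C V (t i)" and g: "g \<in> hom C V U" using cc_spanE[OF p(2)[OF i] fg] .
    have "cov V (\<lambda>s. (g \<odot> s, f \<odot> s) \<in> q i)"
    proof (rule cov_mono[OF ne[OF g] hom_obj(1)[OF g]])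
      fix W s assume s: "s \<in> hom C W V" "\<exists>j\<in>I. \<exists>h. (g \<odot> s, h) \<in> q j \<and> (h, g \<odot> s) \<in> p j"
      then obtain j h where j: "j \<in> I" "(g \<odot> s, h) \<in> q j" "(h, g \<odot> s) \<in> p j" by blast
      have "(f \<odot> s, h) \<in> a i j" using pq[OF ccD(4)[OF p(2)[OF i] fg f s(1)] j(2) i j(1)] .
      from qa[OF j(2) as[OF this i j(1)] j(1) i] show "(g \<odot> s, f \<odot> s) \<in> q i" .
    qed
    then show "(g, f) \<in> q i" by (rule ccD(5)[OF q(2)[OF i] g f])
  next
    assume gf: "(g, f) \<in> q i"
    obtain V where f: "f \<in> hom C V (t i)" and g: "g \<in> hom C V U" using cc_spanE[OF q(2)[OF i] gf] .
    have "cov V (\<lambda>s. (f \<odot> s, g \<odot> s) \<in> p i)"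
    proof (rule cov_mono[OF ne[OF g] hom_obj(1)[OF g]])
      fix W s assume s: "s \<in> hom C W V" "\<exists>j\<in>I. \<exists>h. (g \<odot> s, h) \<in> q j \<and> (h, g \<odot> s) \<in> p j"
      then obtain j h where j: "j \<in> I" "(g \<odot> s, h) \<in> q j" "(h, g \<odot> s) \<in> p j" by blast
      have "(h, f \<odot> s) \<in> a j i" using pq[OF j(3) ccD(4)[OF q(2)[OF i] gf g s(1)] j(1) i] .
      from ap[OF as[OF this j(1) i] j(3) i j(1)] show "(f \<odot> s, g \<odot> s) \<in> p i" .
    qed
    then show "(f, g) \<in> p i" by (rule ccD(5)[OF p(2)[OF i] f g])
  qed
  then have "prod.swap ` p i = q i" by force
  then show "\<psi> i = Inv crib (\<phi> i)" using p(1)[OF i] q(1)[OF i] by simp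
qed

text \<open>All data and inequalities are pushed to L; the bound w in the unit hypothesis comes from
  K by fullness. The resulting equation is pulled back by faithfulness.\<close>

lemma bilateral_embedding:
  fixes K :: "('o, 'm, 'z) inv_quantaloid_scheme" (structure)
  assumes F: "dagger_embedding K L Fo Fm" and b: "bilateral TYPE('i) L"
  shows "bilateral TYPE('i) K"
  unfolding bilateral_def
proof (intro allI impI)
  note F1 = dagger_embeddingD(1)[OF F] note f = cat_embeddingD[OF F1]
  note le = dagger_embeddingD(2)[OF F] and fi = dagger_embeddingD(3,4)[OF F]
  fix I :: "'i set" and t U \<phi> \<psi> A
  assume U: "U \<in> Obj K" and 1: "\<forall>i\<in>I. \<phi> i \<in> hom K U (t i) \<and> \<psi> i \<in> hom K (t i) U"
    and 2: "\<forall>i\<in>I. \<forall>j\<in>I. A i j \<in> hom K (t j) (t i) \<and> Inv K (A i j) = A j i \<and> \<phi> i \<odot> \<psi> j \<sqsubseteq> A i j \<and>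
       \<psi> i \<odot> A i j \<sqsubseteq> \<psi> j \<and> A i j \<odot> \<phi> j \<sqsubseteq> \<phi> i"
    and 3: "\<forall>w\<in>hom K U U. (\<forall>i\<in>I. \<psi> i \<odot> \<phi> i \<sqsubseteq> w) --> Ide K U \<sqsubseteq> w"
  have 1: "\<phi> i \<in> hom K U (t i)" "\<psi> i \<in> hom K (t i) U" if "i \<in> I" for i using 1 that by blast+
  have A: "A i j \<in> hom K (t j) (t i)" if "i \<in> I" "j \<in> I" for i j using 2 that by blast
  have "Fm (\<psi> i) = Inv L (Fm (\<phi> i))" if i: "i \<in> I" for i
  proof (rule b[unfolded bilateral_def, rule_format, where I = I and U = "Fo U" and t = "\<lambda>i. Fo (t i)" and A = "\<lambda>i j. Fm (A i j)"
        and \<phi> = "\<lambda>i. Fm (\<phi> i)" and \<psi> = "\<lambda>i. Fm (\<psi> i)"])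
    show "i \<in> I" by (rule i)
    show "Fo U \<in> Obj L" using f(5)[OF U] .
    show "Fm (\<phi> i) \<in> hom L (Fo U) (Fo (t i)) \<and> Fm (\<psi> i) \<in> hom L (Fo (t i)) (Fo U)" if "i \<in> I" for i
      using 1[OF that] embedding_in[OF F1] by blast
    show "Fm (A i j) \<in> hom L (Fo (t j)) (Fo (t i)) \<and> Inv L (Fm (A i j)) = Fm (A j i) \<and> Fm (\<phi> i) \<odot>\<^bsub>L\<^esub> Fm (\<psi> j) \<sqsubseteq>\<^bsub>L\<^esub> Fm (A i j) \<and>
       Fm (\<psi> i) \<odot>\<^bsub>L\<^esub> Fm (A i j) \<sqsubseteq>\<^bsub>L\<^esub> Fm (\<psi> j) \<and> Fm (A i j) \<odot>\<^bsub>L\<^esub> Fm (\<phi> j) \<sqsubseteq>\<^bsub>L\<^esub> Fm (\<phi> i)" if ij: "i \<in> I" "j \<in> I" for i j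
    proof -
      note p = 1[OF ij(1)] 1[OF ij(2)] A[OF ij]
      show ?thesis
        using 2[rule_format, OF ij] embedding_in[OF F1 p(5)] fi(2)[OF p(5)] f(8)[OF p(1,4)] f(8)[OF p(2,5)] f(8)[OF p(5,3)]
          le[OF f(4)[OF p(1,4)] p(5)] le[OF f(4)[OF p(2,5)] p(4)] le[OF f(4)[OF p(5,3)] p(1)] by simp
    qed
    fix w assume w: "w \<in> hom L (Fo U) (Fo U)" "\<And>i. i \<in> I ==> Fm (\<psi> i) \<odot>\<^bsub>L\<^esub> Fm (\<phi> i) \<sqsubseteq>\<^bsub>L\<^esub> w"
    obtain v where v: "v \<in> hom K U U" "Fm v = w" using embedding_surj[OF F1 U U w(1)] .
    have "\<psi> i \<odot> \<phi> i \<sqsubseteq> v" if "i \<in> I" for i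
      using w(2) that f(8)[OF 1(2)[OF that] 1(1)[OF that]] le[OF f(4)[OF 1(2)[OF that] 1(1)[OF that]] v(1)] v(2) by simp
    then show "Ide L (Fo U) \<sqsubseteq>\<^bsub>L\<^esub> w" using 3 v le[OF f(3)[OF U] v(1)] f(7)[OF U] by auto
  qed
  then show "\<forall>i\<in>I. \<psi> i = Inv K (\<phi> i)"
    using embedding_inj[OF F1 1(2) fi(1)[OF 1(1)]] fi(2)[OF 1(1)] by auto
qed

section \<open>Cauchy completeness and symmetric completeness\<close>

text \<open>A symmetric left adjoint is a left adjoint, which gives one direction. For the other,
  bilaterality applied to each column of M shows that its right adjoint N is the involute. But the
  domain B may fail to be symmetric, so M itself need not be an arrow of \<open>SymDist\<close>; it
  is therefore represented one column at a time, and the representing objects are assembled into a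
  functor.\<close>

lemma (in iqloid) cauchy_complete_iff:
  fixes A :: "('u, 'o, 'm) qcat"
  assumes U: "universe TYPE('u)" and bil: "bilateral TYPE('u) Q" and A: "is_qcat Q A" "symm A"
  shows "cauchy_complete Q A \<longleftrightarrow> symmetrically_complete Q A"
proof
  assume c: "cauchy_complete Q A"
  show "symmetrically_complete Q A" unfolding symmetrically_complete_def
  proof (intro allI impI)
    fix B :: "('u, 'o, 'm) qcat" and M assume s: "sym_left_adjoint (SymDist Q) (B, M, A)"
    then have d: "dst B A M" "symm B" unfolding sym_left_adjoint_def adjoint_def by auto
    have "adjoint (Dist Q) (B, M, A) (A, dinv B A M, B)"
      using s dinv_dst[OF d A(2)] d unfolding sym_left_adjoint_def adjoint_def by (auto simp: hom_Dist)
    then show "\<exists>F. is_qfunctor Q B A F \<and> (B, M, A) = represented B A F"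
      using c unfolding cauchy_complete_def left_adjoint_def by blast
  qed
next
  note a = qcatD[OF A(1)]
  assume sc: "symmetrically_complete Q A"
  show "cauchy_complete Q A" unfolding cauchy_complete_def
  proof (intro allI impI)
    fix B :: "('u, 'o, 'm) qcat" and M assume "left_adjoint (Dist Q) (B, M, A)"
    then obtain N where "adjoint (Dist Q) (B, M, A) (A, N, B)"
      unfolding left_adjoint_def adjoint_def by (auto simp: hom_Dist)
    then have M: "dst B A M" and N: "dst A B N"
      and unit: "\<And>x y. x \<in> qobj B ==> y \<in> qobj B ==> qhom B y x \<sqsubseteq> dcomp B A B N M y x"
      and counit: "\<And>x y. x \<in> qobj A ==> y \<in> qobj A ==> dcomp A B A M N y x \<sqsubseteq> qhom A y x"
      unfolding adjoint_def by (auto simp: hom_Dist)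
    have B: "is_qcat Q B" using dstD(1)[OF M] . note b = qcatD[OF B]
    note p = dstD(3)[OF M] and q = dstD(3)[OF N]
    have un: "Ide Q (qty B x) \<sqsubseteq> w" if x: "x \<in> qobj B" and w: "w \<in> hom Q (qty B x) (qty B x)"
      and le: "\<forall>y\<in>qobj A. N x y \<odot> M y x \<sqsubseteq> w" for x w
    proof -
      have "dcomp B A B N M x x \<sqsubseteq> w" using dcomp_le_iff[OF M N x x w] le by blast
      then have "qhom B x x \<sqsubseteq> w" by (rule le_trans[OF unit[OF x x] _ b(2)[OF x x] dcomp_in[OF M N x x] w])
      then show ?thesis by (rule le_trans[OF b(4)[OF x] _ ide_in[OF b(1)[OF x]] b(2)[OF x x] w])
    qed
    have co: "M y' x \<odot> N x y \<sqsubseteq> qhom A y' y" if "x \<in> qobj B" "y \<in> qobj A" "y' \<in> qobj A" for x y y'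
      using dcomp_le_iff[OF N M that(2,3) a(2)[OF that(2,3)]] counit that by blast
    have sym: "N x y = Inv Q (M y x)" if x: "x \<in> qobj B" and y: "y \<in> qobj A" for x y
      by (rule bil[unfolded bilateral_def, rule_format, where U = "qty B x" and t = "qty A" and A = "qhom A" and \<phi> = "\<lambda>y. M y x" and I = "qobj A"])
        (use b(1) a(2) p q symD[OF A(2)] co dstD(4)[OF M] dstD(5)[OF N] un x y in auto)
    have "\<exists>c. c \<in> qobj A \<and> qty A c = qty B x \<and> (\<forall>y\<in>qobj A. M y x = qhom A y c)" if x: "x \<in> qobj B" for x
    proof -
      let ?X = "qty B x"
      \<comment> \<open>One point with the identity as hom-arrow is always symmetric, so the column
        at x, seen as a distributor out of it, falls under symmetric completeness.\<close>
      define E :: "('u, 'o, 'm) qcat" where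
        "E = \<lparr>qobj = {x}, qty = (\<lambda>z\<in>{x}. ?X), qhom = (\<lambda>y\<in>{x}. \<lambda>z\<in>{x}. Ide Q ?X)\<rparr>"
      note i = ide_in[OF b(1)[OF x]]
      have E1: "qobj E = {x}" "qty E x = ?X" "qhom E x x = Ide Q ?X" by (simp_all add: E_def)
      have E: "is_qcat Q E" "symm E"
        unfolding is_qcat_def symmetric_qcat_def
        using i b(1)[OF x] idl[OF i] le_refl[OF i] inv_ide[OF b(1)[OF x]] small_singleton[OF U] by (auto simp: E_def)
      define \<Theta> where "\<Theta> = (\<lambda>y\<in>qobj A. \<lambda>z\<in>qobj E. M y x)"
      have T: "dst E A \<Theta>" unfolding \<Theta>_def
        by (rule dst_restrictI[OF E(1) A(1)]) (use p[OF x] dstD(4)[OF M x] idr[OF p[OF x]] le_refl[OF p[OF x]] in \<open>auto simp: E1\<close>)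
      note Ti = dinv_dst[OF T E(2) A(2)]
      have e: "dinv E A \<Theta> x y = N x y" "\<Theta> y x = M y x" if "y \<in> qobj A" for y
        using sym[OF x that] that by (simp_all add: dinv_def \<Theta>_def E1)
      have xE: "x \<in> qobj E" by (simp add: E1)
      have D: "dcomp E A E (dinv E A \<Theta>) \<Theta> x x \<in> hom Q ?X ?X" using dcomp_in[OF T Ti xE xE] by (simp add: E1)
      have "Ide Q ?X \<sqsubseteq> dcomp E A E (dinv E A \<Theta>) \<Theta> x x"
        by (rule un[OF x D]) (use dcomp_upper[OF T Ti xE xE] e in force)
      moreover have "dcomp A E A \<Theta> (dinv E A \<Theta>) y' y \<sqsubseteq> qhom A y' y" if "y \<in> qobj A" "y' \<in> qobj A" for y y'
        using dcomp_le_iff[OF Ti T that a(2)[OF that]] e co[OF x] that by (simp add: E1)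
      ultimately have "sym_left_adjoint (SymDist Q) (E, \<Theta>, A)"
        using sym_left_adjoint_SymDist_iff[OF T E(2) A(2)] by (simp add: E1)
      then obtain F where F: "is_qfunctor Q E A F" "(E, \<Theta>, A) = represented E A F"
        using sc unfolding symmetrically_complete_def by blast
      have r: "\<Theta> = rep E A F" using F(2) by (simp add: represented_rep)
      have "M y x = qhom A y (F x)" if "y \<in> qobj A" for y
        using e(2)[OF that] that xE by (simp add: r)
      then show ?thesis using qfunctorD(2,3)[OF F(1) xE] E1 by auto
    qed
    then obtain c where c: "\<And>x. x \<in> qobj B ==> c x \<in> qobj A" "\<And>x. x \<in> qobj B ==> qty A (c x) = qty B x"
      "\<And>x y. x \<in> qobj B ==> y \<in> qobj A ==> M y x = qhom A y (c x)" by metis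
    define F where "F = restrict c (qobj B)"
    have F: "F \<in> qobj B \<rightarrow>\<^sub>E qobj A" "\<And>x. x \<in> qobj B ==> qty A (F x) = qty B x" using c by (auto simp: F_def)
    have d: "dst B A (\<lambda>y\<in>qobj A. \<lambda>x\<in>qobj B. qhom A y (F x))"
      by (rule dst_restrictI[OF B A(1)]) (use c F_def p dstD(4,5)[OF M] in auto)
    have "M = (\<lambda>y\<in>qobj A. \<lambda>x\<in>qobj B. qhom A y (F x))"
      by (rule dst_eqI[OF M d]) (use c F_def in simp)
    then show "\<exists>F. is_qfunctor Q B A F \<and> (B, M, A) = represented B A F"
      using represented_qfunctor[OF A(1) F d] unfolding represented_def by blast
  qed
qed

lemma (in iqloid) SymCat_cc_eq:
  assumes "universe TYPE('u)" "bilateral TYPE('u) Q"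
  shows "(SymCat_cc Q :: (('u, 'o, 'm) qcat, _) category) = SymCat_sc Q"
proof -
  have "{f \<in> Arr (SymCat Q). cauchy_complete Q (Dom (SymCat Q) f) \<and> cauchy_complete Q (Cod (SymCat Q) f)} =
    {f \<in> Arr (SymCat Q :: (('u, 'o, 'm) qcat, _) category). symmetrically_complete Q (Dom (SymCat Q) f) \<and> symmetrically_complete Q (Cod (SymCat Q) f)}"
    using cauchy_complete_iff[OF assms] by (auto simp: SymCat_def)
  moreover have "{A \<in> Obj (SymCat Q). cauchy_complete Q A} = {A \<in> Obj (SymCat Q :: (('u, 'o, 'm) qcat, _) category). symmetrically_complete Q A}"
    using cauchy_complete_iff[OF assms] by auto
  ultimately show ?thesis unfolding SymCat_cc_def SymCat_sc_def full_sub_def by simp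
qed

section \<open>Quantaloids equivalent to one of closed cribles\<close>

text \<open>Full faithfulness is the usual argument with the two natural isomorphisms. The order is
  reflected because x \<le> y says that y is the supremum of x and y, and suprema are
  preserved.\<close>

lemma quantaloid_equivE:
  assumes e: "quantaloid_equiv Q R" and Q: "is_quantaloid Q" and R: "is_quantaloid R"
  obtains Fo Fm where "cat_embedding Q R Fo Fm"
    "\<And>X Y f g. f \<in> hom Q X Y ==> g \<in> hom Q X Y ==> f \<sqsubseteq>\<^bsub>Q\<^esub> g \<longleftrightarrow> Fm f \<sqsubseteq>\<^bsub>R\<^esub> Fm g"
    "\<And>Y. Y \<in> Obj R ==> \<exists>X\<in>Obj Q. \<exists>u\<in>hom R (Fo X) Y. is_iso R u"
proof -
  interpret Q: qloid Q using Q by unfold_locales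
  interpret R: qloid R using R by unfold_locales
  obtain Fo Fm Go Gm where h: "is_homomorphism Q R Fo Fm" "is_homomorphism R Q Go Gm"
    and n1: "naturally_isomorphic Q Q (Go \<circ> Fo) (Gm \<circ> Fm) id id"
    and n2: "naturally_isomorphic R R (Fo \<circ> Go) (Fm \<circ> Gm) id id"
    using e unfolding quantaloid_equiv_def by blast
  note f = functorD[of Q R Fo Fm] and g = functorD[of R Q Go Gm]
  have F: "is_functor Q R Fo Fm" and G: "is_functor R Q Go Gm" using h unfolding is_homomorphism_def by blast+
  note f = functorD[OF F] and g = functorD[OF G]
  obtain \<eta> where e: "\<And>X. X \<in> Obj Q ==> \<eta> X \<in> hom Q (Go (Fo X)) X" "\<And>X. X \<in> Obj Q ==> is_iso Q (\<eta> X)"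
      "\<And>X Y f. f \<in> hom Q X Y ==> \<eta> Y \<odot>\<^bsub>Q\<^esub> Gm (Fm f) = f \<odot>\<^bsub>Q\<^esub> \<eta> X"
    using n1 unfolding naturally_isomorphic_def comp_apply id_apply by blast
  obtain \<theta> where t: "\<And>X. X \<in> Obj R ==> \<theta> X \<in> hom R (Fo (Go X)) X" "\<And>X. X \<in> Obj R ==> is_iso R (\<theta> X)"
      "\<And>X Y f. f \<in> hom R X Y ==> \<theta> Y \<odot>\<^bsub>R\<^esub> Fm (Gm f) = f \<odot>\<^bsub>R\<^esub> \<theta> X"
    using n2 unfolding naturally_isomorphic_def comp_apply id_apply by blast
  have Finj: "x = y" if o: "x \<in> hom Q X Y" "y \<in> hom Q X Y" "Fm x = Fm y" for x y X Y
  proof -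
    note X = Q.hom_obj(1)[OF o(1)]
    obtain v where v: "v \<in> hom Q X (Go (Fo X))" "\<eta> X \<odot>\<^bsub>Q\<^esub> v = Ide Q X" using cat_isoE[OF Q.cat e(2,1)[OF X]] by blast
    have "x \<odot>\<^bsub>Q\<^esub> \<eta> X = y \<odot>\<^bsub>Q\<^esub> \<eta> X" using e(3)[OF o(1)] e(3)[OF o(2)] o(3) by simp
    then have "x \<odot>\<^bsub>Q\<^esub> (\<eta> X \<odot>\<^bsub>Q\<^esub> v) = y \<odot>\<^bsub>Q\<^esub> (\<eta> X \<odot>\<^bsub>Q\<^esub> v)"
      using Q.assoc[OF o(1) e(1)[OF X] v(1)] Q.assoc[OF o(2) e(1)[OF X] v(1)] by simp
    then show ?thesis using v(2) Q.idr[OF o(1)] Q.idr[OF o(2)] by simp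
  qed
  have Ginj: "x = y" if o: "x \<in> hom R X Y" "y \<in> hom R X Y" "Gm x = Gm y" for x y X Y
  proof -
    note X = R.hom_obj(1)[OF o(1)]
    obtain v where v: "v \<in> hom R X (Fo (Go X))" "\<theta> X \<odot>\<^bsub>R\<^esub> v = Ide R X" using cat_isoE[OF R.cat t(2,1)[OF X]] by blast
    have "x \<odot>\<^bsub>R\<^esub> \<theta> X = y \<odot>\<^bsub>R\<^esub> \<theta> X" using t(3)[OF o(1)] t(3)[OF o(2)] o(3) by simp
    then have "x \<odot>\<^bsub>R\<^esub> (\<theta> X \<odot>\<^bsub>R\<^esub> v) = y \<odot>\<^bsub>R\<^esub> (\<theta> X \<odot>\<^bsub>R\<^esub> v)"
      using R.assoc[OF o(1) t(1)[OF X] v(1)] R.assoc[OF o(2) t(1)[OF X] v(1)] by simp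
    then show ?thesis using v(2) R.idr[OF o(1)] R.idr[OF o(2)] by simp
  qed
  have Fsurj: "\<exists>x\<in>hom Q X Y. Fm x = y" if o: "X \<in> Obj Q" "Y \<in> Obj Q" "y \<in> hom R (Fo X) (Fo Y)" for X Y y
  proof -
    obtain v where v: "v \<in> hom Q X (Go (Fo X))" "v \<odot>\<^bsub>Q\<^esub> \<eta> X = Ide Q (Go (Fo X))"
      using cat_isoE[OF Q.cat e(2,1)[OF o(1)]] by blast
    obtain w where w: "w \<in> hom Q Y (Go (Fo Y))" "w \<odot>\<^bsub>Q\<^esub> \<eta> Y = Ide Q (Go (Fo Y))"
      using cat_isoE[OF Q.cat e(2,1)[OF o(2)]] by blast
    note Gy = g(2)[OF o(3)] note eX = e(1)[OF o(1)] and eY = e(1)[OF o(2)]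
    \<comment> \<open>The candidate preimage is \<open>Gm y\<close> conjugated by \<eta>. As
      \<open>Gm\<close> is faithful, it is enough that \<open>Gm (Fm x)\<close> equals
      \<open>Gm y\<close>, which follows by naturality and cancelling \<eta> Y.\<close>
    define x where "x = \<eta> Y \<odot>\<^bsub>Q\<^esub> (Gm y \<odot>\<^bsub>Q\<^esub> v)"
    have x: "x \<in> hom Q X Y" unfolding x_def by (rule Q.comp_in eY Gy v)+
    note GFx = g(2)[OF f(2)[OF x]]
    have "\<eta> Y \<odot>\<^bsub>Q\<^esub> Gm (Fm x) = x \<odot>\<^bsub>Q\<^esub> \<eta> X" using e(3)[OF x] .
    also have "\<dots> = \<eta> Y \<odot>\<^bsub>Q\<^esub> Gm y"
      unfolding x_def using Q.assoc[OF eY Q.comp_in[OF Gy v(1)] eX] Q.assoc[OF Gy v(1) eX] v(2) Q.idr[OF Gy] by simp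
    finally have "w \<odot>\<^bsub>Q\<^esub> (\<eta> Y \<odot>\<^bsub>Q\<^esub> Gm (Fm x)) = w \<odot>\<^bsub>Q\<^esub> (\<eta> Y \<odot>\<^bsub>Q\<^esub> Gm y)" by simp
    then have "Gm (Fm x) = Gm y"
      using Q.assoc[OF w(1) eY GFx] Q.assoc[OF w(1) eY Gy] w(2) Q.idl[OF GFx] Q.idl[OF Gy] by simp
    then show ?thesis using Ginj[OF f(2)[OF x] o(3)] x by blast
  qed
  have "cat_embedding Q R Fo Fm" unfolding cat_embedding_def
  proof (intro conjI allI ballI)
    show "Dom Q x \<in> Obj Q" "Cod Q x \<in> Obj Q" if "x \<in> Arr Q" for x using Q.hom_obj[OF Arr_hom[OF that]] .
    show "bij_betw Fm (hom Q X Y) (hom R (Fo X) (Fo Y))" if "X \<in> Obj Q" "Y \<in> Obj Q" for X Y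
    proof -
      have "hom R (Fo X) (Fo Y) \<subseteq> Fm ` hom Q X Y" using Fsurj[OF that] by blast
      then show ?thesis unfolding bij_betw_def using Finj f(2) by (auto intro!: inj_onI)
    qed
  qed (use Q.ide_in Q.comp_in f in auto)
  moreover have "x \<sqsubseteq>\<^bsub>Q\<^esub> y \<longleftrightarrow> Fm x \<sqsubseteq>\<^bsub>R\<^esub> Fm y" if o: "x \<in> hom Q X Y" "y \<in> hom Q X Y" for x y X Y
  proof -
    note X = Q.hom_obj[OF o(1)]
    have S: "{x, y} \<subseteq> hom Q X Y" using o by blast
    have lub: "is_lub R (Fo X) (Fo Y) {Fm x, Fm y} (Fm s)" if "is_lub Q X Y {x, y} s" for s
    proof -
      have "is_lub R (Fo X) (Fo Y) (Fm ` {x, y}) (Fm s)"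
        using h(1) X S that unfolding is_homomorphism_def by meson
      then show ?thesis by simp
    qed
    show ?thesis
    proof
      assume "x \<sqsubseteq>\<^bsub>Q\<^esub> y"
      from lub[OF Q.lub_pair[OF this o]] show "Fm x \<sqsubseteq>\<^bsub>R\<^esub> Fm y" unfolding is_lub_def by blast
    next
      assume "Fm x \<sqsubseteq>\<^bsub>R\<^esub> Fm y"
      from R.lub_pair[OF this f(2)[OF o(1)] f(2)[OF o(2)]] have "Fm (join Q X Y {x, y}) = Fm y"
        using R.lub_unique lub[OF Q.join_lub[OF X S]] by blast
      then have "join Q X Y {x, y} = y" using Finj[OF Q.join_in[OF X S] o(2)] by blast
      then show "x \<sqsubseteq>\<^bsub>Q\<^esub> y" using Q.join_upper[OF _ X S, of x] by simp
    qed
  qed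
  ultimately show thesis using that t(1,2) g(1) by blast
qed

section \<open>Recovering the involution of a quantaloid equivalent to cribles\<close>

context site
begin

text \<open>Bilaterality for a one-element index set, with the identity of the codomain in the role
  of the symmetric category.\<close>

lemma crib_left_adjoint:
  assumes "adjoint crib u v"
  shows "v = Inv crib u"
proof -
  let ?U = "Dom crib u" and ?X = "Cod crib u"
  have h: "u \<in> hom crib ?U ?X" "v \<in> hom crib ?X ?U" "Ide crib ?U \<preceq> v \<bullet> u" "u \<bullet> v \<preceq> Ide crib ?X"
    using assms Arr_hom[of u crib] unfolding adjoint_def by blast+
  note o = crib.hom_obj[OF h(1)]
  note i = crib.ide_in[OF o(1)] crib.ide_in[OF o(2)]
  have "Ide crib ?U \<preceq> w" if "w \<in> hom crib ?U ?U" "v \<bullet> u \<preceq> w" for w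
    using crib.le_trans[OF h(3) that(2) i(1) crib.comp_in[OF h(2,1)] that(1)] .
  then show ?thesis
    using crib_bilateral[where ?'i = unit, unfolded bilateral_def, rule_format, where I = "{()}" and U = ?U
        and t = "\<lambda>_. ?X" and \<phi> = "\<lambda>_. u" and \<psi> = "\<lambda>_. v" and A = "\<lambda>_ _. Ide crib ?X" and i = "()"]
      h i crib.inv_ide[OF o(2)] crib.idl[OF h(1)] crib.idr[OF h(2)] crib.le_refl o by auto
qed

text \<open>An inverse is in particular a right adjoint, hence the involute.\<close>

lemma crib_iso_unitary:
  assumes "is_iso crib u" "u \<in> hom crib X Y"
  shows "unitary crib X Y u"
proof -
  obtain v where v: "v \<in> hom crib Y X" "v \<bullet> u = Ide crib X" "u \<bullet> v = Ide crib Y"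
    using cat_isoE[OF crib.cat assms] .
  have "adjoint crib u v" unfolding adjoint_def
    using v assms(2) homD[OF assms(2)] crib.le_refl[OF crib.ide_in] crib.hom_obj[OF assms(2)] by simp
  then show ?thesis using crib_left_adjoint v assms(2) unfolding unitary_def by auto
qed

end

text \<open>Here \<open>Q\<close> has only order and composition, and \<open>Fm\<close> is required
  to respect just these; the unitaries of \<open>ess\<close> are those of
  \<open>crib\<close>.\<close>

locale crib_base = site C J for C :: "('co, 'cm) category" and J +
  fixes Q :: "('qo, 'qm) quantaloid" (structure) and Fo :: "'qo => 'co" and Fm
  assumes Qq: "is_quantaloid Q"
    and emb: "cat_embedding Q crib Fo Fm"
    and ord: "f \<in> hom Q X Y ==> g \<in> hom Q X Y ==> f \<sqsubseteq> g \<longleftrightarrow> Fm f \<preceq> Fm g"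
    and ess: "Z \<in> Obj C ==> \<exists>W\<in>Obj Q. \<exists>u. unitary crib (Fo W) Z u"
begin

sublocale Qq: qloid Q
  using Qq by unfold_locales

lemmas Fe = cat_embeddingD[OF emb]

text \<open>A tabulating pair with an arbitrary vertex U is transported to a vertex in the image of
  \<open>Fo\<close> by composing both legs with a unitary u; the factor u u\<degree> = 1 leaves f
  g\<degree> unchanged, and fullness makes the legs come from \<open>Q\<close>.\<close>

lemma tabularF:
  assumes X: "X \<in> Obj Q" "Y \<in> Obj Q" and q: "q \<in> hom crib (Fo X) (Fo Y)" and t: "t \<in> hom crib (Fo X) (Fo Y)"
    and le: "\<And>W f g. f \<in> hom Q W Y ==> g \<in> hom Q W X ==> sym_left_adjoint crib (Fm f) ==> sym_left_adjoint crib (Fm g) ==>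
      Fm f \<bullet> Inv crib (Fm g) \<preceq> q ==> Fm f \<bullet> Inv crib (Fm g) \<preceq> t"
  shows "q \<preceq> t"
proof (rule crib_tabular[OF q t])
  fix U f g assume U: "U \<in> Obj C" and f: "f \<in> hom crib U (Fo Y)" and g: "g \<in> hom crib U (Fo X)"
    and s: "sym_left_adjoint crib f" "sym_left_adjoint crib g" and fg: "f \<bullet> Inv crib g \<preceq> q"
  obtain W u where W: "W \<in> Obj Q" and u: "unitary crib (Fo W) U u" using ess[OF U] by blast
  have uh: "u \<in> hom crib (Fo W) U" "u \<bullet> Inv crib u = Ide crib U" using u unfolding unitary_def by blast+
  note su = crib.unitary_sym_left_adjoint[OF u]
  obtain f' where f': "f' \<in> hom Q W Y" "Fm f' = f \<bullet> u" using embedding_surj[OF emb W X(2) crib.comp_in[OF f uh(1)]] .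
  obtain g' where g': "g' \<in> hom Q W X" "Fm g' = g \<bullet> u" using embedding_surj[OF emb W X(1) crib.comp_in[OF g uh(1)]] .
  note ui = crib.inv_in[OF uh(1)] and gi = crib.inv_in[OF g]
  have "Fm f' \<bullet> Inv crib (Fm g') = f \<bullet> ((u \<bullet> Inv crib u) \<bullet> Inv crib g)"
    using crib.inv_comp[OF g uh(1)] crib.assoc[OF f uh(1) crib.comp_in[OF ui gi]] crib.assoc[OF uh(1) ui gi] by (simp add: f' g')
  then have e: "Fm f' \<bullet> Inv crib (Fm g') = f \<bullet> Inv crib g" using uh(2) crib.idl[OF gi] by simp
  show "f \<bullet> Inv crib g \<preceq> t"
    using le[OF f'(1) g'(1)] crib.sym_left_adjoint_comp[OF uh(1) su f s(1)] crib.sym_left_adjoint_comp[OF uh(1) su g s(2)] fg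
    unfolding e[symmetric] by (simp add: f' g')
qed

lemma adjointF:
  assumes f: "f \<in> hom Q X Y" and g: "g \<in> hom Q Y X"
  shows "adjoint Q f g \<longleftrightarrow> adjoint crib (Fm f) (Fm g)"
proof -
  note o = Qq.hom_obj[OF f] note Ff = embedding_in[OF emb f] and Fg = embedding_in[OF emb g]
  show ?thesis unfolding adjoint_def
    using f g homD[OF f] homD[OF Ff] Fg ord[OF Qq.ide_in[OF o(1)] Qq.comp_in[OF g f]] ord[OF Qq.comp_in[OF f g] Qq.ide_in[OF o(2)]]
      Fe(7) Fe(8)[OF g f] Fe(8)[OF f g] o by simp
qed

abbreviation "Qi \<equiv> with_canonical_inv Q"

text \<open>Let p be the preimage of the reversed crible of q. It bounds the defining set because
  adjoints in \<open>Q\<close> map to reversals. It is the least bound: if t is a bound, tabulating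
  q gives Fm q \<le> (Fm t)\<degree>, and reversal turns this into Fm p \<le> Fm t.\<close>

lemma canonical_inv:
  assumes q: "q \<in> hom Q X Y"
  shows "canonical_inv Q q \<in> hom Q Y X" "Fm (canonical_inv Q q) = Inv crib (Fm q)"
proof -
  note o = Qq.hom_obj[OF q] note Fq = embedding_in[OF emb q]
  define S where "S = {g \<odot> f' | U f g f' g'. f \<in> hom Q U Y \<and> g \<in> hom Q U X \<and>
        adjoint Q f f' \<and> adjoint Q g g' \<and> f \<odot> g' \<sqsubseteq> q}"
  have S: "canonical_inv Q q = join Q Y X S" using homD[OF q] by (simp add: canonical_inv_def S_def)
  obtain p where p: "p \<in> hom Q Y X" "Fm p = Inv crib (Fm q)"
    using embedding_surj[OF emb o(2,1) crib.inv_in[OF Fq]] .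
  have adj: "f' \<in> hom Q Y' U" "Fm f' = Inv crib (Fm f)" if h: "f \<in> hom Q U Y'" "adjoint Q f f'" for f f' U Y'
  proof -
    show f': "f' \<in> hom Q Y' U" using h(2) homD[OF h(1)] unfolding adjoint_def by simp
    show "Fm f' = Inv crib (Fm f)" using crib_left_adjoint adjointF[OF h(1) f'] h(2) by blast
  qed
  have "is_lub Q Y X S p" unfolding is_lub_def
  proof (intro conjI ballI impI)
    show "p \<in> hom Q Y X" by (rule p)
    show "x \<sqsubseteq> p" if xS: "x \<in> S" for x
    proof -
      obtain U f g f' g' where x: "x = g \<odot> f'" and f: "f \<in> hom Q U Y" "adjoint Q f f'"
        and g: "g \<in> hom Q U X" "adjoint Q g g'" and le: "f \<odot> g' \<sqsubseteq> q" using xS unfolding S_def by blast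
      note f' = adj[OF f] and g' = adj[OF g]
      have "Fm (f \<odot> g') \<preceq> Fm q" using ord[OF Qq.comp_in[OF f(1) g'(1)] q] le by blast
      from crib.inv_mono[OF this embedding_in[OF emb Qq.comp_in[OF f(1) g'(1)]] Fq]
      have "Inv crib (Inv crib (Fm g)) \<bullet> Inv crib (Fm f) \<preceq> Fm p"
        using crib.inv_comp[OF embedding_in[OF emb f(1)] embedding_in[OF emb g'(1)]] Fe(8)[OF f(1) g'(1)] p(2) g'(2) by simp
      then have "Fm x \<preceq> Fm p" using crib.inv_inv[OF embedding_in[OF emb g(1)]] Fe(8)[OF g(1) f'(1)] f'(2) x by simp
      then show ?thesis using ord[OF Qq.comp_in[OF g(1) f'(1)] p(1)] x by simp
    qed
    fix t assume t: "t \<in> hom Q Y X" "\<forall>x\<in>S. x \<sqsubseteq> t"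
    note Ft = embedding_in[OF emb t(1)]
    have "Fm q \<preceq> Inv crib (Fm t)"
    proof (rule tabularF[OF o Fq crib.inv_in[OF Ft]])
      fix W f g assume f: "f \<in> hom Q W Y" "sym_left_adjoint crib (Fm f)" and g: "g \<in> hom Q W X" "sym_left_adjoint crib (Fm g)"
        and le: "Fm f \<bullet> Inv crib (Fm g) \<preceq> Fm q"
      note W = Qq.hom_obj(1)[OF f(1)]
      note Ff = embedding_in[OF emb f(1)] and Fg = embedding_in[OF emb g(1)]
      obtain f' where f': "f' \<in> hom Q Y W" "Fm f' = Inv crib (Fm f)" using embedding_surj[OF emb o(2) W crib.inv_in[OF Ff]] .
      obtain g' where g': "g' \<in> hom Q X W" "Fm g' = Inv crib (Fm g)" using embedding_surj[OF emb o(1) W crib.inv_in[OF Fg]] .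
      have "adjoint Q f f'" "adjoint Q g g'"
        using adjointF[OF f(1) f'(1)] adjointF[OF g(1) g'(1)] f(2) g(2) f'(2) g'(2) unfolding sym_left_adjoint_def by simp_all
      moreover have "f \<odot> g' \<sqsubseteq> q" using ord[OF Qq.comp_in[OF f(1) g'(1)] q] Fe(8)[OF f(1) g'(1)] g'(2) le by simp
      ultimately have "g \<odot> f' \<in> S" using f(1) g(1) unfolding S_def by blast
      then have "Fm g \<bullet> Inv crib (Fm f) \<preceq> Fm t"
        using t ord[OF Qq.comp_in[OF g(1) f'(1)] t(1)] Fe(8)[OF g(1) f'(1)] f'(2) by simp
      from crib.inv_mono[OF this crib.comp_in[OF Fg crib.inv_in[OF Ff]] Ft]
      show "Fm f \<bullet> Inv crib (Fm g) \<preceq> Inv crib (Fm t)"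
        using crib.inv_comp[OF Fg crib.inv_in[OF Ff]] crib.inv_inv[OF Ff] by simp
    qed
    from crib.inv_mono[OF this Fq crib.inv_in[OF Ft]] have "Fm p \<preceq> Fm t" using crib.inv_inv[OF Ft] p(2) by simp
    then show "p \<sqsubseteq> t" using ord[OF p(1) t(1)] by blast
  qed
  then have "canonical_inv Q q = p" using Qq.join_eq S by simp
  then show "canonical_inv Q q \<in> hom Q Y X" "Fm (canonical_inv Q q) = Inv crib (Fm q)" using p by simp_all
qed

lemma Qi_embedding: "dagger_embedding Qi crib Fo Fm"
  unfolding dagger_embedding_def canonical_with_inv
  using emb ord canonical_inv by (simp add: cat_embedding_def)

sublocale Qi: iqloid Qi
  using dagger_embedding_inv_quantaloid[OF Qi_embedding crib_inv_quantaloid] by unfold_locales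

lemma Qi_bilateral: "bilateral TYPE('i) Qi"
  using bilateral_embedding[OF Qi_embedding crib_bilateral] .

text \<open>Tabulation carried back to \<open>Q\<close>; it supplies the hypothesis
  \<open>tab\<close> of \<open>splitting_dense\<close>.\<close>

lemma Qi_tabular:
  assumes q: "q \<in> hom Qi X Y" and t: "t \<in> hom Qi X Y"
    and le: "\<And>W f g. f \<in> hom Qi W Y ==> g \<in> hom Qi W X ==> sym_left_adjoint Qi f ==> sym_left_adjoint Qi g ==>
      f \<odot>\<^bsub>Qi\<^esub> Inv Qi g \<sqsubseteq>\<^bsub>Qi\<^esub> q ==> f \<odot>\<^bsub>Qi\<^esub> Inv Qi g \<sqsubseteq>\<^bsub>Qi\<^esub> t"
  shows "q \<sqsubseteq>\<^bsub>Qi\<^esub> t"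
proof -
  note E = Qi_embedding note E1 = dagger_embeddingD(1)[OF E] note hQ = canonical_with_inv hom_with_inv
  have "Fm q \<preceq> Fm t"
  proof (rule tabularF)
    show "X \<in> Obj Q" "Y \<in> Obj Q" using Qi.hom_obj[OF q] by (simp_all add: canonical_with_inv)
    show "Fm q \<in> hom crib (Fo X) (Fo Y)" "Fm t \<in> hom crib (Fo X) (Fo Y)" using embedding_in[OF E1] q t by blast+
    fix W f g assume f: "f \<in> hom Q W Y" "sym_left_adjoint crib (Fm f)" and g: "g \<in> hom Q W X" "sym_left_adjoint crib (Fm g)"
        and fg: "Fm f \<bullet> Inv crib (Fm g) \<preceq> Fm q"
    have h: "f \<in> hom Qi W Y" "g \<in> hom Qi W X" using f g by (simp_all add: canonical_with_inv)
    note gi = Qi.inv_in[OF h(2)]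
    have e: "Fm (f \<odot>\<^bsub>Qi\<^esub> Inv Qi g) = Fm f \<bullet> Inv crib (Fm g)"
      using cat_embeddingD(8)[OF E1 h(1) gi] dagger_embeddingD(4)[OF E h(2)] by simp
    have "f \<odot>\<^bsub>Qi\<^esub> Inv Qi g \<sqsubseteq>\<^bsub>Qi\<^esub> q" using dagger_embeddingD(2)[OF E Qi.comp_in[OF h(1) gi] q] fg e by simp
    then have "f \<odot>\<^bsub>Qi\<^esub> Inv Qi g \<sqsubseteq>\<^bsub>Qi\<^esub> t"
      using le[OF h] dagger_embedding_sym_left_adjoint[OF E crib_inv_quantaloid] h f(2) g(2) by blast
    then show "Fm f \<bullet> Inv crib (Fm g) \<preceq> Fm t"
      using dagger_embeddingD(2)[OF E Qi.comp_in[OF h(1) gi] t] e by simp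
  qed
  then show ?thesis using dagger_embeddingD(2)[OF E q t] by blast
qed

sublocale bc: base_change Qi crib Fo Fm
  using Qi_embedding by unfold_locales

lemma small_Arr_crib:
  assumes U: "universe TYPE('u)" and C: "small_category TYPE('u) C"
  shows "small TYPE('u) (Arr crib)"
proof -
  have "Arr crib \<subseteq> Obj C \<times> Pow (Arr C \<times> Arr C) \<times> Obj C"
  proof safe
    fix X R Y assume "(X, R, Y) \<in> Arr crib"
    then have c: "cc X Y R" by simp
    show "X \<in> Obj C" "Y \<in> Obj C" using ccD[OF c] by blast+
    fix f g assume "(f, g) \<in> R"
    then show "f \<in> Arr C" "g \<in> Arr C" using cc_spanE[OF c] homD(1) by metis+
  qed
  moreover have "small TYPE('u) (Obj C)" "small TYPE('u) (Arr C)" using C unfolding small_category_def by blast+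
  ultimately show ?thesis by (intro small_subset[OF small_Times[OF U _ small_Times[OF U small_Pow[OF U small_Times[OF U]]]]])
qed

lemma SymDist_Qi_equivalence:
  assumes U: "universe TYPE('u)" and C: "small_category TYPE('u) C" and sQ: "small_category TYPE('u) Q"
  shows "dagger_equivalence (SymDist Qi :: (('u, _, _) qcat, _) inv_quantaloid) (SymDist crib)
    bc.bcat (\<lambda>(A, M, B). (bc.bcat A, bc.bdist A B M, bc.bcat B))"
  unfolding dagger_equivalence_def
proof (intro conjI bc.base_change_embedding ballI)
  fix B :: "('u, _, _) qcat" assume "B \<in> Obj (SymDist crib)"
  then have B: "is_qcat crib B" "crib.symm B" by simp_all
  have "\<exists>A :: ('u, _, _) qcat. is_qcat Qi A \<and> Qi.symm A \<and> (\<exists>u. unitary (SymDist crib) (bc.bcat A) B u)"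
  proof (rule bc.base_change_dense[OF U _ small_Arr_crib[OF U C] _ B])
    show "small TYPE('u) (Obj Qi)" using sQ unfolding small_category_def by (simp add: canonical_with_inv)
    fix l t assume l: "l \<in> Obj crib" and t: "t \<in> hom crib l l"
      and le: "\<And>k u. k \<in> Obj Qi ==> u \<in> hom crib (Fo k) l ==> sym_left_adjoint crib u ==> u \<bullet> Inv crib u \<preceq> t"
    \<comment> \<open>A single unitary already gives u u\<degree> = 1, so the density condition is
      met by one term.\<close>
    obtain k u where u: "k \<in> Obj Q" "unitary crib (Fo k) l u" using ess[of l] l crib_simps(1) by blast
    then show "Ide crib l \<preceq> t"
      using le[of k u] crib.unitary_sym_left_adjoint[OF u(2)] by (simp add: unitary_def canonical_with_inv)
  qed
  then show "\<exists>A\<in>Obj (SymDist Qi :: (('u, _, _) qcat, _) inv_quantaloid). \<exists>u. unitary (SymDist crib) (bc.bcat A) B u" by auto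
qed

lemma SymDist_splitting_equivalence:
  assumes U: "universe TYPE('u)" and sQ: "small_category TYPE('u) Q"
    and E: "\<forall>e\<in>E. sym_idempotent Qi e" and I: "\<forall>X\<in>Obj Q. Ide Q X \<in> E"
  shows "\<exists>Fo Fm. dagger_equivalence (SymDist Qi :: (('u, _, _) qcat, _) inv_quantaloid)
    (SymDist (splitting Qi E) :: (('u, _, _) qcat, _) inv_quantaloid) Fo Fm"
proof -
  interpret sp: splitting_of Qi E using E by unfold_locales blast
  interpret S: iqloid "splitting Qi E" using sp.SE_inv_quantaloid by unfold_locales
  have I': "\<forall>X\<in>Obj Qi. Ide Qi X \<in> E" using I by (simp add: canonical_with_inv)
  interpret be: base_change Qi "splitting Qi E" "Ide Qi" "\<lambda>x. (Ide Qi (Dom Qi x), x, Ide Qi (Cod Qi x))"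
    using sp.splitting_embedding[OF I'] by unfold_locales
  have EA: "E \<subseteq> Arr Q" using E unfolding sym_idempotent_def by (auto simp: canonical_with_inv)
  have "Arr (splitting Qi E) \<subseteq> Arr Q \<times> Arr Q \<times> Arr Q"
    using EA homD(1)[of _ Q] by (auto simp: splitting_def canonical_with_inv)
  then have sA: "small TYPE('u) (Arr (splitting Qi E))"
    using sQ small_subset small_Times[OF U _ small_Times[OF U]] unfolding small_category_def by blast
  have sO: "small TYPE('u) (Obj Qi)" using sQ unfolding small_category_def by (simp add: canonical_with_inv)
  have "dagger_equivalence (SymDist Qi :: (('u, _, _) qcat, _) inv_quantaloid) (SymDist (splitting Qi E))
    be.bcat (\<lambda>(A, M, B). (be.bcat A, be.bdist A B M, be.bcat B))"
    unfolding dagger_equivalence_def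
  proof (intro conjI be.base_change_embedding ballI)
    fix B :: "('u, _, _) qcat" assume "B \<in> Obj (SymDist (splitting Qi E))"
    then have B: "is_qcat (splitting Qi E) B" "S.symm B" by simp_all
    have "\<exists>A :: ('u, _, _) qcat. is_qcat Qi A \<and> Qi.symm A \<and> (\<exists>u. unitary (SymDist (splitting Qi E)) (be.bcat A) B u)"
      by (rule be.base_change_dense[OF U sO sA sp.splitting_dense[OF Qi_tabular I'] B]) simp_all
    then show "\<exists>A\<in>Obj (SymDist Qi :: (('u, _, _) qcat, _) inv_quantaloid). \<exists>u. unitary (SymDist (splitting Qi E)) (be.bcat A) B u" by auto
  qed
  then show ?thesis by (intro exI)
qed

end

section \<open>Sheaves and their relations\<close>

text \<open>The two codings are fixed once and for all: \<open>cf\<close> codes objects of the site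
  and \<open>pr\<close> codes pairs, so that elements of presheaves and pairs of sections are again
  points of the universe.\<close>

locale sheaf_site = site C J for C :: "('co, 'cm) category" (structure) and J +
  fixes pr :: "'u \<times> 'u => 'u" and cf :: "'co => 'u"
  assumes univ: "universe TYPE('u)" and sC: "small_category TYPE('u) C"
    and pr: "inj pr" and cf: "inj_on cf (Obj C)"
begin

lemma small_C: "small TYPE('u) (Obj C)" "small TYPE('u) (Arr C)"
  using sC unfolding small_category_def by blast+

abbreviation sh :: "('u, 'co, 'cm) presheaf => bool" where
  "sh \<equiv> is_sheaf C J"

lemma presheafD:
  fixes F :: "('u, 'co, 'cm) presheaf"
  assumes "is_presheaf C F"
  shows "X \<in> Obj C ==> small TYPE('u) (val F X)"
    and "f \<in> hom C V X ==> x \<in> val F X ==> act F f x \<in> val F V"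
    and "X \<in> Obj C ==> x \<in> val F X ==> act F (Ide C X) x = x"
    and "g \<in> hom C V X ==> f \<in> hom C W V ==> x \<in> val F X ==> act F (g \<odot> f) x = act F f (act F g x)"
proof -
  note p = assms[unfolded is_presheaf_def]
  show "X \<in> Obj C ==> small TYPE('u) (val F X)" "X \<in> Obj C ==> x \<in> val F X ==> act F (Ide C X) x = x"
    "g \<in> hom C V X ==> f \<in> hom C W V ==> x \<in> val F X ==> act F (g \<odot> f) x = act F f (act F g x)"
    using p by blast+
  assume f: "f \<in> hom C V X" "x \<in> val F X"
  have "act F f \<in> val F (Cod C f) \<rightarrow>\<^sub>E val F (Dom C f)" using p homD(1)[OF f(1)] by blast
  then show "act F f x \<in> val F V" using homD[OF f(1)] f(2) by auto
qed

lemma shD: "sh F ==> is_presheaf C F"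
  unfolding is_sheaf_def by blast

lemmas act_in = presheafD(2)[OF shD]
lemmas act_id = presheafD(3)[OF shD]
lemmas act_comp = presheafD(4)[OF shD]

text \<open>On a covering sieve where the restrictions agree, both sections amalgamate the same
  matching family.\<close>

lemma sheaf_separated:
  assumes F: "sh F" and X: "X \<in> Obj C" and x: "x \<in> val F X" "y \<in> val F X" and c: "cov X (\<lambda>s. act F s x = act F s y)"
  shows "x = y"
proof -
  obtain S where S: "S \<in> J X" "\<forall>s\<in>S. act F s x = act F s y" using c unfolding cov_def by blast
  note s = sieveD[OF J_sieve[OF X S(1)]]
  have "matching_family C F S (\<lambda>s. act F s x)" unfolding matching_family_def
  proof (intro conjI ballI impI)
    show "act F f x \<in> val F (Dom C f)" if "f \<in> S" for f using act_in[OF F s(1)[OF that] x(1)] .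
    show "act F (f \<odot> g) x = act F g (act F f x)" if "f \<in> S" "g \<in> Arr C" "Cod C g = Dom C f" for f g
      using act_comp[OF F s(1)[OF that(1)] homI[OF that(2) refl that(3)] x(1)] .
  qed
  then have "\<exists>!a. a \<in> val F X \<and> (\<forall>f\<in>S. act F f a = act F f x)" using F X S(1) unfolding is_sheaf_def by blast
  then show ?thesis using x S(2) by (metis (full_types))
qed

text \<open>Gluing of data given as a relation: \<rho> s a says that a is the prescribed restriction
  along s. Single-valued, stable under restriction and locally defined, such data form a matching
  family on a covering sieve, which is thus found rather than given.\<close>

lemma sheaf_glue:
  assumes F: "sh F" and X: "X \<in> Obj C" and c: "cov X (\<lambda>s. \<exists>a. \<rho> s a)"
    and i: "\<And>V s a. s \<in> hom C V X ==> \<rho> s a ==> a \<in> val F V"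
    and u: "\<And>V s a b. s \<in> hom C V X ==> \<rho> s a ==> \<rho> s b ==> a = b"
    and r: "\<And>V W s t a. s \<in> hom C V X ==> \<rho> s a ==> t \<in> hom C W V ==> \<rho> (s \<odot> t) (act F t a)"
  shows "\<exists>x\<in>val F X. \<forall>V s a. s \<in> hom C V X --> \<rho> s a --> act F s x = a"
proof -
  define S where "S = {s \<in> Arr C. Cod C s = X \<and> (\<exists>a. \<rho> s a)}"
  have S: "S \<in> J X" unfolding S_def by (rule cov_sieve[OF X c]) (use r in blast)
  have h: "s \<in> hom C (Dom C s) X" if "s \<in> S" for s using that by (simp add: S_def hom_def)
  define m where "m s = (THE a. \<rho> s a)" for s
  have m: "m s = a" if "s \<in> hom C V X" "\<rho> s a" for s V a unfolding m_def using u that by blast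
  have "matching_family C F S m" unfolding matching_family_def
  proof (intro conjI ballI impI)
    fix f assume f: "f \<in> S"
    then obtain a where a: "\<rho> f a" by (auto simp: S_def)
    show "m f \<in> val F (Dom C f)" using m[OF h[OF f] a] i[OF h[OF f] a] by simp
    fix g assume g: "g \<in> Arr C" "Cod C g = Dom C f"
    note gh = homI[OF g(1) refl g(2)]
    show "m (f \<odot> g) = act F g (m f)"
      using m[OF h[OF f] a] m[OF comp_in[OF h[OF f] gh] r[OF h[OF f] a gh]] by simp
  qed
  then obtain x where x: "x \<in> val F X" "\<forall>f\<in>S. act F f x = m f" using F X S unfolding is_sheaf_def by blast
  have "act F s x = a" if "s \<in> hom C V X" "\<rho> s a" for V s a
    using x(2) m[OF that] that homD[OF that(1)] by (auto simp: S_def)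
  then show ?thesis using x(1) by blast
qed

text \<open>A subsheaf of the product of G and F, described independently of a choice of product.
  The codomain comes first in the pairs, as in hom-arrows, and extensionality makes equality a
  matter of the objects of the site.\<close>

definition srel :: "('u, 'co, 'cm) presheaf => ('u, 'co, 'cm) presheaf => ('co => ('u \<times> 'u) set) => bool" where
  "srel F G M \<longleftrightarrow> sh F \<and> sh G \<and> M \<in> extensional (Obj C) \<and>
     (\<forall>V y x. V \<in> Obj C --> (y, x) \<in> M V --> y \<in> val G V \<and> x \<in> val F V) \<and>
     (\<forall>V W s y x. s \<in> hom C W V --> (y, x) \<in> M V --> (act G s y, act F s x) \<in> M W) \<and>
     (\<forall>V y x. V \<in> Obj C --> y \<in> val G V --> x \<in> val F V -->
        cov V (\<lambda>s. (act G s y, act F s x) \<in> M (Dom C s)) --> (y, x) \<in> M V)"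

lemmas srel_conjs = srel_def[THEN iffD1, THEN conjunct2, THEN conjunct2]
  srel_def[THEN iffD1, THEN conjunct2, THEN conjunct2, THEN conjunct2]

lemmas srelD = srel_def[THEN iffD1, THEN conjunct1] srel_def[THEN iffD1, THEN conjunct2, THEN conjunct1]
  srel_conjs(1)[THEN conjunct1] srel_conjs(2)[THEN conjunct1, rule_format, THEN conjunct1]
  srel_conjs(2)[THEN conjunct1, rule_format, THEN conjunct2] srel_conjs(2)[THEN conjunct2, THEN conjunct1, rule_format]
  srel_conjs(2)[THEN conjunct2, THEN conjunct2, rule_format]

lemma srelI:
  assumes F: "sh F" and G: "sh G"
    and "\<And>V y x. V \<in> Obj C ==> (y, x) \<in> M V ==> y \<in> val G V \<and> x \<in> val F V"
    and "\<And>V W s y x. s \<in> hom C W V ==> (y, x) \<in> M V ==> (act G s y, act F s x) \<in> M W"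
    and "\<And>V y x. V \<in> Obj C ==> y \<in> val G V ==> x \<in> val F V ==>
      cov V (\<lambda>s. (act G s y, act F s x) \<in> M (Dom C s)) ==> (y, x) \<in> M V"
  shows "srel F G (restrict M (Obj C))"
  unfolding srel_def
proof (intro conjI F G allI impI)
  show "restrict M (Obj C) \<in> extensional (Obj C)" by simp
  show "y \<in> val G V" "x \<in> val F V" if "V \<in> Obj C" "(y, x) \<in> restrict M (Obj C) V" for V y x
    using assms(3)[OF that(1)] that by auto
  show "(act G s y, act F s x) \<in> restrict M (Obj C) W" if "s \<in> hom C W V" "(y, x) \<in> restrict M (Obj C) V" for V W s y x
    using assms(4)[OF that(1)] that hom_obj[OF that(1)] by simp
  show "(y, x) \<in> restrict M (Obj C) V" if "V \<in> Obj C" "y \<in> val G V" "x \<in> val F V"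
    "cov V (\<lambda>s. (act G s y, act F s x) \<in> restrict M (Obj C) (Dom C s))" for V y x
  proof -
    have "cov V (\<lambda>s. (act G s y, act F s x) \<in> M (Dom C s))"
      by (rule cov_mono[OF that(4,1)]) (use hom_obj(1) homD(2)[of _ C] in simp)
    then show ?thesis using assms(5)[OF that(1-3)] that(1) by simp
  qed
qed

text \<open>
  The elements \<open>(X, x)\<close> of a presheaf are coded in the universe by \<open>pr\<close> and \<open>cf\<close>, since the objects
  of an enriched category must belong to \<open>'u\<close>.
\<close>

definition pc :: "'co \<times> 'u => 'u" where
  "pc p = pr (cf (fst p), snd p)"

definition dc :: "'u => 'co \<times> 'u" where
  "dc = inv_into (Obj C \<times> UNIV) pc"

lemma dc_pc [simp]: "X \<in> Obj C ==> dc (pc (X, x)) = (X, x)"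
proof -
  have "inj_on pc (Obj C \<times> UNIV)" using cf by (auto simp: inj_on_def pc_def inj_eq[OF pr])
  then show "X \<in> Obj C ==> dc (pc (X, x)) = (X, x)" unfolding dc_def by (simp add: inv_into_f_f)
qed

definition elems :: "('u, 'co, 'cm) presheaf => 'u set" where
  "elems F = pc ` (SIGMA X:Obj C. val F X)"

lemma elemsI [simp]: "X \<in> Obj C ==> x \<in> val F X ==> pc (X, x) \<in> elems F"
  by (auto simp: elems_def)

lemma elemsE:
  assumes "u \<in> elems F"
  obtains X x where "u = pc (X, x)" "X \<in> Obj C" "x \<in> val F X"
  using assms by (auto simp: elems_def)

text \<open>The relation spread out as a matrix over elements: the entry at y and x consists of the
  spans along which the restrictions become related. For \<open>idr\<close> it measures where two
  elements agree.\<close>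

definition dqs :: "('u, 'co, 'cm) presheaf => ('u, 'co, 'cm) presheaf => ('co => ('u \<times> 'u) set) => 'co => 'u => 'co => 'u => ('cm \<times> 'cm) set" where
  "dqs F G M Y y X x = {(f, g). \<exists>V. f \<in> hom C V Y \<and> g \<in> hom C V X \<and> (act G f y, act F g x) \<in> M V}"

lemma dqs_iff:
  "f \<in> hom C V Y ==> g \<in> hom C V X ==> (f, g) \<in> dqs F G M Y y X x \<longleftrightarrow> (act G f y, act F g x) \<in> M V"
  unfolding dqs_def using homD(2)[of f C _ Y] by auto

lemma dqs_cc:
  assumes M: "srel F G M" and X: "X \<in> Obj C" "x \<in> val F X" and Y: "Y \<in> Obj C" "y \<in> val G Y"
  shows "cc X Y (dqs F G M Y y X x)"
proof (rule ccI[OF X(1) Y(1)])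
  note F = srelD(1)[OF M] and G = srelD(2)[OF M]
  show "\<exists>V. f \<in> hom C V Y \<and> g \<in> hom C V X" if "(f, g) \<in> dqs F G M Y y X x" for f g
    using that unfolding dqs_def by blast
  show "(f \<odot> s, g \<odot> s) \<in> dqs F G M Y y X x"
    if "(f, g) \<in> dqs F G M Y y X x" "f \<in> hom C V Y" "g \<in> hom C V X" "s \<in> hom C W V" for f g s V W
    using srelD(6)[OF M that(4)] that(1) act_comp[OF F that(3,4) X(2)] act_comp[OF G that(2,4) Y(2)]
    by (simp add: dqs_iff[OF that(2,3)] dqs_iff[OF comp_in[OF that(2,4)] comp_in[OF that(3,4)]])
  show "(f, g) \<in> dqs F G M Y y X x"
    if h: "f \<in> hom C V Y" "g \<in> hom C V X" "cov V (\<lambda>s. (f \<odot> s, g \<odot> s) \<in> dqs F G M Y y X x)" for f g V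
  proof -
    note V = hom_obj(1)[OF h(1)]
    have "cov V (\<lambda>s. (act G s (act G f y), act F s (act F g x)) \<in> M (Dom C s))"
    proof (rule cov_mono[OF h(3) V])
      fix W s assume s: "s \<in> hom C W V" "(f \<odot> s, g \<odot> s) \<in> dqs F G M Y y X x"
      then show "(act G s (act G f y), act F s (act F g x)) \<in> M (Dom C s)"
        using dqs_iff[OF comp_in[OF h(1) s(1)] comp_in[OF h(2) s(1)]] act_comp[OF F h(2) s(1) X(2)]
          act_comp[OF G h(1) s(1) Y(2)] homD(2)[OF s(1)] by simp
    qed
    then show ?thesis using srelD(7)[OF M V act_in[OF G h(1) Y(2)] act_in[OF F h(2) X(2)]] dqs_iff[OF h(1,2)] by blast
  qed
qed

definition ddist where
  "ddist F G M = (\<lambda>v\<in>elems G. \<lambda>u\<in>elems F.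
     (fst (dc u), dqs F G M (fst (dc v)) (snd (dc v)) (fst (dc u)) (snd (dc u)), fst (dc v)))"

lemma ddist_simp [simp]:
  "X \<in> Obj C ==> x \<in> val F X ==> Y \<in> Obj C ==> y \<in> val G Y ==>
    ddist F G M (pc (Y, y)) (pc (X, x)) = (X, dqs F G M Y y X x, Y)"
  by (simp add: ddist_def)

definition idr :: "('u, 'co, 'cm) presheaf => 'co => ('u \<times> 'u) set" where
  "idr F = (\<lambda>V\<in>Obj C. {(x, x) | x. x \<in> val F V})"

lemma idr_srel:
  assumes F: "sh F"
  shows "srel F F (idr F)"
  unfolding idr_def
proof (rule srelI[OF F F])
  show "(y, x) \<in> {(x, x) | x. x \<in> val F V}"
    if h: "V \<in> Obj C" "y \<in> val F V" "x \<in> val F V" "cov V (\<lambda>s. (act F s y, act F s x) \<in> {(x, x) | x. x \<in> val F (Dom C s)})" for V y x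
    using sheaf_separated[OF F h(1-3) cov_mono[OF h(4,1)]] h(3) by simp
qed (use act_in[OF F] in auto)

lemma dqs_idr:
  assumes F: "sh F" and f: "f \<in> hom C V Y" "y \<in> val F Y" and g: "g \<in> hom C V X" "x \<in> val F X"
  shows "(f, g) \<in> dqs F F (idr F) Y y X x \<longleftrightarrow> act F f y = act F g x"
  unfolding dqs_iff[OF f(1) g(1)] using act_in[OF F f] hom_obj(1)[OF f(1)] by (auto simp: idr_def)

definition El :: "('u, 'co, 'cm) presheaf => ('u, 'co, 'co \<times> ('cm \<times> 'cm) set \<times> 'co) qcat" where
  "El F = \<lparr>qobj = elems F, qty = (\<lambda>u\<in>elems F. fst (dc u)), qhom = ddist F F (idr F)\<rparr>"

lemma El_simps [simp]:
  "qobj (El F) = elems F" "qhom (El F) = ddist F F (idr F)"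
  "X \<in> Obj C ==> x \<in> val F X ==> qty (El F) (pc (X, x)) = X"
  by (simp_all add: El_def)

lemma dqs_step:
  assumes M: "srel F G M" and X: "X \<in> Obj C" "x \<in> val F X" and Y: "Y \<in> Obj C" "y \<in> val G Y"
    and Z: "Z \<in> Obj C" "z \<in> val G Z"
  shows "ccomp X Z (dqs G G (idr G) Z z Y y) (dqs F G M Y y X x) \<subseteq> dqs F G M Z z X x"
proof (rule ccomp_least[OF dqs_cc[OF M X Z]])
  fix h f g assume h: "(h, f) \<in> dqs G G (idr G) Z z Y y" "(f, g) \<in> dqs F G M Y y X x"
  obtain V where V: "h \<in> hom C V Z" "f \<in> hom C V Y" using cc_spanE[OF dqs_cc[OF idr_srel[OF srelD(2)[OF M]] Y Z] h(1)] .
  have g: "g \<in> hom C V X" using cc_span2(1)[OF dqs_cc[OF M X Y] h(2) V(2)] .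
  show "(h, g) \<in> dqs F G M Z z X x"
    using h dqs_idr[OF srelD(2)[OF M] V(1) Z(2) V(2) Y(2)] by (simp add: dqs_iff[OF V(2) g] dqs_iff[OF V(1) g])
qed

lemma dqs_step2:
  assumes M: "srel F G M" and X: "X \<in> Obj C" "x \<in> val F X" and Y: "Y \<in> Obj C" "y \<in> val G Y"
    and Z: "Z \<in> Obj C" "z \<in> val F Z"
  shows "ccomp Z Y (dqs F G M Y y X x) (dqs F F (idr F) X x Z z) \<subseteq> dqs F G M Y y Z z"
proof (rule ccomp_least[OF dqs_cc[OF M Z Y]])
  fix h f g assume h: "(h, f) \<in> dqs F G M Y y X x" "(f, g) \<in> dqs F F (idr F) X x Z z"
  obtain V where V: "h \<in> hom C V Y" "f \<in> hom C V X" using cc_spanE[OF dqs_cc[OF M X Y] h(1)] .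
  have g: "g \<in> hom C V Z" using cc_span2(1)[OF dqs_cc[OF idr_srel[OF srelD(1)[OF M]] Z X] h(2) V(2)] .
  show "(h, g) \<in> dqs F G M Y y Z z"
    using h dqs_idr[OF srelD(1)[OF M] V(2) X(2) g Z(2)] by (simp add: dqs_iff[OF V] dqs_iff[OF V(1) g])
qed

lemma El_qcat:
  assumes F: "sh F"
  shows "is_qcat crib (El F)" "crib.symm (El F)"
proof -
  note i = idr_srel[OF F]
  have sm: "small TYPE('u) (elems F)" unfolding elems_def
    by (rule small_image, rule small_Sigma[OF univ small_C(1)], rule presheafD(1)[OF shD[OF F]])
  show "is_qcat crib (El F)" unfolding is_qcat_def El_simps
  proof (intro conjI ballI)
    show "qty (El F) \<in> elems F \<rightarrow>\<^sub>E Obj crib" by (auto simp: El_def elim!: elemsE)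
    show "ddist F F (idr F) \<in> (\<Pi>\<^sub>E y\<in>elems F. \<Pi>\<^sub>E x\<in>elems F. hom crib (qty (El F) x) (qty (El F) y))"
      unfolding ddist_def using dqs_cc[OF i] by (auto simp: hom_crib El_def elim!: elemsE)
    show "ddist F F (idr F) w v \<bullet> ddist F F (idr F) v u \<preceq> ddist F F (idr F) w u"
      if "u \<in> elems F" "v \<in> elems F" "w \<in> elems F" for u v w
      using that dqs_step[OF i] crib_comp[OF dqs_cc[OF i] dqs_cc[OF i]] by (auto elim!: elemsE)
    show "Ide crib (qty (El F) u) \<preceq> ddist F F (idr F) u u" if "u \<in> elems F" for u
      using that cid_least[OF dqs_cc[OF i]] dqs_idr[OF F] by (auto elim!: elemsE)
  qed (use sm in simp)
  show "crib.symm (El F)" unfolding symmetric_qcat_def El_simps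
  proof (intro ballI)
    fix u v assume "u \<in> elems F" "v \<in> elems F"
    then obtain X x Y y where e: "u = pc (X, x)" "v = pc (Y, y)" and X: "X \<in> Obj C" "x \<in> val F X" and Y: "Y \<in> Obj C" "y \<in> val F Y"
      by (auto elim!: elemsE)
    have "prod.swap ` dqs F F (idr F) Y y X x = dqs F F (idr F) X x Y y"
      using hom_obj(1) by (auto simp: dqs_def idr_def image_def) blast+
    then show "ddist F F (idr F) u v = Inv crib (ddist F F (idr F) v u)" using X Y by (simp add: e)
  qed
qed

lemma ddist_dst:
  assumes M: "srel F G M"
  shows "crib.dst (El F) (El G) (ddist F G M)"
proof -
  note F = srelD(1)[OF M] and G = srelD(2)[OF M]
  have "crib.dst (El F) (El G) (\<lambda>v\<in>qobj (El G). \<lambda>u\<in>qobj (El F). ddist F G M v u)"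
    unfolding El_simps(1)
  proof (rule crib.dst_restrictI[OF El_qcat(1)[OF F] El_qcat(1)[OF G], unfolded El_simps(1)])
    show "ddist F G M v u \<in> hom crib (qty (El F) u) (qty (El G) v)" if "u \<in> elems F" "v \<in> elems G" for u v
      using that dqs_cc[OF M] by (auto simp: hom_crib elim!: elemsE)
    show "qhom (El G) w v \<bullet> ddist F G M v u \<preceq> ddist F G M w u" if "u \<in> elems F" "v \<in> elems G" "w \<in> elems G" for u v w
      using that dqs_step[OF M] crib_comp[OF dqs_cc[OF M] dqs_cc[OF idr_srel[OF G]]] by (auto elim!: elemsE)
    show "ddist F G M v u \<bullet> qhom (El F) u w \<preceq> ddist F G M v w" if "u \<in> elems F" "w \<in> elems F" "v \<in> elems G" for u v w
      using that dqs_step2[OF M] crib_comp[OF dqs_cc[OF idr_srel[OF F]] dqs_cc[OF M]] by (auto elim!: elemsE)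
  qed
  then show ?thesis by (simp add: ddist_def cong: restrict_cong)
qed

definition th where
  "th \<Theta> Y y X x = fst (snd (\<Theta> (pc (Y, y)) (pc (X, x))))"

context
  fixes F G \<Theta>
  assumes F: "sh F" and G: "sh G" and T: "crib.dst (El F) (El G) \<Theta>"
begin

lemma th:
  assumes "X \<in> Obj C" "x \<in> val F X" "Y \<in> Obj C" "y \<in> val G Y"
  shows "\<Theta> (pc (Y, y)) (pc (X, x)) = (X, th \<Theta> Y y X x, Y)" "cc X Y (th \<Theta> Y y X x)"
  using crib.dstD(3)[OF T, of "pc (X, x)" "pc (Y, y)"] assms by (auto simp: hom_crib th_def)

text \<open>Equal restrictions f y = f' y' put (f', f) into the hom-arrow between these elements,
  and likewise on the other side. The two actions on a distributor then move a span from one entry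
  to another, so membership depends on the restrictions only.\<close>

lemma th_move:
  assumes X: "X \<in> Obj C" "x \<in> val F X" and Y: "Y \<in> Obj C" "y \<in> val G Y"
    and X': "X' \<in> Obj C" "x' \<in> val F X'" and Y': "Y' \<in> Obj C" "y' \<in> val G Y'"
    and f: "f \<in> hom C V Y" "f' \<in> hom C V Y'" "act G f y = act G f' y'"
    and g: "g \<in> hom C V X" "g' \<in> hom C V X'" "act F g x = act F g' x'"
    and h: "(f, g) \<in> th \<Theta> Y y X x"
  shows "(f', g') \<in> th \<Theta> Y' y' X' x'"
proof -
  note iF = idr_srel[OF F] and iG = idr_srel[OF G]
  have "qhom (El G) (pc (Y', y')) (pc (Y, y)) \<bullet> \<Theta> (pc (Y, y)) (pc (X, x)) \<preceq> \<Theta> (pc (Y', y')) (pc (X, x))"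
    using crib.dstD(4)[OF T, of "pc (X, x)" "pc (Y, y)" "pc (Y', y')"] X Y Y' by simp
  then have 1: "ccomp X Y' (dqs G G (idr G) Y' y' Y y) (th \<Theta> Y y X x) \<subseteq> th \<Theta> Y' y' X x"
    using X Y Y' th(1)[OF X Y] th(1)[OF X Y'] crib_comp[OF th(2)[OF X Y] dqs_cc[OF iG Y Y']] by simp
  have "\<Theta> (pc (Y', y')) (pc (X, x)) \<bullet> qhom (El F) (pc (X, x)) (pc (X', x')) \<preceq> \<Theta> (pc (Y', y')) (pc (X', x'))"
    using crib.dstD(5)[OF T, of "pc (X, x)" "pc (X', x')" "pc (Y', y')"] X X' Y' by simp
  then have 2: "ccomp X' Y' (th \<Theta> Y' y' X x) (dqs F F (idr F) X x X' x') \<subseteq> th \<Theta> Y' y' X' x'"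
    using X X' Y' th(1)[OF X Y'] th(1)[OF X' Y'] crib_comp[OF dqs_cc[OF iF X' X] th(2)[OF X Y']] by simp
  have "(f', f) \<in> dqs G G (idr G) Y' y' Y y" using dqs_idr[OF G f(2) Y'(2) f(1) Y(2)] f(3) by simp
  then have "(f', g) \<in> th \<Theta> Y' y' X x" using 1 ccompI[OF th(2)[OF X Y] dqs_cc[OF iG Y Y'] _ h] by blast
  moreover have "(g, g') \<in> dqs F F (idr F) X x X' x'" using dqs_idr[OF F g(1) X(2) g(2) X'(2)] g(3) by simp
  ultimately show ?thesis using 2 ccompI[OF dqs_cc[OF iF X' X] th(2)[OF X Y']] by blast
qed

text \<open>The inverse of \<open>ddist\<close>. By \<open>th_move\<close> every entry is determined
  by the entries at elements over one object and the span of identities.\<close>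

definition relof :: "'co => ('u \<times> 'u) set" where
  "relof = (\<lambda>V\<in>Obj C. {(y, x). y \<in> val G V \<and> x \<in> val F V \<and> (Ide C V, Ide C V) \<in> th \<Theta> V y V x})"

lemma th_relof:
  assumes X: "X \<in> Obj C" "x \<in> val F X" and Y: "Y \<in> Obj C" "y \<in> val G Y" and f: "f \<in> hom C V Y" and g: "g \<in> hom C V X"
  shows "(f, g) \<in> th \<Theta> Y y X x \<longleftrightarrow> (act G f y, act F g x) \<in> relof V"
proof -
  note V = hom_obj(1)[OF f] note i = ide_in[OF V]
  note a = act_in[OF G f Y(2)] act_in[OF F g X(2)]
  have "(f, g) \<in> th \<Theta> Y y X x \<longleftrightarrow> (Ide C V, Ide C V) \<in> th \<Theta> V (act G f y) V (act F g x)"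
    using th_move[OF X Y V a(2) V a(1) f i _ g i] th_move[OF V a(2) V a(1) X Y i f _ i g] act_id[OF F V a(2)] act_id[OF G V a(1)] by auto
  then show ?thesis using a V by (simp add: relof_def)
qed

lemma relof_srel: "srel F G relof"
  unfolding relof_def
proof (rule srelI[OF F G])
  let ?R = "\<lambda>V. {(y, x). y \<in> val G V \<and> x \<in> val F V \<and> (Ide C V, Ide C V) \<in> th \<Theta> V y V x}"
  have R: "?R V = relof V" if "V \<in> Obj C" for V using that by (simp add: relof_def)
  show "y \<in> val G V \<and> x \<in> val F V" if "(y, x) \<in> ?R V" for V y x using that by simp
  show "(act G s y, act F s x) \<in> ?R W" if h: "s \<in> hom C W V" "(y, x) \<in> ?R V" for V W s y x
  proof -
    note o = hom_obj[OF h(1)]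
    have yx: "y \<in> val G V" "x \<in> val F V" "(Ide C V, Ide C V) \<in> th \<Theta> V y V x" using h(2) by simp_all
    have "(Ide C V \<odot> s, Ide C V \<odot> s) \<in> th \<Theta> V y V x"
      using ccD(4)[OF th(2)[OF o(2) yx(2) o(2) yx(1)] yx(3) ide_in[OF o(2)] h(1)] .
    then show ?thesis unfolding R[OF o(1)] using th_relof[OF o(2) yx(2) o(2) yx(1) h(1) h(1)] idl[OF h(1)] by simp
  qed
  show "(y, x) \<in> ?R V" if h: "V \<in> Obj C" "y \<in> val G V" "x \<in> val F V" "cov V (\<lambda>s. (act G s y, act F s x) \<in> ?R (Dom C s))" for V y x
  proof -
    note i = ide_in[OF h(1)]
    have "cov V (\<lambda>s. (Ide C V \<odot> s, Ide C V \<odot> s) \<in> th \<Theta> V y V x)"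
    proof (rule cov_mono[OF h(4,1)])
      fix W s assume s: "s \<in> hom C W V" "(act G s y, act F s x) \<in> ?R (Dom C s)"
      then show "(Ide C V \<odot> s, Ide C V \<odot> s) \<in> th \<Theta> V y V x"
        using R[OF hom_obj(1)[OF s(1)]] homD(2)[OF s(1)] idl[OF s(1)] th_relof[OF h(1,3,1,2) s(1) s(1)] by simp
    qed
    then show ?thesis using ccD(5)[OF th(2)[OF h(1,3,1,2)] i i] h by blast
  qed
qed

lemma ddist_relof: "ddist F G relof = \<Theta>"
proof (rule crib.dst_eqI[OF ddist_dst[OF relof_srel] T])
  fix u v assume "u \<in> qobj (El F)" "v \<in> qobj (El G)"
  then obtain X x Y y where e: "u = pc (X, x)" "v = pc (Y, y)" and X: "X \<in> Obj C" "x \<in> val F X" and Y: "Y \<in> Obj C" "y \<in> val G Y"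
    by (auto elim!: elemsE)
  have "dqs F G relof Y y X x = th \<Theta> Y y X x"
  proof (intro set_eqI, clarify)
    fix f g
    show "(f, g) \<in> dqs F G relof Y y X x \<longleftrightarrow> (f, g) \<in> th \<Theta> Y y X x"
      using cc_spanE[OF dqs_cc[OF relof_srel X Y], of f g] cc_spanE[OF th(2)[OF X Y], of f g]
        dqs_iff[of f _ Y g X F G relof y x] th_relof[OF X Y] by metis
  qed
  then show "ddist F G relof v u = \<Theta> v u" using th(1)[OF X Y] X Y by (simp add: e)
qed

end

lemma srel_ddist_iff:
  assumes "V \<in> Obj C" "y \<in> val G V" "x \<in> val F V" and F: "sh F" "sh G"
  shows "(Ide C V, Ide C V) \<in> dqs F G M V y V x \<longleftrightarrow> (y, x) \<in> M V"
  using act_id[OF F(1) assms(1,3)] act_id[OF F(2) assms(1,2)] by (simp add: dqs_iff[OF ide_in[OF assms(1)] ide_in[OF assms(1)]])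

lemma ddist_le_iff:
  assumes M: "srel F G M" and N: "srel F G N"
  shows "(\<forall>v\<in>elems G. \<forall>u\<in>elems F. ddist F G M v u \<preceq> ddist F G N v u) \<longleftrightarrow> (\<forall>V\<in>Obj C. M V \<subseteq> N V)"
proof
  note F = srelD(1,2)[OF M]
  assume a: "\<forall>v\<in>elems G. \<forall>u\<in>elems F. ddist F G M v u \<preceq> ddist F G N v u"
  show "\<forall>V\<in>Obj C. M V \<subseteq> N V"
  proof (intro ballI subsetI, clarify)
    fix V y x assume V: "V \<in> Obj C" and h: "(y, x) \<in> M V"
    note yx = srelD(4,5)[OF M V h]
    have "ddist F G M (pc (V, y)) (pc (V, x)) \<preceq> ddist F G N (pc (V, y)) (pc (V, x))"
      using a[rule_format, OF elemsI[OF V yx(1)] elemsI[OF V yx(2)]] .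
    then have "dqs F G M V y V x \<subseteq> dqs F G N V y V x" using V yx by simp
    then show "(y, x) \<in> N V" using srel_ddist_iff[OF V yx F] h by blast
  qed
next
  assume a: "\<forall>V\<in>Obj C. M V \<subseteq> N V"
  have "dqs F G M Y y X x \<subseteq> dqs F G N Y y X x" for Y y X x
    unfolding dqs_def using a hom_obj(1) by blast
  then show "\<forall>v\<in>elems G. \<forall>u\<in>elems F. ddist F G M v u \<preceq> ddist F G N v u" by (auto elim!: elemsE)
qed

lemma srel_eqI: "srel F G M ==> srel F G N ==> (\<And>V. V \<in> Obj C ==> M V = N V) ==> M = N"
  using extensionalityI[OF srelD(3) srelD(3)] .

lemma ddist_inj:
  assumes "srel F G M" "srel F G N" "ddist F G M = ddist F G N"
  shows "M = N"
proof (rule srel_eqI[OF assms(1,2)])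
  have "\<forall>v\<in>elems G. \<forall>u\<in>elems F. ddist F G M v u \<preceq> ddist F G N v u \<and> ddist F G N v u \<preceq> ddist F G M v u"
    unfolding assms(3) by (auto elim!: elemsE)
  then show "M V = N V" if "V \<in> Obj C" for V
    using ddist_le_iff[OF assms(1,2)] ddist_le_iff[OF assms(2,1)] that by blast
qed

lemma swap_mem: "(a, b) \<in> prod.swap ` S \<longleftrightarrow> (b, a) \<in> S"
  by force

definition rinv :: "('co => ('u \<times> 'u) set) => 'co => ('u \<times> 'u) set" where
  "rinv M = (\<lambda>V\<in>Obj C. prod.swap ` M V)"

lemma ddist_rinv:
  assumes M: "srel F G M"
  shows "srel G F (rinv M)" "ddist G F (rinv M) = crib.dinv (El F) (El G) (ddist F G M)"
proof -
  note F = srelD(1,2)[OF M]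
  note sw = swap_mem
  show r: "srel G F (rinv M)" unfolding rinv_def
  proof (rule srelI[OF F(2,1)], unfold sw)
    show "y \<in> val F V \<and> x \<in> val G V" if "V \<in> Obj C" "(x, y) \<in> M V" for V y x
      using srelD(4,5)[OF M that] by blast
    show "(act G s x, act F s y) \<in> M W" if "s \<in> hom C W V" "(x, y) \<in> M V" for V W s y x
      using srelD(6)[OF M that] .
    show "(x, y) \<in> M V" if "V \<in> Obj C" "y \<in> val F V" "x \<in> val G V" "cov V (\<lambda>s. (act G s x, act F s y) \<in> M (Dom C s))" for V y x
      using srelD(7)[OF M that(1,3,2,4)] .
  qed
  note c = El_qcat(2)[OF F(1)] El_qcat(2)[OF F(2)]
  show "ddist G F (rinv M) = crib.dinv (El F) (El G) (ddist F G M)"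
  proof (rule crib.dst_eqI[OF ddist_dst[OF r] crib.dinv_dst[OF ddist_dst[OF M] c]])
    fix u v assume "u \<in> qobj (El G)" "v \<in> qobj (El F)"
    then obtain X x Y y where e: "v = pc (X, x)" "u = pc (Y, y)" and X: "X \<in> Obj C" "x \<in> val F X" and Y: "Y \<in> Obj C" "y \<in> val G Y"
      by (auto elim!: elemsE)
    have "dqs G F (rinv M) X x Y y = prod.swap ` dqs F G M Y y X x"
    proof (intro set_eqI, clarify)
      fix g f
      have "(act F g x, act G f y) \<in> rinv M V \<longleftrightarrow> (act G f y, act F g x) \<in> M V" if "f \<in> hom C V Y" for V
        using hom_obj(1)[OF that] by (simp add: rinv_def sw)
      then show "(g, f) \<in> dqs G F (rinv M) X x Y y \<longleftrightarrow> (g, f) \<in> prod.swap ` dqs F G M Y y X x"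
        unfolding dqs_def swap_mem by auto
    qed
    then show "ddist G F (rinv M) v u = crib.dinv (El F) (El G) (ddist F G M) v u"
      using X Y by (simp add: e crib.dinv_def)
  qed
qed

text \<open>The pointwise composite is in general not closed under gluing, so it is not itself an
  \<open>srel\<close>; the composite distributor is compared with it through common upper
  bounds.\<close>

lemma ddist_comp_le_iff:
  assumes M: "srel F G M" and N: "srel G H N" and \<chi>: "srel F H \<chi>"
  shows "(\<forall>w\<in>elems H. \<forall>u\<in>elems F. crib.dcomp (El F) (El G) (El H) (ddist G H N) (ddist F G M) w u \<preceq> ddist F H \<chi> w u)
    \<longleftrightarrow> (\<forall>V\<in>Obj C. N V O M V \<subseteq> \<chi> V)"
proof -
  note F = srelD(1,2)[OF M] and H = srelD(2)[OF N]
  note d = ddist_dst[OF M] ddist_dst[OF N] ddist_dst[OF \<chi>]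
  have "(\<forall>w\<in>elems H. \<forall>u\<in>elems F. crib.dcomp (El F) (El G) (El H) (ddist G H N) (ddist F G M) w u \<preceq> ddist F H \<chi> w u)
    \<longleftrightarrow> (\<forall>w\<in>elems H. \<forall>u\<in>elems F. \<forall>v\<in>elems G. ddist G H N w v \<bullet> ddist F G M v u \<preceq> ddist F H \<chi> w u)"
    using crib.dcomp_le_iff[OF d(1,2)] crib.dstD(3)[OF d(3)] by simp
  also have "\<dots> \<longleftrightarrow> (\<forall>V\<in>Obj C. N V O M V \<subseteq> \<chi> V)"
  proof
    assume a: "\<forall>w\<in>elems H. \<forall>u\<in>elems F. \<forall>v\<in>elems G. ddist G H N w v \<bullet> ddist F G M v u \<preceq> ddist F H \<chi> w u"
    show "\<forall>V\<in>Obj C. N V O M V \<subseteq> \<chi> V"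
    proof (intro ballI subsetI, clarify)
      fix V z y x assume V: "V \<in> Obj C" and h: "(z, y) \<in> N V" "(y, x) \<in> M V"
      note x = srelD(5)[OF M V h(2)] and y = srelD(4)[OF M V h(2)] and z = srelD(4)[OF N V h(1)]
      note c = dqs_cc[OF M V x V y] dqs_cc[OF N V y V z]
      have "ddist G H N (pc (V, z)) (pc (V, y)) \<bullet> ddist F G M (pc (V, y)) (pc (V, x)) \<preceq> ddist F H \<chi> (pc (V, z)) (pc (V, x))"
        using a[rule_format, OF elemsI[OF V z] elemsI[OF V x] elemsI[OF V y]] .
      then have "ccomp V V (dqs G H N V z V y) (dqs F G M V y V x) \<subseteq> dqs F H \<chi> V z V x"
        using crib_comp[OF c] V x y z by simp
      then show "(z, x) \<in> \<chi> V"
        using ccompI[OF c] srel_ddist_iff[OF V z y F(2) H] srel_ddist_iff[OF V y x F] srel_ddist_iff[OF V z x F(1) H] h by blast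
    qed
  next
    assume a: "\<forall>V\<in>Obj C. N V O M V \<subseteq> \<chi> V"
    have "ccomp X Z (dqs G H N Z z Y y) (dqs F G M Y y X x) \<subseteq> dqs F H \<chi> Z z X x"
      if X: "X \<in> Obj C" "x \<in> val F X" and Y: "Y \<in> Obj C" "y \<in> val G Y" and Z: "Z \<in> Obj C" "z \<in> val H Z" for X x Y y Z z
    proof (rule ccomp_least[OF dqs_cc[OF \<chi> X Z]])
      fix h f g assume h: "(h, f) \<in> dqs G H N Z z Y y" "(f, g) \<in> dqs F G M Y y X x"
      obtain V where V: "h \<in> hom C V Z" "f \<in> hom C V Y" using cc_spanE[OF dqs_cc[OF N Y Z] h(1)] .
      have g: "g \<in> hom C V X" using cc_span2(1)[OF dqs_cc[OF M X Y] h(2) V(2)] .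
      show "(h, g) \<in> dqs F H \<chi> Z z X x"
        using h a[rule_format, OF hom_obj(1)[OF g]] unfolding dqs_iff[OF V] dqs_iff[OF V(2) g] dqs_iff[OF V(1) g] by blast
    qed
    then show "\<forall>w\<in>elems H. \<forall>u\<in>elems F. \<forall>v\<in>elems G. ddist G H N w v \<bullet> ddist F G M v u \<preceq> ddist F H \<chi> w u"
      using crib_comp[OF dqs_cc[OF M] dqs_cc[OF N]] by (auto elim!: elemsE)
  qed
  finally show ?thesis .
qed

lemma srel_comp_ex:
  assumes M: "srel F G M" and N: "srel G H N"
  obtains \<chi> where "srel F H \<chi>" "ddist F H \<chi> = crib.dcomp (El F) (El G) (El H) (ddist G H N) (ddist F G M)"
    "\<And>V. V \<in> Obj C ==> N V O M V \<subseteq> \<chi> V"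
    "\<And>\<omega> V. srel F H \<omega> ==> \<forall>V\<in>Obj C. N V O M V \<subseteq> \<omega> V ==> V \<in> Obj C ==> \<chi> V \<subseteq> \<omega> V"
proof -
  note F = srelD(1)[OF M] and H = srelD(2)[OF N]
  note D = crib.dcomp_dst[OF ddist_dst[OF M] ddist_dst[OF N]]
  define \<chi> where "\<chi> = relof F H (crib.dcomp (El F) (El G) (El H) (ddist G H N) (ddist F G M))"
  have \<chi>: "srel F H \<chi>" and e: "ddist F H \<chi> = crib.dcomp (El F) (El G) (El H) (ddist G H N) (ddist F G M)"
    unfolding \<chi>_def using relof_srel[OF F H D] ddist_relof[OF F H D] by blast+
  show thesis
  proof (rule that[OF \<chi> e])
    have "\<forall>w\<in>elems H. \<forall>u\<in>elems F. ddist F H \<chi> w u \<preceq> ddist F H \<chi> w u" by (auto elim!: elemsE)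
    then show "N V O M V \<subseteq> \<chi> V" if "V \<in> Obj C" for V
      using ddist_comp_le_iff[OF M N \<chi>] that unfolding e by blast
    show "\<chi> V \<subseteq> \<omega> V" if "srel F H \<omega>" "\<forall>V\<in>Obj C. N V O M V \<subseteq> \<omega> V" "V \<in> Obj C" for \<omega> V
      using ddist_comp_le_iff[OF M N that(1)] ddist_le_iff[OF \<chi> that(1)] that unfolding e by blast
  qed
qed

text \<open>Composition corresponds to the least local relation above the pointwise composites. Any
  \<chi> with this property qualifies: \<open>rcomp\<close> in general, the pointwise composite
  itself for graphs.\<close>

lemma ddist_comp:
  assumes M: "srel F G M" and N: "srel G H N" and \<chi>: "srel F H \<chi>"
    and up: "\<And>V. V \<in> Obj C ==> N V O M V \<subseteq> \<chi> V"
    and lo: "\<And>\<omega> V. srel F H \<omega> ==> \<forall>V\<in>Obj C. N V O M V \<subseteq> \<omega> V ==> V \<in> Obj C ==> \<chi> V \<subseteq> \<omega> V"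
  shows "ddist F H \<chi> = crib.dcomp (El F) (El G) (El H) (ddist G H N) (ddist F G M)"
proof -
  obtain \<kappa> where k: "srel F H \<kappa>" "ddist F H \<kappa> = crib.dcomp (El F) (El G) (El H) (ddist G H N) (ddist F G M)"
    "\<And>V. V \<in> Obj C ==> N V O M V \<subseteq> \<kappa> V"
    "\<And>\<omega> V. srel F H \<omega> ==> \<forall>V\<in>Obj C. N V O M V \<subseteq> \<omega> V ==> V \<in> Obj C ==> \<kappa> V \<subseteq> \<omega> V"
    using srel_comp_ex[OF M N] by blast
  have "\<chi> = \<kappa>" by (rule srel_eqI[OF \<chi> k(1)]) (use lo[OF k(1)] k(3) k(4)[OF \<chi>] up in blast)
  then show ?thesis using k(2) by simp
qed

end

section \<open>Composition of local relations, and transformations as functional relations\<close>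

context sheaf_site
begin

text \<open>A middle element is required only locally, as for images of sheaves.\<close>

definition rcomp :: "('u, 'co, 'cm) presheaf => ('u, 'co, 'cm) presheaf => ('co => ('u \<times> 'u) set) => ('co => ('u \<times> 'u) set) => 'co => ('u \<times> 'u) set" where
  "rcomp F H N M = (\<lambda>V\<in>Obj C. {(z, x). z \<in> val H V \<and> x \<in> val F V \<and>
     cov V (\<lambda>s. (act H s z, act F s x) \<in> N (Dom C s) O M (Dom C s))})"

lemma rcomp_srel:
  assumes M: "srel F G M" and N: "srel G H N"
  shows "srel F H (rcomp F H N M)"
  unfolding rcomp_def
proof (rule srelI)
  show F: "sh F" and H: "sh H" using srelD(1)[OF M] srelD(2)[OF N] .
  let ?P = "\<lambda>z x s. (act H s z, act F s x) \<in> N (Dom C s) O M (Dom C s)"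
  let ?R = "\<lambda>V. {(z, x). z \<in> val H V \<and> x \<in> val F V \<and> cov V (?P z x)}"
  have sh: "?P z x (s \<odot> t) \<longleftrightarrow> ?P (act H s z) (act F s x) t"
    if "s \<in> hom C W V" "t \<in> hom C W' W" "z \<in> val H V" "x \<in> val F V" for W W' V s t z x
    using act_comp[OF F that(1,2,4)] act_comp[OF H that(1,2,3)] homD(2)[of _ C, OF that(2)] homD(2)[of _ C, OF comp_in[OF that(1,2)]] by simp
  show "z \<in> val H V \<and> x \<in> val F V" if "(z, x) \<in> ?R V" for V z x using that by simp
  show "(act H s z, act F s x) \<in> ?R W" if s: "s \<in> hom C W V" and "(z, x) \<in> ?R V" for V W s z x
  proof -
    have h: "z \<in> val H V" "x \<in> val F V" "cov V (?P z x)" using that(2) by simp_all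
    have "cov W (?P (act H s z) (act F s x))"
      by (rule cov_mono[OF cov_pull[OF h(3) s] hom_obj(1)[OF s]]) (use sh[OF s _ h(1,2)] in blast)
    then show ?thesis using act_in[OF H s h(1)] act_in[OF F s h(2)] by simp
  qed
  show "(z, x) \<in> ?R V" if h: "V \<in> Obj C" "z \<in> val H V" "x \<in> val F V" "cov V (\<lambda>s. (act H s z, act F s x) \<in> ?R (Dom C s))" for V z x
  proof -
    have "cov V (?P z x)"
    proof (rule cov_trans[OF h(4,1)])
      fix W s assume s: "s \<in> hom C W V" and a: "(act H s z, act F s x) \<in> ?R (Dom C s)"
      have "cov W (?P (act H s z) (act F s x))" using a homD(2)[OF s] by simp
      then show "cov W (\<lambda>t. ?P z x (s \<odot> t))"
        by (rule cov_mono[OF _ hom_obj(1)[OF s]]) (use sh[OF s _ h(2,3)] in blast)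
    next
      fix W W' s t assume s: "s \<in> hom C W V" and a: "?P z x s" and t: "t \<in> hom C W' W"
      obtain y where y: "(act H s z, y) \<in> N W" "(y, act F s x) \<in> M W" using a homD(2)[OF s] by auto
      show "?P z x (s \<odot> t)" unfolding sh[OF s t h(2,3)]
        using srelD(6)[OF N t y(1)] srelD(6)[OF M t y(2)] homD(2)[OF t] by auto
    qed
    then show ?thesis using h by simp
  qed
qed

lemma ddist_rcomp:
  assumes M: "srel F G M" and N: "srel G H N"
  shows "ddist F H (rcomp F H N M) = crib.dcomp (El F) (El G) (El H) (ddist G H N) (ddist F G M)"
proof (rule ddist_comp[OF M N rcomp_srel[OF M N]])
  show "N V O M V \<subseteq> rcomp F H N M V" if V: "V \<in> Obj C" for V
  proof clarify
    fix z y x assume h: "(z, y) \<in> N V" "(y, x) \<in> M V"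
    have "cov V (\<lambda>s. (act H s z, act F s x) \<in> N (Dom C s) O M (Dom C s))"
    proof (rule cov_all[OF V])
      fix W s assume s: "s \<in> hom C W V"
      show "(act H s z, act F s x) \<in> N (Dom C s) O M (Dom C s)"
        using srelD(6)[OF N s h(1)] srelD(6)[OF M s h(2)] homD(2)[OF s] by auto
    qed
    then show "(z, x) \<in> rcomp F H N M V" using V srelD(4)[OF N V h(1)] srelD(5)[OF M V h(2)] by (simp add: rcomp_def)
  qed
  show "rcomp F H N M V \<subseteq> \<omega> V" if w: "srel F H \<omega>" "\<forall>V\<in>Obj C. N V O M V \<subseteq> \<omega> V" "V \<in> Obj C" for \<omega> V
  proof clarify
    fix z x assume "(z, x) \<in> rcomp F H N M V"
    then have h: "z \<in> val H V" "x \<in> val F V" "cov V (\<lambda>s. (act H s z, act F s x) \<in> N (Dom C s) O M (Dom C s))"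
      using w(3) by (simp_all add: rcomp_def)
    have "cov V (\<lambda>s. (act H s z, act F s x) \<in> \<omega> (Dom C s))"
    proof (rule cov_mono[OF h(3) w(3)])
      fix W s assume s: "s \<in> hom C W V" and a: "(act H s z, act F s x) \<in> N (Dom C s) O M (Dom C s)"
      show "(act H s z, act F s x) \<in> \<omega> (Dom C s)" using w(2) hom_obj(1)[OF s] homD(2)[OF s] a by auto
    qed
    then show "(z, x) \<in> \<omega> V" using srelD(7)[OF w(1,3) h(1,2)] by blast
  qed
qed

text \<open>The unit compares the diagonal with a composite in the sense of \<open>rcomp\<close>, so
  it asserts totality only locally. The counit bounds a composite from above and so can be tested
  pointwise: it is single-valuedness.\<close>

lemma ddist_sym_left_adjoint_iff:
  assumes M: "srel F G M"
  shows "sym_left_adjoint (SymDist crib) (El F, ddist F G M, El G) \<longleftrightarrow>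
    (\<forall>V\<in>Obj C. \<forall>x\<in>val F V. cov V (\<lambda>s. \<exists>y. (y, act F s x) \<in> M (Dom C s))) \<and>
    (\<forall>V\<in>Obj C. \<forall>x y y'. (y, x) \<in> M V --> (y', x) \<in> M V --> y = y')"
proof -
  note F = srelD(1)[OF M] and G = srelD(2)[OF M] note r = ddist_rinv[OF M]
  have "sym_left_adjoint (SymDist crib) (El F, ddist F G M, El G) \<longleftrightarrow>
    (\<forall>V\<in>Obj C. idr F V \<subseteq> rcomp F F (rinv M) M V) \<and> (\<forall>V\<in>Obj C. M V O rinv M V \<subseteq> idr G V)"
    unfolding crib.sym_left_adjoint_SymDist_iff[OF ddist_dst[OF M] El_qcat(2)[OF F] El_qcat(2)[OF G]]
      r(2)[symmetric] ddist_rcomp[OF M r(1), symmetric]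
      ddist_le_iff[OF idr_srel[OF F] rcomp_srel[OF M r(1)], symmetric] ddist_comp_le_iff[OF r(1) M idr_srel[OF G], symmetric] El_simps
    by blast
  also have "(\<forall>V\<in>Obj C. idr F V \<subseteq> rcomp F F (rinv M) M V) \<longleftrightarrow>
    (\<forall>V\<in>Obj C. \<forall>x\<in>val F V. cov V (\<lambda>s. \<exists>y. (y, act F s x) \<in> M (Dom C s)))"
  proof -
    have "cov V (\<lambda>s. (act F s x, act F s x) \<in> rinv M (Dom C s) O M (Dom C s)) \<longleftrightarrow> cov V (\<lambda>s. \<exists>y. (y, act F s x) \<in> M (Dom C s))"
      if V: "V \<in> Obj C" for V x
    proof -
      have *: "(act F s x, act F s x) \<in> rinv M (Dom C s) O M (Dom C s) \<longleftrightarrow> (\<exists>y. (y, act F s x) \<in> M (Dom C s))"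
        if "s \<in> hom C W V" for s W
        using hom_obj(1)[OF that] homD(2)[OF that] by (auto simp: rinv_def swap_mem)
      show ?thesis
        by (rule iffI; erule cov_mono[OF _ V]) (use * in blast)+
    qed
    then show ?thesis by (fastforce simp: idr_def rcomp_def)
  qed
  also have "(\<forall>V\<in>Obj C. M V O rinv M V \<subseteq> idr G V) \<longleftrightarrow> (\<forall>V\<in>Obj C. \<forall>x y y'. (y, x) \<in> M V --> (y', x) \<in> M V --> y = y')"
  proof -
    have "M V O rinv M V \<subseteq> idr G V \<longleftrightarrow> (\<forall>x y y'. (y, x) \<in> M V --> (y', x) \<in> M V --> y = y')" if V: "V \<in> Obj C" for V
    proof -
      have 1: "(a, b) \<in> idr G V \<longleftrightarrow> a = b \<and> a \<in> val G V" for a b using V by (auto simp: idr_def)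
      have 2: "(a, b) \<in> M V O rinv M V \<longleftrightarrow> (\<exists>x. (a, x) \<in> M V \<and> (b, x) \<in> M V)" for a b
        using V by (auto simp: rinv_def swap_mem)
      show ?thesis unfolding subset_iff split_paired_All 1 2 using srelD(4)[OF M V] by blast
    qed
    then show ?thesis by simp
  qed
  finally show ?thesis .
qed

lemma transformationD:
  assumes "is_transformation C F G A"
  shows "V \<in> Obj C ==> x \<in> val F V ==> A V x \<in> val G V"
    and "f \<in> hom C V W ==> x \<in> val F W ==> A V (act F f x) = act G f (A W x)"
    and "A \<in> (\<Pi>\<^sub>E X\<in>Obj C. val F X \<rightarrow>\<^sub>E val G X)"
  using assms unfolding is_transformation_def by (blast intro: PiE_mem)+

lemma transformation_eqI:
  assumes "is_transformation C F G A" "is_transformation C F G B" "\<And>V x. V \<in> Obj C ==> x \<in> val F V ==> A V x = B V x"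
  shows "A = B"
proof (rule PiE_ext[OF transformationD(3)[OF assms(1)] transformationD(3)[OF assms(2)]])
  fix V assume V: "V \<in> Obj C"
  show "A V = B V"
    by (rule PiE_ext[OF PiE_mem[OF transformationD(3)[OF assms(1)] V] PiE_mem[OF transformationD(3)[OF assms(2)] V] assms(3)[OF V]])
qed

lemma transformationI:
  assumes "\<And>V x. V \<in> Obj C ==> x \<in> val F V ==> a V x \<in> val G V"
    and "\<And>V W f x. f \<in> hom C V W ==> x \<in> val F W ==> act F f x \<in> val F V ==> a V (act F f x) = act G f (a W x)"
    and F: "sh F"
  shows "is_transformation C F G (\<lambda>V\<in>Obj C. \<lambda>x\<in>val F V. a V x)"
  unfolding is_transformation_def
proof (intro conjI allI ballI)
  show "(\<lambda>V\<in>Obj C. \<lambda>x\<in>val F V. a V x) \<in> (\<Pi>\<^sub>E X\<in>Obj C. val F X \<rightarrow>\<^sub>E val G X)" using assms(1) by auto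
  fix V W f x assume f: "f \<in> hom C V W" and x: "x \<in> val F W"
  show "(\<lambda>V\<in>Obj C. \<lambda>x\<in>val F V. a V x) V (act F f x) = act G f ((\<lambda>V\<in>Obj C. \<lambda>x\<in>val F V. a V x) W x)"
    using hom_obj[OF f] act_in[OF F f x] assms(2)[OF f x] x by simp
qed

lemma Sh_simps [simp]:
  "Obj (Sh C J) = {F :: ('u, 'co, 'cm) presheaf. sh F}"
  "(F, A, G) \<in> Arr (Sh C J) \<longleftrightarrow> sh F \<and> sh G \<and> is_transformation C F G A"
  "Dom (Sh C J) (F, A, G) = F" "Cod (Sh C J) (F, A, G) = G"
  "Ide (Sh C J) F = (F, \<lambda>X\<in>Obj C. \<lambda>x\<in>val F X. x, F)"
  "(G', B, H) \<odot>\<^bsub>Sh C J\<^esub> (F, A, G) = (F, \<lambda>X\<in>Obj C. compose (val F X) (B X) (A X), H)"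
  by (simp_all add: Sh_def)

lemma hom_Sh: "hom (Sh C J) F G = {(F :: ('u, 'co, 'cm) presheaf, A, G) | A. sh F \<and> sh G \<and> is_transformation C F G A}"
  by (auto simp: hom_def[of "Sh C J"])

lemma transformation_comp:
  assumes F: "sh F" and a: "is_transformation C F G A" and b: "is_transformation C G H B"
  shows "is_transformation C F H (\<lambda>X\<in>Obj C. compose (val F X) (B X) (A X))"
  unfolding compose_def
proof (rule transformationI[OF _ _ F])
  show "B V (A V x) \<in> val H V" if "V \<in> Obj C" "x \<in> val F V" for V x
    using transformationD(1)[OF b] transformationD(1)[OF a] that by blast
  show "B V (A V (act F f x)) = act H f (B W (A W x))" if f: "f \<in> hom C V W" and "x \<in> val F W" for V W f x
    using transformationD(2)[OF b f transformationD(1)[OF a hom_obj(2)[OF f] that(2)]] transformationD(2)[OF a f that(2)] by simp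
qed

definition gph :: "('u, 'co, 'cm) presheaf => ('co => 'u => 'u) => 'co => ('u \<times> 'u) set" where
  "gph F A = (\<lambda>V\<in>Obj C. {(A V x, x) | x. x \<in> val F V})"

lemma gph_iff: "V \<in> Obj C ==> (y, x) \<in> gph F A V \<longleftrightarrow> x \<in> val F V \<and> y = A V x"
  by (auto simp: gph_def)

lemma gph_srel:
  assumes F: "sh F" and G: "sh G" and a: "is_transformation C F G A"
  shows "srel F G (gph F A)"
  unfolding gph_def
proof (rule srelI[OF F G])
  note t = transformationD[OF a]
  show "y \<in> val G V \<and> x \<in> val F V" if "V \<in> Obj C" "(y, x) \<in> {(A V x, x) | x. x \<in> val F V}" for V y x
    using that t(1) by auto
  show "(act G s y, act F s x) \<in> {(A W x, x) | x. x \<in> val F W}" if s: "s \<in> hom C W V" and "(y, x) \<in> {(A V x, x) | x. x \<in> val F V}" for V W s y x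
    using that(2) act_in[OF F s] t(2)[OF s] by auto
  show "(y, x) \<in> {(A V x, x) | x. x \<in> val F V}" if h: "V \<in> Obj C" "y \<in> val G V" "x \<in> val F V"
    "cov V (\<lambda>s. (act G s y, act F s x) \<in> {(A (Dom C s) x, x) | x. x \<in> val F (Dom C s)})" for V y x
  proof -
    have "cov V (\<lambda>s. act G s y = act G s (A V x))"
    proof (rule cov_mono[OF h(4,1)])
      fix W s assume s: "s \<in> hom C W V" "(act G s y, act F s x) \<in> {(A (Dom C s) x, x) | x. x \<in> val F (Dom C s)}"
      show "act G s y = act G s (A V x)" using s(2) t(2)[OF s(1) h(3)] homD(2)[OF s(1)] by auto
    qed
    then have "y = A V x" using sheaf_separated[OF G h(1,2) t(1)[OF h(1,3)]] by blast
    then show ?thesis using h(3) by simp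
  qed
qed

text \<open>Single-valuedness makes the locally existing values compatible, hence they glue in the
  sheaf G; as M is local, the glued value is related to x. So local totality becomes
  totality.\<close>

lemma srel_functional_gph:
  assumes M: "srel F G M"
    and tot: "\<forall>V\<in>Obj C. \<forall>x\<in>val F V. cov V (\<lambda>s. \<exists>y. (y, act F s x) \<in> M (Dom C s))"
    and fn: "\<forall>V\<in>Obj C. \<forall>x y y'. (y, x) \<in> M V --> (y', x) \<in> M V --> y = y'"
  obtains A where "is_transformation C F G A" "M = gph F A"
proof -
  note F = srelD(1)[OF M] and G = srelD(2)[OF M]
  have ex: "\<exists>y. (y, x) \<in> M V" if V: "V \<in> Obj C" and x: "x \<in> val F V" for V x
  proof -
    have "\<exists>y\<in>val G V. \<forall>W s a. s \<in> hom C W V --> (a, act F s x) \<in> M (Dom C s) --> act G s y = a"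
    proof (rule sheaf_glue[OF G V bspec[OF bspec[OF tot V] x]])
      fix W s a assume s: "s \<in> hom C W V" "(a, act F s x) \<in> M (Dom C s)"
      note W = hom_obj(1)[OF s(1)]
      have a: "(a, act F s x) \<in> M W" using s(2) homD(2)[OF s(1)] by simp
      show "a \<in> val G W" using srelD(4)[OF M W a] .
      show "a = b" if "(b, act F s x) \<in> M (Dom C s)" for b using fn W a that homD(2)[OF s(1)] by auto
      show "(act G t a, act F (s \<odot> t) x) \<in> M (Dom C (s \<odot> t))" if t: "t \<in> hom C W' W" for W' t
        using srelD(6)[OF M t a] act_comp[OF F s(1) t x] homD(2)[of _ C, OF comp_in[OF s(1) t]] by simp
    qed
    then obtain y where y: "y \<in> val G V" "\<forall>W s a. s \<in> hom C W V --> (a, act F s x) \<in> M (Dom C s) --> act G s y = a" by blast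
    have "cov V (\<lambda>s. (act G s y, act F s x) \<in> M (Dom C s))"
      by (rule cov_mono[OF bspec[OF bspec[OF tot V] x] V]) (use y(2) in blast)
    then show ?thesis using srelD(7)[OF M V y(1) x] by blast
  qed
  define a where "a V x = (THE y. (y, x) \<in> M V)" for V x
  have a: "(y, x) \<in> M V \<longleftrightarrow> x \<in> val F V \<and> y = a V x" if V: "V \<in> Obj C" for V x y
  proof -
    have "a V x = y" if "(y, x) \<in> M V" for y unfolding a_def using fn V that by blast
    then show ?thesis using ex[OF V] srelD(5)[OF M V] by blast
  qed
  show thesis
  proof (rule that)
    show "is_transformation C F G (\<lambda>V\<in>Obj C. \<lambda>x\<in>val F V. a V x)"
    proof (rule transformationI[OF _ _ F])
      show "a V x \<in> val G V" if "V \<in> Obj C" "x \<in> val F V" for V x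
        using srelD(4)[OF M that(1)] a[OF that(1)] that(2) by blast
      show "a V (act F f x) = act G f (a W x)" if f: "f \<in> hom C V W" "x \<in> val F W" for V W f x
        using srelD(6)[OF M f(1)] a[OF hom_obj(1)[OF f(1)]] a[OF hom_obj(2)[OF f(1)]] f(2) by metis
    qed
    show "M = gph F (\<lambda>V\<in>Obj C. \<lambda>x\<in>val F V. a V x)"
    proof (rule extensionalityI[OF srelD(3)[OF M]])
      show "gph F (\<lambda>V\<in>Obj C. \<lambda>x\<in>val F V. a V x) \<in> extensional (Obj C)" by (simp add: gph_def)
      show "M V = gph F (\<lambda>V\<in>Obj C. \<lambda>x\<in>val F V. a V x) V" if "V \<in> Obj C" for V
        using a[OF that] that by (auto simp: gph_def)
    qed
  qed
qed

definition Graph :: "('u, 'co, 'cm) transformation => ('u, 'co, 'co \<times> ('cm \<times> 'cm) set \<times> 'co) distributor" where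
  "Graph = (\<lambda>(F, A, G). (El F, ddist F G (gph F A), El G))"

lemma Graph_embedding: "cat_embedding (Sh C J) (sym_maps (SymDist crib)) El Graph"
proof -
  have in_hom: "Graph (F, A, G) \<in> hom (sym_maps (SymDist crib)) (El F) (El G)"
    if F: "sh F" and G: "sh G" and a: "is_transformation C F G A" for F G A
  proof -
    note g = gph_srel[OF F G a]
    have "sym_left_adjoint (SymDist crib) (El F, ddist F G (gph F A), El G)" unfolding ddist_sym_left_adjoint_iff[OF g]
    proof (intro conjI ballI allI impI)
      fix V assume V: "V \<in> Obj C"
      show "cov V (\<lambda>s. \<exists>y. (y, act F s x) \<in> gph F A (Dom C s))" if x: "x \<in> val F V" for x
      proof (rule cov_all[OF V])
        fix W s assume s: "s \<in> hom C W V"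
        show "\<exists>y. (y, act F s x) \<in> gph F A (Dom C s)" using gph_iff[OF hom_obj(1)[OF s]] act_in[OF F s x] homD(2)[OF s] by simp
      qed
      show "y = y'" if "(y, x) \<in> gph F A V" "(y', x) \<in> gph F A V" for x y y' using that gph_iff[OF V] by simp
    qed
    then show ?thesis using ddist_dst[OF g] El_qcat(2)[OF F] El_qcat(2)[OF G] by (simp add: Graph_def hom_sym_maps crib.hom_SymDist)
  qed
  show ?thesis unfolding cat_embedding_def
  proof (intro conjI allI ballI)
    show "Dom (Sh C J) f \<in> Obj (Sh C J)" "Cod (Sh C J) f \<in> Obj (Sh C J)" if "f \<in> Arr (Sh C J)" for f :: "('u, 'co, 'cm) transformation"
      using that by (cases f; simp)+
    have idt: "is_transformation C F F (\<lambda>X\<in>Obj C. \<lambda>x\<in>val F X. x)" if "sh F" for F :: "('u, 'co, 'cm) presheaf"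
      by (rule transformationI[OF _ refl that])
    show "Ide (Sh C J) F \<in> hom (Sh C J) F F" if "F \<in> Obj (Sh C J)" for F :: "('u, 'co, 'cm) presheaf"
      using that idt by (simp add: hom_Sh)
    show "g \<odot>\<^bsub>Sh C J\<^esub> f \<in> hom (Sh C J) F H" if "f \<in> hom (Sh C J) F G" "g \<in> hom (Sh C J) G H" for f g and F G H :: "('u, 'co, 'cm) presheaf"
      using that transformation_comp by (auto simp: hom_Sh)
    show "El F \<in> Obj (sym_maps (SymDist crib))" if "F \<in> Obj (Sh C J)" for F using that El_qcat by simp
    show "Graph (Ide (Sh C J) F) = Ide (sym_maps (SymDist crib)) (El F)" if F: "F \<in> Obj (Sh C J)" for F
    proof -
      have "gph F (\<lambda>X\<in>Obj C. \<lambda>x\<in>val F X. x) = idr F" unfolding gph_def idr_def by (rule restrict_ext) auto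
      then show ?thesis by (simp add: Graph_def)
    qed
    show "Graph (g \<odot>\<^bsub>Sh C J\<^esub> f) = Graph g \<odot>\<^bsub>sym_maps (SymDist crib)\<^esub> Graph f"
      if h: "f \<in> hom (Sh C J) F G" "g \<in> hom (Sh C J) G H" for f g and F G H :: "('u, 'co, 'cm) presheaf"
    proof -
      obtain A B where f: "f = (F, A, G)" "sh F" "sh G" "is_transformation C F G A" and g: "g = (G, B, H)" "sh H" "is_transformation C G H B"
        using h unfolding hom_Sh by blast
      let ?c = "\<lambda>X\<in>Obj C. compose (val F X) (B X) (A X)"
      have e: "gph F ?c V = gph G B V O gph F A V" if "V \<in> Obj C" for V
        using transformationD(1)[OF f(4) that] that by (auto simp: compose_def relcomp_unfold gph_iff[OF that])
      have "ddist F H (gph F ?c) = crib.dcomp (El F) (El G) (El H) (ddist G H (gph G B)) (ddist F G (gph F A))"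
        by (rule ddist_comp[OF gph_srel[OF f(2-4)] gph_srel[OF f(3) g(2,3)] gph_srel[OF f(2) g(2) transformation_comp[OF f(2,4) g(3)]]])
          (use e in auto)
      then show ?thesis by (simp add: Graph_def f(1) g(1))
    qed
    show "bij_betw Graph (hom (Sh C J) F G) (hom (sym_maps (SymDist crib)) (El F) (El G))"
      if "F \<in> Obj (Sh C J)" "G \<in> Obj (Sh C J)" for F G
    proof -
      have F: "sh F" and G: "sh G" using that by simp_all
      have "inj_on Graph (hom (Sh C J) F G)"
      proof (rule inj_onI)
        fix f g assume "f \<in> hom (Sh C J) F G" "g \<in> hom (Sh C J) F G" and e: "Graph f = Graph g"
        then obtain A B where f: "f = (F, A, G)" "is_transformation C F G A" and g: "g = (F, B, G)" "is_transformation C F G B"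
          by (auto simp: hom_Sh)
        have "gph F A = gph F B" using ddist_inj[OF gph_srel[OF F G f(2)] gph_srel[OF F G g(2)]] e by (simp add: Graph_def f(1) g(1))
        then have "A V x = B V x" if "V \<in> Obj C" "x \<in> val F V" for V x
          using gph_iff[OF that(1)] that(2) by metis
        then show "f = g" using transformation_eqI[OF f(2) g(2)] by (simp add: f(1) g(1))
      qed
      moreover have "\<exists>f\<in>hom (Sh C J) F G. Graph f = u" if u: "u \<in> hom (sym_maps (SymDist crib)) (El F) (El G)" for u
      proof -
        obtain \<Theta> where t: "u = (El F, \<Theta>, El G)" "crib.dst (El F) (El G) \<Theta>" and s: "sym_left_adjoint (SymDist crib) u"
          using u by (auto simp: hom_sym_maps crib.hom_SymDist)
        note r = relof_srel[OF F G t(2)] note d = ddist_relof[OF F G t(2)]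
        have "sym_left_adjoint (SymDist crib) (El F, ddist F G (relof F G \<Theta>), El G)" using s t(1) d by simp
        then obtain A where "is_transformation C F G A" "relof F G \<Theta> = gph F A"
          using srel_functional_gph[OF r] unfolding ddist_sym_left_adjoint_iff[OF r] by blast
        then show ?thesis using d by (intro bexI[of _ "(F, A, G)"]) (simp_all add: Graph_def t(1) hom_Sh F G)
      qed
      moreover have "Graph f \<in> hom (sym_maps (SymDist crib)) (El F) (El G)" if "f \<in> hom (Sh C J) F G" for f
        using that in_hom[OF F G] unfolding hom_Sh by blast
      ultimately show ?thesis unfolding bij_betw_def by blast
    qed
  qed
qed

end

section \<open>The sheaf of a symmetric category enriched in closed cribles\<close>

context site
begin

definition cr :: "('u => 'u => 'o \<times> ('m \<times> 'm) set \<times> 'o) => 'u => 'u => ('m \<times> 'm) set" where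
  "cr M y x = fst (snd (M y x))"

lemma dst_cr:
  assumes "crib.dst A B M" "x \<in> qobj A" "y \<in> qobj B"
  shows "M y x = (qty A x, cr M y x, qty B y)" "cc (qty A x) (qty B y) (cr M y x)"
  using crib.dstD(3)[OF assms] by (auto simp: hom_crib cr_def)

text \<open>Entries of a composite are closed cribles, so it is enough that each span of \<Xi>
  factors locally, possibly through different y on different members of the cover.\<close>

lemma dcomp_crib_eqI:
  assumes M: "crib.dst A B M" and N: "crib.dst B D N" and \<Xi>: "crib.dst A D \<Xi>"
    and lo: "\<And>x y z k h g. x \<in> qobj A ==> y \<in> qobj B ==> z \<in> qobj D ==> (k, h) \<in> cr N z y ==> (h, g) \<in> cr M y x ==> (k, g) \<in> cr \<Xi> z x"
    and up: "\<And>x z k g U. x \<in> qobj A ==> z \<in> qobj D ==> (k, g) \<in> cr \<Xi> z x ==> k \<in> hom C U (qty D z) ==> g \<in> hom C U (qty A x) ==>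
      cov U (\<lambda>s. \<exists>y\<in>qobj B. \<exists>h. (k \<odot> s, h) \<in> cr N z y \<and> (h, g \<odot> s) \<in> cr M y x)"
  shows "crib.dcomp A B D N M = \<Xi>"
proof (rule crib.dst_eqI[OF crib.dcomp_dst[OF M N] \<Xi>])
  fix x z assume x: "x \<in> qobj A" and z: "z \<in> qobj D"
  note d = dst_cr[OF crib.dcomp_dst[OF M N] x z] and e = dst_cr[OF \<Xi> x z]
  have comp: "N z y \<bullet> M y x = (qty A x, ccomp (qty A x) (qty D z) (cr N z y) (cr M y x), qty D z)" if y: "y \<in> qobj B" for y
    using dst_cr[OF M x y] dst_cr[OF N y z] by simp
  have "N z y \<bullet> M y x \<preceq> \<Xi> z x" if y: "y \<in> qobj B" for y
    using comp[OF y] e(1) ccomp_least[OF e(2) lo[OF x y z]] by simp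
  then have "crib.dcomp A B D N M z x \<preceq> \<Xi> z x"
    using crib.dcomp_le_iff[OF M N x z crib.dstD(3)[OF \<Xi> x z]] by blast
  then have 1: "cr (crib.dcomp A B D N M) z x \<subseteq> cr \<Xi> z x" using d(1) e(1) by simp
  have sub: "(k, g) \<in> cr (crib.dcomp A B D N M) z x"
    if y: "y \<in> qobj B" and h: "(k, h) \<in> cr N z y" "(h, g) \<in> cr M y x" for y k h g
    using crib.dcomp_upper[OF M N x z y] comp[OF y] d(1) ccompI[OF dst_cr(2)[OF M x y] dst_cr(2)[OF N y z] h] by auto
  have "cr \<Xi> z x \<subseteq> cr (crib.dcomp A B D N M) z x"
  proof clarify
    fix k g assume kg: "(k, g) \<in> cr \<Xi> z x"
    then obtain U where U: "k \<in> hom C U (qty D z)" "g \<in> hom C U (qty A x)" using cc_spanE[OF e(2)] by blast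
    show "(k, g) \<in> cr (crib.dcomp A B D N M) z x"
      by (rule ccD(5)[OF d(2) U cov_mono[OF up[OF x z kg U] hom_obj(1)[OF U(1)]]]) (use sub in blast)
  qed
  then show "crib.dcomp A B D N M z x = \<Xi> z x" using 1 d(1) e(1) by simp
qed

end

context sheaf_site
begin

context
  fixes A :: "('u, 'co, 'co \<times> ('cm \<times> 'cm) set \<times> 'co) qcat" and c :: "('cm \<times> 'u \<times> 'cm) set => 'u"
  assumes A: "is_qcat crib A" and As: "crib.symm A" and c: "inj_on c (Pow (Arr C \<times> qobj A \<times> Arr C))"
begin

abbreviation "hm \<equiv> cr (qhom A)"
abbreviation "tp \<equiv> qty A"

lemmas R = dst_cr[OF crib.dst_id[OF A]]
lemmas ty = crib.qcatD(1)[OF A, simplified]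

text \<open>\<open>(f, g) \<in> hm a b\<close> reads: a restricted along f equals b restricted along
  g. Symmetry, the composition law and the identity law of A say that this is an equivalence
  relation on restrictions of objects.\<close>

lemma R_sym: "(f, g) \<in> hm a b ==> a \<in> qobj A ==> b \<in> qobj A ==> (g, f) \<in> hm b a"
  using crib.symD[OF As, of a b] R(1)[of a b] R(1)[of b a] swap_mem[of f g "hm b a"] by simp

lemma R_trans: "(h, f) \<in> hm a b ==> (f, g) \<in> hm b d ==> a \<in> qobj A ==> b \<in> qobj A ==> d \<in> qobj A ==> (h, g) \<in> hm a d"
  using crib.qcatD(3)[OF A, of d b a] R[of d b] R[of b a] R(1)[of d a] ccompI[of "tp d" "tp b" "hm b d" "tp a" "hm a b" h f g] by auto

lemma R_refl: "f \<in> hom C U (tp a) ==> a \<in> qobj A ==> (f, f) \<in> hm a a"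
  using crib.qcatD(4)[OF A, of a] R(1)[of a a] cid_refl[of f U "tp a"] ty[of a] by auto

text \<open>
  The triple \<open>(s, a, f)\<close> says that, restricted along \<open>s\<close>, the section is the restriction of \<open>a\<close>
  along \<open>f\<close>.
\<close>

definition sec :: "'co => ('cm \<times> 'u \<times> 'cm) set => bool" where
  "sec W L \<longleftrightarrow> (\<forall>s a f. (s, a, f) \<in> L --> a \<in> qobj A \<and> (\<exists>V. s \<in> hom C V W \<and> f \<in> hom C V (tp a))) \<and>
     (\<forall>s a f b g. (s, a, f) \<in> L --> (s, b, g) \<in> L --> (f, g) \<in> hm a b) \<and>
     (\<forall>V V' s a f t. (s, a, f) \<in> L --> s \<in> hom C V W --> t \<in> hom C V' V --> (s \<odot> t, a, f \<odot> t) \<in> L) \<and>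
     (\<forall>s a f b g. (s, a, f) \<in> L --> b \<in> qobj A --> (g, f) \<in> hm b a --> (s, b, g) \<in> L) \<and>
     (\<forall>V s a f. s \<in> hom C V W --> a \<in> qobj A --> f \<in> hom C V (tp a) --> cov V (\<lambda>t. (s \<odot> t, a, f \<odot> t) \<in> L) --> (s, a, f) \<in> L) \<and>
     cov W (\<lambda>s. \<exists>a f. (s, a, f) \<in> L)"

lemmas sec_conjs = sec_def[THEN iffD1, THEN conjunct1] sec_def[THEN iffD1, THEN conjunct2]

lemmas secD = sec_conjs(1)[rule_format, THEN conjunct1] sec_conjs(1)[rule_format, THEN conjunct2]
  sec_conjs(2)[THEN conjunct1, rule_format] sec_conjs(2)[THEN conjunct2, THEN conjunct1, rule_format]
  sec_conjs(2)[THEN conjunct2, THEN conjunct2, THEN conjunct1, rule_format]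
  sec_conjs(2)[THEN conjunct2, THEN conjunct2, THEN conjunct2, THEN conjunct1, rule_format]
  sec_conjs(2)[THEN conjunct2, THEN conjunct2, THEN conjunct2, THEN conjunct2]

lemma sec_dom: "sec W L ==> (s, a, f) \<in> L ==> s \<in> hom C V W ==> f \<in> hom C V (tp a)"
  using secD(2)[of W L s a f] homD(2)[of s C V W] homD(2)[of s C _ W] by metis

definition rs :: "'cm => ('cm \<times> 'u \<times> 'cm) set => ('cm \<times> 'u \<times> 'cm) set" where
  "rs h L = {(s, a, f). s \<in> Arr C \<and> Cod C s = Dom C h \<and> (h \<odot> s, a, f) \<in> L}"

lemma rs_iff: "h \<in> hom C V W ==> s \<in> hom C V' V ==> (s, a, f) \<in> rs h L \<longleftrightarrow> (h \<odot> s, a, f) \<in> L"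
  by (simp add: rs_def hom_def)

lemma rs_dom: "h \<in> hom C V W ==> (s, a, f) \<in> rs h L ==> s \<in> hom C (Dom C s) V"
  by (simp add: rs_def hom_def)

lemma rs_sec:
  assumes L: "sec W L" and h: "h \<in> hom C V W"
  shows "sec V (rs h L)"
  unfolding sec_def
proof (intro conjI allI impI)
  note d = rs_dom[OF h] and i = rs_iff[OF h]
  show "a \<in> qobj A" "\<exists>V'. s \<in> hom C V' V \<and> f \<in> hom C V' (tp a)" "(s, b, g) \<in> rs h L ==> (f, g) \<in> hm a b"
    if m: "(s, a, f) \<in> rs h L" for s a f b g
  proof -
    note s = d[OF m] note m' = m[unfolded i[OF s]]
    show "a \<in> qobj A" using secD(1)[OF L m'] .
    show "\<exists>V'. s \<in> hom C V' V \<and> f \<in> hom C V' (tp a)" using s sec_dom[OF L m' comp_in[OF h s]] by blast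
    show "(s, b, g) \<in> rs h L ==> (f, g) \<in> hm a b" using secD(3)[OF L m'] i[OF s] by blast
  qed
  show "(s \<odot> t, a, f \<odot> t) \<in> rs h L" if "(s, a, f) \<in> rs h L" "s \<in> hom C V' V" "t \<in> hom C V'' V'" for V' V'' s a f t
    using secD(4)[OF L _ comp_in[OF h that(2)] that(3)] that(1) i[OF that(2)] i[OF comp_in[OF that(2,3)]] assoc[OF h that(2,3)] by simp
  show "(s, b, g) \<in> rs h L" if "(s, a, f) \<in> rs h L" "b \<in> qobj A" "(g, f) \<in> hm b a" for s a f b g
    using secD(5)[OF L _ that(2,3)] that(1) i[OF d[OF that(1)]] by blast
  show "(s, a, f) \<in> rs h L" if s: "s \<in> hom C V' V" and f: "a \<in> qobj A" "f \<in> hom C V' (tp a)"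
    and cv: "cov V' (\<lambda>t. (s \<odot> t, a, f \<odot> t) \<in> rs h L)" for V' s a f
  proof -
    have "cov V' (\<lambda>t. ((h \<odot> s) \<odot> t, a, f \<odot> t) \<in> L)"
    proof (rule cov_mono[OF cv hom_obj(1)[OF s]])
      fix V'' t assume t: "t \<in> hom C V'' V'"
      show "(s \<odot> t, a, f \<odot> t) \<in> rs h L ==> ((h \<odot> s) \<odot> t, a, f \<odot> t) \<in> L"
        using i[OF comp_in[OF s t]] assoc[OF h s t] by simp
    qed
    then show ?thesis unfolding i[OF s] using secD(6)[OF L comp_in[OF h s] f] by blast
  qed
  show "cov V (\<lambda>s. \<exists>a f. (s, a, f) \<in> rs h L)"
    by (rule cov_mono[OF cov_pull[OF secD(7)[OF L] h] hom_obj(1)[OF h]]) (use i in blast)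
qed

lemma rs_id:
  assumes L: "sec W L" and W: "W \<in> Obj C"
  shows "rs (Ide C W) L = L"
proof (intro set_eqI, clarify)
  fix s a f
  have *: "s \<in> hom C V W ==> (s, a, f) \<in> rs (Ide C W) L \<longleftrightarrow> (s, a, f) \<in> L" for V
    using rs_iff[OF ide_in[OF W]] idl by simp
  show "(s, a, f) \<in> rs (Ide C W) L \<longleftrightarrow> (s, a, f) \<in> L"
    using * rs_dom[OF ide_in[OF W]] secD(2)[OF L] by blast
qed

lemma rs_comp:
  assumes h: "h \<in> hom C V W" and k: "k \<in> hom C U V"
  shows "rs (h \<odot> k) L = rs k (rs h L)"
proof (intro set_eqI, clarify)
  fix s a f
  have *: "s \<in> hom C U' U ==> (s, a, f) \<in> rs (h \<odot> k) L \<longleftrightarrow> (s, a, f) \<in> rs k (rs h L)" for U'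
    using rs_iff[OF comp_in[OF h k]] rs_iff[OF k] rs_iff[OF h comp_in[OF k]] assoc[OF h k] by simp
  show "(s, a, f) \<in> rs (h \<odot> k) L \<longleftrightarrow> (s, a, f) \<in> rs k (rs h L)"
    using * rs_dom[OF comp_in[OF h k]] rs_dom[OF k] by blast
qed

lemma rs_ide_iff: "sec W L ==> h \<in> hom C V W ==> (Ide C V, a, f) \<in> rs h L \<longleftrightarrow> (h, a, f) \<in> L"
  using rs_iff[OF _ ide_in[OF hom_obj(1)]] idr by metis

text \<open>One triple at the identity generates the whole section: it is restricted along u, and
  closure under \<open>hm\<close> then reaches every triple over u.\<close>

lemma sec_eqI:
  assumes L: "sec V L" and K: "sec V K" and V: "V \<in> Obj C" and m: "(Ide C V, a, f) \<in> L" "(Ide C V, a, f) \<in> K"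
  shows "L = K"
proof -
  note a = secD(1)[OF L m(1)]
  have "L \<subseteq> K" if L: "sec V L" and K: "sec V K" and m: "(Ide C V, a, f) \<in> L" "(Ide C V, a, f) \<in> K" for L K
  proof clarify
    fix u b g assume u: "(u, b, g) \<in> L"
    then obtain U where h: "u \<in> hom C U V" using secD(2)[OF L] by blast
    note r = secD(4)[OF L m(1) ide_in[OF V] h] secD(4)[OF K m(2) ide_in[OF V] h]
    show "(u, b, g) \<in> K" using secD(5)[OF K r(2) secD(1)[OF L u]] secD(3)[OF L u] r idl[OF h] by simp
  qed
  then show ?thesis using assms by blast
qed

text \<open>K consists of the triples that belong locally to the given sections. It restricts to L s
  on the cover because each L s already contains whatever belongs to it locally.\<close>

lemma sec_glue:
  assumes W: "W \<in> Obj C" and S: "S \<in> J W" and L: "\<And>s. s \<in> S ==> sec (Dom C s) (L s)"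
    and m: "\<And>V s t. s \<in> S ==> t \<in> hom C V (Dom C s) ==> L (s \<odot> t) = rs t (L s)"
  shows "\<exists>K. sec W K \<and> (\<forall>s\<in>S. rs s K = L s)"
proof -
  note sv = sieveD[OF J_sieve[OF W S]]
  \<comment> \<open>The family is read at identities, which turns membership in L s at t into a
    condition on the composite of s and t alone; the matching condition says exactly that this is
    consistent.\<close>
  define P where "P a s f \<longleftrightarrow> s \<in> S \<and> (Ide C (Dom C s), a, f) \<in> L s" for a s f
  have P: "P a (s \<odot> t) f \<longleftrightarrow> (t, a, f) \<in> L s" if s: "s \<in> S" and t: "t \<in> hom C V (Dom C s)" for a s t f V
    unfolding P_def using sv(2)[OF s t] m[OF s t] homD(2)[of _ C, OF comp_in[OF sv(1)[OF s] t]] rs_ide_iff[OF L[OF s] t] by simp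
  have Pr: "P a (s \<odot> t) (f \<odot> t)" if p: "P a s f" and t: "t \<in> hom C V (Dom C s)" for a s f t V
  proof -
    have s: "s \<in> S" using p unfolding P_def by blast
    note i = ide_in[OF hom_obj(1)[OF sv(1)[OF s]]]
    show ?thesis unfolding P[OF s t] using secD(4)[OF L[OF s] _ i t] p[unfolded P_def] idl[OF t] by simp
  qed
  define K where "K = {(s, a, f). a \<in> qobj A \<and> (\<exists>V. s \<in> hom C V W \<and> f \<in> hom C V (tp a) \<and> cov V (\<lambda>t. P a (s \<odot> t) (f \<odot> t)))}"
  have ti: "(s, a, f) \<in> K \<longleftrightarrow> a \<in> qobj A \<and> f \<in> hom C V (tp a) \<and> cov V (\<lambda>t. P a (s \<odot> t) (f \<odot> t))"
    if "s \<in> hom C V W" for s a f V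
    unfolding K_def using that homD(2)[of s C _ W] by auto
  have st: "(s \<odot> t, a, f \<odot> t) \<in> K" if h: "(s, a, f) \<in> K" "s \<in> hom C V W" "t \<in> hom C V' V" for s a f t V V'
  proof -
    note f = h(1)[unfolded ti[OF h(2)]]
    have "cov V' (\<lambda>u. P a ((s \<odot> t) \<odot> u) ((f \<odot> t) \<odot> u))"
    proof (rule cov_mono[OF cov_pull[OF _ h(3)] hom_obj(1)[OF h(3)]])
      show "cov V (\<lambda>t. P a (s \<odot> t) (f \<odot> t))" using f by blast
      fix U u assume u: "u \<in> hom C U V'"
      show "P a (s \<odot> (t \<odot> u)) (f \<odot> (t \<odot> u)) ==> P a ((s \<odot> t) \<odot> u) ((f \<odot> t) \<odot> u)"
        using assoc[OF h(2,3) u] assoc[OF _ h(3) u, of f "tp a"] f by simp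
    qed
    then show ?thesis using f comp_in[OF _ h(3)] unfolding ti[OF comp_in[OF h(2,3)]] by blast
  qed
  have rS: "rs s K = L s" if s: "s \<in> S" for s
  proof (intro set_eqI, clarify)
    fix t a f
    note h = sv(1)[OF s]
    have *: "(t, a, f) \<in> rs s K \<longleftrightarrow> (t, a, f) \<in> L s" if t: "t \<in> hom C V (Dom C s)" for V
    proof -
      have "P a ((s \<odot> t) \<odot> u) (f \<odot> u) \<longleftrightarrow> (t \<odot> u, a, f \<odot> u) \<in> L s" if u: "u \<in> hom C U V" for U u
        using P[OF s comp_in[OF t u]] assoc[OF h t u] by simp
      then have e: "cov V (\<lambda>u. P a ((s \<odot> t) \<odot> u) (f \<odot> u)) \<longleftrightarrow> cov V (\<lambda>u. (t \<odot> u, a, f \<odot> u) \<in> L s)"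
        by (intro iffI; elim cov_mono[OF _ hom_obj(1)[OF t]]) blast+
      have up: "cov V (\<lambda>u. (t \<odot> u, a, f \<odot> u) \<in> L s)" if "(t, a, f) \<in> L s"
        by (rule cov_all[OF hom_obj(1)[OF t]]) (use secD(4)[OF L[OF s] that t] in blast)
      show ?thesis unfolding rs_iff[OF h t] ti[OF comp_in[OF h t]] e
        using secD(1)[OF L[OF s]] sec_dom[OF L[OF s] _ t] secD(6)[OF L[OF s] t] up by blast
    qed
    then show "(t, a, f) \<in> rs s K \<longleftrightarrow> (t, a, f) \<in> L s" using rs_dom[OF h] secD(2)[OF L[OF s]] by blast
  qed
  have "sec W K" unfolding sec_def
  proof (intro conjI allI impI)
    show "a \<in> qobj A" "\<exists>V. s \<in> hom C V W \<and> f \<in> hom C V (tp a)" if "(s, a, f) \<in> K" for s a f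
      using that unfolding K_def by blast+
    show "(f, g) \<in> hm a b" if h: "(s, a, f) \<in> K" "(s, b, g) \<in> K" for s a f b g
    proof -
      obtain V where s: "s \<in> hom C V W" using h(1) unfolding K_def by blast
      note f = h(1)[unfolded ti[OF s]] and g = h(2)[unfolded ti[OF s]]
      have "cov V (\<lambda>t. P a (s \<odot> t) (f \<odot> t) \<and> P b (s \<odot> t) (g \<odot> t))" using cov_conj f g hom_obj(1)[OF s] by blast
      then have "cov V (\<lambda>t. (f \<odot> t, g \<odot> t) \<in> hm a b)"
        by (rule cov_mono[OF _ hom_obj(1)[OF s]]) (use secD(3)[OF L] in \<open>unfold P_def, blast\<close>)
      then show ?thesis using ccD(5)[OF R(2)] f g by blast
    qed
    show "(s \<odot> t, a, f \<odot> t) \<in> K" if "(s, a, f) \<in> K" "s \<in> hom C V W" "t \<in> hom C V' V" for V V' s a f t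
      using st[OF that] .
    show "(s, b, g) \<in> K" if h: "(s, a, f) \<in> K" "b \<in> qobj A" "(g, f) \<in> hm b a" for s a f b g
    proof -
      obtain V where s: "s \<in> hom C V W" using h(1) unfolding K_def by blast
      note f = h(1)[unfolded ti[OF s]]
      have a: "a \<in> qobj A" using f by blast
      have g: "g \<in> hom C V (tp b)" using cc_span2(2)[OF R(2)[OF a h(2)] h(3)] f by blast
      have "cov V (\<lambda>t. P b (s \<odot> t) (g \<odot> t))"
      proof (rule cov_mono[OF _ hom_obj(1)[OF s]])
        show "cov V (\<lambda>t. P a (s \<odot> t) (f \<odot> t))" using f by blast
        show "P b (s \<odot> t) (g \<odot> t)" if t: "t \<in> hom C V' V" and "P a (s \<odot> t) (f \<odot> t)" for V' t
          using that(2) secD(5)[OF L _ h(2) ccD(4)[OF R(2)[OF a h(2)] h(3) g t]] unfolding P_def by blast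
      qed
      then show ?thesis using g h(2) unfolding ti[OF s] by blast
    qed
    show "(s, a, f) \<in> K" if s: "s \<in> hom C V W" and f: "a \<in> qobj A" "f \<in> hom C V (tp a)" and cv: "cov V (\<lambda>t. (s \<odot> t, a, f \<odot> t) \<in> K)" for V s a f
    proof -
      have "cov V (\<lambda>t. P a (s \<odot> t) (f \<odot> t))"
      proof (rule cov_trans[OF cv hom_obj(1)[OF s]])
        fix V' t assume t: "t \<in> hom C V' V" and "(s \<odot> t, a, f \<odot> t) \<in> K"
        then have "cov V' (\<lambda>u. P a ((s \<odot> t) \<odot> u) ((f \<odot> t) \<odot> u))" using ti[OF comp_in[OF s t]] by blast
        then show "cov V' (\<lambda>u. P a (s \<odot> (t \<odot> u)) (f \<odot> (t \<odot> u)))"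
          by (rule cov_mono[OF _ hom_obj(1)[OF t]]) (use assoc[OF s t] assoc[OF f(2) t] in simp)
      next
        fix V' V'' t u assume t: "t \<in> hom C V' V" "P a (s \<odot> t) (f \<odot> t)" "u \<in> hom C V'' V'"
        show "P a (s \<odot> (t \<odot> u)) (f \<odot> (t \<odot> u))"
          using Pr[OF t(2), of u] t(3) homD(2)[of _ C, OF comp_in[OF s t(1)]] assoc[OF s t(1,3)] assoc[OF f(2) t(1,3)] by simp
      qed
      then show ?thesis using f unfolding ti[OF s] by blast
    qed
    show "cov W (\<lambda>s. \<exists>a f. (s, a, f) \<in> K)"
    proof (rule cov_trans[OF _ W])
      show "cov W (\<lambda>s. s \<in> S)" using S unfolding cov_def by blast
      show "cov V (\<lambda>t. \<exists>a f. (s \<odot> t, a, f) \<in> K)" if s: "s \<in> hom C V W" "s \<in> S" for V s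
      proof -
        have "sec V (rs s K)" using L[OF s(2)] rS[OF s(2)] homD(2)[OF s(1)] by simp
        then show ?thesis
          by (rule cov_mono[OF secD(7) hom_obj(1)[OF s(1)]]) (use rs_iff[OF s(1)] in blast)
      qed
      show "\<exists>a f. (s \<odot> t, a, f) \<in> K" if "s \<in> hom C V W" "\<exists>a f. (s, a, f) \<in> K" "t \<in> hom C V' V" for V V' s t
        using st that by blast
    qed
  qed
  then show ?thesis using rS by blast
qed

lemma sec_separated:
  assumes W: "W \<in> Obj C" and S: "S \<in> J W" and L: "sec W L" and K: "sec W K" and e: "\<forall>s\<in>S. rs s L = rs s K"
  shows "L \<subseteq> K"
proof clarify
  fix s a f assume m: "(s, a, f) \<in> L"
  then obtain V where s: "s \<in> hom C V W" "f \<in> hom C V (tp a)" using secD(2)[OF L] by blast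
  have "cov W (\<lambda>s. s \<in> S)" using S unfolding cov_def by blast
  then have "cov V (\<lambda>t. (s \<odot> t, a, f \<odot> t) \<in> K)"
  proof (rule cov_mono[OF cov_pull[OF _ s(1)] hom_obj(1)[OF s(1)]])
    fix V' t assume t: "t \<in> hom C V' V" "s \<odot> t \<in> S"
    show "(s \<odot> t, a, f \<odot> t) \<in> K"
      using secD(4)[OF L m s(1) t(1)] e t(2) rs_ide_iff[OF L comp_in[OF s(1) t(1)]] rs_ide_iff[OF K comp_in[OF s(1) t(1)]] by blast
  qed
  then show "(s, a, f) \<in> K" using secD(6)[OF K s(1) secD(1)[OF L m] s(2)] by blast
qed

definition dec :: "'u => ('cm \<times> 'u \<times> 'cm) set" where
  "dec = inv_into (Pow (Arr C \<times> qobj A \<times> Arr C)) c"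

lemma sec_Pow: "sec W L ==> L \<in> Pow (Arr C \<times> qobj A \<times> Arr C)"
  using secD(1,2)[of W L] homD(1)[of _ C] by auto blast+

lemma dec: "sec W L ==> dec (c L) = L"
  unfolding dec_def using inv_into_f_f[OF c sec_Pow] by blast

definition SF :: "('u, 'co, 'cm) presheaf" where
  "SF = \<lparr>val = (\<lambda>W\<in>Obj C. c ` {L. sec W L}),
     act = (\<lambda>h\<in>Arr C. \<lambda>u\<in>c ` {L. sec (Cod C h) L}. c (rs h (dec u)))\<rparr>"

lemma SF_val: "W \<in> Obj C ==> u \<in> val SF W \<longleftrightarrow> (\<exists>L. u = c L \<and> sec W L)"
  by (auto simp: SF_def)

lemma SF_act: "h \<in> hom C V W ==> sec W L ==> act SF h (c L) = c (rs h L)"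
  using dec by (auto simp: SF_def hom_def)

lemma SF_sheaf: "sh SF"
proof -
  have "is_presheaf C SF" unfolding is_presheaf_def
  proof (intro conjI ballI allI)
    show "val SF \<in> extensional (Obj C)" by (simp add: SF_def)
    show "small TYPE('u) (val SF W)" if W: "W \<in> Obj C" for W
    proof -
      have "{L. sec W L} \<subseteq> Pow (Arr C \<times> qobj A \<times> Arr C)" using sec_Pow by blast
      moreover have "small TYPE('u) (qobj A)" using A unfolding is_qcat_def by blast
      ultimately show ?thesis using W small_image[OF small_subset[OF small_Pow[OF univ small_Times[OF univ small_C(2) small_Times[OF univ _ small_C(2)]]]]]
        by (simp add: SF_def)
    qed
    have "c (rs h (dec u)) \<in> c ` {L. sec (Dom C h) L}" if "h \<in> Arr C" "u \<in> c ` {L. sec (Cod C h) L}" for h u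
      using that rs_sec[of "Cod C h" _ h "Dom C h"] dec by (auto simp: hom_def)
    then show "act SF \<in> (\<Pi>\<^sub>E f\<in>Arr C. val SF (Cod C f) \<rightarrow>\<^sub>E val SF (Dom C f))"
      using hom_obj[OF homI[OF _ refl refl]] by (auto simp: SF_def)
    show "act SF (Ide C W) u = u" if W: "W \<in> Obj C" and u: "u \<in> val SF W" for W u
      using u SF_act[OF ide_in[OF W]] rs_id[OF _ W] SF_val[OF W] by auto
    show "act SF (g \<odot> f) u = act SF f (act SF g u)" if f: "f \<in> hom C X Y" and g: "g \<in> hom C Y Z" and u: "u \<in> val SF Z" for X Y Z f g u
      using u SF_act[OF comp_in[OF g f]] SF_act[OF g] SF_act[OF f rs_sec[OF _ g]] rs_comp[OF g f] SF_val[OF hom_obj(2)[OF g]] by auto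
  qed
  moreover have "\<exists>!u. u \<in> val SF W \<and> (\<forall>s\<in>S. act SF s u = x s)"
    if W: "W \<in> Obj C" and S: "S \<in> J W" and x: "matching_family C SF S x" for W S x
  proof -
    note sv = sieveD[OF J_sieve[OF W S]]
    have "\<exists>L. x s = c L \<and> sec (Dom C s) L" if "s \<in> S" for s
      using x SF_val[OF hom_obj(1)[OF sv(1)[OF that]]] that unfolding matching_family_def by blast
    then obtain L where L: "\<And>s. s \<in> S ==> x s = c (L s) \<and> sec (Dom C s) (L s)" by metis
    have inj: "c \<alpha> = c \<beta> ==> sec V \<alpha> ==> sec V' \<beta> ==> \<alpha> = \<beta>" for \<alpha> \<beta> V V' using dec by metis
    have "L (s \<odot> t) = rs t (L s)" if s: "s \<in> S" and t: "t \<in> hom C V (Dom C s)" for V s t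
    proof -
      have "c (L (s \<odot> t)) = c (rs t (L s))"
        using x s t L[OF s] L[OF sv(2)[OF s t]] SF_act[OF t] unfolding matching_family_def by (auto simp: hom_def)
      then show ?thesis using inj L[OF s] L[OF sv(2)[OF s t]] rs_sec[OF _ t] by blast
    qed
    then obtain K where K: "sec W K" "\<forall>s\<in>S. rs s K = L s" using sec_glue[OF W S] L by metis
    show ?thesis
    proof (rule ex1I[of _ "c K"])
      show "c K \<in> val SF W \<and> (\<forall>s\<in>S. act SF s (c K) = x s)"
        using K L SF_val[OF W] SF_act[OF sv(1) K(1)] by auto
      fix u assume u: "u \<in> val SF W \<and> (\<forall>s\<in>S. act SF s u = x s)"
      then obtain \<rho> where r: "u = c \<rho>" "sec W \<rho>" using SF_val[OF W] by blast
      have "rs s \<rho> = rs s K" if s: "s \<in> S" for s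
      proof (rule inj[OF _ rs_sec[OF r(2) sv(1)[OF s]] rs_sec[OF K(1) sv(1)[OF s]]])
        show "c (rs s \<rho>) = c (rs s K)" using u r(1) SF_act[OF sv(1)[OF s] r(2)] K(2) L[OF s] s by simp
      qed
      then have "\<rho> = K" using sec_separated[OF W S r(2) K(1)] sec_separated[OF W S K(1) r(2)] by simp
      then show "u = c K" using r(1) by simp
    qed
  qed
  ultimately show ?thesis unfolding is_sheaf_def by blast
qed

text \<open>The object a restricted along f, as a section over U. These sections guarantee that
  every span of a hom-arrow of A passes through some section.\<close>

lemma sec_principal:
  assumes a: "a \<in> qobj A" and f: "f \<in> hom C U (tp a)"
  shows "sec U {(s, b, g). b \<in> qobj A \<and> (\<exists>V. s \<in> hom C V U) \<and> (g, f \<odot> s) \<in> hm b a}"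
  unfolding sec_def
proof (intro conjI allI impI)
  let ?L = "{(s, b, g). b \<in> qobj A \<and> (\<exists>V. s \<in> hom C V U) \<and> (g, f \<odot> s) \<in> hm b a}"
  show "b \<in> qobj A" if "(s, b, g) \<in> ?L" for s b g using that by simp
  show "\<exists>V. s \<in> hom C V U \<and> g \<in> hom C V (tp b)" if "(s, b, g) \<in> ?L" for s b g
    using that cc_span2(2)[OF R(2)[OF a]] comp_in[OF f] by blast
  show "(g, h) \<in> hm b d" if "(s, b, g) \<in> ?L" "(s, d, h) \<in> ?L" for s b g d h
    using that R_trans R_sym a by blast
  show "(s \<odot> t, b, g \<odot> t) \<in> ?L" if h: "(s, b, g) \<in> ?L" "s \<in> hom C V U" "t \<in> hom C V' V" for V V' s b g t
  proof -
    have b: "b \<in> qobj A" "(g, f \<odot> s) \<in> hm b a" using h(1) by simp_all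
    have "(g \<odot> t, (f \<odot> s) \<odot> t) \<in> hm b a"
      using ccD(4)[OF R(2)[OF a b(1)] b(2) cc_span2(2)[OF R(2)[OF a b(1)] b(2) comp_in[OF f h(2)]] h(3)] .
    then show ?thesis using b(1) comp_in[OF h(2,3)] assoc[OF f h(2,3)] by auto
  qed
  show "(s, d, h) \<in> ?L" if "(s, b, g) \<in> ?L" "d \<in> qobj A" "(h, g) \<in> hm d b" for s b g d h
    using that R_trans a by blast
  show "(s, b, g) \<in> ?L" if s: "s \<in> hom C V U" and b: "b \<in> qobj A" and g: "g \<in> hom C V (tp b)" and cv: "cov V (\<lambda>t. (s \<odot> t, b, g \<odot> t) \<in> ?L)" for V s b g
  proof -
    have "(g, f \<odot> s) \<in> hm b a"
    proof (rule ccD(5)[OF R(2)[OF a b] g comp_in[OF f s] cov_mono[OF cv hom_obj(1)[OF s]]])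
      show "(g \<odot> t, (f \<odot> s) \<odot> t) \<in> hm b a" if "t \<in> hom C V' V" "(s \<odot> t, b, g \<odot> t) \<in> ?L" for V' t
        using that assoc[OF f s that(1)] by simp
    qed
    then show ?thesis using b s by blast
  qed
  show "cov U (\<lambda>s. \<exists>b g. (s, b, g) \<in> ?L)"
    by (rule cov_all[OF hom_obj(1)[OF f]]) (use a R_refl[OF comp_in[OF f] a] in blast)
qed

text \<open>Evaluation between the sheaf of sections and A: at a and L, the spans (f, s) such that L
  restricted along s is a restricted along f.\<close>

definition EA :: "'u => 'u => 'co \<times> ('cm \<times> 'cm) set \<times> 'co" where
  "EA = (\<lambda>a\<in>qobj A. \<lambda>u\<in>elems SF. (fst (dc u), {(f, s). (s, a, f) \<in> dec (snd (dc u))}, tp a))"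

lemma SF_elemsE:
  assumes "u \<in> elems SF"
  obtains W L where "u = pc (W, c L)" "W \<in> Obj C" "sec W L"
  using assms by (auto elim!: elemsE simp: SF_val)

lemma SF_elemsI: "W \<in> Obj C ==> sec W L ==> pc (W, c L) \<in> elems SF"
  using SF_val by (intro elemsI) auto

lemma EA_simp: "a \<in> qobj A ==> W \<in> Obj C ==> sec W L ==> EA a (pc (W, c L)) = (W, {(f, s). (s, a, f) \<in> L}, tp a)"
  using dec SF_elemsI by (simp add: EA_def)

lemma EA_cc:
  assumes a: "a \<in> qobj A" and W: "W \<in> Obj C" and L: "sec W L"
  shows "cc W (tp a) {(f, s). (s, a, f) \<in> L}"
proof (rule ccI[OF W ty[OF a]])
  show "\<exists>V. f \<in> hom C V (tp a) \<and> s \<in> hom C V W" if "(f, s) \<in> {(f, s). (s, a, f) \<in> L}" for f s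
    using secD(2)[OF L] that by blast
  show "(f \<odot> t, s \<odot> t) \<in> {(f, s). (s, a, f) \<in> L}"
    if "(f, s) \<in> {(f, s). (s, a, f) \<in> L}" "f \<in> hom C V (tp a)" "s \<in> hom C V W" "t \<in> hom C V' V" for V V' f s t
    using secD(4)[OF L] that by simp
  show "(f, s) \<in> {(f, s). (s, a, f) \<in> L}"
    if "f \<in> hom C V (tp a)" "s \<in> hom C V W" "cov V (\<lambda>t. (f \<odot> t, s \<odot> t) \<in> {(f, s). (s, a, f) \<in> L})" for V f s
    using secD(6)[OF L that(2) a that(1)] that(3) by simp
qed

lemma SF_dqs:
  assumes W: "W \<in> Obj C" "sec W L" and X: "X \<in> Obj C" "sec X K" and s: "s \<in> hom C V W" and t: "t \<in> hom C V X"
  shows "(s, t) \<in> dqs SF SF (idr SF) W (c L) X (c K) \<longleftrightarrow> rs s L = rs t K"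
proof -
  have "c (rs s L) = c (rs t K) \<longleftrightarrow> rs s L = rs t K" using dec[OF rs_sec[OF W(2) s]] dec[OF rs_sec[OF X(2) t]] by metis
  then show ?thesis using dqs_idr[OF SF_sheaf s _ t] SF_val W X SF_act[OF s W(2)] SF_act[OF t X(2)] by metis
qed

lemma EA_dst: "crib.dst (El SF) A EA"
proof -
  have "crib.dst (El SF) A (\<lambda>a\<in>qobj A. \<lambda>u\<in>qobj (El SF). EA a u)"
  proof (rule crib.dst_restrictI[OF El_qcat(1)[OF SF_sheaf] A], unfold El_simps(1))
    fix u a assume u: "u \<in> elems SF" and a: "a \<in> qobj A"
    obtain W L where e: "u = pc (W, c L)" and W: "W \<in> Obj C" and L: "sec W L" using SF_elemsE[OF u] .
    note E = EA_simp[OF _ W L] EA_cc[OF _ W L]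
    have v: "c L \<in> val SF W" using SF_val[OF W] L by blast
    show "EA a u \<in> hom crib (qty (El SF) u) (tp a)" unfolding e using E a W v by (simp add: hom_crib)
    show "qhom A b a \<bullet> EA a u \<preceq> EA b u" if b: "b \<in> qobj A" for b
    proof -
      have "ccomp W (tp b) (hm b a) {(f, s). (s, a, f) \<in> L} \<subseteq> {(f, s). (s, b, f) \<in> L}"
        by (rule ccomp_least[OF E(2)[OF b]]) (use secD(5)[OF L _ b] in blast)
      then show ?thesis unfolding e using E(1)[OF a] E(1)[OF b] E(2)[OF a] R[OF a b] by simp
    qed
    show "EA a u \<bullet> qhom (El SF) u v \<preceq> EA a v" if v0: "v \<in> elems SF" for v
    proof -
      obtain X K where d: "v = pc (X, c K)" and X: "X \<in> Obj C" and K: "sec X K" using SF_elemsE[OF v0] .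
      have w: "c K \<in> val SF X" using SF_val[OF X] K by blast
      note q = dqs_cc[OF idr_srel[OF SF_sheaf] X w W v]
      have "ccomp X (tp a) {(f, s). (s, a, f) \<in> L} (dqs SF SF (idr SF) W (c L) X (c K)) \<subseteq> {(f, s). (s, a, f) \<in> K}"
      proof (rule ccomp_least[OF EA_cc[OF a X K]])
        fix f s t assume h: "(f, s) \<in> {(f, s). (s, a, f) \<in> L}" "(s, t) \<in> dqs SF SF (idr SF) W (c L) X (c K)"
        obtain V where s: "s \<in> hom C V W" and t: "t \<in> hom C V X" using cc_spanE[OF q h(2)] .
        have "rs s L = rs t K" using h(2) SF_dqs[OF W L X K s t] by blast
        then show "(f, t) \<in> {(f, s). (s, a, f) \<in> K}" using h(1) rs_ide_iff[OF L s] rs_ide_iff[OF K t] by auto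
      qed
      then show ?thesis unfolding e d using E[OF a] EA_simp[OF a X K] crib_comp[OF q E(2)[OF a]] W X v w by simp
    qed
  qed
  then show ?thesis by (simp add: EA_def cong: restrict_cong)
qed

lemma EA_cr: "a \<in> qobj A ==> W \<in> Obj C ==> sec W L ==> (f, s) \<in> cr EA a (pc (W, c L)) \<longleftrightarrow> (s, a, f) \<in> L"
  by (simp add: cr_def EA_simp)

lemma EA_dinv_cr:
  "a \<in> qobj A ==> u \<in> elems SF ==> (s, f) \<in> cr (crib.dinv (El SF) A EA) u a \<longleftrightarrow> (f, s) \<in> cr EA a u"
  using dst_cr(1)[OF EA_dst, of u a] by (simp add: cr_def crib.dinv_def) (metis crib_simps(6) fst_conv snd_conv swap_mem)

text \<open>For EA\<degree> EA: two sections sharing a triple agree there by \<open>sec_eqI\<close>,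
  and equal restrictions share triples locally because sections are locally inhabited. For EA
  EA\<degree>: triples of one section over the same arrow are linked by \<open>hm\<close>, and
  conversely the principal section of a span links its two ends.\<close>

lemma EA_unitary: "unitary (SymDist crib) (El SF) A (El SF, EA, A)"
proof (rule crib.unitary_SymDistI[OF EA_dst El_qcat(2)[OF SF_sheaf] As])
  note i = crib.dinv_dst[OF EA_dst El_qcat(2)[OF SF_sheaf] As]

  have q: "(s, t) \<in> cr (qhom (El SF)) (pc (W, c L)) (pc (X, c K)) \<longleftrightarrow> rs s L = rs t K"
    if "W \<in> Obj C" "sec W L" "X \<in> Obj C" "sec X K" "s \<in> hom C V W" "t \<in> hom C V X" for W L X K s t V
  proof -
    have "c L \<in> val SF W" "c K \<in> val SF X" using SF_val that(1-4) by blast+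
    then show ?thesis using SF_dqs[OF that] that(1,3) by (simp add: cr_def)
  qed
  show "crib.dcomp (El SF) A (El SF) (crib.dinv (El SF) A EA) EA = qhom (El SF)"
  proof (rule dcomp_crib_eqI[OF EA_dst i crib.dst_id[OF El_qcat(1)[OF SF_sheaf]]], unfold El_simps(1))
    fix u w assume u: "u \<in> elems SF" and w: "w \<in> elems SF"
    obtain X K where e: "u = pc (X, c K)" and X: "X \<in> Obj C" and K: "sec X K" using SF_elemsE[OF u] .
    obtain W L where d: "w = pc (W, c L)" and W: "W \<in> Obj C" and L: "sec W L" using SF_elemsE[OF w] .
    have tyw: "qty (El SF) w = W" "qty (El SF) u = X" unfolding d e by (rule El_simps(3); use SF_val L K W X in blast)+
    note E = EA_dinv_cr[OF _ w, unfolded d EA_cr[OF _ W L]] EA_cr[OF _ X K]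
    show "(s, t) \<in> cr (qhom (El SF)) w u" if a: "a \<in> qobj A" and h: "(s, f) \<in> cr (crib.dinv (El SF) A EA) w a" "(f, t) \<in> cr EA a u" for a s f t
    proof -
      have m: "(s, a, f) \<in> L" "(t, a, f) \<in> K" using h E[OF a] EA_dinv_cr[OF a w] EA_cr[OF a W L] by (simp_all add: d e)
      obtain V where V: "s \<in> hom C V W" "f \<in> hom C V (tp a)" using secD(2)[OF L m(1)] by blast
      obtain V' where V': "t \<in> hom C V' X" "f \<in> hom C V' (tp a)" using secD(2)[OF K m(2)] by blast
      have t: "t \<in> hom C V X" using V' homD(2)[OF V(2)] homD(2)[OF V'(2)] by simp
      have "rs s L = rs t K"
        using sec_eqI[OF rs_sec[OF L V(1)] rs_sec[OF K t] hom_obj(1)[OF t]] m rs_ide_iff[OF L V(1)] rs_ide_iff[OF K t] by blast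
      then show ?thesis unfolding d e using q[OF W L X K V(1) t] by blast
    qed
    show "cov U (\<lambda>r. \<exists>a\<in>qobj A. \<exists>h. (s \<odot> r, h) \<in> cr (crib.dinv (El SF) A EA) w a \<and> (h, t \<odot> r) \<in> cr EA a u)"
      if h: "(s, t) \<in> cr (qhom (El SF)) w u" and s0: "s \<in> hom C U (qty (El SF) w)" "t \<in> hom C U (qty (El SF) u)" for s t U
    proof -
      note s = s0[unfolded tyw]
      have eq: "rs s L = rs t K" using h q[OF W L X K s] by (simp add: d e)
      show ?thesis
      proof (rule cov_mono[OF secD(7)[OF rs_sec[OF L s(1)]] hom_obj(1)[OF s(1)]])
        fix V r assume r: "r \<in> hom C V U" "\<exists>a f. (r, a, f) \<in> rs s L"
        then obtain a f where m: "(s \<odot> r, a, f) \<in> L" "(t \<odot> r, a, f) \<in> K" using rs_iff[OF s(1) r(1)] rs_iff[OF s(2) r(1)] eq by blast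
        note a = secD(1)[OF L m(1)]
        show "\<exists>a\<in>qobj A. \<exists>h. (s \<odot> r, h) \<in> cr (crib.dinv (El SF) A EA) w a \<and> (h, t \<odot> r) \<in> cr EA a u"
          using m a EA_dinv_cr[OF a w] EA_cr[OF a W L] EA_cr[OF a X K] unfolding d e by blast
      qed
    qed
  qed
  show "crib.dcomp A (El SF) A EA (crib.dinv (El SF) A EA) = qhom A"
  proof (rule dcomp_crib_eqI[OF i EA_dst crib.dst_id[OF A]], unfold El_simps(1))
    fix a b assume b: "b \<in> qobj A" and a: "a \<in> qobj A"
    show "(f, g) \<in> hm a b" if u: "u \<in> elems SF" and h: "(f, s) \<in> cr EA a u" "(s, g) \<in> cr (crib.dinv (El SF) A EA) u b" for u f s g
    proof -
      obtain W L where e: "u = pc (W, c L)" and W: "W \<in> Obj C" and L: "sec W L" using SF_elemsE[OF u] .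
      show ?thesis using h EA_dinv_cr[OF b u] EA_cr[OF a W L] EA_cr[OF b W L] secD(3)[OF L] unfolding e by blast
    qed
    show "cov U (\<lambda>r. \<exists>u\<in>elems SF. \<exists>h. (f \<odot> r, h) \<in> cr EA a u \<and> (h, g \<odot> r) \<in> cr (crib.dinv (El SF) A EA) u b)"
      if h: "(f, g) \<in> hm a b" and f: "f \<in> hom C U (tp a)" and g: "g \<in> hom C U (tp b)" for f g U
    proof -
      note U = hom_obj(1)[OF f]
      let ?L = "{(s, b, g). b \<in> qobj A \<and> (\<exists>V. s \<in> hom C V U) \<and> (g, f \<odot> s) \<in> hm b a}"
      note L = sec_principal[OF a f] note u = SF_elemsI[OF U L]
      show ?thesis
      proof (rule cov_all[OF U], rule bexI[OF _ u], rule exI, rule conjI)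
        fix V r assume r: "r \<in> hom C V U"
        show "(f \<odot> r, r) \<in> cr EA a (pc (U, c ?L))" unfolding EA_cr[OF a U L] using a r R_refl[OF comp_in[OF f r] a] by blast
        have "(g \<odot> r, f \<odot> r) \<in> hm b a" using R_sym[OF ccD(4)[OF R(2)[OF b a] h f r] a b] .
        then show "(r, g \<odot> r) \<in> cr (crib.dinv (El SF) A EA) (pc (U, c ?L)) b"
          unfolding EA_dinv_cr[OF b u] EA_cr[OF b U L] using b r by blast
      qed
    qed
  qed
qed

end

lemma El_dense:
  assumes "is_qcat crib A" "crib.symm A"
  shows "\<exists>F u. sh F \<and> unitary (SymDist crib) (El F) A u"
proof -
  have "small TYPE('u) (qobj A)" using assms(1) unfolding is_qcat_def by blast
  then obtain c :: "_ => 'u" where "inj_on c (Pow (Arr C \<times> qobj A \<times> Arr C))"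
    using small_inj[OF small_Pow[OF univ small_Times[OF univ small_C(2) small_Times[OF univ _ small_C(2)]]]] by blast
  then show ?thesis using SF_sheaf[OF assms] EA_unitary[OF assms] by blast
qed

end

section \<open>Internal relations between sheaves\<close>

context sheaf_site
begin

abbreviation T :: "(('u, 'co, 'cm) presheaf, ('u, 'co, 'cm) transformation) category" where
  "T \<equiv> Sh C J"

abbreviation tcomp (infixl "\<star>" 70) where "g \<star> f \<equiv> g \<odot>\<^bsub>T\<^esub> f"

abbreviation tr :: "('u, 'co, 'cm) presheaf => ('u, 'co, 'cm) presheaf => ('co => 'u => 'u) => bool" where
  "tr \<equiv> is_transformation C"

lemma T_category: "is_category T"
proof -
  interpret S: iqloid "SymDist crib :: (('u, 'co, 'co \<times> ('cm \<times> 'cm) set \<times> 'co) qcat, _) inv_quantaloid"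
    using crib.SymDist_inv_quantaloid by unfold_locales
  show ?thesis using embedding_is_category[OF Graph_embedding S.sym_maps_category] .
qed

lemma comp_hom:
  "sh F ==> sh G ==> sh H ==> tr F G A ==> tr G H B ==> (G, B, H) \<star> (F, A, G) \<in> hom T F H"
  using transformation_comp by (simp add: hom_Sh)

lemma comp_eq_iff:
  assumes "sh F" "tr F G A" "tr G H B" "tr F H \<gamma>"
  shows "(G, B, H) \<star> (F, A, G) = (F, \<gamma>, H) \<longleftrightarrow> (\<forall>V\<in>Obj C. \<forall>x\<in>val F V. B V (A V x) = \<gamma> V x)"
proof -
  have "(\<lambda>X\<in>Obj C. compose (val F X) (B X) (A X)) = \<gamma> \<longleftrightarrow> (\<forall>V\<in>Obj C. \<forall>x\<in>val F V. B V (A V x) = \<gamma> V x)"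
    using transformation_eqI[OF transformation_comp[OF assms(1-3)] assms(4)] by (auto simp: compose_def)
  then show ?thesis by simp
qed

lemma comp_eq_comp_iff:
  assumes "sh F" "tr F G A" "tr G H B" "tr F G' A'" "tr G' H B'"
  shows "(G, B, H) \<star> (F, A, G) = (G', B', H) \<star> (F, A', G') \<longleftrightarrow>
    (\<forall>V\<in>Obj C. \<forall>x\<in>val F V. B V (A V x) = B' V (A' V x))"
  using comp_eq_iff[OF assms(1-3) transformation_comp[OF assms(1,4,5)]] by (simp add: compose_def)

text \<open>The elementwise substitute for being a monomorphism into a product;
  \<open>mono_spans_iff\<close> proves the two equivalent.\<close>

definition jinj :: "('u, 'co, 'cm) presheaf => ('co => 'u => 'u) => ('co => 'u => 'u) => bool" where
  "jinj S \<gamma> D \<longleftrightarrow> (\<forall>V\<in>Obj C. inj_on (\<lambda>u. (\<gamma> V u, D V u)) (val S V))"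

lemma jinjD: "jinj S \<gamma> D ==> V \<in> Obj C ==> u \<in> val S V ==> w \<in> val S V ==> \<gamma> V u = \<gamma> V w ==> D V u = D V w ==> u = w"
  unfolding jinj_def inj_on_def by blast

definition rel :: "('u, 'co, 'cm) presheaf => ('co => 'u => 'u) => ('co => 'u => 'u) => 'co => ('u \<times> 'u) set" where
  "rel S \<gamma> D = (\<lambda>V\<in>Obj C. (\<lambda>u. (\<gamma> V u, D V u)) ` val S V)"

text \<open>Joint injectivity makes the pointwise preimages unique, so any choice of them is
  natural.\<close>

lemma factor:
  assumes sh: "sh R" "sh S" and a: "tr R Y A" "tr R X B" and g: "tr S Y \<gamma>" "tr S X D" and j: "jinj S \<gamma> D"
    and le: "\<And>V. V \<in> Obj C ==> rel R A B V \<subseteq> rel S \<gamma> D V"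
  obtains \<eta> where "tr R S \<eta>" "(S, \<gamma>, Y) \<star> (R, \<eta>, S) = (R, A, Y)" "(S, D, X) \<star> (R, \<eta>, S) = (R, B, X)"
proof -
  have "\<exists>w\<in>val S V. \<gamma> V w = A V u \<and> D V w = B V u" if "V \<in> Obj C" "u \<in> val R V" for V u
    using le[OF that(1)] that unfolding rel_def by force
  then obtain e where e: "\<And>V u. V \<in> Obj C ==> u \<in> val R V ==> e V u \<in> val S V \<and> \<gamma> V (e V u) = A V u \<and> D V (e V u) = B V u"
    by metis
  have t: "tr R S (\<lambda>V\<in>Obj C. \<lambda>u\<in>val R V. e V u)"
  proof (rule transformationI[OF _ _ sh(1)])
    show "e V u \<in> val S V" if "V \<in> Obj C" "u \<in> val R V" for V u using e that by blast
    show "e V (act R f u) = act S f (e W u)" if f: "f \<in> hom C V W" "u \<in> val R W" "act R f u \<in> val R V" for V W f u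
    proof -
      note o = hom_obj[OF f(1)] note eu = e[OF o(2) f(2)] and ef = e[OF o(1) f(3)]
      show ?thesis
        by (rule jinjD[OF j o(1)])
          (use ef eu act_in[OF sh(2) f(1)] transformationD(2)[OF a(1) f(1,2)] transformationD(2)[OF a(2) f(1,2)]
            transformationD(2)[OF g(1) f(1)] transformationD(2)[OF g(2) f(1)] in auto)
    qed
  qed
  show thesis
    by (rule that[OF t]; subst comp_eq_iff[OF sh(1) t]) (use a g e in auto)
qed

lemma jinj_unique:
  assumes sh: "sh R" "sh S" and g: "tr S Y \<gamma>" "tr S X D" and j: "jinj S \<gamma> D" and h: "h \<in> hom T R S" "k \<in> hom T R S"
    and e: "(S, \<gamma>, Y) \<star> h = (S, \<gamma>, Y) \<star> k" "(S, D, X) \<star> h = (S, D, X) \<star> k"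
  shows "h = k"
proof -
  obtain \<eta> \<theta> where n: "h = (R, \<eta>, S)" "tr R S \<eta>" "k = (R, \<theta>, S)" "tr R S \<theta>" using h unfolding hom_Sh by blast
  note 1 = e(1)[unfolded n(1,3), unfolded comp_eq_comp_iff[OF sh(1) n(2) g(1) n(4) g(1)]]
  note 2 = e(2)[unfolded n(1,3), unfolded comp_eq_comp_iff[OF sh(1) n(2) g(2) n(4) g(2)]]
  have "\<eta> = \<theta>"
    by (rule transformation_eqI[OF n(2,4)], rule jinjD[OF j]) (use 1 2 transformationD(1)[OF n(2)] transformationD(1)[OF n(4)] in auto)
  then show ?thesis using n by simp
qed

lemma factor_unique:
  assumes sh: "sh R" "sh S" and a: "tr R Y A" "tr R X B" and g: "tr S Y \<gamma>" "tr S X D" and j: "jinj S \<gamma> D"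
    and le: "\<And>V. V \<in> Obj C ==> rel R A B V \<subseteq> rel S \<gamma> D V"
  shows "\<exists>!h. h \<in> hom T R S \<and> (S, \<gamma>, Y) \<star> h = (R, A, Y) \<and> (S, D, X) \<star> h = (R, B, X)"
proof -
  obtain \<eta> where n: "tr R S \<eta>" "(S, \<gamma>, Y) \<star> (R, \<eta>, S) = (R, A, Y)" "(S, D, X) \<star> (R, \<eta>, S) = (R, B, X)"
    using factor[OF sh a g j le] .
  have m: "(R, \<eta>, S) \<in> hom T R S" using n(1) sh by (simp add: hom_Sh)
  show ?thesis
  proof (rule ex1I[of _ "(R, \<eta>, S)"], intro conjI m n(2,3))
    fix h assume h: "h \<in> hom T R S \<and> (S, \<gamma>, Y) \<star> h = (R, A, Y) \<and> (S, D, X) \<star> h = (R, B, X)"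
    show "h = (R, \<eta>, S)"
      by (rule jinj_unique[OF sh g j _ m]) (simp_all only: h n(2,3))
  qed
qed

text \<open>The sections of the tabulating sheaf are the codes of the related pairs, and the
  projections decode. A matching family splits into two families, which glue separately; the pair of
  glued sections is related because M is local.\<close>

lemma tabulate:
  assumes M: "srel F G M"
  obtains P \<pi> \<rho> where "sh P" "tr P G \<pi>" "tr P F \<rho>" "jinj P \<pi> \<rho>" "rel P \<pi> \<rho> = M"
proof -
  note F = srelD(1)[OF M] and G = srelD(2)[OF M]
  define un where "un = inv pr"
  have un [simp]: "un (pr z) = z" for z unfolding un_def using pr by simp
  define P :: "('u, 'co, 'cm) presheaf" where "P = \<lparr>val = (\<lambda>V\<in>Obj C. pr ` M V),
    act = (\<lambda>f\<in>Arr C. \<lambda>u\<in>pr ` M (Cod C f). pr (act G f (fst (un u)), act F f (snd (un u))))\<rparr>"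
  have v: "u \<in> val P V \<longleftrightarrow> (\<exists>y x. u = pr (y, x) \<and> (y, x) \<in> M V)" if "V \<in> Obj C" for u V
    using that by (auto simp: P_def)
  have a: "act P f (pr (y, x)) = pr (act G f y, act F f x)" if "f \<in> hom C W V" "(y, x) \<in> M V" for f W V y x
    using that by (auto simp: P_def hom_def)
  have pre: "is_presheaf C P" unfolding is_presheaf_def
  proof (intro conjI ballI allI)
    show "val P \<in> extensional (Obj C)" by (simp add: P_def)
    show "small TYPE('u) (val P V)" if V: "V \<in> Obj C" for V
    proof -
      have "M V \<subseteq> val G V \<times> val F V" using srelD(4,5)[OF M V] by auto
      then show ?thesis
        using V small_image[OF small_subset[OF small_Times[OF univ presheafD(1)[OF shD[OF G] V] presheafD(1)[OF shD[OF F] V]]]]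
        by (simp add: P_def)
    qed
    have "pr (act G f (fst (un u)), act F f (snd (un u))) \<in> pr ` M (Dom C f)" if "f \<in> Arr C" "u \<in> pr ` M (Cod C f)" for f u
      using that srelD(6)[OF M homI[OF that(1) refl refl]] by auto
    then show "act P \<in> (\<Pi>\<^sub>E f\<in>Arr C. val P (Cod C f) \<rightarrow>\<^sub>E val P (Dom C f))"
      using hom_obj[OF homI[OF _ refl refl]] by (auto simp: P_def)
    show "act P (Ide C V) u = u" if V: "V \<in> Obj C" and u: "u \<in> val P V" for V u
    proof -
      obtain y x where yx: "u = pr (y, x)" "(y, x) \<in> M V" using u v[OF V] by blast
      show ?thesis using a[OF ide_in[OF V] yx(2)] act_id[OF G V srelD(4)[OF M V yx(2)]] act_id[OF F V srelD(5)[OF M V yx(2)]] yx(1) by simp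
    qed
    show "act P (g \<odot> f) u = act P f (act P g u)" if f: "f \<in> hom C U V" and g: "g \<in> hom C V W" and u: "u \<in> val P W" for U V W f g u
    proof -
      note W = hom_obj(2)[OF g]
      obtain y x where yx: "u = pr (y, x)" "(y, x) \<in> M W" using u v[OF W] by blast
      show ?thesis using a[OF comp_in[OF g f] yx(2)] a[OF g yx(2)] a[OF f srelD(6)[OF M g yx(2)]]
          act_comp[OF G g f srelD(4)[OF M W yx(2)]] act_comp[OF F g f srelD(5)[OF M W yx(2)]] yx(1) by simp
    qed
  qed
  have P: "sh P" unfolding is_sheaf_def
  proof (intro conjI pre ballI allI impI)
    fix V S m assume V: "V \<in> Obj C" and S: "S \<in> J V" and m: "matching_family C P S m"
    note sv = sieveD[OF J_sieve[OF V S]]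
    have "\<exists>y x. m s = pr (y, x) \<and> (y, x) \<in> M (Dom C s)" if "s \<in> S" for s
      using m v[OF hom_obj(1)[OF sv(1)[OF that]]] that unfolding matching_family_def by blast
    then obtain my mx where mm: "\<And>s. s \<in> S ==> m s = pr (my s, mx s) \<and> (my s, mx s) \<in> M (Dom C s)" by metis
    have st: "my (s \<odot> t) = act G t (my s) \<and> mx (s \<odot> t) = act F t (mx s)"
      if s: "s \<in> S" and t: "t \<in> Arr C" "Cod C t = Dom C s" for s t
    proof -
      note h = homI[OF t(1) refl t(2)]
      have "m (s \<odot> t) = act P t (m s)" using m s t unfolding matching_family_def by blast
      then show ?thesis using mm[OF s] mm[OF sv(2)[OF s h]] a[OF h, of "my s" "mx s"] by (simp add: inj_eq[OF pr])
    qed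
    have "matching_family C G S my" "matching_family C F S mx" unfolding matching_family_def
      using st mm srelD(4)[OF M hom_obj(1)[OF sv(1)]] srelD(5)[OF M hom_obj(1)[OF sv(1)]] by blast+
    then obtain y x where y: "y \<in> val G V" "\<forall>s\<in>S. act G s y = my s" and x: "x \<in> val F V" "\<forall>s\<in>S. act F s x = mx s"
      using F G V S unfolding is_sheaf_def by blast
    have yx: "(y, x) \<in> M V"
      by (rule srelD(7)[OF M V y(1) x(1)]) (use S mm x y in \<open>unfold cov_def, intro bexI[OF _ S], simp\<close>)
    show "\<exists>!u. u \<in> val P V \<and> (\<forall>s\<in>S. act P s u = m s)"
    proof (rule ex1I[of _ "pr (y, x)"])
      show "pr (y, x) \<in> val P V \<and> (\<forall>s\<in>S. act P s (pr (y, x)) = m s)"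
        using yx v[OF V] a[OF sv(1) yx] mm x y by auto
      fix u assume u: "u \<in> val P V \<and> (\<forall>s\<in>S. act P s u = m s)"
      then obtain y' x' where u': "u = pr (y', x')" "(y', x') \<in> M V" using v[OF V] by blast
      have e: "act G s y' = act G s y \<and> act F s x' = act F s x" if s: "s \<in> S" for s
        using u mm[OF s] a[OF sv(1)[OF s] u'(2)] x y s unfolding u'(1) by (simp add: inj_eq[OF pr])
      have "y' = y" by (rule sheaf_separated[OF G V srelD(4)[OF M V u'(2)] y(1)]) (use S e in \<open>unfold cov_def, blast\<close>)
      moreover have "x' = x" by (rule sheaf_separated[OF F V srelD(5)[OF M V u'(2)] x(1)]) (use S e in \<open>unfold cov_def, blast\<close>)
      ultimately show "u = pr (y, x)" using u'(1) by simp
    qed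
  qed
  let ?\<pi> = "\<lambda>V\<in>Obj C. \<lambda>u\<in>val P V. fst (un u)" and ?\<rho> = "\<lambda>V\<in>Obj C. \<lambda>u\<in>val P V. snd (un u)"
  show thesis
  proof (rule that[OF P])
    show "tr P G ?\<pi>"
    proof (rule transformationI[OF _ _ P])
      show "fst (un u) \<in> val G V" if "V \<in> Obj C" "u \<in> val P V" for V u using v[OF that(1)] that(2) srelD(4)[OF M that(1)] by auto
      show "fst (un (act P f u)) = act G f (fst (un u))" if f: "f \<in> hom C V W" "u \<in> val P W" for V W f u
        using v[OF hom_obj(2)[OF f(1)]] f(2) a[OF f(1)] by auto
    qed
    show "tr P F ?\<rho>"
    proof (rule transformationI[OF _ _ P])
      show "snd (un u) \<in> val F V" if "V \<in> Obj C" "u \<in> val P V" for V u using v[OF that(1)] that(2) srelD(5)[OF M that(1)] by auto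
      show "snd (un (act P f u)) = act F f (snd (un u))" if f: "f \<in> hom C V W" "u \<in> val P W" for V W f u
        using v[OF hom_obj(2)[OF f(1)]] f(2) a[OF f(1)] by auto
    qed
    show "jinj P ?\<pi> ?\<rho>" unfolding jinj_def inj_on_def using v by auto
    show "rel P ?\<pi> ?\<rho> = M"
    proof (rule extensionalityI[OF _ srelD(3)[OF M]])
      show "rel P ?\<pi> ?\<rho> \<in> extensional (Obj C)" by (simp add: rel_def)
      show "rel P ?\<pi> ?\<rho> V = M V" if V: "V \<in> Obj C" for V
        using V v[OF V] by (force simp: rel_def image_iff)
    qed
  qed
qed

text \<open>One construction for two uses: with R = S and equal legs it is the kernel pair of a
  span, and with the two conditions identical it is a pullback.\<close>

lemma srel_agree:
  assumes R: "sh R" and S: "sh S" and Y: "sh Y" "tr R Y A" "tr S Y \<gamma>" and X: "sh X" "tr R X B" "tr S X D"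
  shows "srel R S (\<lambda>V\<in>Obj C. {(u, w). u \<in> val S V \<and> w \<in> val R V \<and> \<gamma> V u = A V w \<and> D V u = B V w})"
proof (rule srelI[OF R S])
  let ?K = "\<lambda>V. {(u, w). u \<in> val S V \<and> w \<in> val R V \<and> \<gamma> V u = A V w \<and> D V u = B V w}"
  show "u \<in> val S V \<and> w \<in> val R V" if "(u, w) \<in> ?K V" for V u w using that by simp
  show "(act S s u, act R s w) \<in> ?K W" if s: "s \<in> hom C W V" and "(u, w) \<in> ?K V" for V W s u w
    using that act_in[OF S s] act_in[OF R s] transformationD(2)[OF Y(2) s] transformationD(2)[OF Y(3) s]
      transformationD(2)[OF X(2) s] transformationD(2)[OF X(3) s] by simp
  show "(u, w) \<in> ?K V" if h: "V \<in> Obj C" "u \<in> val S V" "w \<in> val R V" "cov V (\<lambda>s. (act S s u, act R s w) \<in> ?K (Dom C s))" for V u w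
  proof -
    have e: "act Y s (\<gamma> V u) = act Y s (A V w) \<and> act X s (D V u) = act X s (B V w)"
      if "s \<in> hom C W V" "(act S s u, act R s w) \<in> ?K (Dom C s)" for W s
      using that(2) transformationD(2)[OF Y(2) that(1) h(3)] transformationD(2)[OF Y(3) that(1) h(2)]
        transformationD(2)[OF X(2) that(1) h(3)] transformationD(2)[OF X(3) that(1) h(2)] homD(2)[OF that(1)] by simp
    have "\<gamma> V u = A V w"
      by (rule sheaf_separated[OF Y(1) h(1) transformationD(1)[OF Y(3) h(1,2)] transformationD(1)[OF Y(2) h(1,3)]],
        rule cov_mono[OF h(4,1)]) (use e in blast)
    moreover have "D V u = B V w"
      by (rule sheaf_separated[OF X(1) h(1) transformationD(1)[OF X(3) h(1,2)] transformationD(1)[OF X(2) h(1,3)]],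
        rule cov_mono[OF h(4,1)]) (use e in blast)
    ultimately show ?thesis using h by simp
  qed
qed

text \<open>Let k and l be the projections of the kernel pair of the span. Composed with the
  monomorphism they have the same components in the product, so they coincide, and any pair of
  sections with equal images is a pair of equal sections.\<close>

lemma jinj_mono:
  assumes sh: "sh R" "sh P" "sh Y" "sh X" and m: "is_mono T (R, \<mu>, P)" "tr R P \<mu>" and p: "is_product T Y X P (P, \<pi>, Y) (P, \<rho>, X)"
    and t: "tr P Y \<pi>" "tr P X \<rho>" and a: "tr R Y A" "tr R X B"
    and e: "(P, \<pi>, Y) \<star> (R, \<mu>, P) = (R, A, Y)" "(P, \<rho>, X) \<star> (R, \<mu>, P) = (R, B, X)"
  shows "jinj R A B"
  unfolding jinj_def
proof (intro ballI inj_onI)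
  fix V u w assume V: "V \<in> Obj C" and u: "u \<in> val R V" "w \<in> val R V" "(A V u, B V u) = (A V w, B V w)"
  note K = srel_agree[OF sh(1,1,3) a(1,1) sh(4) a(2,2)]
  obtain K k l where k: "sh K" "tr K R k" "tr K R l" "jinj K k l"
    "rel K k l = (\<lambda>V\<in>Obj C. {(u, w). u \<in> val R V \<and> w \<in> val R V \<and> A V u = A V w \<and> B V u = B V w})"
    using tabulate[OF K] by blast
  have kl: "A V (k V z) = A V (l V z) \<and> B V (k V z) = B V (l V z)" if "V \<in> Obj C" "z \<in> val K V" for V z
    using fun_cong[OF k(5), of V] that by (auto simp: rel_def)
  let ?k = "(K, k, R)" and ?l = "(K, l, R)" and ?m = "(R, \<mu>, P)"
  have h: "?k \<in> hom T K R" "?l \<in> hom T K R" "?m \<in> hom T R P" "(P, \<pi>, Y) \<in> hom T P Y" "(P, \<rho>, X) \<in> hom T P X"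
    using k sh m t by (simp_all add: hom_Sh)
  note c = cat_comp[OF T_category]
  have eq: "(P, \<pi>, Y) \<star> (?m \<star> ?k) = (P, \<pi>, Y) \<star> (?m \<star> ?l)" "(P, \<rho>, X) \<star> (?m \<star> ?k) = (P, \<rho>, X) \<star> (?m \<star> ?l)"
    unfolding cat_assoc[OF T_category h(4,3,1), symmetric] cat_assoc[OF T_category h(4,3,2), symmetric]
      cat_assoc[OF T_category h(5,3,1), symmetric] cat_assoc[OF T_category h(5,3,2), symmetric] e
      comp_eq_comp_iff[OF k(1,2) a(1) k(3) a(1)] comp_eq_comp_iff[OF k(1,2) a(2) k(3) a(2)] using kl by blast+
  have "?m \<star> ?k = ?m \<star> ?l"
  proof -
    have "\<exists>!z. z \<in> hom T K P \<and> (P, \<pi>, Y) \<star> z = (P, \<pi>, Y) \<star> (?m \<star> ?k) \<and> (P, \<rho>, X) \<star> z = (P, \<rho>, X) \<star> (?m \<star> ?k)"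
      using p c[OF h(4) c[OF h(3,1)]] c[OF h(5) c[OF h(3,1)]] unfolding is_product_def by blast
    then show ?thesis using eq c[OF h(3,1)] c[OF h(3,2)] by metis
  qed
  then have "?k = ?l" using m(1) h(1,2) unfolding is_mono_def Sh_simps(3) by blast
  moreover obtain z where "z \<in> val K V" "u = k V z" "w = l V z"
  proof -
    have "(u, w) \<in> rel K k l V" unfolding k(5) using V u by simp
    then show thesis using that V by (auto simp: rel_def)
  qed
  ultimately show "u = w" by simp
qed

lemma product_ex:
  assumes Y: "sh Y" and X: "sh X"
  obtains P \<pi> \<rho> where "sh P" "tr P Y \<pi>" "tr P X \<rho>" "jinj P \<pi> \<rho>" "is_product T Y X P (P, \<pi>, Y) (P, \<rho>, X)"
    "\<And>V. V \<in> Obj C ==> rel P \<pi> \<rho> V = val Y V \<times> val X V"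
proof -
  have "srel X Y (\<lambda>V\<in>Obj C. val Y V \<times> val X V)"
    by (rule srelI[OF X Y]) (use act_in[OF X] act_in[OF Y] in auto)
  then obtain P \<pi> \<rho> where P: "sh P" "tr P Y \<pi>" "tr P X \<rho>" "jinj P \<pi> \<rho>" "rel P \<pi> \<rho> = (\<lambda>V\<in>Obj C. val Y V \<times> val X V)"
    using tabulate by blast
  have "\<exists>!h. h \<in> hom T W P \<and> (P, \<pi>, Y) \<star> h = f \<and> (P, \<rho>, X) \<star> h = g" if fg: "f \<in> hom T W Y" "g \<in> hom T W X" for W f g
  proof -
    obtain A B where f: "f = (W, A, Y)" "tr W Y A" and g: "g = (W, B, X)" "tr W X B" and W: "sh W"
      using fg unfolding hom_Sh by blast
    have "rel W A B V \<subseteq> rel P \<pi> \<rho> V" if "V \<in> Obj C" for V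
      using transformationD(1)[OF f(2) that] transformationD(1)[OF g(2) that] that unfolding P(5) by (auto simp: rel_def)
    then show ?thesis unfolding f(1) g(1) by (rule factor_unique[OF W P(1) f(2) g(2) P(2-4)])
  qed
  then have "is_product T Y X P (P, \<pi>, Y) (P, \<rho>, X)" unfolding is_product_def using P X Y by (simp add: hom_Sh)
  then show thesis using that[OF P(1-4)] P(5) by simp
qed

text \<open>From a monomorphism, joint injectivity comes from the kernel pair. Conversely a jointly
  injective span factors through the concrete product of \<open>product_ex\<close>, and the factor
  is monic because the components determine an arrow.\<close>

lemma mono_spans_iff:
  "r \<in> mono_spans T X Y \<longleftrightarrow> (\<exists>R A B. r = ((R, A, Y), (R, B, X)) \<and> sh R \<and> sh X \<and> sh Y \<and> tr R Y A \<and> tr R X B \<and> jinj R A B)"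
proof
  assume "r \<in> mono_spans T X Y"
  then obtain P p q m where r: "r = (p \<star> m, q \<star> m)" and p: "is_product T Y X P p q" and m: "is_mono T m" "Cod T m = P"
    unfolding mono_spans_def by blast
  have "p \<in> hom T P Y" "q \<in> hom T P X" using p unfolding is_product_def by blast+
  then obtain \<pi> \<rho> where pq: "p = (P, \<pi>, Y)" "q = (P, \<rho>, X)" and t: "tr P Y \<pi>" "tr P X \<rho>" and s: "sh P" "sh Y" "sh X"
    unfolding hom_Sh by blast
  have "m \<in> hom T (Dom T m) P" using m unfolding is_mono_def hom_def by blast
  then obtain R \<mu> where mm: "m = (R, \<mu>, P)" "tr R P \<mu>" "sh R" unfolding hom_Sh by blast
  obtain A B where ab: "p \<star> m = (R, A, Y)" "tr R Y A" "q \<star> m = (R, B, X)" "tr R X B"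
    using comp_hom[OF mm(3) s(1,2) mm(2) t(1)] comp_hom[OF mm(3) s(1,3) mm(2) t(2)] unfolding hom_Sh pq mm(1) by blast
  have "jinj R A B"
    using jinj_mono[OF mm(3) s m(1)[unfolded mm(1)] mm(2) p[unfolded pq] t ab(2,4)] ab(1,3) unfolding pq mm(1) by blast
  then show "\<exists>R A B. r = ((R, A, Y), (R, B, X)) \<and> sh R \<and> sh X \<and> sh Y \<and> tr R Y A \<and> tr R X B \<and> jinj R A B"
    using r ab s mm(3) by blast
next
  assume "\<exists>R A B. r = ((R, A, Y), (R, B, X)) \<and> sh R \<and> sh X \<and> sh Y \<and> tr R Y A \<and> tr R X B \<and> jinj R A B"
  then obtain R A B where r: "r = ((R, A, Y), (R, B, X))" and s: "sh R" "sh X" "sh Y" and t: "tr R Y A" "tr R X B" and j: "jinj R A B" by blast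
  obtain P \<pi> \<rho> where P: "sh P" "tr P Y \<pi>" "tr P X \<rho>" "jinj P \<pi> \<rho>" "is_product T Y X P (P, \<pi>, Y) (P, \<rho>, X)"
    "\<And>V. V \<in> Obj C ==> rel P \<pi> \<rho> V = val Y V \<times> val X V"
    using product_ex[OF s(3,2)] by blast
  have "rel R A B V \<subseteq> rel P \<pi> \<rho> V" if "V \<in> Obj C" for V
    using transformationD(1)[OF t(1) that] transformationD(1)[OF t(2) that] that unfolding P(6)[OF that] by (auto simp: rel_def)
  then obtain \<mu> where m: "tr R P \<mu>" "(P, \<pi>, Y) \<star> (R, \<mu>, P) = (R, A, Y)" "(P, \<rho>, X) \<star> (R, \<mu>, P) = (R, B, X)"
    using factor[OF s(1) P(1) t P(2-4)] by blast
  have h: "(R, \<mu>, P) \<in> hom T R P" "(P, \<pi>, Y) \<in> hom T P Y" "(P, \<rho>, X) \<in> hom T P X" using m(1) s P by (simp_all add: hom_Sh)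
  have "is_mono T (R, \<mu>, P)" unfolding is_mono_def
  proof (intro conjI allI ballI impI)
    show "(R, \<mu>, P) \<in> Arr T" using m(1) s(1) P(1) by simp
    fix W f g assume fg: "f \<in> hom T W (Dom T (R, \<mu>, P))" "g \<in> hom T W (Dom T (R, \<mu>, P))" "(R, \<mu>, P) \<star> f = (R, \<mu>, P) \<star> g"
    have f: "f \<in> hom T W R" "g \<in> hom T W R" using fg by simp_all
    have "sh W" using f unfolding hom_Sh by blast
    moreover have "(R, A, Y) \<star> f = (R, A, Y) \<star> g" "(R, B, X) \<star> f = (R, B, X) \<star> g"
      using cat_assoc[OF T_category h(2,1) f(1)] cat_assoc[OF T_category h(2,1) f(2)]
        cat_assoc[OF T_category h(3,1) f(1)] cat_assoc[OF T_category h(3,1) f(2)] unfolding m(2,3) fg(3) by metis+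
    ultimately show "f = g" using jinj_unique[OF _ s(1) t j f] by blast
  qed
  moreover have "Cod T (R, \<mu>, P) = P" by simp
  moreover have "r = ((P, \<pi>, Y) \<star> (R, \<mu>, P), (P, \<rho>, X) \<star> (R, \<mu>, P))" unfolding m(2,3) r ..
  ultimately show "r \<in> mono_spans T X Y" unfolding mono_spans_def using P(5) by blast
qed

definition relOf :: "('u, 'co, 'cm) transformation \<times> ('u, 'co, 'cm) transformation => 'co => ('u \<times> 'u) set" where
  "relOf r = rel (fst (fst r)) (fst (snd (fst r))) (fst (snd (snd r)))"

lemma relOf_simp [simp]: "relOf ((R, A, Y), (R', B, X)) = rel R A B"
  by (simp add: relOf_def)

lemma relOf_srel:
  assumes "r \<in> mono_spans T X Y"
  shows "srel X Y (relOf r)"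
proof -
  obtain R A B where r: "r = ((R, A, Y), (R, B, X))" and s: "sh R" "sh X" "sh Y" and t: "tr R Y A" "tr R X B" and j: "jinj R A B"
    using assms unfolding mono_spans_iff by blast
  note a = transformationD[OF t(1)] and b = transformationD[OF t(2)]
  have "srel X Y (rel R A B)" unfolding rel_def
  proof (rule srelI[OF s(2,3)])
    let ?R = "\<lambda>V. (\<lambda>u. (A V u, B V u)) ` val R V"
    show "y \<in> val Y V \<and> x \<in> val X V" if "V \<in> Obj C" "(y, x) \<in> ?R V" for V y x using that a(1) b(1) by auto
    show "(act Y f y, act X f x) \<in> ?R W" if f: "f \<in> hom C W V" and "(y, x) \<in> ?R V" for V W f y x
    proof -
      obtain u where u: "u \<in> val R V" "y = A V u" "x = B V u" using \<open>(y, x) \<in> ?R V\<close> by blast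
      show ?thesis using a(2)[OF f u(1)] b(2)[OF f u(1)] act_in[OF s(1) f u(1)] u by (metis (mono_tags, lifting) imageI)
    qed
    show "(y, x) \<in> ?R V" if h: "V \<in> Obj C" "y \<in> val Y V" "x \<in> val X V" "cov V (\<lambda>f. (act Y f y, act X f x) \<in> ?R (Dom C f))" for V y x
    proof -
      \<comment> \<open>Local preimages u of the pair (y, x). They are unique by joint injectivity,
        hence glue: the pointwise image of a mono span is already local.\<close>
      define \<theta> where "\<theta> f u \<longleftrightarrow> u \<in> val R (Dom C f) \<and> A (Dom C f) u = act Y f y \<and> B (Dom C f) u = act X f x" for f u
      have c: "cov V (\<lambda>f. \<exists>u. \<theta> f u)"
      proof (rule cov_mono[OF h(4,1)])
        fix f assume "(act Y f y, act X f x) \<in> ?R (Dom C f)"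
        then obtain u where "u \<in> val R (Dom C f)" "(act Y f y, act X f x) = (A (Dom C f) u, B (Dom C f) u)" by blast
        then show "\<exists>u. \<theta> f u" unfolding \<theta>_def by auto
      qed
      have "\<exists>u\<in>val R V. \<forall>W f w. f \<in> hom C W V --> \<theta> f w --> act R f u = w"
      proof (rule sheaf_glue[OF s(1) h(1) c])
        fix W f u assume f: "f \<in> hom C W V" and m: "\<theta> f u"
        have u: "u \<in> val R W" "A W u = act Y f y" "B W u = act X f x" using m homD(2)[OF f] by (simp_all add: \<theta>_def)
        show "u \<in> val R W" using u(1) .
        show "u = w" if "\<theta> f w" for w
          by (rule jinjD[OF j hom_obj(1)[OF f] u(1)]) (use that u homD(2)[OF f] in \<open>simp_all add: \<theta>_def\<close>)
        show "\<theta> (f \<odot> g) (act R g u)" if g: "g \<in> hom C W' W" for W' g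
          using homD(2)[of _ C, OF comp_in[OF f g]] act_in[OF s(1) g u(1)] a(2)[OF g u(1)] b(2)[OF g u(1)] u(2,3)
            act_comp[OF s(3) f g h(2)] act_comp[OF s(2) f g h(3)] by (simp add: \<theta>_def)
      qed
      then obtain u where u: "u \<in> val R V" "\<forall>W f w. f \<in> hom C W V --> \<theta> f w --> act R f u = w" by blast
      have e: "act Y f y = act Y f (A V u) \<and> act X f x = act X f (B V u)" if f: "f \<in> hom C W V" and "\<exists>w. \<theta> f w" for W f
        using that u(2) a(2)[OF f u(1)] b(2)[OF f u(1)] homD(2)[OF f] unfolding \<theta>_def by metis
      have "y = A V u" by (rule sheaf_separated[OF s(3) h(1,2) a(1)[OF h(1) u(1)] cov_mono[OF c h(1)]]) (use e in blast)
      moreover have "x = B V u" by (rule sheaf_separated[OF s(2) h(1,3) b(1)[OF h(1) u(1)] cov_mono[OF c h(1)]]) (use e in blast)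
      ultimately show ?thesis using u(1) by blast
    qed
  qed
  then show ?thesis by (simp add: r)
qed

lemma mono_span_ex:
  assumes M: "srel X Y M"
  obtains r where "r \<in> mono_spans T X Y" "relOf r = M"
proof -
  obtain P \<pi> \<rho> where P: "sh P" "tr P Y \<pi>" "tr P X \<rho>" "jinj P \<pi> \<rho>" "rel P \<pi> \<rho> = M" using tabulate[OF M] by blast
  show thesis by (rule that[of "((P, \<pi>, Y), (P, \<rho>, X))"]) (use P srelD(1,2)[OF M] mono_spans_iff in auto)
qed

text \<open>The left span is arbitrary and only s is monic. This generality is what images call for,
  where a composite span is compared with the mono spans above it.\<close>

lemma span_le_iff:
  assumes f: "f \<in> hom T R Y" and g: "g \<in> hom T R X" and s: "s \<in> mono_spans T X Y"
  shows "span_le T (f, g) s \<longleftrightarrow> (\<forall>V\<in>Obj C. relOf (f, g) V \<subseteq> relOf s V)"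
proof -
  obtain A B where fg: "f = (R, A, Y)" "g = (R, B, X)" and R: "sh R" and a: "tr R Y A" "tr R X B" using f g unfolding hom_Sh by blast
  obtain S \<gamma> D where s: "s = ((S, \<gamma>, Y), (S, D, X))" and S: "sh S" and t: "tr S Y \<gamma>" "tr S X D" and j: "jinj S \<gamma> D"
    using s unfolding mono_spans_iff by blast
  have "span_le T (f, g) s \<longleftrightarrow> (\<exists>\<eta>. tr R S \<eta> \<and> (S, \<gamma>, Y) \<star> (R, \<eta>, S) = f \<and> (S, D, X) \<star> (R, \<eta>, S) = g)"
    unfolding span_le_def s fg(1) using R S by (auto simp: hom_Sh simp del: Sh_simps(6))
  also have "\<dots> \<longleftrightarrow> (\<forall>V\<in>Obj C. relOf (f, g) V \<subseteq> relOf s V)"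
  proof
    assume "\<exists>\<eta>. tr R S \<eta> \<and> (S, \<gamma>, Y) \<star> (R, \<eta>, S) = f \<and> (S, D, X) \<star> (R, \<eta>, S) = g"
    then obtain \<eta> where n: "tr R S \<eta>" "\<forall>V\<in>Obj C. \<forall>x\<in>val R V. \<gamma> V (\<eta> V x) = A V x" "\<forall>V\<in>Obj C. \<forall>x\<in>val R V. D V (\<eta> V x) = B V x"
      unfolding fg using comp_eq_iff[OF R _ t(1) a(1)] comp_eq_iff[OF R _ t(2) a(2)] by blast
    have "(A V x, B V x) \<in> rel S \<gamma> D V" if "V \<in> Obj C" "x \<in> val R V" for V x
      unfolding rel_def using n(2,3) transformationD(1)[OF n(1) that] that by (simp add: image_iff) metis
    then show "\<forall>V\<in>Obj C. relOf (f, g) V \<subseteq> relOf s V" unfolding fg s by (auto simp: rel_def[of R])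
  next
    assume "\<forall>V\<in>Obj C. relOf (f, g) V \<subseteq> relOf s V"
    then show "\<exists>\<eta>. tr R S \<eta> \<and> (S, \<gamma>, Y) \<star> (R, \<eta>, S) = f \<and> (S, D, X) \<star> (R, \<eta>, S) = g"
      using factor[OF R S a t j] unfolding fg s relOf_simp by blast
  qed
  finally show ?thesis .
qed

lemma mono_spans_hom:
  assumes "r \<in> mono_spans T X Y"
  obtains R where "fst r \<in> hom T R Y" "snd r \<in> hom T R X"
  using assms unfolding mono_spans_iff by (fastforce simp: hom_Sh)

lemma mono_span_le_iff:
  "r \<in> mono_spans T X Y ==> s \<in> mono_spans T X Y ==> span_le T r s \<longleftrightarrow> (\<forall>V\<in>Obj C. relOf r V \<subseteq> relOf s V)"
  using mono_spans_hom span_le_iff by (metis prod.collapse)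

lemma pullback_ex:
  assumes k: "k \<in> hom T S Y" and f: "f \<in> hom T R Y"
  obtains a b where "is_pullback T k f a b"
proof -
  obtain \<kappa> A where kf: "k = (S, \<kappa>, Y)" "f = (R, A, Y)" and s: "sh S" "sh R" "sh Y" and t: "tr S Y \<kappa>" "tr R Y A" using k f unfolding hom_Sh by blast
  obtain P \<pi> \<rho> where P: "sh P" "tr P S \<pi>" "tr P R \<rho>" "jinj P \<pi> \<rho>"
    "rel P \<pi> \<rho> = (\<lambda>V\<in>Obj C. {(u, w). u \<in> val S V \<and> w \<in> val R V \<and> \<kappa> V u = A V w \<and> \<kappa> V u = A V w})"
    using tabulate[OF srel_agree[OF s(2,1,3) t(2,1) s(3) t(2,1)]] by blast
  show thesis
  proof (rule that[of "(P, \<pi>, S)" "(P, \<rho>, R)"], unfold is_pullback_def, intro conjI allI ballI impI)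
    show "k \<in> Arr T" "f \<in> Arr T" "Cod T k = Cod T f" using s t by (simp_all add: kf)
    show "(P, \<pi>, S) \<in> hom T (Dom T (P, \<pi>, S)) (Dom T k)" "(P, \<rho>, R) \<in> hom T (Dom T (P, \<pi>, S)) (Dom T f)"
      using P s by (simp_all add: kf hom_Sh)
    show "k \<star> (P, \<pi>, S) = f \<star> (P, \<rho>, R)" unfolding kf comp_eq_comp_iff[OF P(1,2) t(1) P(3) t(2)]
    proof (intro ballI)
      show "\<kappa> V (\<pi> V z) = A V (\<rho> V z)" if "V \<in> Obj C" "z \<in> val P V" for V z
        using fun_cong[OF P(5), of V] that by (auto simp: rel_def)
    qed
    fix W a b assume ab: "a \<in> hom T W (Dom T k)" "b \<in> hom T W (Dom T f)" "k \<star> a = f \<star> b"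
    then obtain \<gamma> D where a: "a = (W, \<gamma>, S)" "b = (W, D, R)" and W: "sh W" and g: "tr W S \<gamma>" "tr W R D" unfolding kf Sh_simps(3) hom_Sh by blast
    have e: "\<forall>V\<in>Obj C. \<forall>z\<in>val W V. \<kappa> V (\<gamma> V z) = A V (D V z)"
      using ab(3) unfolding kf a comp_eq_comp_iff[OF W g(1) t(1) g(2) t(2)] .
    have "rel W \<gamma> D V \<subseteq> rel P \<pi> \<rho> V" if "V \<in> Obj C" for V
      using e transformationD(1)[OF g(1) that] transformationD(1)[OF g(2) that] that unfolding P(5) by (auto simp: rel_def)
    then show "\<exists>!h. h \<in> hom T W (Dom T (P, \<pi>, S)) \<and> (P, \<pi>, S) \<star> h = a \<and> (P, \<rho>, R) \<star> h = b"
      unfolding a Sh_simps(3) by (rule factor_unique[OF W P(1) g P(2-4)])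
  qed
qed

text \<open>Comparing with the pullback tabulated above shows that every pullback is computed pointwise.\<close>

lemma pullback_rel:
  assumes h: "h \<in> hom T S Z" and k: "k \<in> hom T S Y" and f: "f \<in> hom T R Y" and g: "g \<in> hom T R X" and p: "is_pullback T k f a b"
  shows "\<exists>P. h \<star> a \<in> hom T P Z \<and> g \<star> b \<in> hom T P X"
    and "V \<in> Obj C ==> relOf (h \<star> a, g \<star> b) V = relOf (h, k) V O relOf (f, g) V"
proof -
  obtain \<eta> \<kappa> where hk: "h = (S, \<eta>, Z)" "k = (S, \<kappa>, Y)" and s: "sh S" "sh Z" "sh Y" and t: "tr S Z \<eta>" "tr S Y \<kappa>" using h k unfolding hom_Sh by blast
  obtain A B where fg: "f = (R, A, Y)" "g = (R, B, X)" and r: "sh R" "sh X" and u: "tr R Y A" "tr R X B" using f g unfolding hom_Sh by blast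
  have "a \<in> hom T (Dom T a) S" "b \<in> hom T (Dom T a) R" and sq: "k \<star> a = f \<star> b" using p unfolding is_pullback_def hk fg by simp_all
  then obtain P \<gamma> D where ab: "a = (P, \<gamma>, S)" "b = (P, D, R)" and P: "sh P" and v: "tr P S \<gamma>" "tr P R D" unfolding hom_Sh by blast
  show "\<exists>P. h \<star> a \<in> hom T P Z \<and> g \<star> b \<in> hom T P X"
    unfolding hk fg ab using comp_hom[OF P s(1,2) v(1) t(1)] comp_hom[OF P r v(2) u(2)] by blast
  assume V: "V \<in> Obj C"
  have e: "\<forall>V\<in>Obj C. \<forall>x\<in>val P V. \<kappa> V (\<gamma> V x) = A V (D V x)"
    using sq unfolding hk fg ab comp_eq_comp_iff[OF P v(1) t(2) v(2) u(1)] .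
  have ex: "\<exists>x\<in>val P V. \<gamma> V x = y \<and> D V x = z" if yz: "y \<in> val S V" "z \<in> val R V" "\<kappa> V y = A V z" for y z
  proof -
    obtain Q \<pi> \<rho> where q: "sh Q" "tr Q S \<pi>" "tr Q R \<rho>" "jinj Q \<pi> \<rho>"
      "rel Q \<pi> \<rho> = (\<lambda>V\<in>Obj C. {(u, w). u \<in> val S V \<and> w \<in> val R V \<and> \<kappa> V u = A V w \<and> \<kappa> V u = A V w})"
      using tabulate[OF srel_agree[OF r(1) s(1,3) u(1) t(2) s(3) u(1) t(2)]] by blast
    have "k \<star> (Q, \<pi>, S) = f \<star> (Q, \<rho>, R)" unfolding hk fg comp_eq_comp_iff[OF q(1,2) t(2) q(3) u(1)]
    proof (intro ballI)
      show "\<kappa> V (\<pi> V z) = A V (\<rho> V z)" if "V \<in> Obj C" "z \<in> val Q V" for V z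
        using fun_cong[OF q(5), of V] that by (auto simp: rel_def)
    qed
    moreover have "(Q, \<pi>, S) \<in> hom T Q (Dom T k)" "(Q, \<rho>, R) \<in> hom T Q (Dom T f)" using q s r by (simp_all add: hk fg hom_Sh)
    ultimately obtain i where i: "i \<in> hom T Q (Dom T a)" "a \<star> i = (Q, \<pi>, S)" "b \<star> i = (Q, \<rho>, R)"
      using p unfolding is_pullback_def by blast
    obtain \<iota> where n: "i = (Q, \<iota>, P)" "tr Q P \<iota>" using i(1) unfolding ab Sh_simps(3) hom_Sh by blast
    have "(y, z) \<in> rel Q \<pi> \<rho> V" using yz V unfolding q(5) by simp
    then obtain w where w: "w \<in> val Q V" "y = \<pi> V w" "z = \<rho> V w" using V by (auto simp: rel_def)
    show ?thesis
      using i(2,3) transformationD(1)[OF n(2) V w(1)] w V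
      unfolding ab n(1) comp_eq_iff[OF q(1) n(2) v(1) q(2)] comp_eq_iff[OF q(1) n(2) v(2) q(3)] by metis
  qed
  have "relOf (h \<star> a, g \<star> b) V = (\<lambda>x. (\<eta> V (\<gamma> V x), B V (D V x))) ` val P V"
    using V by (auto simp: hk fg ab rel_def compose_def)
  also have "\<dots> = rel S \<eta> \<kappa> V O rel R A B V"
  proof (intro set_eqI, clarify)
    fix y z
    show "(y, z) \<in> (\<lambda>x. (\<eta> V (\<gamma> V x), B V (D V x))) ` val P V \<longleftrightarrow> (y, z) \<in> rel S \<eta> \<kappa> V O rel R A B V"
    proof
      assume "(y, z) \<in> (\<lambda>x. (\<eta> V (\<gamma> V x), B V (D V x))) ` val P V"
      then obtain x where x: "x \<in> val P V" "y = \<eta> V (\<gamma> V x)" "z = B V (D V x)" by blast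
      have "(y, \<kappa> V (\<gamma> V x)) \<in> rel S \<eta> \<kappa> V" "(\<kappa> V (\<gamma> V x), z) \<in> rel R A B V"
        unfolding rel_def using V x e transformationD(1)[OF v(1) V x(1)] transformationD(1)[OF v(2) V x(1)] by auto
      then show "(y, z) \<in> rel S \<eta> \<kappa> V O rel R A B V" by blast
    next
      assume "(y, z) \<in> rel S \<eta> \<kappa> V O rel R A B V"
      then obtain c d where "c \<in> val S V" "y = \<eta> V c" "d \<in> val R V" "z = B V d" "\<kappa> V c = A V d" using V by (auto simp: rel_def)
      then show "(y, z) \<in> (\<lambda>x. (\<eta> V (\<gamma> V x), B V (D V x))) ` val P V" using ex[of c d] by force
    qed
  qed
  finally show "relOf (h \<star> a, g \<star> b) V = relOf (h, k) V O relOf (f, g) V" by (simp add: hk fg)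
qed

end

section \<open>The involutive quantaloid of internal relations of the topos\<close>

context sheaf_site
begin

text \<open>A subobject as the fibre of \<open>relOf\<close> over a local relation. In this form
  composition, order and reversal are expressed by the relation instead of by
  representatives.\<close>

definition subr :: "('u, 'co, 'cm) presheaf => ('u, 'co, 'cm) presheaf => ('co => ('u \<times> 'u) set) =>
    ('u, 'co, 'cm) presheaf \<times> (('u, 'co, 'cm) transformation \<times> ('u, 'co, 'cm) transformation) set \<times> ('u, 'co, 'cm) presheaf" where
  "subr X Y M = (X, {r \<in> mono_spans T X Y. relOf r = M}, Y)"

lemma subobject_class_subr:
  assumes r: "r \<in> mono_spans T X Y"
  shows "(X, subobject_class T X Y r, Y) = subr X Y (relOf r)"
proof -
  have "span_le T r s \<and> span_le T s r \<longleftrightarrow> relOf s = relOf r" if s: "s \<in> mono_spans T X Y" for s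
    using mono_span_le_iff[OF r s] mono_span_le_iff[OF s r] srel_eqI[OF relOf_srel[OF s] relOf_srel[OF r]] by auto
  then have "subobject_class T X Y r = {s \<in> mono_spans T X Y. relOf s = relOf r}" unfolding subobject_class_def by blast
  then show ?thesis by (simp add: subr_def)
qed

lemma hom_Rel: "hom (Rel T) X Y = {subr X Y M | M. srel X Y M}"
proof -
  have o: "sh X" "sh Y" if "r \<in> mono_spans T X Y" for r using that unfolding mono_spans_iff by blast+
  have "f \<in> hom (Rel T) X Y \<longleftrightarrow> (\<exists>r\<in>mono_spans T X Y. f = (X, subobject_class T X Y r, Y))" for f
    by (cases f, simp add: hom_def Rel_def del: split_paired_Ex split_paired_All) (use o in blast)
  then have "f \<in> hom (Rel T) X Y \<longleftrightarrow> (\<exists>r\<in>mono_spans T X Y. f = subr X Y (relOf r))" for f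
    using subobject_class_subr by simp
  moreover have "(\<exists>r\<in>mono_spans T X Y. f = subr X Y (relOf r)) \<longleftrightarrow> (\<exists>M. f = subr X Y M \<and> srel X Y M)" for f
    using relOf_srel mono_span_ex by blast
  ultimately show ?thesis by blast
qed

lemma Rel_simps:
  "Obj (Rel T) = {F. sh F}" "f \<in> Arr (Rel T) ==> f \<in> hom (Rel T) (Dom (Rel T) f) (Cod (Rel T) f)"
  "subr X Y M \<sqsubseteq>\<^bsub>Rel T\<^esub> subr X' Y' M' \<longleftrightarrow> X = X' \<and> Y = Y' \<and>
    (\<forall>r\<in>mono_spans T X Y. \<forall>s\<in>mono_spans T X' Y'. relOf r = M --> relOf s = M' --> span_le T r s)"
  by (auto simp: Rel_def hom_def subr_def)

definition Rdist :: "('u, 'co, 'cm) presheaf \<times> (('u, 'co, 'cm) transformation \<times> ('u, 'co, 'cm) transformation) set \<times> ('u, 'co, 'cm) presheaf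
    => ('u, 'co, 'co \<times> ('cm \<times> 'cm) set \<times> 'co) distributor" where
  "Rdist = (\<lambda>(X, R, Y). (El X, ddist X Y (relOf (SOME r. r \<in> R)), El Y))"

lemma Rdist_subr:
  assumes "srel X Y M"
  shows "Rdist (subr X Y M) = (El X, ddist X Y M, El Y)"
proof -
  have "\<exists>r. r \<in> {r \<in> mono_spans T X Y. relOf r = M}" using mono_span_ex[OF assms] by blast
  then have "relOf (SOME r. r \<in> {r \<in> mono_spans T X Y. relOf r = M}) = M" by (rule someI2_ex) simp
  then show ?thesis by (simp add: Rdist_def subr_def)
qed

lemma rcomp_le_iff:
  assumes M: "srel X Y M" and N: "srel Y Z N" and \<omega>: "srel X Z \<omega>"
  shows "(\<forall>V\<in>Obj C. rcomp X Z N M V \<subseteq> \<omega> V) \<longleftrightarrow> (\<forall>V\<in>Obj C. N V O M V \<subseteq> \<omega> V)"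
  using ddist_le_iff[OF rcomp_srel[OF M N] \<omega>] ddist_comp_le_iff[OF M N \<omega>] unfolding ddist_rcomp[OF M N] by simp

text \<open>A mono span lies above the given span exactly if its relation contains the pointwise
  composite, equivalently its local closure \<open>rcomp\<close>. The least such mono spans are
  those whose relation is \<open>rcomp\<close> itself.\<close>

lemma is_image_rel_iff:
  assumes M: "srel X Y M" and N: "srel Y Z N" and f: "f \<in> hom T P Z" and g: "g \<in> hom T P X"
    and e: "\<And>V. V \<in> Obj C ==> relOf (f, g) V = N V O M V"
  shows "is_image T X Z (f, g) i \<longleftrightarrow> i \<in> mono_spans T X Z \<and> relOf i = rcomp X Z N M"
proof -
  let ?\<chi> = "rcomp X Z N M"
  note \<chi> = rcomp_srel[OF M N]
  have le: "span_le T (f, g) j \<longleftrightarrow> (\<forall>V\<in>Obj C. ?\<chi> V \<subseteq> relOf j V)" if j: "j \<in> mono_spans T X Z" for j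
    using span_le_iff[OF f g j] rcomp_le_iff[OF M N relOf_srel[OF j]] e by simp
  obtain j where j: "j \<in> mono_spans T X Z" "relOf j = ?\<chi>" using mono_span_ex[OF \<chi>] .
  show ?thesis
  proof
    assume "is_image T X Z (f, g) i"
    then have i: "i \<in> mono_spans T X Z" "span_le T (f, g) i" "span_le T i j" using le[OF j(1)] j unfolding is_image_def by auto
    have "relOf i = ?\<chi>"
      by (rule srel_eqI[OF relOf_srel[OF i(1)] \<chi>]) (use i le[OF i(1)] mono_span_le_iff[OF i(1) j(1)] j(2) in auto)
    then show "i \<in> mono_spans T X Z \<and> relOf i = ?\<chi>" using i(1) by simp
  next
    assume i: "i \<in> mono_spans T X Z \<and> relOf i = ?\<chi>"
    then have "span_le T (f, g) i" using le[of i] by simp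
    moreover have "span_le T i k" if "k \<in> mono_spans T X Z" "span_le T (f, g) k" for k
      using mono_span_le_iff[of i X Z k] le[OF that(1)] that i by simp
    ultimately show "is_image T X Z (f, g) i" unfolding is_image_def using i by blast
  qed
qed

lemma Rel_comp:
  assumes M: "srel X Y M" and N: "srel Y Z N"
  shows "subr Y Z N \<odot>\<^bsub>Rel T\<^esub> subr X Y M = subr X Z (rcomp X Z N M)"
proof -
  let ?S = "{r \<in> mono_spans T Y Z. relOf r = N}" and ?R = "{r \<in> mono_spans T X Y. relOf r = M}"
  have im: "is_image T X Z (h \<star> a, g \<star> b) i \<longleftrightarrow> i \<in> mono_spans T X Z \<and> relOf i = rcomp X Z N M"
    if hk: "(h, k) \<in> ?S" and fg: "(f, g) \<in> ?R" and p: "is_pullback T k f a b" for h k f g a b i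
  proof -
    obtain S where S: "h \<in> hom T S Z" "k \<in> hom T S Y" using mono_spans_hom[of "(h, k)" Y Z] hk by auto
    obtain R where R: "f \<in> hom T R Y" "g \<in> hom T R X" using mono_spans_hom[of "(f, g)" X Y] fg by auto
    obtain P where P: "h \<star> a \<in> hom T P Z" "g \<star> b \<in> hom T P X" using pullback_rel(1)[OF S R p] by blast
    show ?thesis using is_image_rel_iff[OF M N P] pullback_rel(2)[OF S R p] hk fg by simp
  qed
  \<comment> \<open>Composition in \<open>Rel\<close> collects images over all representatives and
    all pullbacks. By \<open>im\<close> they all have the same relation; the witnesses found here
    ensure that the collection is the whole class and not empty.\<close>
  obtain s where "s \<in> mono_spans T Y Z" "relOf s = N" using mono_span_ex[OF N] .
  then obtain h k where hk: "(h, k) \<in> ?S" by (cases s) auto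
  obtain r where "r \<in> mono_spans T X Y" "relOf r = M" using mono_span_ex[OF M] .
  then obtain f g where fg: "(f, g) \<in> ?R" by (cases r) auto
  obtain S where S: "k \<in> hom T S Y" using mono_spans_hom[of "(h, k)" Y Z] hk by auto
  obtain R where R: "f \<in> hom T R Y" using mono_spans_hom[of "(f, g)" X Y] fg by auto
  obtain a b where p: "is_pullback T k f a b" using pullback_ex[OF S R] .
  have "(\<exists>(h, k)\<in>?S. \<exists>(f, g)\<in>?R. \<exists>a b. is_pullback T k f a b \<and> is_image T X Z (h \<star> a, g \<star> b) i) \<longleftrightarrow>
    i \<in> mono_spans T X Z \<and> relOf i = rcomp X Z N M" for i
  proof
    assume "\<exists>(h, k)\<in>?S. \<exists>(f, g)\<in>?R. \<exists>a b. is_pullback T k f a b \<and> is_image T X Z (h \<star> a, g \<star> b) i"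
    then show "i \<in> mono_spans T X Z \<and> relOf i = rcomp X Z N M" using im by blast
  next
    assume "i \<in> mono_spans T X Z \<and> relOf i = rcomp X Z N M"
    then have "is_image T X Z (h \<star> a, g \<star> b) i" using im[OF hk fg p] by blast
    then show "\<exists>(h, k)\<in>?S. \<exists>(f, g)\<in>?R. \<exists>a b. is_pullback T k f a b \<and> is_image T X Z (h \<star> a, g \<star> b) i"
      using hk fg p by blast
  qed
  then show ?thesis by (simp add: Rel_def subr_def)
qed

lemma mono_spans_swap:
  assumes "r \<in> mono_spans T X Y"
  shows "prod.swap r \<in> mono_spans T Y X" "relOf (prod.swap r) = rinv (relOf r)"
proof -
  obtain R \<alpha> \<beta> where r: "r = ((R, \<alpha>, Y), (R, \<beta>, X))" and s: "sh R" "sh X" "sh Y" "tr R Y \<alpha>" "tr R X \<beta>" and j: "jinj R \<alpha> \<beta>"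
    using assms unfolding mono_spans_iff by blast
  have "jinj R \<beta> \<alpha>" using j unfolding jinj_def inj_on_def by auto
  then show "prod.swap r \<in> mono_spans T Y X" unfolding mono_spans_iff using r s by auto
  show "relOf (prod.swap r) = rinv (relOf r)" by (auto simp: r rel_def rinv_def image_image cong: restrict_cong)
qed

lemma Rel_inv:
  assumes M: "srel X Y M"
  shows "Inv (Rel T) (subr X Y M) = subr Y X (rinv M)"
proof -
  have rr: "rinv (rinv N) = N" if "srel X Y N" for N
    by (rule srel_eqI[OF ddist_rinv(1)[OF ddist_rinv(1)[OF that]] that]) (simp add: rinv_def image_image)
  have "prod.swap ` {r \<in> mono_spans T X Y. relOf r = M} = {r \<in> mono_spans T Y X. relOf r = rinv M}"
  proof (intro set_eqI iffI)
    show "s \<in> {r \<in> mono_spans T Y X. relOf r = rinv M}" if "s \<in> prod.swap ` {r \<in> mono_spans T X Y. relOf r = M}" for s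
      using that mono_spans_swap by auto
    fix s assume "s \<in> {r \<in> mono_spans T Y X. relOf r = rinv M}"
    then have s: "prod.swap s \<in> mono_spans T X Y" "relOf (prod.swap s) = M" using mono_spans_swap[of s Y X] rr[OF M] by auto
    then show "s \<in> prod.swap ` {r \<in> mono_spans T X Y. relOf r = M}" by (intro image_eqI[of _ _ "prod.swap s"]) auto
  qed
  then show ?thesis by (simp add: Rel_def subr_def)
qed

lemma Rel_ide:
  assumes X: "sh X"
  shows "Ide (Rel T) X = subr X X (idr X)"
proof -
  have t: "tr X X (\<lambda>V\<in>Obj C. \<lambda>x\<in>val X V. x)" by (rule transformationI[OF _ refl X])
  have "jinj X (\<lambda>V\<in>Obj C. \<lambda>x\<in>val X V. x) (\<lambda>V\<in>Obj C. \<lambda>x\<in>val X V. x)" unfolding jinj_def inj_on_def by auto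
  then have m: "(Ide T X, Ide T X) \<in> mono_spans T X X" using t X by (auto simp: mono_spans_iff)
  have "relOf (Ide T X, Ide T X) = idr X" by (auto simp: idr_def rel_def Setcompr_eq_image cong: restrict_cong)
  then show ?thesis using subobject_class_subr[OF m] by (simp add: Rel_def)
qed

lemma Rdist_equivalence: "dagger_equivalence (Rel T) (SymDist crib) El Rdist"
proof -
  have im: "Rdist (subr X Y M) \<in> hom (SymDist crib) (El X) (El Y)" if "srel X Y M" for X Y M
    using ddist_dst[OF that] El_qcat(2)[OF srelD(1)[OF that]] El_qcat(2)[OF srelD(2)[OF that]]
    by (simp add: Rdist_subr[OF that] crib.hom_SymDist)
  have emb: "cat_embedding (Rel T) (SymDist crib) El Rdist" unfolding cat_embedding_def
  proof (intro conjI allI ballI)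
    show "Dom (Rel T) f \<in> Obj (Rel T)" "Cod (Rel T) f \<in> Obj (Rel T)" if "f \<in> Arr (Rel T)" for f
      using Rel_simps(2)[OF that] srelD(1,2) unfolding hom_Rel Rel_simps(1) by blast+
    show "Ide (Rel T) X \<in> hom (Rel T) X X" if "X \<in> Obj (Rel T)" for X
      using that Rel_ide idr_srel unfolding hom_Rel Rel_simps(1) by blast
    show "El X \<in> Obj (SymDist crib)" if "X \<in> Obj (Rel T)" for X using that El_qcat unfolding Rel_simps(1) by simp
    show "Rdist (Ide (Rel T) X) = Ide (SymDist crib) (El X)" if "X \<in> Obj (Rel T)" for X
      using that Rel_ide Rdist_subr[OF idr_srel] unfolding Rel_simps(1) by simp
    fix X Y Z f g assume f: "f \<in> hom (Rel T) X Y" and g: "g \<in> hom (Rel T) Y Z"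
    then obtain M N where e: "f = subr X Y M" "g = subr Y Z N" and M: "srel X Y M" and N: "srel Y Z N" unfolding hom_Rel by blast
    show "g \<odot>\<^bsub>Rel T\<^esub> f \<in> hom (Rel T) X Z" unfolding e Rel_comp[OF M N] hom_Rel using rcomp_srel[OF M N] by blast
    show "Rdist (g \<odot>\<^bsub>Rel T\<^esub> f) = Rdist g \<odot>\<^bsub>SymDist crib\<^esub> Rdist f"
      unfolding e Rel_comp[OF M N] Rdist_subr[OF M] Rdist_subr[OF N] Rdist_subr[OF rcomp_srel[OF M N]] ddist_rcomp[OF M N] by simp
  next
    fix X Y assume "X \<in> Obj (Rel T)" "Y \<in> Obj (Rel T)"
    then have X: "sh X" and Y: "sh Y" unfolding Rel_simps(1) by blast+
    show "bij_betw Rdist (hom (Rel T) X Y) (hom (SymDist crib) (El X) (El Y))" unfolding bij_betw_def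
    proof (intro conjI inj_onI set_eqI iffI)
      fix f g assume "f \<in> hom (Rel T) X Y" "g \<in> hom (Rel T) X Y" "Rdist f = Rdist g"
      then show "f = g" unfolding hom_Rel using Rdist_subr ddist_inj by (smt (verit) Pair_inject mem_Collect_eq)
    next
      show "u \<in> hom (SymDist crib) (El X) (El Y)" if "u \<in> Rdist ` hom (Rel T) X Y" for u
        using that im unfolding hom_Rel by blast
      fix u assume "u \<in> hom (SymDist crib) (El X) (El Y)"
      then obtain \<Theta> where u: "u = (El X, \<Theta>, El Y)" and t: "crib.dst (El X) (El Y) \<Theta>" unfolding crib.hom_SymDist by blast
      note r = relof_srel[OF X Y t]
      have "u = Rdist (subr X Y (relof X Y \<Theta>))" unfolding u Rdist_subr[OF r] ddist_relof[OF X Y t] ..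
      then show "u \<in> Rdist ` hom (Rel T) X Y" unfolding hom_Rel using r by blast
    qed
  qed
  have "dagger_embedding (Rel T) (SymDist crib) El Rdist" unfolding dagger_embedding_def
  proof (intro conjI allI ballI emb)
    fix X Y f assume "f \<in> hom (Rel T) X Y"
    then obtain M where f: "f = subr X Y M" and M: "srel X Y M" unfolding hom_Rel by blast
    note i = ddist_rinv[OF M]
    show "Inv (Rel T) f \<in> hom (Rel T) Y X" unfolding f Rel_inv[OF M] hom_Rel using i(1) by blast
    show "Rdist (Inv (Rel T) f) = Inv (SymDist crib) (Rdist f)"
      unfolding f Rel_inv[OF M] Rdist_subr[OF M] Rdist_subr[OF i(1)] i(2) by simp
    fix g assume "g \<in> hom (Rel T) X Y"
    then obtain N where g: "g = subr X Y N" and N: "srel X Y N" unfolding hom_Rel by blast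
    obtain r s where rs: "r \<in> mono_spans T X Y" "relOf r = M" "s \<in> mono_spans T X Y" "relOf s = N"
      using mono_span_ex[OF M] mono_span_ex[OF N] by metis
    have "f \<sqsubseteq>\<^bsub>Rel T\<^esub> g \<longleftrightarrow> (\<forall>V\<in>Obj C. M V \<subseteq> N V)" unfolding f g Rel_simps(3) using rs mono_span_le_iff by blast
    then show "f \<sqsubseteq>\<^bsub>Rel T\<^esub> g \<longleftrightarrow> Rdist f \<sqsubseteq>\<^bsub>SymDist crib\<^esub> Rdist g"
      unfolding f g Rdist_subr[OF M] Rdist_subr[OF N] using ddist_le_iff[OF M N] by simp
  qed
  moreover have "\<exists>F\<in>Obj (Rel T). \<exists>u. unitary (SymDist crib) (El F) A u" if "A \<in> Obj (SymDist crib)" for A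
    using El_dense[of A] that unfolding Rel_simps(1) by auto
  ultimately show ?thesis unfolding dagger_equivalence_def by blast
qed

lemma Graph_equiv: "category_equiv T (sym_maps (SymDist crib :: (('u, 'co, 'co \<times> ('cm \<times> 'cm) set \<times> 'co) qcat, _) inv_quantaloid))"
proof (rule embedding_equiv[OF Graph_embedding])
  interpret S: iqloid "SymDist crib :: (('u, 'co, 'co \<times> ('cm \<times> 'cm) set \<times> 'co) qcat, _) inv_quantaloid"
    using crib.SymDist_inv_quantaloid by unfold_locales
  show "is_category (sym_maps (SymDist crib :: (('u, 'co, 'co \<times> ('cm \<times> 'cm) set \<times> 'co) qcat, _) inv_quantaloid))" by (rule S.sym_maps_category)
  fix A :: "('u, 'co, 'co \<times> ('cm \<times> 'cm) set \<times> 'co) qcat" assume "A \<in> Obj (sym_maps (SymDist crib))"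
  then obtain F u where F: "sh F" "unitary (SymDist crib) (El F) A u" using El_dense[of A] by auto
  then show "\<exists>X\<in>Obj T. \<exists>u\<in>hom (sym_maps (SymDist crib)) (El X) A. is_iso (sym_maps (SymDist crib)) u"
    using S.unitary_is_iso[OF F(2)] by auto
qed

end

section \<open>Assembling the equivalences\<close>

theorem theorem3p14:
  fixes C :: "('co, 'cm) category"
    and J :: "'co \<Rightarrow> 'cm set set"
    and Q :: "('qo, 'qm) quantaloid"
    and E :: "'qm set"
  assumes "universe TYPE('u)"
    and "is_site C J" and "small_category TYPE('u) C"
    and "is_quantaloid Q" and "small_category TYPE('u) Q"
    and "quantaloid_equiv Q (crible_quantaloid C J)"
    and "\<forall>e\<in>E. sym_idempotent (with_canonical_inv Q) e"
    and "\<forall>X\<in>Obj Q. Ide Q X \<in> E"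
  shows
    "let Qi = with_canonical_inv Q;
         ShQE = (ShQ Qi E :: (('u, 'qm, 'qm \<times> 'qm \<times> 'qm) qcat, _) category);
         SymCatQ = (SymCat_cc Qi :: (('u, 'qo, 'qm) qcat, _) category);
         ShC = (Sh C J :: (('u, 'co, 'cm) presheaf, _) category);
         RelQE = (RelQ Qi E :: (('u, 'qm, 'qm \<times> 'qm \<times> 'qm) qcat, _) inv_quantaloid);
         SymDistQ = (SymDist Qi :: (('u, 'qo, 'qm) qcat, _) inv_quantaloid)
     in
       (is_category ShQE \<and> is_category SymCatQ \<and> is_category ShC \<and>
        category_equiv ShQE SymCatQ \<and> category_equiv SymCatQ ShC) \<and>
       (is_inv_quantaloid RelQE \<and> is_inv_quantaloid SymDistQ \<and> is_inv_quantaloid (Rel ShC) \<and>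
        inv_quantaloid_equiv RelQE SymDistQ \<and> inv_quantaloid_equiv SymDistQ (Rel ShC))"
proof -
  note U = assms(1) and sC = assms(3) and sQ = assms(5)
  note sQ' = sQ[unfolded small_category_def]
  interpret s: site C J using assms(2) by unfold_locales
  have R: "is_quantaloid (crible_quantaloid C J)"
    using s.crib_inv_quantaloid unfolding is_inv_quantaloid_def s.crib_def by simp
  obtain Fo Fm where emb: "cat_embedding Q (crible_quantaloid C J) Fo Fm"
    and ord: "\<And>X Y f g. f \<in> hom Q X Y \<Longrightarrow> g \<in> hom Q X Y \<Longrightarrow> f \<sqsubseteq>\<^bsub>Q\<^esub> g \<longleftrightarrow> Fm f \<sqsubseteq>\<^bsub>crible_quantaloid C J\<^esub> Fm g"
    and ess: "\<And>Z. Z \<in> Obj (crible_quantaloid C J) \<Longrightarrow> \<exists>W\<in>Obj Q. \<exists>u\<in>hom (crible_quantaloid C J) (Fo W) Z. is_iso (crible_quantaloid C J) u"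
    using quantaloid_equivE[OF assms(6,4) R] by blast
  interpret b: crib_base C J Q Fo Fm
  proof unfold_locales
    show "is_quantaloid Q" by (rule assms(4))
    show "cat_embedding Q s.crib Fo Fm" using emb unfolding cat_embedding_def s.crib_def by simp
    show "f \<sqsubseteq>\<^bsub>Q\<^esub> g \<longleftrightarrow> Fm f \<sqsubseteq>\<^bsub>s.crib\<^esub> Fm g" if "f \<in> hom Q X Y" "g \<in> hom Q X Y" for f g X Y
      using ord[OF that] unfolding s.crib_def by simp
    fix Z assume Z: "Z \<in> Obj C"
    then have "Z \<in> Obj (crible_quantaloid C J)" by (simp add: crible_quantaloid_def)
    then obtain W u where W: "W \<in> Obj Q" and u: "u \<in> hom (crible_quantaloid C J) (Fo W) Z" "is_iso (crible_quantaloid C J) u"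
      using ess by blast
    \<comment> \<open>Being an isomorphism does not involve the involution, so u remains one in
      \<open>crib\<close> and is unitary there.\<close>
    have "u \<in> hom s.crib (Fo W) Z" "is_iso s.crib u" using u unfolding is_iso_def s.crib_def by simp_all
    then show "\<exists>W\<in>Obj Q. \<exists>u. unitary s.crib (Fo W) Z u" using s.crib_iso_unitary W by blast
  qed
  obtain pr :: "'u \<times> 'u \<Rightarrow> 'u" where pr: "inj pr" using universe_pairing[OF U] .
  obtain cf :: "'co \<Rightarrow> 'u" where cf: "inj_on cf (Obj C)" using small_inj sC unfolding small_category_def by blast
  interpret sh: sheaf_site C J pr cf using U sC pr cf by unfold_locales
  interpret sp: splitting_of "with_canonical_inv Q" E using assms(7) by unfold_locales blast
  interpret se: iqloid "splitting (with_canonical_inv Q) E" using sp.SE_inv_quantaloid by unfold_locales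
  let ?Qi = "with_canonical_inv Q"
  let ?S = "SymDist ?Qi :: (('u, 'qo, 'qm) qcat, _) inv_quantaloid"
  let ?SE = "SymDist (splitting ?Qi E) :: (('u, 'qm, 'qm \<times> 'qm \<times> 'qm) qcat, _) inv_quantaloid"
  let ?SC = "SymDist s.crib :: (('u, 'co, _) qcat, _) inv_quantaloid"
  let ?T = "Sh C J :: (('u, 'co, 'cm) presheaf, _) category"
  have sQi: "small TYPE('u) (Obj ?Qi)" "small TYPE('u) (Arr ?Qi)" using sQ' by (simp_all add: canonical_with_inv)
  have "E \<subseteq> Arr Q" using assms(7) by (auto simp: sym_idempotent_def canonical_with_inv)
  then have sE: "small TYPE('u) E" using small_subset sQ' by blast
  have "Arr (splitting ?Qi E) \<subseteq> E \<times> Arr Q \<times> E"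
    by (auto simp: splitting_def hom_def canonical_with_inv)
  then have sS: "small TYPE('u) (Obj (splitting ?Qi E))" "small TYPE('u) (Arr (splitting ?Qi E))"
    using sE small_subset[OF small_Times[OF U sE small_Times[OF U _ sE]]] sQ' by (auto simp: splitting_def)
  have q: "is_inv_quantaloid ?S" "is_inv_quantaloid ?SE" "is_inv_quantaloid ?SC"
    using b.Qi.SymDist_inv_quantaloid se.SymDist_inv_quantaloid s.crib.SymDist_inv_quantaloid by blast+
  interpret S: iqloid ?S using q(1) by unfold_locales
  interpret SE: iqloid ?SE using q(2) by unfold_locales
  interpret SC: iqloid ?SC using q(3) by unfold_locales
  note d1 = b.SymDist_Qi_equivalence[OF U sC sQ]
  obtain Go Gm where d2: "dagger_equivalence ?S ?SE Go Gm" using b.SymDist_splitting_equivalence[OF U sQ] assms(7,8) by blast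
  note d3 = se.SymDist_sc_equivalence[OF U sS] and d4 = sh.Rdist_equivalence
  have q4: "is_inv_quantaloid (SymDist_sc (splitting ?Qi E) :: (('u, _, _) qcat, _) inv_quantaloid)"
    using dagger_embedding_inv_quantaloid[OF _ q(2)] d3 unfolding dagger_equivalence_def by blast
  have q5: "is_inv_quantaloid (Rel ?T)"
    using dagger_embedding_inv_quantaloid[OF _ q(3)] d4 unfolding dagger_equivalence_def by blast
  \<comment> \<open>Completion and splitting both map into \<open>SymDist\<close> over the split
    base, so the second equivalence is traversed backwards.\<close>
  have r1: "inv_quantaloid_equiv (SymDist_sc (splitting ?Qi E) :: (('u, _, _) qcat, _) inv_quantaloid) ?S"
    using inv_quantaloid_equiv_trans[OF dagger_equivalence_equiv[OF d3 q(2)] inv_quantaloid_equiv_sym[OF dagger_equivalence_equiv[OF d2 q(2)]] q4 q(2,1)] .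
  have r2: "inv_quantaloid_equiv ?S (Rel ?T)"
    using inv_quantaloid_equiv_trans[OF dagger_equivalence_equiv[OF d1 q(3)] inv_quantaloid_equiv_sym[OF dagger_equivalence_equiv[OF d4 q(3)]] q(1,3) q5] .
  \<comment> \<open>For \<open>Q\<close> the two completeness notions agree, as bilaterality has
    been transported to it; from here on only symmetric completeness is used.\<close>
  have cc: "(SymCat_cc ?Qi :: (('u, 'qo, 'qm) qcat, _) category) = SymCat_sc ?Qi"
    using b.Qi.SymCat_cc_eq[OF U b.Qi_bilateral] .
  note m = S.sym_maps_category SE.sym_maps_category SC.sym_maps_category
  note c = b.Qi.SymCat_sc_category se.SymCat_sc_category sh.T_category
  note e1 = b.Qi.SymCat_sc_equiv[OF U sQi] and e2 = se.SymCat_sc_equiv[OF U sS]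
  \<comment> \<open>The same zigzag on the level of symmetric left adjoints, to which dagger
    equivalences restrict.\<close>
  have k1: "category_equiv (SymCat_sc (splitting ?Qi E) :: (('u, _, _) qcat, _) category) (sym_maps ?S)"
    using category_equiv_trans[OF e2 category_equiv_sym[OF dagger_equivalence_sym_maps[OF d2 q(2)]] c(2) m(2,1)] .
  have k2: "category_equiv (SymCat_sc (splitting ?Qi E) :: (('u, _, _) qcat, _) category) (SymCat_sc ?Qi :: (('u, 'qo, 'qm) qcat, _) category)"
    using category_equiv_trans[OF k1 category_equiv_sym[OF e1] c(2) m(1) c(1)] .
  have k3: "category_equiv (SymCat_sc ?Qi :: (('u, 'qo, 'qm) qcat, _) category) (sym_maps ?SC)"
    using category_equiv_trans[OF e1 dagger_equivalence_sym_maps[OF d1 q(3)] c(1) m(1,3)] .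
  have k4: "category_equiv (SymCat_sc ?Qi :: (('u, 'qo, 'qm) qcat, _) category) ?T"
    using category_equiv_trans[OF k3 category_equiv_sym[OF sh.Graph_equiv] c(1) m(3) c(3)] .
  show ?thesis unfolding Let_def ShQ_def RelQ_def cc using c k2 k4 q4 q(1) q5 r1 r2 by blast
qed

end
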